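(* Let $u$ be a solution of the thin eigenvalue problem in $\Omega$ (with parameters $s\in(0,1)$, $a=1-2s$, $\lambda>0$). If $x_0\in\Omega$ satisfies $u(x_0,0)=0$ and $x_0\in R_u$, i.e. $\nabla_xu(x_0,0)\neq0$, then there is a neighborhood $V\subset\Omega$ of $x_0$ in which $\{x\in V:u(x,0)=0\}$ is - a $C^{1,\alpha}$ graph for every $0<\alpha<2s$, if $s\le1/2$; - a $C^{2,\alpha}$ graph for every $0<\alpha<2s-1$, if $s>1/2$.
   Context: $\Omega\subset\mathbb{R}^n$ is a smooth bounded domain, $\mathbb{R}^+=(0,\infty)$, points of $\mathbb{R}^{n+1}$ are $(x,y)$ with $x\in\mathbb{R}^n$, $y\in\mathbb{R}$. For $U\subset\{y>0\}$ open, $L^2(a,U)=\{f: f\,y^{a/2}\in L^2(U)\}$ and $H^1(a,U)=\{f: f,\nabla f\in L^2(a,U)\}$. A solution of the thin eigenvalue problem in $\Omega$ is a function $u$ with $u\in H^1(a,\Omega\times(0,T))$ for every $T>0$ satisfying $\operatorname{div}(y^a\nabla u)=0$ in $\Omega\times\mathbb{R}^+$ and $\lim_{y\to0^+}y^a u_y(x,y)=-\lambda u_+(x,0)$ for $x\in\Omega$, in the weak sense: $\int_{\Omega\times\mathbb{R}^+}y^a\nabla u\cdot\nabla\psi\,dx\,dy=\lambda\int_\Omega u_+(x,0)\psi(x,0)\,dx$ for all $\psi\in C_c^\infty(\Omega\times\mathbb{R})$; $u_+=\max(u,0)$. The trace $u(\cdot,0)$ is identified with its $C^1$ representative on $\Omega$,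 and $\nabla_x$ is the gradient in $x$. The regular set is $R_u=\{x\in\Omega: u(x,0)=0\text{ and }\nabla_xu(x,0)\ne0\}$. A "graph" means a graph of a function of $n-1$ of the coordinates over the remaining one, after a rotation of coordinates. *)

theory Defs
  imports "HOL-Analysis.Analysis"
begin

text \<open>
  Points of \<open>\<real>\<^sup>n\<close> have type \<open>real ^ 'n\<close>; points \<open>(x, y)\<close> of \<open>\<real>\<^sup>n\<^sup>+\<^sup>1\<close> have type
  \<open>(real ^ 'n) \<times> real\<close>.
\<close>

definition grad :: "('a::real_inner \<Rightarrow> real) \<Rightarrow> 'a \<Rightarrow> 'a" where
  "grad f x = (THE D. GDERIV f x :> D)"

text \<open>
  The classes \<open>C\<^sup>k\<close> and \<open>C\<^sup>k\<^sup>,\<^sup>\<alpha>\<close> are defined by recursion over directional derivatives. Both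
  predicates are meant for open \<open>S\<close> and finite-dimensional domains. The Hoelder class is the uniform
  one: all derivatives up to order \<open>k\<close> are bounded on \<open>S\<close>, and those of order \<open>k\<close> are
  \<open>\<alpha>\<close>-Hoelder on all of \<open>S\<close>.
\<close>

primrec Ck_on :: "nat \<Rightarrow> ('a::real_normed_vector \<Rightarrow> 'b::real_normed_vector) \<Rightarrow> 'a set \<Rightarrow> bool" where
  "Ck_on 0 f S \<longleftrightarrow> continuous_on S f"
| "Ck_on (Suc k) f S \<longleftrightarrow>
     (\<forall>x\<in>S. f differentiable (at x)) \<and> (\<forall>v. Ck_on k (\<lambda>x. frechet_derivative f (at x) v) S)"

definition smooth_on :: "('a::real_normed_vector \<Rightarrow> 'b::real_normed_vector) \<Rightarrow> 'a set \<Rightarrow> bool" where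
  "smooth_on f S \<longleftrightarrow> (\<forall>k. Ck_on k f S)"

primrec Ck_holder_on ::
  "nat \<Rightarrow> real \<Rightarrow> ('a::real_normed_vector \<Rightarrow> real) \<Rightarrow> 'a set \<Rightarrow> bool" where
  "Ck_holder_on 0 \<alpha> f S \<longleftrightarrow>
     bounded (f ` S) \<and> (\<exists>C. \<forall>x\<in>S. \<forall>y\<in>S. \<bar>f x - f y\<bar> \<le> C * norm (x - y) powr \<alpha>)"
| "Ck_holder_on (Suc k) \<alpha> f S \<longleftrightarrow>
     bounded (f ` S) \<and> (\<forall>x\<in>S. f differentiable (at x)) \<and>
     (\<forall>v. Ck_holder_on k \<alpha> (\<lambda>x. frechet_derivative f (at x) v) S)"

definition test_function :: "'a::real_normed_vector set \<Rightarrow> ('a \<Rightarrow> real) \<Rightarrow> bool" where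
  "test_function U \<psi> \<longleftrightarrow>
     smooth_on \<psi> UNIV \<and> compact (closure {z. \<psi> z \<noteq> 0}) \<and> closure {z. \<psi> z \<noteq> 0} \<subseteq> U"

text \<open>
  A function of all coordinates except the \<open>i\<close>-th one, with domain an open subset of \<open>\<real>\<^sup>n\<^sup>-\<^sup>1\<close>, is
  encoded as a function on an open cylinder in the \<open>i\<close>-th direction that is constant along that
  direction. This includes \<open>n = 1\<close>, where such a function is a constant. The bounds in
  \<^const>\<open>Ck_holder_on\<close> on the cylinder and on its base agree.
\<close>

definition omits_coordinate :: "'n \<Rightarrow> (real ^ 'n::finite \<Rightarrow> real) \<Rightarrow> (real ^ 'n) set \<Rightarrow> bool" where
  "omits_coordinate i g D \<longleftrightarrow>
     (\<forall>x\<in>D. \<forall>t. x + t *\<^sub>R axis i 1 \<in> D \<and> g (x + t *\<^sub>R axis i 1) = g x)"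

definition is_Ck_holder_graph :: "nat \<Rightarrow> real \<Rightarrow> (real ^ 'n::finite) set \<Rightarrow> bool" where
  "is_Ck_holder_graph k \<alpha> Z \<longleftrightarrow>
     (\<exists>(A :: real ^ 'n ^ 'n) i g D.
        rotation_matrix A \<and> open D \<and> omits_coordinate i g D \<and> Ck_holder_on k \<alpha> g D \<and>
        Z = {x. A *v x \<in> D \<and> (A *v x) $ i = g (A *v x)})"

text \<open>
  In \<open>smooth_boundary\<close> all orthogonal changes of coordinates are allowed, not only rotations: for
  \<open>n = 1\<close> the two end points of an interval need opposite orientations.
\<close>

definition smooth_boundary :: "(real ^ 'n::finite) set \<Rightarrow> bool" where
  "smooth_boundary \<Omega> \<longleftrightarrow>
     (\<forall>p \<in> frontier \<Omega>. \<exists>r>0. \<exists>(A :: real ^ 'n ^ 'n) i \<gamma>.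
        orthogonal_matrix A \<and> omits_coordinate i \<gamma> UNIV \<and> smooth_on \<gamma> UNIV \<and>
        \<Omega> \<inter> ball p r = {x \<in> ball p r. (A *v x) $ i > \<gamma> (A *v x)})"

definition smooth_bounded_domain :: "(real ^ 'n::finite) set \<Rightarrow> bool" where
  "smooth_bounded_domain \<Omega> \<longleftrightarrow>
     \<Omega> \<noteq> {} \<and> open \<Omega> \<and> connected \<Omega> \<and> bounded \<Omega> \<and> smooth_boundary \<Omega>"

definition L2_on :: "'a::euclidean_space set \<Rightarrow> ('a \<Rightarrow> 'b::euclidean_space) \<Rightarrow> bool" where
  "L2_on U f \<longleftrightarrow>
     set_borel_measurable lebesgue U f \<and> set_integrable lebesgue U (\<lambda>z. (norm (f z))\<^sup>2)"

definition L2_tendsto ::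
  "'a::euclidean_space set \<Rightarrow> (nat \<Rightarrow> 'a \<Rightarrow> 'b::euclidean_space) \<Rightarrow> ('a \<Rightarrow> 'b) \<Rightarrow> bool" where
  "L2_tendsto U F f \<longleftrightarrow>
     (\<forall>k. L2_on U (\<lambda>z. F k z - f z)) \<and>
     (\<lambda>k. LINT z:U|lebesgue. (norm (F k z - f z))\<^sup>2) \<longlonglongrightarrow> 0"

definition weighted ::
  "real \<Rightarrow> ('a \<times> real \<Rightarrow> 'b::real_vector) \<Rightarrow> 'a \<times> real \<Rightarrow> 'b" where
  "weighted a f = (\<lambda>(x, y). (y powr (a / 2)) *\<^sub>R f (x, y))"

definition has_weak_gradient ::
  "'a::euclidean_space set \<Rightarrow> ('a \<Rightarrow> real) \<Rightarrow> ('a \<Rightarrow> 'a) \<Rightarrow> bool" where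
  "has_weak_gradient U f G \<longleftrightarrow>
     (\<forall>K. compact K \<and> K \<subseteq> U \<longrightarrow> set_integrable lebesgue K f \<and> set_integrable lebesgue K G) \<and>
     (\<forall>\<psi>. test_function U \<psi> \<longrightarrow>
        (LINT z:U|lebesgue. f z *\<^sub>R grad \<psi> z) = - (LINT z:U|lebesgue. \<psi> z *\<^sub>R G z))"

definition H1_weighted ::
  "real \<Rightarrow> ('a::euclidean_space \<times> real) set \<Rightarrow> ('a \<times> real \<Rightarrow> real) \<Rightarrow> bool" where
  "H1_weighted a U f \<longleftrightarrow>
     L2_on U (weighted a f) \<and> (\<exists>G. has_weak_gradient U f G \<and> L2_on U (weighted a G))"

text \<open>
  \<open>has_trace a \<Omega> T u f\<close>: the Sobolev trace of \<open>u \<in> H\<^sup>1(a, \<Omega> \<times> (0, T))\<close> on \<open>\<Omega> \<times> {0}\<close> is \<open>f\<close>, that is,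
  \<open>f\<close> is the \<open>L\<^sup>2(\<Omega>)\<close> limit of \<open>\<phi>\<^sub>k(\<cdot>, 0)\<close> for smooth \<open>\<phi>\<^sub>k\<close> converging to \<open>u\<close> in
  \<open>H\<^sup>1(a, \<Omega> \<times> (0, T))\<close>.
\<close>

definition has_trace ::
  "real \<Rightarrow> 'a::euclidean_space set \<Rightarrow> real \<Rightarrow> ('a \<times> real \<Rightarrow> real) \<Rightarrow> ('a \<Rightarrow> real) \<Rightarrow> bool" where
  "has_trace a \<Omega> T u f \<longleftrightarrow>
     (\<exists>G \<phi>. has_weak_gradient (\<Omega> \<times> {0<..<T}) u G \<and> (\<forall>k. smooth_on (\<phi> k) UNIV) \<and>
        L2_tendsto (\<Omega> \<times> {0<..<T}) (\<lambda>k. weighted a (\<phi> k)) (weighted a u) \<and>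
        L2_tendsto (\<Omega> \<times> {0<..<T}) (\<lambda>k. weighted a (grad (\<phi> k))) (weighted a G) \<and>
        L2_tendsto \<Omega> (\<lambda>k x. \<phi> k (x, 0)) f)"

text \<open>
  The values \<open>u (x, 0)\<close> are the chosen representative of the trace of \<open>u\<close>; in \<open>\<Omega> \<times> (0, \<infinity>)\<close> only
  the almost-everywhere class of \<open>u\<close> matters.
  The weak equation encodes both \<open>div (y\<^sup>a \<nabla>u) = 0\<close> and the boundary condition on \<open>\<Omega> \<times> {0}\<close>.
\<close>

definition thin_eigen_solution ::
  "real \<Rightarrow> real \<Rightarrow> 'a::euclidean_space set \<Rightarrow> ('a \<times> real \<Rightarrow> real) \<Rightarrow> bool" where
  "thin_eigen_solution a lam \<Omega> u \<longleftrightarrow>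
     (\<forall>T>0. H1_weighted a (\<Omega> \<times> {0<..<T}) u \<and> has_trace a \<Omega> T u (\<lambda>x. u (x, 0))) \<and>
     (\<exists>G. has_weak_gradient (\<Omega> \<times> {0<..}) u G \<and>
        (\<forall>\<psi>. test_function (\<Omega> \<times> UNIV) \<psi> \<longrightarrow>
           (LINT z:\<Omega> \<times> {0<..}|lebesgue. snd z powr a * (G z \<bullet> grad \<psi> z)) =
           lam * (LINT x:\<Omega>|lebesgue. max (u (x, 0)) 0 * \<psi> (x, 0))))"

definition regular_set :: "'a::euclidean_space set \<Rightarrow> ('a \<times> real \<Rightarrow> real) \<Rightarrow> 'a set" where
  "regular_set \<Omega> u = {x \<in> \<Omega>. u (x, 0) = 0 \<and> grad (\<lambda>x. u (x, 0)) x \<noteq> 0}"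

end

theory Submission
  imports Defs
begin

text \<open>
  With \<open>p = n - 2 s\<close>, the function \<open>\<bar>(x, y) - (x', 0)\<bar>\<^sup>-\<^sup>p\<close> is the fundamental solution of \<open>div (y\<^sup>a \<nabla> \<cdot>)\<close>
  with pole on \<open>{y = 0}\<close>. Testing the weak equation with a smooth truncation of it at scale \<open>\<epsilon>\<close>, times a
  cutoff, and letting \<open>\<epsilon> \<rightarrow> 0\<close> writes the trace \<open>v = u(\<cdot>, 0)\<close> near \<open>x\<^sub>0\<close> as a constant times the Riesz
  potential of \<open>f = v\<^sub>+\<close> (cut off) of order \<open>2 s\<close>, plus a smooth function. Since \<open>\<nabla>v(x\<^sub>0) \<noteq> 0\<close>, the zero set
  of \<open>v\<close> is locally a \<open>C\<^sup>1\<close> graph, hence a null set, so \<open>f\<close> is Lipschitz and differentiable almost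
  everywhere. The potential of \<open>f\<close> has the potential of the bounded function \<open>\<nabla>f\<close> as its gradient, which
  is \<open>C\<^sup>0\<^sup>,\<^sup>\<alpha>\<close> for \<open>\<alpha> < 2 s\<close> and \<open>C\<^sup>1\<^sup>,\<^sup>\<alpha>\<close> for \<open>\<alpha> < 2 s - 1\<close>; the implicit function theorem carries this over to
  the zero set. For \<open>n = 1\<close> the zero set near \<open>x\<^sub>0\<close> is a point and no regularity is needed.
\<close>

section \<open>Calculus of continuously differentiable functions\<close>

text \<open>The limit on regularity comes from \<open>max v 0\<close>: its gradient jumps across the
  nodal set, so the source of the potential is Lipschitz and no better, and the exponents
  \<open>2 s\<close> and \<open>2 s - 1\<close> are what a kernel of order \<open>2 s\<close> adds
  to a bounded gradient. The fundamental solution is singular exactly where the trace is wanted.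
  Truncating its derivative in the variable \<open>\<bar>z\<bar>^2\<close> leaves as defect in the
  equation a nonnegative bump of width \<epsilon>, whose mass against \<open>y^a\<close> is the same
  for all \<epsilon> because \<open>p = n - 1 + a\<close>. Pairing u with the bumps averages u near
  \<open>(x', 0)\<close>, and an estimate of u minus its trace in thin strips turns the averages
  into a multiple of the trace. The test functions depend on y only through \<open>y^2\<close>,
  which removes the boundary term of the second integration by parts. All terms from the cutoff live
  on a shell at positive distance from the poles and give the smooth remainder. For n = 1 the
  exponent \<open>1 - 2 s\<close> need not be positive, so this case is separated.\<close>

lemma has_derivative_cong_open:
  assumes "open S" "x \<in> S" "\<And>y. y \<in> S \<Longrightarrow> f y = g y"
  shows "(f has_derivative D) (at x) \<longleftrightarrow> (g has_derivative D) (at x)"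
  using assms has_derivative_transform_within_open[of f D x UNIV S g]
    has_derivative_transform_within_open[of g D x UNIV S f] by auto

lemma frechet_derivative_cong_open:
  assumes "open S" "x \<in> S" "\<And>y. y \<in> S \<Longrightarrow> f y = g y"
  shows "frechet_derivative f (at x) = frechet_derivative g (at x)"
  unfolding frechet_derivative_def using has_derivative_cong_open[OF assms] by simp

lemma differentiable_cong_open:
  assumes "open S" "x \<in> S" "\<And>y. y \<in> S \<Longrightarrow> f y = g y"
  shows "f differentiable (at x) \<longleftrightarrow> g differentiable (at x)"
  unfolding differentiable_def using has_derivative_cong_open[OF assms] by simp

lemma frechet_derivative_eq: "(f has_derivative D) (at x) \<Longrightarrow> frechet_derivative f (at x) = D"
  by (metis frechet_derivative_at)

lemma Ck_on_cong:
  assumes "open S" "\<And>x. x \<in> S \<Longrightarrow> f x = g x"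
  shows "Ck_on k f S \<longleftrightarrow> Ck_on k g S"
  using assms(2)
proof (induction k arbitrary: f g)
  case 0 then show ?case using continuous_on_cong[of S S f g] by simp
next
  case (Suc k)
  have "Ck_on k (\<lambda>x. frechet_derivative f (at x) v) S = Ck_on k (\<lambda>x. frechet_derivative g (at x) v) S" for v
    by (rule Suc.IH) (simp add: frechet_derivative_cong_open[OF assms(1) _ Suc.prems])
  then show ?case using differentiable_cong_open[OF assms(1) _ Suc.prems] by simp
qed

text \<open>On an open set the derivative is unique, so the recursion may continue with any explicit
  formula \<open>f'\<close> in place of \<open>frechet_derivative\<close>.\<close>

lemma Ck_on_SucI:
  assumes "open S" "\<And>x. x \<in> S \<Longrightarrow> (f has_derivative f' x) (at x)"
    "\<And>v. Ck_on k (\<lambda>x. f' x v) S"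
  shows "Ck_on (Suc k) f S"
proof -
  have "Ck_on k (\<lambda>x. frechet_derivative f (at x) v) S" for v
    using Ck_on_cong[OF assms(1), of "\<lambda>x. frechet_derivative f (at x) v" "\<lambda>x. f' x v" k]
      assms(2,3) frechet_derivative_eq by metis
  then show ?thesis using assms(2) by (auto simp: differentiable_def)
qed

lemma Ck_on_subset: "Ck_on k f S \<Longrightarrow> T \<subseteq> S \<Longrightarrow> Ck_on k f T"
  by (induction k arbitrary: f) (auto intro: continuous_on_subset)

lemma Ck_on_imp_continuous_on: "Ck_on k f S \<Longrightarrow> continuous_on S f"
  by (cases k) (auto intro!: continuous_at_imp_continuous_on differentiable_imp_continuous_within)

lemma Ck_on_Suc_imp: "Ck_on (Suc k) f S \<Longrightarrow> Ck_on k f S"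
proof (induction k arbitrary: f)
  case 0 then show ?case using Ck_on_imp_continuous_on[OF 0] by simp
next
  case (Suc k) then show ?case by (metis Ck_on.simps(2))
qed

lemma Ck_on_mono: "Ck_on k f S \<Longrightarrow> j \<le> k \<Longrightarrow> Ck_on j f S"
  by (induction k) (auto simp: le_Suc_eq simp del: Ck_on.simps dest: Ck_on_Suc_imp)

lemma Ck_on_Un:
  assumes "open S" "open T" shows "Ck_on k f S \<Longrightarrow> Ck_on k f T \<Longrightarrow> Ck_on k f (S \<union> T)"
  by (induction k arbitrary: f) (use assms in \<open>auto intro: continuous_on_open_Un\<close>)

lemma Ck_on_const [simp]: "Ck_on k (\<lambda>x. c) S"
proof (induction k arbitrary: c)
  case (Suc k) then show ?case by (auto simp: frechet_derivative_eq[OF has_derivative_const])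
qed auto

lemma Ck_on_linear: "bounded_linear f \<Longrightarrow> Ck_on k f S"
  by (cases k) (auto simp: frechet_derivative_eq[OF bounded_linear_imp_has_derivative] linear_continuous_on
    bounded_linear_imp_differentiable)

lemma Ck_on_has_derivative:
  assumes "Ck_on (Suc k) f S" "x \<in> S"
  shows "(f has_derivative frechet_derivative f (at x)) (at x)"
  using assms frechet_derivative_works by auto

lemma Ck_on_add:
  assumes "open S" shows "Ck_on k f S \<Longrightarrow> Ck_on k g S \<Longrightarrow> Ck_on k (\<lambda>x. f x + g x) S"
proof (induction k arbitrary: f g)
  case (Suc k)
  show ?case
  proof (rule Ck_on_SucI[OF assms])
    fix x assume "x \<in> S"
    then show "((\<lambda>x. f x + g x) has_derivative (\<lambda>v. frechet_derivative f (at x) v + frechet_derivative g (at x) v)) (at x)"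
      using Suc.prems[THEN Ck_on_has_derivative] by (auto intro: has_derivative_add)
  qed (use Suc in auto)
qed (auto intro: continuous_on_add)

lemma Ck_on_mult:
  fixes f g :: "'a::real_normed_vector \<Rightarrow> real"
  assumes "open S" shows "Ck_on k f S \<Longrightarrow> Ck_on k g S \<Longrightarrow> Ck_on k (\<lambda>x. f x * g x) S"
proof (induction k arbitrary: f g)
  case (Suc k)
  show ?case
  proof (rule Ck_on_SucI[OF assms])
    fix x assume "x \<in> S"
    then show "((\<lambda>x. f x * g x) has_derivative (\<lambda>v. f x * frechet_derivative g (at x) v + frechet_derivative f (at x) v * g x)) (at x)"
      using Suc.prems[THEN Ck_on_has_derivative] by (auto intro: has_derivative_mult)
  next
    fix v
    have "Ck_on k (\<lambda>x. frechet_derivative f (at x) v) S" "Ck_on k (\<lambda>x. frechet_derivative g (at x) v) S"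
      using Suc.prems by auto
    then show "Ck_on k (\<lambda>x. f x * frechet_derivative g (at x) v + frechet_derivative f (at x) v * g x) S"
      using Suc.prems[THEN Ck_on_Suc_imp] by (intro Ck_on_add[OF assms] Suc.IH)
  qed
qed (auto intro: continuous_on_mult)

lemma Ck_on_uminus:
  fixes f :: "'a::real_normed_vector \<Rightarrow> real"
  assumes "open S" "Ck_on k f S" shows "Ck_on k (\<lambda>x. - f x) S"
  using Ck_on_mult[OF assms(1) Ck_on_const[of k "-1"] assms(2)] by simp

lemma Ck_on_diff:
  fixes f :: "'a::real_normed_vector \<Rightarrow> real"
  assumes "open S" "Ck_on k f S" "Ck_on k g S" shows "Ck_on k (\<lambda>x. f x - g x) S"
  using Ck_on_add[OF assms(1,2) Ck_on_uminus[OF assms(1,3)]] by simp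

lemma Ck_on_prod:
  fixes f :: "'i \<Rightarrow> 'a::real_normed_vector \<Rightarrow> real"
  assumes "open S" "\<And>i. i \<in> I \<Longrightarrow> Ck_on k (f i) S" shows "Ck_on k (\<lambda>x. \<Prod>i\<in>I. f i x) S"
  using assms(2) by (induction I rule: infinite_finite_induct) (auto intro: Ck_on_mult[OF assms(1)])

text \<open>Only \<open>h\<close> is generalised in the induction: the derivative of the composition
  in direction \<open>v\<close> is a fixed derivative of \<open>f\<close> times the derivative of
  \<open>h\<close> composed with \<open>f\<close>, and the latter is again a composition with
  \<open>f\<close>, of one order less.\<close>

lemma Ck_on_compose_real:
  fixes f :: "'a::real_normed_vector \<Rightarrow> real" and h :: "real \<Rightarrow> real"
  assumes "open S" "open T" "\<And>x. x \<in> S \<Longrightarrow> f x \<in> T"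
  shows "Ck_on k f S \<Longrightarrow> Ck_on k h T \<Longrightarrow> Ck_on k (\<lambda>x. h (f x)) S"
proof (induction k arbitrary: h)
  case 0 then show ?case
    using continuous_on_compose2[of T h S f] assms(3) by auto
next
  case (Suc k)
  show ?case
  proof (rule Ck_on_SucI[OF assms(1)])
    fix x assume x: "x \<in> S"
    have f: "(f has_derivative frechet_derivative f (at x)) (at x)"
      using Suc.prems x by (auto simp: frechet_derivative_works[symmetric])
    have h: "(h has_derivative frechet_derivative h (at (f x))) (at (f x))"
      using Suc.prems x assms(3) by (auto simp: frechet_derivative_works[symmetric])
    have "frechet_derivative h (at (f x)) t = t * frechet_derivative h (at (f x)) 1" for t
      using linear_scale[OF has_derivative_linear[OF h], of t 1] by simp
    then have eq: "(\<lambda>v. frechet_derivative f (at x) v * frechet_derivative h (at (f x)) 1) =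
        (\<lambda>v. frechet_derivative h (at (f x)) (frechet_derivative f (at x) v))"
      by (intro ext) (rule sym)
    show "((\<lambda>x. h (f x)) has_derivative (\<lambda>v. frechet_derivative f (at x) v * frechet_derivative h (at (f x)) 1)) (at x)"
      unfolding eq by (rule has_derivative_compose[OF f h])
  next
    fix v
    show "Ck_on k (\<lambda>x. frechet_derivative f (at x) v * frechet_derivative h (at (f x)) 1) S"
      using Ck_on_mult[OF assms(1) _ Suc.IH[OF Ck_on_Suc_imp[OF Suc.prems(1)]], of "\<lambda>x. frechet_derivative f (at x) v" "\<lambda>t. frechet_derivative h (at t) 1"]
        Suc.prems unfolding Ck_on.simps(2) by blast
  qed
qed

lemma Ck_on_real_SucI:
  fixes f :: "real \<Rightarrow> real"
  assumes "open S" "\<And>x. x \<in> S \<Longrightarrow> (f has_real_derivative f' x) (at x)" "Ck_on k f' S"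
  shows "Ck_on (Suc k) f S"
  by (rule Ck_on_SucI[OF assms(1), where f' = "\<lambda>x v. f' x * v"])
    (use assms in \<open>auto simp: has_field_derivative_def intro: Ck_on_mult[OF assms(1)]\<close>)

lemma Ck_on_real_deriv:
  fixes f :: "real \<Rightarrow> real"
  assumes "open S" "Ck_on (Suc k) f S" "\<And>x. x \<in> S \<Longrightarrow> (f has_real_derivative f' x) (at x)"
  shows "Ck_on k f' S"
proof -
  have "Ck_on k (\<lambda>x. frechet_derivative f (at x) 1) S" using assms(2) by simp
  moreover have "frechet_derivative f (at x) 1 = f' x" if "x \<in> S" for x
    using frechet_derivative_eq assms(3)[OF that] unfolding has_field_derivative_def by fastforce
  ultimately show ?thesis
    using Ck_on_cong[OF assms(1), of "\<lambda>x. frechet_derivative f (at x) 1" f' k] by blast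
qed

lemma Ck_on_powr: "Ck_on k (\<lambda>x::real. x powr r) {0<..}"
proof (induction k arbitrary: r)
  case 0 then show ?case by (auto intro!: continuous_intros)
next
  case (Suc k)
  show ?case
  proof (rule Ck_on_real_SucI)
    show "((\<lambda>x. x powr r) has_real_derivative r * x powr (r - 1)) (at x)" if "x \<in> {0<..}" for x
      using that by (auto intro!: derivative_eq_intros)
    show "Ck_on k (\<lambda>x. r * x powr (r - 1)) {0<..}"
      by (intro Ck_on_mult Ck_on_const Suc) auto
  qed auto
qed

text \<open>Radial functions are written throughout in the squared norm, which unlike the norm is
  smooth at the centre.\<close>

lemma Ck_on_norm_sq:
  fixes c :: "'a::real_inner"
  shows "Ck_on k (\<lambda>z. (norm (z - c))\<^sup>2) UNIV"
proof (cases k)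
  case 0 then show ?thesis by (auto intro!: continuous_intros)
next
  case (Suc j)
  have "Ck_on j (\<lambda>x. 2 * ((x - c) \<bullet> v)) UNIV" for v
    unfolding inner_diff_left
    by (intro Ck_on_mult Ck_on_const Ck_on_diff Ck_on_linear bounded_linear_inner_left open_UNIV)
  moreover have "((\<lambda>z. (norm (z - c))\<^sup>2) has_derivative (\<lambda>v. 2 * ((x - c) \<bullet> v))) (at x)" for x
    unfolding power2_norm_eq_inner by (auto intro!: derivative_eq_intros simp: inner_commute)
  ultimately show ?thesis unfolding Suc
    by (intro Ck_on_SucI[where f' = "\<lambda>x v. 2 * ((x - c) \<bullet> v)"]) auto
qed

lemma smooth_on_antiderivative:
  fixes f :: "real \<Rightarrow> real"
  assumes "smooth_on f UNIV"
  obtains F where "smooth_on F UNIV" "\<And>x. (F has_real_derivative f x) (at x)"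
proof -
  have c: "continuous_on UNIV f" using assms Ck_on.simps(1) unfolding smooth_on_def by metis
  have "\<exists>F. \<forall>x::real. -\<infinity> < ereal x \<longrightarrow> ereal x < \<infinity> \<longrightarrow> (F has_vector_derivative f x) (at x)"
    by (rule einterval_antiderivative) (use c in \<open>auto simp: continuous_on_eq_continuous_at\<close>)
  then obtain F where F: "\<And>x. (F has_real_derivative f x) (at x)"
    by (auto simp: has_real_derivative_iff_has_vector_derivative)
  have "Ck_on k F UNIV" for k
    by (rule Ck_on_mono[of "Suc k"], rule Ck_on_real_SucI[OF _ F]) (use assms in \<open>auto simp: smooth_on_def\<close>)
  then show ?thesis using that F unfolding smooth_on_def by blast
qed

section \<open>A smooth step function\<close>

text \<open>\<open>flat_fun 0\<close> is the classical function \<open>exp (- (1 / t))\<close>, flat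
  at 0. The factors \<open>(1 / t) ^ k\<close> make the family closed under differentiation up to
  linear combinations, so that smoothness of all members is a single induction.\<close>

definition flat_fun :: "nat \<Rightarrow> real \<Rightarrow> real" where
  "flat_fun k t = (if t > 0 then (1 / t) ^ k * exp (- (1 / t)) else 0)"

lemma flat_fun_deriv: "(flat_fun k has_real_derivative (flat_fun (k + 2) t - of_nat k * flat_fun (k + 1) t)) (at t)"
proof -
  consider "t > 0" | "t < 0" | "t = 0" by linarith
  then show ?thesis
  proof cases
    case 1
    have "((\<lambda>t. (1 / t) ^ k * exp (- (1 / t))) has_real_derivative (flat_fun (k + 2) t - of_nat k * flat_fun (k + 1) t)) (at t)"
      using 1 by (cases k) (auto intro!: derivative_eq_intros simp: flat_fun_def divide_simps power2_eq_square, auto simp: algebra_simps power_Suc[symmetric] simp del: power_Suc, metis Suc_pred neq0_conv)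
    then show ?thesis
      by (rule has_field_derivative_transform_within_open[where S = "{0<..}"]) (use 1 in \<open>auto simp: flat_fun_def\<close>)
  next
    case 2
    have "((\<lambda>t. 0) has_real_derivative (flat_fun (k + 2) t - of_nat k * flat_fun (k + 1) t)) (at t)"
      using 2 by (auto simp: flat_fun_def)
    then show ?thesis
      by (rule has_field_derivative_transform_within_open[where S = "{..<0}"]) (use 2 in \<open>auto simp: flat_fun_def\<close>)
  next
    case 3
    have "((\<lambda>h. flat_fun (k+1) h) \<longlongrightarrow> 0) (at 0)"
    proof (rule filterlim_split_at)
      have "((\<lambda>h::real. 0) \<longlongrightarrow> 0) (at_left (0::real))" by simp
      then show "(flat_fun (k+1) \<longlongrightarrow> 0) (at_left (0::real))"
        by (rule tendsto_cong[THEN iffD1, rotated]) (auto simp: flat_fun_def eventually_at_filter)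
      have "((\<lambda>h. (inverse h) ^ (k+1) / exp (inverse h)) \<longlongrightarrow> 0) (at_right (0::real))"
        by (rule filterlim_compose[OF tendsto_power_div_exp_0 filterlim_inverse_at_top_right])
      then show "(flat_fun (k+1) \<longlongrightarrow> 0) (at_right (0::real))"
        by (rule tendsto_cong[THEN iffD1, rotated])
          (auto simp: flat_fun_def eventually_at_filter exp_minus divide_inverse)
    qed
    \<comment> \<open>The difference quotient at 0 is the next member of the family, and that tends
      to 0 because the exponential beats every power.\<close>
    moreover have "(flat_fun k h - flat_fun k 0) / (h - 0) = flat_fun (k+1) h" if "h \<noteq> 0" for h
      using that by (simp add: flat_fun_def)
    ultimately have "((\<lambda>h. (flat_fun k h - flat_fun k 0) / (h - 0)) \<longlongrightarrow> 0) (at 0)"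
      by (subst tendsto_cong[of _ "flat_fun (k+1)"]) (auto simp: eventually_at_filter)
    then show ?thesis using 3 by (simp add: has_field_derivative_iff flat_fun_def)
  qed
qed

lemma Ck_on_flat_fun: "Ck_on m (flat_fun k) UNIV"
proof (induction m arbitrary: k)
  case 0 then show ?case
    using DERIV_isCont[OF flat_fun_deriv] by (auto intro!: continuous_at_imp_continuous_on)
next
  case (Suc m)
  show ?case
    by (rule Ck_on_real_SucI[OF _ flat_fun_deriv]) (auto intro!: Ck_on_diff Ck_on_mult Suc)
qed

text \<open>The step is the normalised antiderivative of the bump
  \<open>flat_fun 0 t * flat_fun 0 (1 - t)\<close>. Strict positivity of the derivative on (0, 1) is
  recorded because it later makes the mass of \<open>bump\<close> positive.\<close>

lemma smooth_step_exists:
  "\<exists>\<sigma> \<sigma>' :: real \<Rightarrow> real. smooth_on \<sigma> UNIV \<and> (\<forall>t. (\<sigma> has_real_derivative \<sigma>' t) (at t)) \<and>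
     (\<forall>t\<le>0. \<sigma> t = 0) \<and> (\<forall>t\<ge>1. \<sigma> t = 1) \<and> (\<forall>t. \<sigma>' t \<ge> 0) \<and> (\<forall>t. 0 < t \<and> t < 1 \<longrightarrow> \<sigma>' t > 0) \<and>
     (\<forall>t. t \<le> 0 \<or> t \<ge> 1 \<longrightarrow> \<sigma>' t = 0)"
proof -
  define b where "b t = flat_fun 0 t * flat_fun 0 (1 - t)" for t
  have "Ck_on k (\<lambda>t::real. 1 - t) UNIV" for k
    by (intro Ck_on_diff Ck_on_const Ck_on_linear bounded_linear_ident open_UNIV)
  then have "Ck_on k (\<lambda>t. flat_fun 0 (1 - t)) UNIV" for k
    by (rule Ck_on_compose_real[OF open_UNIV open_UNIV UNIV_I _ Ck_on_flat_fun])
  then have b: "smooth_on b UNIV" unfolding smooth_on_def b_def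
    by (intro allI Ck_on_mult Ck_on_flat_fun open_UNIV)
  obtain F where F: "smooth_on F UNIV" "\<And>x. (F has_real_derivative b x) (at x)"
    using smooth_on_antiderivative[OF b] by blast
  have b0: "b t = 0" if "t \<le> 0 \<or> t \<ge> 1" for t using that by (auto simp: b_def flat_fun_def)
  have bp: "b t > 0" if "0 < t" "t < 1" for t using that by (auto simp: b_def flat_fun_def)
  have bn: "b t \<ge> 0" for t by (auto simp: b_def flat_fun_def)
  have F0: "F t = F 0" if "t \<le> 0" for t
  proof (cases "t = 0")
    case False
    have "\<exists>z. t < z \<and> z < 0 \<and> F 0 - F t = (0 - t) * b z"
      by (rule MVT2) (use that False F in auto)
    then obtain z where "z < 0" "F 0 - F t = (0 - t) * b z" by blast
    then show ?thesis using b0[of z] by simp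
  qed simp
  have F1: "F t = F 1" if "t \<ge> 1" for t
  proof (cases "t = 1")
    case False
    have "\<exists>z. 1 < z \<and> z < t \<and> F t - F 1 = (t - 1) * b z"
      by (rule MVT2) (use that False F in auto)
    then obtain z where "1 < z" "F t - F 1 = (t - 1) * b z" by blast
    then show ?thesis using b0[of z] by simp
  qed simp
  have "\<exists>z::real. 0 < z \<and> z < 1 \<and> F 1 - F 0 = (1 - 0) * b z" by (rule MVT2) (use F in auto)
  then have pos: "F 1 - F 0 > 0" using bp by force
  define \<sigma> where "\<sigma> t = (F t - F 0) * (1 / (F 1 - F 0))" for t
  have "smooth_on \<sigma> UNIV" using F(1) unfolding smooth_on_def \<sigma>_def
    by (intro allI Ck_on_mult Ck_on_diff Ck_on_const open_UNIV) auto
  moreover have "(\<sigma> has_real_derivative b t / (F 1 - F 0)) (at t)" for t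
    unfolding \<sigma>_def using pos by (auto intro!: derivative_eq_intros F)
  moreover have "\<sigma> t = 0" if "t \<le> 0" for t unfolding \<sigma>_def F0[OF that] by simp
  moreover have "\<sigma> t = 1" if "t \<ge> 1" for t unfolding \<sigma>_def F1[OF that] using pos by simp
  moreover have "b t / (F 1 - F 0) \<ge> 0" for t using pos bn by simp
  moreover have "b t / (F 1 - F 0) > 0" if "0 < t" "t < 1" for t using pos bp[OF that] by simp
  moreover have "b t / (F 1 - F 0) = 0" if "t \<le> 0 \<or> t \<ge> 1" for t using b0[OF that] by simp
  ultimately show ?thesis
    by (intro exI[of _ \<sigma>] exI[of _ "\<lambda>t. b t / (F 1 - F 0)"] conjI allI impI) blast+
qed

definition smooth_step :: "real \<Rightarrow> real" where
  "smooth_step = (SOME \<sigma>. \<exists>\<sigma>'. smooth_on \<sigma> UNIV \<and> (\<forall>t. (\<sigma> has_real_derivative \<sigma>' t) (at t)) \<and>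
     (\<forall>t\<le>0. \<sigma> t = 0) \<and> (\<forall>t\<ge>1. \<sigma> t = 1) \<and> (\<forall>t. \<sigma>' t \<ge> 0) \<and> (\<forall>t. 0 < t \<and> t < 1 \<longrightarrow> \<sigma>' t > 0) \<and>
     (\<forall>t. t \<le> 0 \<or> t \<ge> 1 \<longrightarrow> \<sigma>' t = 0))"

lemma smooth_step:
  shows smooth_on_smooth_step: "smooth_on smooth_step UNIV"
    and smooth_step_0: "t \<le> 0 \<Longrightarrow> smooth_step t = 0"
    and smooth_step_1: "t \<ge> 1 \<Longrightarrow> smooth_step t = 1"
    and DERIV_smooth_step: "(smooth_step has_real_derivative deriv smooth_step t) (at t)"
    and deriv_smooth_step_nonneg: "deriv smooth_step t \<ge> 0"
    and deriv_smooth_step_pos: "0 < t \<Longrightarrow> t < 1 \<Longrightarrow> deriv smooth_step t > 0"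
    and deriv_smooth_step_0: "t \<le> 0 \<or> t \<ge> 1 \<Longrightarrow> deriv smooth_step t = 0"
proof -
  obtain \<sigma>' where *: "smooth_on smooth_step UNIV \<and> (\<forall>t. (smooth_step has_real_derivative \<sigma>' t) (at t)) \<and>
     (\<forall>t\<le>0. smooth_step t = 0) \<and> (\<forall>t\<ge>1. smooth_step t = 1) \<and> (\<forall>t. \<sigma>' t \<ge> 0) \<and> (\<forall>t. 0 < t \<and> t < 1 \<longrightarrow> \<sigma>' t > 0) \<and>
     (\<forall>t. t \<le> 0 \<or> t \<ge> 1 \<longrightarrow> \<sigma>' t = 0)"
    using someI_ex[OF smooth_step_exists] unfolding smooth_step_def by blast
  then have "deriv smooth_step t = \<sigma>' t" for t by (simp add: DERIV_imp_deriv)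
  with * show "smooth_on smooth_step UNIV" "t \<le> 0 \<Longrightarrow> smooth_step t = 0"
    "t \<ge> 1 \<Longrightarrow> smooth_step t = 1" "(smooth_step has_real_derivative deriv smooth_step t) (at t)"
    "deriv smooth_step t \<ge> 0" "0 < t \<Longrightarrow> t < 1 \<Longrightarrow> deriv smooth_step t > 0"
    "t \<le> 0 \<or> t \<ge> 1 \<Longrightarrow> deriv smooth_step t = 0" by auto
qed

lemma Ck_on_smooth_step: "Ck_on k smooth_step UNIV"
  using smooth_on_smooth_step by (simp add: smooth_on_def)

lemma Ck_on_deriv_smooth_step: "Ck_on k (deriv smooth_step) UNIV"
  by (rule Ck_on_real_deriv[OF _ Ck_on_smooth_step DERIV_smooth_step]) auto

lemma smooth_step_mono: "s \<le> t \<Longrightarrow> smooth_step s \<le> smooth_step t"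
  using DERIV_nonneg_imp_nondecreasing[of s t smooth_step] DERIV_smooth_step deriv_smooth_step_nonneg by blast

lemma smooth_step_bounds: "0 \<le> smooth_step t" "smooth_step t \<le> 1"
  using smooth_step_mono[of "min t 0" t] smooth_step_0[of "min t 0"] smooth_step_mono[of t "max t 1"] smooth_step_1[of "max t 1"] by auto

section \<open>Calculus of Hoelder classes\<close>

lemma Ck_holder_on_cong:
  assumes "open S" "\<And>x. x \<in> S \<Longrightarrow> f x = g x"
  shows "Ck_holder_on k \<alpha> f S \<longleftrightarrow> Ck_holder_on k \<alpha> g S"
  using assms(2)
proof (induction k arbitrary: f g)
  case 0
  have "f ` S = g ` S" using 0 by auto
  then show ?case using 0 by simp
next
  case (Suc k)
  have "Ck_holder_on k \<alpha> (\<lambda>x. frechet_derivative f (at x) v) S =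
      Ck_holder_on k \<alpha> (\<lambda>x. frechet_derivative g (at x) v) S" for v
    by (rule Suc.IH) (simp add: frechet_derivative_cong_open[OF assms(1) _ Suc.prems])
  moreover have "f ` S = g ` S" using Suc.prems by auto
  ultimately show ?case using differentiable_cong_open[OF assms(1) _ Suc.prems] by simp
qed

lemma Ck_holder_on_SucI:
  assumes "open S" "bounded (f ` S)" "\<And>x. x \<in> S \<Longrightarrow> (f has_derivative f' x) (at x)"
    "\<And>v. Ck_holder_on k \<alpha> (\<lambda>x. f' x v) S"
  shows "Ck_holder_on (Suc k) \<alpha> f S"
proof -
  have "Ck_holder_on k \<alpha> (\<lambda>x. frechet_derivative f (at x) v) S" for v
    using Ck_holder_on_cong[OF assms(1), of "\<lambda>x. frechet_derivative f (at x) v" "\<lambda>x. f' x v" k \<alpha>]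
      assms(3,4) frechet_derivative_eq by metis
  then show ?thesis using assms(2,3) by (auto simp: differentiable_def)
qed

lemma Ck_holder_on_has_derivative:
  assumes "Ck_holder_on (Suc k) \<alpha> f S" "x \<in> S"
  shows "(f has_derivative frechet_derivative f (at x)) (at x)"
  using assms frechet_derivative_works by auto

lemma Ck_holder_on_imp_bounded: "Ck_holder_on k \<alpha> f S \<Longrightarrow> bounded (f ` S)"
  by (cases k) auto

lemma Ck_holder_on_subset: "Ck_holder_on k \<alpha> f S \<Longrightarrow> T \<subseteq> S \<Longrightarrow> Ck_holder_on k \<alpha> f T"
proof (induction k arbitrary: f)
  case 0 then show ?case using bounded_subset[OF _ image_mono, of f S T] unfolding Ck_holder_on.simps by blast
next
  case (Suc k) then show ?case using bounded_subset[OF _ image_mono] by (auto simp: subset_iff)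
qed

text \<open>At distances up to 1 the Lipschitz bound is the stronger one; at larger distances
  boundedness of \<open>f\<close> takes over, whence the constant
  \<open>\<bar>L\<bar> + 2 * \<bar>M\<bar>\<close>.\<close>

lemma Lipschitz_imp_holder:
  fixes f :: "'a::real_normed_vector \<Rightarrow> real"
  assumes "bounded (f ` S)" and L: "\<And>x y. x \<in> S \<Longrightarrow> y \<in> S \<Longrightarrow> \<bar>f x - f y\<bar> \<le> L * norm (x - y)"
    and \<alpha>: "0 < \<alpha>" "\<alpha> \<le> 1"
  shows "Ck_holder_on 0 \<alpha> f S"
proof -
  obtain M where M: "\<And>x. x \<in> S \<Longrightarrow> \<bar>f x\<bar> \<le> M" using assms(1) by (auto simp: bounded_iff)
  have "\<bar>f x - f y\<bar> \<le> (\<bar>L\<bar> + 2 * \<bar>M\<bar>) * norm (x - y) powr \<alpha>" if "x \<in> S" "y \<in> S" for x y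
  proof (cases "norm (x - y) \<le> 1")
    case True
    have "norm (x - y) powr 1 \<le> norm (x - y) powr \<alpha>"
      using True \<alpha> by (intro powr_mono') auto
    then have "norm (x - y) \<le> norm (x - y) powr \<alpha>" by simp
    then have "\<bar>L\<bar> * norm (x - y) \<le> \<bar>L\<bar> * norm (x - y) powr \<alpha>" by (intro mult_left_mono) auto
    moreover have "L * norm (x - y) \<le> \<bar>L\<bar> * norm (x - y)" by (intro mult_right_mono) auto
    moreover have "0 \<le> 2 * \<bar>M\<bar> * norm (x - y) powr \<alpha>" by simp
    ultimately show ?thesis using L[OF that] unfolding distrib_right by linarith
  next
    case False
    then have "1 \<le> norm (x - y) powr \<alpha>" using \<alpha> by (intro ge_one_powr_ge_zero) auto
    then have "2 * \<bar>M\<bar> * 1 \<le> 2 * \<bar>M\<bar> * norm (x - y) powr \<alpha>" by (intro mult_left_mono) auto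
    moreover have "0 \<le> \<bar>L\<bar> * norm (x - y) powr \<alpha>" by simp
    ultimately show ?thesis using M[OF that(1)] M[OF that(2)] unfolding distrib_right by linarith
  qed
  then show ?thesis using assms(1) by auto
qed

text \<open>\<open>Ck_holder_on\<close> bounds one directional derivative at a time; summing over
  the basis recovers a bound of the operator norm.\<close>

lemma linear_bound_Basis:
  fixes A :: "'a::euclidean_space \<Rightarrow> real"
  assumes "linear A" "\<And>b. b \<in> Basis \<Longrightarrow> \<bar>A b\<bar> \<le> M b"
  shows "\<bar>A v\<bar> \<le> (\<Sum>b\<in>Basis. M b) * norm v"
proof -
  have "A v = (\<Sum>b\<in>Basis. (v \<bullet> b) * A b)"
    using Linear_Algebra.linear_componentwise[OF assms(1), of v 1] by simp
  then have "\<bar>A v\<bar> \<le> (\<Sum>b\<in>Basis. \<bar>(v \<bullet> b) * A b\<bar>)" using sum_abs by simp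
  also have "\<dots> \<le> (\<Sum>b\<in>Basis. norm v * M b)"
    unfolding abs_mult by (intro sum_mono mult_mono assms Basis_le_norm) auto
  finally show ?thesis by (simp add: sum_distrib_left mult.commute)
qed

lemma derivative_Basis_bound_imp_Lipschitz:
  fixes f :: "'a::euclidean_space \<Rightarrow> real"
  assumes "convex S" "\<And>x. x \<in> S \<Longrightarrow> (f has_derivative f' x) (at x within S)"
    "\<And>b x. b \<in> Basis \<Longrightarrow> x \<in> S \<Longrightarrow> \<bar>f' x b\<bar> \<le> M b" "x \<in> S" "y \<in> S"
  shows "\<bar>f x - f y\<bar> \<le> (\<Sum>b\<in>Basis. M b) * norm (x - y)"
proof -
  have "onorm (f' x) \<le> (\<Sum>b\<in>Basis. M b)" if "x \<in> S" for x
    by (rule onorm_bound) (use that assms(3)[of _ x]  linear_bound_Basis[OF has_derivative_linear[OF assms(2)[OF that]]]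
      in \<open>auto intro!: sum_nonneg intro: order_trans[OF abs_ge_zero]\<close>)
  then show ?thesis using differentiable_bound[OF assms(1,2) _ assms(5,4), of "\<Sum>b\<in>Basis. M b"]
    by (simp add: norm_minus_commute abs_minus_commute)
qed

lemma Ck_holder_on_Suc_imp_Lipschitz:
  fixes f :: "'a::euclidean_space \<Rightarrow> real"
  assumes "convex S" "Ck_holder_on (Suc k) \<alpha> f S"
  obtains L where "\<And>x y. x \<in> S \<Longrightarrow> y \<in> S \<Longrightarrow> \<bar>f x - f y\<bar> \<le> L * norm (x - y)"
proof -
  have "\<exists>M. \<forall>x\<in>S. \<bar>frechet_derivative f (at x) b\<bar> \<le> M" for b
    using Ck_holder_on_imp_bounded[of k \<alpha> "\<lambda>x. frechet_derivative f (at x) b" S] assms(2)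
    by (auto simp: bounded_iff)
  then obtain M where "\<And>b x. x \<in> S \<Longrightarrow> \<bar>frechet_derivative f (at x) b\<bar> \<le> M b" by metis
  then show ?thesis
    using derivative_Basis_bound_imp_Lipschitz[OF assms(1), of f "\<lambda>x. frechet_derivative f (at x)" M]
      has_derivative_at_withinI[OF Ck_holder_on_has_derivative[OF assms(2)]] that by blast
qed

text \<open>Convexity turns bounded first derivatives into a Lipschitz bound, and
  \<open>\<alpha> \<le> 1\<close> turns that into the Hoelder bound. Product and chain rules rely on
  this descent, since they multiply derivatives by factors that were not differentiated.\<close>

lemma Ck_holder_on_Suc_imp:
  fixes f :: "'a::euclidean_space \<Rightarrow> real"
  assumes "convex S" "0 < \<alpha>" "\<alpha> \<le> 1"
  shows "Ck_holder_on (Suc k) \<alpha> f S \<Longrightarrow> Ck_holder_on k \<alpha> f S"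
proof (induction k arbitrary: f)
  case 0
  show ?case
    by (rule Ck_holder_on_Suc_imp_Lipschitz[OF assms(1) 0], rule Lipschitz_imp_holder)
      (use 0 assms in auto)
next
  case (Suc k) then show ?case by (metis Ck_holder_on.simps(2))
qed

lemma Ck_holder_on_const [simp]: "Ck_holder_on k \<alpha> (\<lambda>x. c) S"
proof (induction k arbitrary: c)
  case 0
  have "bounded ((\<lambda>x. c) ` S)" by (auto simp: bounded_iff)
  then show ?case by (auto intro: exI[of _ 0])
next
  case (Suc k)
  have "bounded ((\<lambda>x. c) ` S)" by (auto simp: bounded_iff)
  then show ?case using Suc by (auto simp: frechet_derivative_eq[OF has_derivative_const])
qed

lemma Ck_holder_on_add:
  assumes "open S"
  shows "Ck_holder_on k \<alpha> f S \<Longrightarrow> Ck_holder_on k \<alpha> g S \<Longrightarrow> Ck_holder_on k \<alpha> (\<lambda>x. f x + g x) S"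
proof (induction k arbitrary: f g)
  case 0
  then obtain C C' where "\<forall>x\<in>S. \<forall>y\<in>S. \<bar>f x - f y\<bar> \<le> C * norm (x - y) powr \<alpha>"
    "\<forall>x\<in>S. \<forall>y\<in>S. \<bar>g x - g y\<bar> \<le> C' * norm (x - y) powr \<alpha>" by auto
  then have "\<forall>x\<in>S. \<forall>y\<in>S. \<bar>(f x + g x) - (f y + g y)\<bar> \<le> (C + C') * norm (x - y) powr \<alpha>"
    unfolding distrib_right by (smt (verit, ccfv_SIG))
  then show ?case using 0 bounded_plus_comp[of f S g] by auto
next
  case (Suc k)
  show ?case
  proof (rule Ck_holder_on_SucI[OF assms])
    show "bounded ((\<lambda>x. f x + g x) ` S)" using Suc.prems bounded_plus_comp[of f S g] by simp
    fix x assume "x \<in> S"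
    then show "((\<lambda>x. f x + g x) has_derivative (\<lambda>v. frechet_derivative f (at x) v + frechet_derivative g (at x) v)) (at x)"
      using Suc.prems[THEN Ck_holder_on_has_derivative] by (auto intro: has_derivative_add)
  qed (use Suc in auto)
qed

lemma bounded_mult_comp:
  fixes f g :: "'a \<Rightarrow> real"
  assumes "bounded (f ` S)" "bounded (g ` S)" shows "bounded ((\<lambda>x. f x * g x) ` S)"
proof -
  obtain M N where "\<forall>x\<in>S. \<bar>f x\<bar> \<le> M" "\<forall>x\<in>S. \<bar>g x\<bar> \<le> N" using assms by (auto simp: bounded_iff)
  then have "\<forall>x\<in>S. \<bar>f x * g x\<bar> \<le> M * N" by (auto simp: abs_mult intro!: mult_mono intro: order_trans[OF abs_ge_zero])
  then show ?thesis by (auto simp: bounded_iff)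
qed

lemma Ck_holder_on_mult:
  fixes f g :: "'a::euclidean_space \<Rightarrow> real"
  assumes "open S" "convex S" "0 < \<alpha>" "\<alpha> \<le> 1"
  shows "Ck_holder_on k \<alpha> f S \<Longrightarrow> Ck_holder_on k \<alpha> g S \<Longrightarrow> Ck_holder_on k \<alpha> (\<lambda>x. f x * g x) S"
proof (induction k arbitrary: f g)
  case 0
  then obtain C C' M N where C: "\<forall>x\<in>S. \<forall>y\<in>S. \<bar>f x - f y\<bar> \<le> C * norm (x - y) powr \<alpha>"
    "\<forall>x\<in>S. \<forall>y\<in>S. \<bar>g x - g y\<bar> \<le> C' * norm (x - y) powr \<alpha>" "\<forall>x\<in>S. \<bar>f x\<bar> \<le> M" "\<forall>x\<in>S. \<bar>g x\<bar> \<le> N"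
    by (auto simp: bounded_iff)
  have "\<bar>f x * g x - f y * g y\<bar> \<le> (M * C' + C * N) * norm (x - y) powr \<alpha>" if "x \<in> S" "y \<in> S" for x y
  proof -
    have "f x * g x - f y * g y = f x * (g x - g y) + (f x - f y) * g y" by algebra
    also have "\<bar>\<dots>\<bar> \<le> \<bar>f x\<bar> * \<bar>g x - g y\<bar> + \<bar>f x - f y\<bar> * \<bar>g y\<bar>" by (metis abs_mult abs_triangle_ineq)
    also have "\<dots> \<le> M * (C' * norm (x - y) powr \<alpha>) + (C * norm (x - y) powr \<alpha>) * N"
      by (intro add_mono mult_mono) (use C that in \<open>auto intro: order_trans[OF abs_ge_zero]\<close>)
    finally show ?thesis by (simp add: algebra_simps)
  qed
  then show ?case using 0 bounded_mult_comp[of f S g] by auto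
next
  case (Suc k)
  show ?case
  proof (rule Ck_holder_on_SucI[OF assms(1)])
    show "bounded ((\<lambda>x. f x * g x) ` S)" using Suc.prems bounded_mult_comp[of f S g] by simp
    fix x assume "x \<in> S"
    then show "((\<lambda>x. f x * g x) has_derivative (\<lambda>v. f x * frechet_derivative g (at x) v + frechet_derivative f (at x) v * g x)) (at x)"
      using Suc.prems[THEN Ck_holder_on_has_derivative] by (auto intro: has_derivative_mult)
  next
    fix v
    have "Ck_holder_on k \<alpha> (\<lambda>x. frechet_derivative f (at x) v) S" "Ck_holder_on k \<alpha> (\<lambda>x. frechet_derivative g (at x) v) S"
      using Suc.prems by auto
    then show "Ck_holder_on k \<alpha> (\<lambda>x. f x * frechet_derivative g (at x) v + frechet_derivative f (at x) v * g x) S"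
      using Suc.prems[THEN Ck_holder_on_Suc_imp[OF assms(2-4)]] by (intro Ck_holder_on_add[OF assms(1)] Suc.IH)
  qed
qed

text \<open>The induction is on the order with \<open>f\<close> fixed: the derivative of
  \<open>1 / f\<close> is built from \<open>1 / f\<close> and a derivative of \<open>f\<close>, both
  of the lower order. The uniform bound \<open>m\<close> stands in for pointwise nonvanishing
  because the classes are uniform on \<open>S\<close>.\<close>

lemma Ck_holder_on_inverse:
  fixes f :: "'a::euclidean_space \<Rightarrow> real"
  assumes S: "open S" "convex S" "0 < \<alpha>" "\<alpha> \<le> 1" and m: "m > 0" "\<And>x. x \<in> S \<Longrightarrow> m \<le> f x"
  shows "Ck_holder_on k \<alpha> f S \<Longrightarrow> Ck_holder_on k \<alpha> (\<lambda>x. inverse (f x)) S"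
proof (induction k)
  have b: "\<bar>inverse (f x)\<bar> \<le> inverse m" if "x \<in> S" for x
    using m(1) m(2)[OF that] by (simp add: le_imp_inverse_le)
  then have bd: "bounded ((\<lambda>x. inverse (f x)) ` S)" by (auto simp: bounded_iff)
  {
    case 0
    then obtain C where C: "\<forall>x\<in>S. \<forall>y\<in>S. \<bar>f x - f y\<bar> \<le> C * norm (x - y) powr \<alpha>" by auto
    have "\<bar>inverse (f x) - inverse (f y)\<bar> \<le> (inverse m * C * inverse m) * norm (x - y) powr \<alpha>" if "x \<in> S" "y \<in> S" for x y
    proof -
      have "f x \<noteq> 0" "f y \<noteq> 0" using m that by force+
      then have "inverse (f x) - inverse (f y) = - (inverse (f x) * (f x - f y) * inverse (f y))"
        by (rule inverse_diff_inverse)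
      also have "\<bar>\<dots>\<bar> \<le> inverse m * (C * norm (x - y) powr \<alpha>) * inverse m"
        unfolding abs_minus abs_mult
        using C[rule_format, OF that] order_trans[OF abs_ge_zero C[rule_format, OF that]] m(1)
        by (intro mult_mono b that) (auto simp: zero_le_mult_iff)
      finally show ?thesis by (simp add: algebra_simps)
    qed
    then show ?case using bd by auto
  next
    case (Suc k)
    show ?case
    proof (rule Ck_holder_on_SucI[OF S(1) bd])
      fix x assume "x \<in> S"
      then have "f x \<noteq> 0" using m by force
      then show "((\<lambda>x. inverse (f x)) has_derivative (\<lambda>v. (- 1) * (inverse (f x) * frechet_derivative f (at x) v * inverse (f x)))) (at x)"
        using Deriv.has_derivative_inverse[OF _ Ck_holder_on_has_derivative[OF Suc.prems \<open>x \<in> S\<close>]] by simp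
    next
      fix v
      have "Ck_holder_on k \<alpha> (\<lambda>x. frechet_derivative f (at x) v) S"
        using Suc.prems by auto
      then show "Ck_holder_on k \<alpha> (\<lambda>x. (- 1) * (inverse (f x) * frechet_derivative f (at x) v * inverse (f x))) S"
        using Suc.prems[THEN Ck_holder_on_Suc_imp[OF S(2-4)]]
        by (intro Ck_holder_on_mult[OF S] Suc.IH Ck_holder_on_const)
    qed
  }
qed

text \<open>One order of differentiability is spent on the Hoelder bound: the next derivative is
  bounded on the compact \<open>K\<close>, hence the current one is Lipschitz on the convex
  \<open>S\<close>.\<close>

lemma Ck_on_imp_Ck_holder_on:
  fixes f :: "'a::euclidean_space \<Rightarrow> real"
  assumes K: "compact K" "K \<subseteq> U" "S \<subseteq> K" "convex S" and \<alpha>: "0 < \<alpha>" "\<alpha> \<le> 1"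
  shows "Ck_on (Suc k) f U \<Longrightarrow> Ck_holder_on k \<alpha> f S"
proof (induction k arbitrary: f)
  have bd: "bounded (f ` S)" if "continuous_on U f" for f :: "'a \<Rightarrow> real"
    using compact_imp_bounded[OF compact_continuous_image[OF continuous_on_subset[OF that K(2)] K(1)]]
      bounded_subset image_mono[OF K(3)] by metis
  {
    case 0
    have "bounded ((\<lambda>x. frechet_derivative f (at x) b) ` S)" for b
      by (rule bd) (use 0 in auto)
    then have "\<exists>M. \<forall>x\<in>S. \<bar>frechet_derivative f (at x) b\<bar> \<le> M" for b by (auto simp: bounded_iff)
    then obtain M where M: "\<And>b x. x \<in> S \<Longrightarrow> \<bar>frechet_derivative f (at x) b\<bar> \<le> M b" by metis
    have "(f has_derivative frechet_derivative f (at x)) (at x within S)" if "x \<in> S" for x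
      using Ck_on_has_derivative[OF 0] that K has_derivative_at_withinI by blast
    then show ?case
      using Lipschitz_imp_holder[OF bd[OF Ck_on_imp_continuous_on[OF 0]] _ \<alpha>]
        derivative_Basis_bound_imp_Lipschitz[OF K(4), of f "\<lambda>x. frechet_derivative f (at x)" M] M by blast
  next
    case (Suc k)
    have "f differentiable at x" if "x \<in> S" for x using Suc.prems that K by auto
    moreover have "Ck_holder_on k \<alpha> (\<lambda>x. frechet_derivative f (at x) v) S" for v
      using Suc.prems by (intro Suc.IH) auto
    ultimately show ?case using bd[OF Ck_on_imp_continuous_on[OF Suc.prems]] by simp
  }
qed

section \<open>Level sets as graphs\<close>

text \<open>A quantitative implicit function theorem. The neighbourhood is a box, tall in direction
  \<open>i\<close> and thin in the others, over a base encoded as the cylinder \<open>D\<close>. On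
  it \<open>v\<close> has opposite signs at top and bottom, which gives a zero over each base point,
  and increases along \<open>axis i 1\<close> with speed at least \<open>m\<close>, which makes that
  zero unique. Besides the graph, the uniform data for Hoelder regularity are returned: the lower
  bound \<open>m\<close>, a Lipschitz constant of \<open>g\<close>, and a formula for its
  derivative.\<close>

lemma implicit_graph:
  fixes v :: "real ^ 'n::finite \<Rightarrow> real"
  assumes O: "open O'" "x0 \<in> O'" and v: "Ck_on 1 v O'" "v x0 = 0"
    and pos: "frechet_derivative v (at x0) (axis i 1) > 0"
  obtains V D g m L where "open V" "x0 \<in> V" "V \<subseteq> O'" "open D" "convex D" "omits_coordinate i g D"
    "{x \<in> V. v x = 0} = {x \<in> D. x $ i = g x}"
    "\<And>x. x \<in> D \<Longrightarrow> x + (g x - x $ i) *\<^sub>R axis i 1 \<in> V"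
    "m > 0" "\<And>x. x \<in> V \<Longrightarrow> m \<le> frechet_derivative v (at x) (axis i 1)"
    "\<And>x y. x \<in> D \<Longrightarrow> y \<in> D \<Longrightarrow> \<bar>g x - g y\<bar> \<le> L * norm (x - y)" "bounded (g ` D)"
    "\<And>x. x \<in> D \<Longrightarrow> (g has_derivative (\<lambda>e. e $ i - frechet_derivative v (at (x + (g x - x $ i) *\<^sub>R axis i 1)) e /
         frechet_derivative v (at (x + (g x - x $ i) *\<^sub>R axis i 1)) (axis i 1))) (at x)"
proof -
  define F where "F x = frechet_derivative v (at x)" for x
  define ax :: "real ^ 'n" where "ax = axis i 1"
  define n where "n = real CARD('n)"
  have n: "n \<ge> 1" unfolding n_def by (simp add: Suc_le_eq)
  have ax: "ax $ i = 1" "\<And>j. j \<noteq> i \<Longrightarrow> ax $ j = 0" "norm ax = 1" "ax \<in> Basis"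
    by (auto simp: ax_def axis_def norm_axis_1[unfolded axis_def] Basis_vec_def)
  have der: "(v has_derivative F x) (at x)" if "x \<in> O'" for x
    using v that frechet_derivative_works unfolding F_def by auto
  have cont: "continuous_on O' (\<lambda>x. F x e)" for e using v(1) by (simp add: F_def)
  \<comment> \<open>Half of the value at \<open>x0\<close>, so that it stays a strict lower bound
    nearby.\<close>
  define m where "m = F x0 ax / 2"
  have m: "m > 0" using pos by (simp add: m_def F_def ax_def)
  define O1 where "O1 = (O' \<inter> (\<lambda>x. F x ax) -` {m<..}) \<inter>
    (\<Inter>b\<in>Basis. O' \<inter> (\<lambda>x. F x b) -` {- (\<bar>F x0 b\<bar> + 1)<..<\<bar>F x0 b\<bar> + 1})"
  have "open O1" unfolding O1_def
    by (intro open_Int open_INT finite_Basis ballI continuous_open_preimage cont O(1)) auto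
  moreover have "x0 \<in> O1" using m O(2) by (auto simp: O1_def m_def)
  ultimately obtain R where R: "R > 0" "ball x0 R \<subseteq> O1" using open_contains_ball by blast
  \<comment> \<open>The l1 norm dominates the Euclidean one, so points of the cube of half side
    \<open>r\<close> are at distance at most \<open>n * r = R / 2\<close> from
    \<open>x0\<close>.\<close>
  define r where "r = R / (2 * n)"
  have r: "r > 0" using R n by (simp add: r_def)
  define V0 where "V0 = {x :: real ^ 'n. \<forall>j. \<bar>x $ j - x0 $ j\<bar> \<le> r}"
  have V0_O1: "V0 \<subseteq> O1"
  proof
    fix x assume x: "x \<in> V0"
    have "norm (x - x0) \<le> (\<Sum>j\<in>UNIV. \<bar>(x - x0) $ j\<bar>)" by (rule norm_le_l1_cart)
    also have "\<dots> \<le> (\<Sum>j\<in>(UNIV::'n set). r)" by (intro sum_mono) (use x in \<open>auto simp: V0_def\<close>)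
    also have "\<dots> = R / 2" using n by (simp add: r_def n_def)
    also have "\<dots> < R" using R by simp
    finally show "x \<in> O1" using R by (auto simp: dist_norm norm_minus_commute)
  qed
  have V0_O: "x \<in> O'" if "x \<in> V0" for x using V0_O1 that by (auto simp: O1_def)
  have V0m: "F x ax > m" if "x \<in> V0" for x using V0_O1 that by (auto simp: O1_def)
  have conv: "convex V0"
  proof -
    have "V0 = cbox (x0 - (\<chi> j. r)) (x0 + (\<chi> j. r))"
      by (auto simp: V0_def mem_box_cart abs_le_iff algebra_simps)
    then show ?thesis by (simp add: convex_box)
  qed
  have V0b: "\<bar>F x b\<bar> \<le> \<bar>F x0 b\<bar> + 1" if "x \<in> V0" "b \<in> Basis" for x b
  proof -
    have "x \<in> (\<lambda>x. F x b) -` {- (\<bar>F x0 b\<bar> + 1)<..<\<bar>F x0 b\<bar> + 1}"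
      using subsetD[OF V0_O1 that(1)] that(2) unfolding O1_def by blast
    then show ?thesis by (simp add: abs_le_iff)
  qed
  define B where "B = (\<Sum>b\<in>Basis. \<bar>F x0 b\<bar> + 1)"
  have B0: "B > 0" unfolding B_def by (intro sum_pos) auto
  have lip: "\<bar>v x - v y\<bar> \<le> B * norm (x - y)" if "x \<in> V0" "y \<in> V0" for x y
    unfolding B_def
    by (rule derivative_Basis_bound_imp_Lipschitz[OF conv _ _ that, of v F])
      (auto intro!: has_derivative_at_withinI der V0_O V0b)
  have mono: "v (x + t *\<^sub>R ax) - v x \<ge> m * t" if "x \<in> V0" "x + t *\<^sub>R ax \<in> V0" "t > 0" for x t
  proof -
    have seg: "x + s *\<^sub>R ax \<in> V0" if "0 \<le> s" "s \<le> t" for s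
    proof -
      have "x + s *\<^sub>R ax = (1 - s / t) *\<^sub>R x + (s / t) *\<^sub>R (x + t *\<^sub>R ax)"
        using \<open>t > 0\<close> by (simp add: algebra_simps)
      then show ?thesis using conv \<open>x \<in> V0\<close> \<open>x + t *\<^sub>R ax \<in> V0\<close> that \<open>t > 0\<close>
        by (simp add: convexD_alt)
    qed
    have "((\<lambda>s. v (x + s *\<^sub>R ax)) has_real_derivative F (x + s *\<^sub>R ax) ax) (at s)" if "0 \<le> s" "s \<le> t" for s
    proof -
      have "((\<lambda>s. v (x + s *\<^sub>R ax)) has_derivative (\<lambda>h. F (x + s *\<^sub>R ax) (h *\<^sub>R ax))) (at s)"
        by (rule has_derivative_compose[where f = "\<lambda>s. x + s *\<^sub>R ax" and g = v and f' = "\<lambda>h. h *\<^sub>R ax"])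
          (auto intro!: derivative_eq_intros der[OF V0_O[OF seg[OF that]]])
      moreover have "(\<lambda>h. F (x + s *\<^sub>R ax) (h *\<^sub>R ax)) = (\<lambda>h. F (x + s *\<^sub>R ax) ax * h)"
        using linear_scale[OF has_derivative_linear[OF der[OF V0_O[OF seg[OF that]]]]] by (auto simp: mult.commute)
      ultimately show ?thesis by (simp add: has_field_derivative_def)
    qed
    then have "\<exists>z>0. z < t \<and> v (x + t *\<^sub>R ax) - v (x + 0 *\<^sub>R ax) = (t - 0) * F (x + z *\<^sub>R ax) ax"
      by (intro MVT2) (use that in auto)
    then obtain z where "0 < z" "z < t" "v (x + t *\<^sub>R ax) - v x = t * F (x + z *\<^sub>R ax) ax" by auto
    moreover have "m * t \<le> F (x + z *\<^sub>R ax) ax * t"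
      using V0m[OF seg[of z]] calculation that by (intro mult_right_mono) auto
    ultimately show ?thesis by (simp add: mult.commute)
  qed
  \<comment> \<open>On the axis through \<open>x0\<close>, \<open>v\<close> has size at least
    \<open>m * r\<close> at distance \<open>r\<close>. Moving sideways by \<delta> in every
    coordinate changes \<open>v\<close> by at most \<open>B * (n * \<delta>)\<close>, which this
    choice keeps below \<open>m * r\<close>, so the signs at top and bottom persist over all of
    \<open>D\<close>.\<close>
  define \<delta> where "\<delta> = min (r/2) (m * r / (2 * B * n))"
  have \<delta>: "0 < \<delta>" "\<delta> < r" "B * (n * \<delta>) < m * r"
  proof -
    show "0 < \<delta>" "\<delta> < r" using r m B0 n by (auto simp: \<delta>_def)
    have "B * (n * \<delta>) \<le> B * (n * (m * r / (2 * B * n)))" using B0 n by (intro mult_left_mono) (auto simp: \<delta>_def)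
    also have "\<dots> = m * r / 2" using B0 n by (simp add: field_simps)
    also have "\<dots> < m * r" using m r by simp
    finally show "B * (n * \<delta>) < m * r" .
  qed
  define D where "D = {x :: real ^ 'n. \<forall>j. j \<noteq> i \<longrightarrow> \<bar>x $ j - x0 $ j\<bar> < \<delta>}"
  define V where "V = {x \<in> D. \<bar>x $ i - x0 $ i\<bar> < r}"
  define pr where "pr x t = x + (t - x $ i) *\<^sub>R ax" for x :: "real ^ 'n" and t
  have pr: "pr x t $ i = t" "j \<noteq> i \<Longrightarrow> pr x t $ j = x $ j" for x t j by (auto simp: pr_def ax)
  have pr_D: "pr x t \<in> D \<longleftrightarrow> x \<in> D" for x t by (auto simp: D_def pr)
  have V_V0: "V \<subseteq> V0"
  proof
    fix x assume x: "x \<in> V"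
    have "\<bar>x $ j - x0 $ j\<bar> \<le> r" for j
      by (cases "j = i") (use x \<delta> in \<open>auto simp: V_def D_def intro: less_imp_le less_trans\<close>)
    then show "x \<in> V0" by (simp add: V0_def)
  qed
  have pr_V0: "pr x t \<in> V0" if "x \<in> D" "\<bar>t - x0 $ i\<bar> \<le> r" for x t
    unfolding V0_def
  proof (intro CollectI allI)
    fix j show "\<bar>pr x t $ j - x0 $ j\<bar> \<le> r"
      by (cases "j = i") (use that \<delta> in \<open>auto simp: pr D_def intro: less_imp_le less_trans\<close>)
  qed
  have D_eq: "D = (\<Inter>j\<in>-{i}. {x. x $ j - x0 $ j < \<delta>} \<inter> {x. x0 $ j - x $ j < \<delta>})"
    by (auto simp: D_def abs_less_iff)
  have openD: "open D" unfolding D_eq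
    by (intro open_INT open_Int open_Collect_less continuous_intros ballI) auto
  have convD: "convex D" unfolding D_eq
  proof (intro convex_INT convex_Int)
    fix j
    have 1: "{x :: real ^ 'n. x $ j - x0 $ j < \<delta>} = {x. axis j 1 \<bullet> x < \<delta> + x0 $ j}" by (auto simp: inner_axis' algebra_simps)
    have 2: "{x :: real ^ 'n. x0 $ j - x $ j < \<delta>} = {x. axis j 1 \<bullet> x > x0 $ j - \<delta>}" by (auto simp: inner_axis' algebra_simps)
    show "convex {x :: real ^ 'n. x $ j - x0 $ j < \<delta>}" "convex {x :: real ^ 'n. x0 $ j - x $ j < \<delta>}"
      unfolding 1 2 by (rule convex_halfspace_lt convex_halfspace_gt)+
  qed
  have x0: "x0 \<in> D" "x0 \<in> V" "x0 \<in> V0" using \<delta> r by (auto simp: D_def V_def V0_def)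
  have "open V"
  proof -
    have "V = D \<inter> {x. x $ i - x0 $ i < r} \<inter> {x. x0 $ i - x $ i < r}" by (auto simp: V_def abs_less_iff)
    then show ?thesis by (auto intro!: open_Int openD open_Collect_less continuous_intros)
  qed
  have prdist: "norm (pr x t - pr y t) \<le> norm (x - y)" for x y t
  proof (rule norm_le_componentwise_cart)
    fix j show "norm ((pr x t - pr y t) $ j) \<le> norm ((x - y) $ j)" by (cases "j = i") (auto simp: pr)
  qed
  have prx0: "norm (pr x t - pr x0 t) \<le> n * \<delta>" if "x \<in> D" for x t
  proof -
    have "norm (pr x t - pr x0 t) \<le> (\<Sum>j\<in>UNIV. \<bar>(pr x t - pr x0 t) $ j\<bar>)" by (rule norm_le_l1_cart)
    also have "\<dots> \<le> (\<Sum>j\<in>(UNIV::'n set). \<delta>)"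
    proof (rule sum_mono)
      fix j show "\<bar>(pr x t - pr x0 t) $ j\<bar> \<le> \<delta>"
        by (cases "j = i") (use that \<delta> in \<open>auto simp: pr D_def intro: less_imp_le\<close>)
    qed
    finally show ?thesis by (simp add: n_def)
  qed
  have prmono: "m * (t - s) \<le> v (pr x t) - v (pr x s)"
    if "x \<in> D" "\<bar>t - x0 $ i\<bar> \<le> r" "\<bar>s - x0 $ i\<bar> \<le> r" "s \<le> t" for x s t
  proof (cases "s = t")
    case False
    have "pr x t = pr x s + (t - s) *\<^sub>R ax" by (simp add: pr_def algebra_simps)
    then show ?thesis using mono[of "pr x s" "t - s"] pr_V0[OF that(1,2)] pr_V0[OF that(1,3)] that False by simp
  qed simp
  have prabs: "m * \<bar>t - s\<bar> \<le> \<bar>v (pr x t) - v (pr x s)\<bar>"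
    if "x \<in> D" "\<bar>t - x0 $ i\<bar> \<le> r" "\<bar>s - x0 $ i\<bar> \<le> r" for x s t
    using prmono[of x t s] prmono[of x s t] that by (cases "s \<le> t") (auto simp: abs_minus_commute)
  have self: "pr x (x $ i) = x" for x by (simp add: pr_def)
  have ex: "\<exists>t. \<bar>t - x0 $ i\<bar> < r \<and> v (pr x t) = 0" if x: "x \<in> D" for x
  proof -
    have "m * r \<le> v (pr x0 (x0 $ i + r)) - v (pr x0 (x0 $ i))" "m * r \<le> v (pr x0 (x0 $ i)) - v (pr x0 (x0 $ i - r))"
      using prmono[OF x0(1), of "x0 $ i + r" "x0 $ i"] prmono[OF x0(1), of "x0 $ i" "x0 $ i - r"] r by auto
    then have 1: "m * r \<le> v (pr x0 (x0 $ i + r))" "m * r \<le> - v (pr x0 (x0 $ i - r))" using v(2) self by auto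
    have 2: "\<bar>v (pr x t) - v (pr x0 t)\<bar> < m * r" if "\<bar>t - x0 $ i\<bar> \<le> r" for t
    proof -
      have "\<bar>v (pr x t) - v (pr x0 t)\<bar> \<le> B * norm (pr x t - pr x0 t)" by (rule lip) (use that x x0 pr_V0 in auto)
      also have "\<dots> \<le> B * (n * \<delta>)" using prx0[OF x] B0 by (intro mult_left_mono) auto
      finally show ?thesis using \<delta> by simp
    qed
    have pm: "v (pr x (x0 $ i + r)) > 0" "v (pr x (x0 $ i - r)) < 0"
      using 1 2[of "x0 $ i + r"] 2[of "x0 $ i - r"] r by auto
    have "continuous_on {x0 $ i - r .. x0 $ i + r} (\<lambda>t. v (pr x t))"
    proof (rule continuous_on_compose2[of V0 v])
      show "continuous_on V0 v" using der V0_O has_derivative_continuous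
        by (metis continuous_at_imp_continuous_on)
      show "continuous_on {x0 $ i - r .. x0 $ i + r} (pr x)" unfolding pr_def by (intro continuous_intros)
      show "pr x ` {x0 $ i - r .. x0 $ i + r} \<subseteq> V0" using pr_V0[OF x] by (auto simp: abs_le_iff)
    qed
    then obtain t where t: "x0 $ i - r \<le> t" "t \<le> x0 $ i + r" "v (pr x t) = 0"
      using IVT'[of "\<lambda>t. v (pr x t)" "x0 $ i - r" 0 "x0 $ i + r"] pm r by auto
    moreover have "t \<noteq> x0 $ i - r" "t \<noteq> x0 $ i + r" using t(3) pm by auto
    ultimately show ?thesis by (intro exI[of _ t]) auto
  qed
  define g where "g x = (SOME t. \<bar>t - x0 $ i\<bar> < r \<and> v (pr x t) = 0)" for x
  have g: "\<bar>g x - x0 $ i\<bar> < r" "v (pr x (g x)) = 0" if "x \<in> D" for x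
    using someI_ex[OF ex[OF that]] unfolding g_def by auto
  have g_unique: "t = g x" if "x \<in> D" "\<bar>t - x0 $ i\<bar> < r" "v (pr x t) = 0" for x t
    using prabs[of x t "g x"] g[OF that(1)] that m by (simp add: mult_le_0_iff)
  have gV: "pr x (g x) \<in> V" if "x \<in> D" for x using g[OF that] that pr_D by (auto simp: V_def pr)
  have omits: "omits_coordinate i g D"
    unfolding omits_coordinate_def ax_def[symmetric]
  proof (intro ballI allI conjI)
    fix x t assume x: "x \<in> D"
    then show "x + t *\<^sub>R ax \<in> D" by (auto simp: D_def ax)
    have "pr (x + t *\<^sub>R ax) s = pr x s" for s by (simp add: pr_def ax algebra_simps)
    then show "g (x + t *\<^sub>R ax) = g x" by (simp add: g_def)
  qed
  have Z: "{x \<in> V. v x = 0} = {x \<in> D. x $ i = g x}"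
  proof (intro equalityI subsetI)
    fix x assume "x \<in> {x \<in> V. v x = 0}"
    then show "x \<in> {x \<in> D. x $ i = g x}" using g_unique[of x "x $ i"] self by (auto simp: V_def)
  next
    fix x assume "x \<in> {x \<in> D. x $ i = g x}"
    then show "x \<in> {x \<in> V. v x = 0}" using g[of x] self[of x] by (auto simp: V_def)
  qed
  \<comment> \<open>Both heights are compared over the same base point \<open>y\<close>: the speed
    \<open>m\<close> bounds their difference by a change of \<open>v\<close>, and since
    \<open>v\<close> vanishes at both graph points, that change is a purely sideways one.\<close>
  have gLip: "\<bar>g x - g y\<bar> \<le> (B / m) * norm (x - y)" if "x \<in> D" "y \<in> D" for x y
  proof -
    have "m * \<bar>g x - g y\<bar> \<le> \<bar>v (pr y (g x)) - v (pr y (g y))\<bar>" by (rule prabs) (use that g less_imp_le in auto)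
    also have "\<dots> = \<bar>v (pr y (g x)) - v (pr x (g x))\<bar>" using g that by simp
    also have "\<dots> \<le> B * norm (pr y (g x) - pr x (g x))" by (intro lip pr_V0 that less_imp_le[OF g(1)])
    also have "\<dots> \<le> B * norm (y - x)" using prdist B0 by (intro mult_left_mono) auto
    finally show ?thesis using m by (simp add: field_simps norm_minus_commute)
  qed
  define \<Gamma> where "\<Gamma> x = pr x (g x)" for x
  \<comment> \<open>\<open>v\<close> is zero along \<open>\<Gamma>\<close>, so
    \<open>A (\<Gamma> y - \<Gamma> x)\<close> is just the remainder in the linearisation of
    \<open>v\<close>. Solving this linear relation for \<open>g y - g x\<close> gives the formula,
    with \<open>d = A ax\<close> as denominator.\<close>
  have gder: "(g has_derivative (\<lambda>e. e $ i - F (\<Gamma> x) e / F (\<Gamma> x) ax)) (at x)" if x: "x \<in> D" for x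
  proof -
    have \<Gamma>x: "\<Gamma> x \<in> V0" "\<Gamma> x \<in> O'" using gV[OF x] V_V0 V0_O by (auto simp: \<Gamma>_def)
    define A where "A = F (\<Gamma> x)"
    define d where "d = A ax"
    have d: "d > 0" using V0m[OF \<Gamma>x(1)] m by (simp add: d_def A_def)
    have Ader: "(v has_derivative A) (at (\<Gamma> x))" using der \<Gamma>x by (simp add: A_def)
    have blA: "bounded_linear A" using Ader by (rule has_derivative_bounded_linear)
    have linA: "linear A" using blA by (rule bounded_linear.linear)
    define C where "C = 2 + B / m"
    have C: "C > 0" using B0 m by (simp add: C_def add_pos_pos)
    have \<Gamma>diff: "\<Gamma> y - \<Gamma> x = (y - x) + ((g y - g x) - (y - x) $ i) *\<^sub>R ax" for y
      by (simp add: \<Gamma>_def pr_def algebra_simps)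
    have \<Gamma>lip: "norm (\<Gamma> y - \<Gamma> x) \<le> C * norm (y - x)" if "y \<in> D" for y
    proof -
      have "norm (\<Gamma> y - \<Gamma> x) \<le> norm (y - x) + norm (((g y - g x) - (y - x) $ i) *\<^sub>R ax)"
        unfolding \<Gamma>diff by (rule norm_triangle_ineq)
      also have "\<dots> \<le> norm (y - x) + (\<bar>g y - g x\<bar> + \<bar>(y - x) $ i\<bar>)"
        by (simp add: ax)
      also have "\<dots> \<le> norm (y - x) + (B / m * norm (y - x) + norm (y - x))"
        by (intro add_mono order_refl gLip that x component_le_norm_cart)
      finally show ?thesis by (simp add: C_def algebra_simps)
    qed
    show ?thesis unfolding A_def[symmetric] d_def[symmetric] has_derivative_at_alt
    proof (intro conjI allI impI)
      show "bounded_linear (\<lambda>e. e $ i - A e / d)"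
        by (intro bounded_linear_sub bounded_linear_divide[THEN bounded_linear_compose] blA bounded_linear_vec_nth)
      fix e :: real assume e: "e > 0"
      \<comment> \<open>In the tolerance \<open>e * d / C\<close>, the factor \<open>C\<close> pays
        for the Lipschitz constant of \<open>\<Gamma>\<close> and \<open>d\<close> for the division
        at the end.\<close>
      obtain \<eta> where \<eta>: "\<eta> > 0" "\<And>z. norm (z - \<Gamma> x) < \<eta> \<Longrightarrow> norm (v z - v (\<Gamma> x) - A (z - \<Gamma> x)) \<le> (e * d / C) * norm (z - \<Gamma> x)"
        using Ader e d C unfolding has_derivative_at_alt by (metis divide_pos_pos mult_pos_pos)
      obtain \<rho> where \<rho>: "\<rho> > 0" "ball x \<rho> \<subseteq> D" using openD x open_contains_ball by blast
      show "\<exists>da>0. \<forall>y. norm (y - x) < da \<longrightarrow> norm (g y - g x - ((y - x) $ i - A (y - x) / d)) \<le> e * norm (y - x)"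
      proof (intro exI[of _ "min \<rho> (\<eta> / C)"] conjI allI impI)
        show "min \<rho> (\<eta> / C) > 0" using \<rho> \<eta> C by simp
        fix y assume y: "norm (y - x) < min \<rho> (\<eta> / C)"
        then have yD: "y \<in> D" using \<rho> by (auto simp: dist_norm norm_minus_commute)
        have "norm (\<Gamma> y - \<Gamma> x) < \<eta>"
          using \<Gamma>lip[OF yD] y C by (auto simp: field_simps intro: le_less_trans)
        from \<eta>(2)[OF this] have "\<bar>A (\<Gamma> y - \<Gamma> x)\<bar> \<le> (e * d / C) * norm (\<Gamma> y - \<Gamma> x)"
          using g[OF x] g[OF yD] by (simp add: \<Gamma>_def)
        also have "\<dots> \<le> (e * d / C) * (C * norm (y - x))" using \<Gamma>lip[OF yD] e d C by (intro mult_left_mono) auto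
        finally have 1: "\<bar>A (\<Gamma> y - \<Gamma> x)\<bar> \<le> d * (e * norm (y - x))" using C by (simp add: field_simps)
        have "A (\<Gamma> y - \<Gamma> x) = A (y - x) + ((g y - g x) - (y - x) $ i) * d"
          unfolding \<Gamma>diff linear_add[OF linA] linear_scale[OF linA] d_def by simp
        then have "g y - g x - ((y - x) $ i - A (y - x) / d) = A (\<Gamma> y - \<Gamma> x) / d"
          using d by (simp add: field_simps)
        then show "norm (g y - g x - ((y - x) $ i - A (y - x) / d)) \<le> e * norm (y - x)"
          using 1 d by (simp add: field_simps)
      qed
    qed
  qed
  have "bounded (g ` D)"
  proof -
    have "\<bar>g x\<bar> \<le> \<bar>x0 $ i\<bar> + r" if "x \<in> D" for x using g(1)[OF that] by linarith
    then show ?thesis by (auto simp: bounded_iff)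
  qed
  show ?thesis
  proof (rule that[of V D g m "B / m"])
    show "V \<subseteq> O'" using V_V0 V0_O by auto
    show "\<And>x. x \<in> D \<Longrightarrow> x + (g x - x $ i) *\<^sub>R axis i 1 \<in> V" using gV by (simp add: pr_def ax_def)
    show "\<And>x. x \<in> V \<Longrightarrow> m \<le> frechet_derivative v (at x) (axis i 1)"
      using V0m V_V0 by (auto simp: F_def ax_def intro: less_imp_le)
    show "\<And>x. x \<in> D \<Longrightarrow> (g has_derivative (\<lambda>e. e $ i - frechet_derivative v (at (x + (g x - x $ i) *\<^sub>R axis i 1)) e /
         frechet_derivative v (at (x + (g x - x $ i) *\<^sub>R axis i 1)) (axis i 1))) (at x)"
      using gder by (simp add: \<Gamma>_def pr_def ax_def F_def)
  qed (use \<open>open V\<close> x0 openD convD omits Z m gLip \<open>bounded (g ` D)\<close> in auto)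
qed

text \<open>The graph map replaces the \<open>i\<close>-th coordinate by \<open>g\<close>, so a
  derivative of the composition involves derivatives of \<open>F\<close> in two directions,
  \<open>e\<close> and \<open>axis i 1\<close>, composed with the same map. Hence \<open>F\<close>
  is generalised in the induction while \<open>g\<close> stays fixed.\<close>

lemma Ck_holder_on_graph_compose:
  fixes F g :: "real ^ 'n::finite \<Rightarrow> real"
  assumes D: "open D" "convex D" and \<alpha>: "0 < \<alpha>" "\<alpha> \<le> 1"
    and \<Gamma>: "\<And>x. x \<in> D \<Longrightarrow> x + (g x - x $ i) *\<^sub>R axis i 1 \<in> U"
    and L: "\<And>x y. x \<in> D \<Longrightarrow> y \<in> D \<Longrightarrow> \<bar>g x - g y\<bar> \<le> L * norm (x - y)"
  shows "Ck_holder_on k \<alpha> F U \<Longrightarrow> Ck_holder_on k \<alpha> g D \<Longrightarrow>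
    Ck_holder_on k \<alpha> (\<lambda>x. F (x + (g x - x $ i) *\<^sub>R axis i 1)) D"
proof (induction k arbitrary: F)
  define \<Gamma> where "\<Gamma> x = x + (g x - x $ i) *\<^sub>R axis i 1" for x
  have \<Gamma>_U: "\<Gamma> x \<in> U" if "x \<in> D" for x using \<Gamma> that by (simp add: \<Gamma>_def)
  have bd: "bounded ((\<lambda>x. F (\<Gamma> x)) ` D)" if "bounded (F ` U)" for F :: "real ^ 'n \<Rightarrow> real"
    by (rule bounded_subset[OF that]) (use \<Gamma>_U in auto)
  have \<Gamma>_Lip: "norm (\<Gamma> x - \<Gamma> y) \<le> (\<bar>L\<bar> + 2) * norm (x - y)" if "x \<in> D" "y \<in> D" for x y
  proof -
    have "\<Gamma> x - \<Gamma> y = (x - y) + ((g x - g y) - (x - y) $ i) *\<^sub>R axis i 1"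
      by (simp add: \<Gamma>_def algebra_simps)
    also have "norm \<dots> \<le> norm (x - y) + \<bar>(g x - g y) - (x - y) $ i\<bar>"
      by (metis norm_triangle_ineq norm_scaleR norm_axis_1 mult.right_neutral)
    also have "\<dots> \<le> norm (x - y) + (\<bar>g x - g y\<bar> + \<bar>(x - y) $ i\<bar>)" by (intro add_left_mono abs_triangle_ineq4)
    also have "\<dots> \<le> norm (x - y) + (L * norm (x - y) + norm (x - y))"
      by (intro add_mono order_refl L that component_le_norm_cart)
    also have "\<dots> \<le> norm (x - y) + (\<bar>L\<bar> * norm (x - y) + norm (x - y))"
      by (intro add_mono mult_right_mono) auto
    finally show ?thesis by (simp add: algebra_simps)
  qed
  {
    case 0
    then obtain C where C: "\<And>x y. x \<in> U \<Longrightarrow> y \<in> U \<Longrightarrow> \<bar>F x - F y\<bar> \<le> C * norm (x - y) powr \<alpha>" by auto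
    have "\<bar>F (\<Gamma> x) - F (\<Gamma> y)\<bar> \<le> (\<bar>C\<bar> * (\<bar>L\<bar> + 2) powr \<alpha>) * norm (x - y) powr \<alpha>" if "x \<in> D" "y \<in> D" for x y
    proof -
      have "\<bar>F (\<Gamma> x) - F (\<Gamma> y)\<bar> \<le> C * norm (\<Gamma> x - \<Gamma> y) powr \<alpha>" using that by (intro C \<Gamma>_U)
      also have "\<dots> \<le> \<bar>C\<bar> * norm (\<Gamma> x - \<Gamma> y) powr \<alpha>" by (intro mult_right_mono) auto
      also have "\<dots> \<le> \<bar>C\<bar> * ((\<bar>L\<bar> + 2) * norm (x - y)) powr \<alpha>"
        using \<alpha> by (intro mult_left_mono powr_mono2 \<Gamma>_Lip that) auto
      finally show ?thesis by (simp add: powr_mult)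
    qed
    then show ?case using bd 0 unfolding \<Gamma>_def by auto
  next
    case (Suc k)
    show ?case unfolding \<Gamma>_def[symmetric]
    proof (rule Ck_holder_on_SucI[OF D(1)])
      show "bounded ((\<lambda>x. F (\<Gamma> x)) ` D)" using Suc.prems by (intro bd) auto
      fix x assume x: "x \<in> D"
      let ?G = "frechet_derivative g (at x)"
      have dg: "(g has_derivative ?G) (at x)" using Ck_holder_on_has_derivative[OF Suc.prems(2) x] .
      have dF: "(F has_derivative frechet_derivative F (at (\<Gamma> x))) (at (\<Gamma> x))"
        using Ck_holder_on_has_derivative[OF Suc.prems(1) \<Gamma>_U[OF x]] .
      have lin: "linear (frechet_derivative F (at (\<Gamma> x)))" using dF has_derivative_linear by blast
      have d\<Gamma>: "(\<Gamma> has_derivative (\<lambda>e. e + (?G e - e $ i) *\<^sub>R axis i 1)) (at x)" unfolding \<Gamma>_def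
        by (auto intro!: derivative_eq_intros dg bounded_linear_imp_has_derivative bounded_linear_vec_nth)
      have "((\<lambda>x. F (\<Gamma> x)) has_derivative (\<lambda>e. frechet_derivative F (at (\<Gamma> x)) (e + (?G e - e $ i) *\<^sub>R axis i 1))) (at x)"
        by (rule has_derivative_compose[OF d\<Gamma> dF])
      then show "((\<lambda>x. F (\<Gamma> x)) has_derivative (\<lambda>e. frechet_derivative F (at (\<Gamma> x)) e +
          (?G e + (- (e $ i))) * frechet_derivative F (at (\<Gamma> x)) (axis i 1))) (at x)"
        by (simp add: linear_add[OF lin] linear_scale[OF lin])
    next
      fix e
      have F: "Ck_holder_on k \<alpha> (\<lambda>x. frechet_derivative F (at x) e) U" for e using Suc.prems by simp
      have g: "Ck_holder_on k \<alpha> g D" using Ck_holder_on_Suc_imp[OF D(2) \<alpha> Suc.prems(2)] .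
      have g': "Ck_holder_on k \<alpha> (\<lambda>x. frechet_derivative g (at x) e) D" using Suc.prems by simp
      have IH: "Ck_holder_on k \<alpha> (\<lambda>x. frechet_derivative F (at (\<Gamma> x)) e) D" for e
        using Suc.IH[OF F g] by (simp add: \<Gamma>_def)
      show "Ck_holder_on k \<alpha> (\<lambda>x. frechet_derivative F (at (\<Gamma> x)) e +
          (frechet_derivative g (at x) e + (- (e $ i))) * frechet_derivative F (at (\<Gamma> x)) (axis i 1)) D"
        by (intro Ck_holder_on_add Ck_holder_on_mult D \<alpha> IH g' Ck_holder_on_const)
    qed
  }
qed

text \<open>Bootstrapping: the derivative of \<open>g\<close> is a quotient of derivatives of
  \<open>v\<close> taken along the graph, so order \<open>k\<close> for \<open>g\<close> yields
  order \<open>k + 1\<close>, up to the order of \<open>v\<close>. The start is the Lipschitz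
  bound.\<close>

lemma Ck_holder_on_implicit:
  fixes v g :: "real ^ 'n::finite \<Rightarrow> real"
  assumes D: "open D" "convex D" and \<alpha>: "0 < \<alpha>" "\<alpha> \<le> 1" and U: "convex U"
    and \<Gamma>: "\<And>x. x \<in> D \<Longrightarrow> x + (g x - x $ i) *\<^sub>R axis i 1 \<in> U"
    and L: "\<And>x y. x \<in> D \<Longrightarrow> y \<in> D \<Longrightarrow> \<bar>g x - g y\<bar> \<le> L * norm (x - y)" "bounded (g ` D)"
    and m: "m > 0" "\<And>x. x \<in> D \<Longrightarrow> m \<le> frechet_derivative v (at (x + (g x - x $ i) *\<^sub>R axis i 1)) (axis i 1)"
    and g: "\<And>x. x \<in> D \<Longrightarrow> (g has_derivative (\<lambda>e. e $ i - frechet_derivative v (at (x + (g x - x $ i) *\<^sub>R axis i 1)) e /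
         frechet_derivative v (at (x + (g x - x $ i) *\<^sub>R axis i 1)) (axis i 1))) (at x)"
  shows "Ck_holder_on k \<alpha> v U \<Longrightarrow> Ck_holder_on k \<alpha> g D"
proof (induction k)
  case 0 show ?case by (rule Lipschitz_imp_holder[OF L(2,1) \<alpha>])
next
  case (Suc k)
  let ?\<Gamma> = "\<lambda>x. x + (g x - x $ i) *\<^sub>R axis i 1"
  have IH: "Ck_holder_on k \<alpha> g D" by (rule Suc.IH[OF Ck_holder_on_Suc_imp[OF U \<alpha> Suc.prems]])
  have v: "Ck_holder_on k \<alpha> (\<lambda>x. frechet_derivative v (at (?\<Gamma> x)) e) D" for e
    by (rule Ck_holder_on_graph_compose[OF D \<alpha> \<Gamma> L(1) _ IH]) (use Suc.prems in auto)
  show ?case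
  proof (rule Ck_holder_on_SucI[OF D(1) L(2)])
    fix x assume "x \<in> D"
    show "(g has_derivative (\<lambda>e. e $ i + (-1) * (frechet_derivative v (at (?\<Gamma> x)) e *
         inverse (frechet_derivative v (at (?\<Gamma> x)) (axis i 1))))) (at x)"
      using g[OF \<open>x \<in> D\<close>] by (simp add: divide_inverse)
  next
    fix e
    show "Ck_holder_on k \<alpha> (\<lambda>x. e $ i + (-1) * (frechet_derivative v (at (?\<Gamma> x)) e *
         inverse (frechet_derivative v (at (?\<Gamma> x)) (axis i 1)))) D"
      by (intro Ck_holder_on_add Ck_holder_on_mult Ck_holder_on_inverse[OF _ _ _ _ m(1)] Ck_holder_on_const D \<alpha> v m(2))
  qed
qed

text \<open>The graph is the image of a piece of the hyperplane \<open>x $ i = 0\<close> under a map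
  that is differentiable there, and differentiable maps between spaces of equal dimension preserve
  null sets.\<close>

lemma negligible_graph:
  fixes g :: "real ^ 'n::finite \<Rightarrow> real"
  assumes om: "omits_coordinate i g D" and g: "\<And>x. x \<in> D \<Longrightarrow> g differentiable (at x)"
  shows "negligible {x \<in> D. x $ i = g x}"
proof -
  let ?\<Gamma> = "\<lambda>x. x + (g x - x $ i) *\<^sub>R axis i 1"
  let ?S = "{x \<in> D. x $ i = 0}"
  have "{x. x $ i = 0} = {x :: real ^ 'n. axis i 1 \<bullet> x = 0}" by (auto simp: inner_axis')
  then have "negligible {x :: real ^ 'n. x $ i = 0}"
    by (metis axis_eq_0_iff negligible_hyperplane zero_neq_one)
  then have "negligible ?S" by (rule negligible_subset) auto
  moreover have "?\<Gamma> differentiable_on ?S"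
    unfolding differentiable_on_def
  proof
    fix x assume "x \<in> ?S"
    then have "g differentiable (at x within ?S)" using g differentiable_at_withinI by blast
    moreover have "(\<lambda>x. x $ i) differentiable (at x within ?S)"
      by (rule bounded_linear_imp_differentiable[OF bounded_linear_vec_nth])
    ultimately show "?\<Gamma> differentiable (at x within ?S)"
      by (intro differentiable_add differentiable_scaleR differentiable_diff) auto
  qed
  ultimately have "negligible (?\<Gamma> ` ?S)" by (intro negligible_differentiable_image_negligible) auto
  moreover have "{x \<in> D. x $ i = g x} \<subseteq> ?\<Gamma> ` ?S"
  proof
    fix x assume x: "x \<in> {x \<in> D. x $ i = g x}"
    \<comment> \<open>\<open>omits_coordinate\<close> lets the point slide down to the hyperplane
      without leaving \<open>D\<close> and without changing \<open>g\<close>.\<close>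
    define y where "y = x + (- (x $ i)) *\<^sub>R axis i 1"
    have "y \<in> D \<and> g y = g x" using om x unfolding omits_coordinate_def y_def by fast
    then have "y \<in> ?S" "?\<Gamma> y = x" using x by (auto simp: y_def)
    then show "x \<in> ?\<Gamma> ` ?S" by force
  qed
  ultimately show ?thesis by (rule negligible_subset)
qed

text \<open>\<open>V\<close> is chosen before the order and the exponent, because one neighbourhood
  has to serve every \<alpha>. The second disjunct covers n = 1, where \<open>g\<close> omits the
  only coordinate, so that it is constant and in every class.\<close>

lemma zero_set_graph_aux:
  fixes v :: "real ^ 'n::finite \<Rightarrow> real"
  assumes O: "open O'" "convex O'" "x0 \<in> O'" and v: "Ck_on 1 v O'" "v x0 = 0"
    and pos: "frechet_derivative v (at x0) (axis i 1) > 0"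
  shows "\<exists>V. open V \<and> x0 \<in> V \<and> V \<subseteq> O' \<and> negligible {x \<in> V. v x = 0} \<and>
    (\<forall>k \<alpha>. 0 < \<alpha> \<longrightarrow> \<alpha> \<le> 1 \<longrightarrow> Ck_holder_on k \<alpha> v O' \<or> CARD('n) = 1 \<longrightarrow> is_Ck_holder_graph k \<alpha> {x \<in> V. v x = 0})"
proof -
  obtain V D g m L where V: "open V" "x0 \<in> V" "V \<subseteq> O'" and D: "open D" "convex D" "omits_coordinate i g D"
    and Z: "{x \<in> V. v x = 0} = {x \<in> D. x $ i = g x}"
    and \<Gamma>: "\<And>x. x \<in> D \<Longrightarrow> x + (g x - x $ i) *\<^sub>R axis i 1 \<in> V"
    and m: "m > 0" "\<And>x. x \<in> V \<Longrightarrow> m \<le> frechet_derivative v (at x) (axis i 1)"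
    and L: "\<And>x y. x \<in> D \<Longrightarrow> y \<in> D \<Longrightarrow> \<bar>g x - g y\<bar> \<le> L * norm (x - y)" "bounded (g ` D)"
    and g: "\<And>x. x \<in> D \<Longrightarrow> (g has_derivative (\<lambda>e. e $ i - frechet_derivative v (at (x + (g x - x $ i) *\<^sub>R axis i 1)) e /
         frechet_derivative v (at (x + (g x - x $ i) *\<^sub>R axis i 1)) (axis i 1))) (at x)"
    by (rule implicit_graph[OF O(1,3) v pos]) (rule that; assumption)
  have neg: "negligible {x \<in> V. v x = 0}" unfolding Z
    by (rule negligible_graph[OF D(3)]) (use g differentiable_def in blast)
  have "is_Ck_holder_graph k \<alpha> {x \<in> V. v x = 0}" if "0 < \<alpha>" "\<alpha> \<le> 1" "Ck_holder_on k \<alpha> v O' \<or> CARD('n) = 1" for k \<alpha>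
  proof -
    have "Ck_holder_on k \<alpha> g D"
      using that(3)
    proof
      assume *: "Ck_holder_on k \<alpha> v O'"
      show ?thesis
        by (rule Ck_holder_on_implicit[OF D(1,2) that(1,2) O(2) _ L m(1) _ g *]) (use \<Gamma> V m(2) in auto)
    next
      assume 1: "CARD('n) = 1"
      have "g x = g y" if "x \<in> D" "y \<in> D" for x y
      proof -
        have all_i: "j = i" for j using 1 by (metis UNIV_I card_1_singletonE singletonD)
        have "y = x + (y $ i - x $ i) *\<^sub>R axis i 1" 
          unfolding vec_eq_iff
        proof
          fix j show "y $ j = (x + (y $ i - x $ i) *\<^sub>R axis i 1) $ j" using all_i[of j] by simp
        qed
        then show ?thesis using D(3) that unfolding omits_coordinate_def by metis
      qed
      then obtain c where "\<And>x. x \<in> D \<Longrightarrow> g x = c" by metis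
      then show ?thesis using Ck_holder_on_cong[OF D(1), of g "\<lambda>_. c"] by simp
    qed
    \<comment> \<open>The graph already lies over a coordinate direction, so the identity serves as
      the rotation.\<close>
    moreover have "rotation_matrix (mat 1 :: real ^ 'n ^ 'n)"
      by (simp add: rotation_matrix_def orthogonal_matrix_id)
    ultimately show ?thesis unfolding is_Ck_holder_graph_def Z
      by (intro exI[of _ "mat 1"] exI[of _ i] exI[of _ g] exI[of _ D]) (use D in auto)
  qed
  with V neg show ?thesis by blast
qed

text \<open>A nonzero derivative has a nonzero partial derivative. If that one is negative,
  \<open>- v\<close> has the same zero set and the right sign; changing the sign of the function
  rather than reflecting the coordinates keeps the matrix a rotation.\<close>

lemma zero_set_graph:
  fixes v :: "real ^ 'n::finite \<Rightarrow> real"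
  assumes O: "open O'" "convex O'" "x0 \<in> O'" and v: "Ck_on 1 v O'" "v x0 = 0"
    and nz: "frechet_derivative v (at x0) e \<noteq> 0"
  shows "\<exists>V. open V \<and> x0 \<in> V \<and> V \<subseteq> O' \<and> negligible {x \<in> V. v x = 0} \<and>
    (\<forall>k \<alpha>. 0 < \<alpha> \<longrightarrow> \<alpha> \<le> 1 \<longrightarrow> Ck_holder_on k \<alpha> v O' \<or> CARD('n) = 1 \<longrightarrow> is_Ck_holder_graph k \<alpha> {x \<in> V. v x = 0})"
proof -
  have d: "(v has_derivative frechet_derivative v (at x0)) (at x0)"
    using v(1) O(3) by (intro Ck_on_has_derivative[of 0]) auto
  obtain i where i: "frechet_derivative v (at x0) (axis i 1) \<noteq> 0"
  proof (rule ccontr)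
    assume "\<not> thesis"
    then have "frechet_derivative v (at x0) b = 0" if "b \<in> Basis" for b
      using \<open>(\<And>i. frechet_derivative v (at x0) (axis i 1) \<noteq> 0 \<Longrightarrow> thesis)\<close> that by (auto simp: Basis_vec_def)
    then have "\<bar>frechet_derivative v (at x0) e\<bar> \<le> (\<Sum>b\<in>(Basis :: (real ^ 'n) set). 0) * norm e"
      by (intro linear_bound_Basis has_derivative_linear[OF d]) auto
    then show False using nz by simp
  qed
  show ?thesis
  proof (cases "frechet_derivative v (at x0) (axis i 1) > 0")
    case True then show ?thesis by (rule zero_set_graph_aux[OF O v])
  next
    case False
    define w where "w x = - v x" for x
    have "frechet_derivative w (at x0) = (\<lambda>h. - frechet_derivative v (at x0) h)"
      unfolding w_def by (rule frechet_derivative_eq) (intro has_derivative_minus d)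
    then have "frechet_derivative w (at x0) (axis i 1) > 0" using False i by simp
    moreover have "Ck_on 1 w O'" unfolding w_def by (rule Ck_on_uminus[OF O(1) v(1)])
    ultimately have *: "\<exists>V. open V \<and> x0 \<in> V \<and> V \<subseteq> O' \<and> negligible {x \<in> V. w x = 0} \<and>
      (\<forall>k \<alpha>. 0 < \<alpha> \<longrightarrow> \<alpha> \<le> 1 \<longrightarrow> Ck_holder_on k \<alpha> w O' \<or> CARD('n) = 1 \<longrightarrow> is_Ck_holder_graph k \<alpha> {x \<in> V. w x = 0})"
      using v(2) by (intro zero_set_graph_aux[OF O, of w i]) (simp_all add: w_def)
    then obtain V where V: "open V" "x0 \<in> V" "V \<subseteq> O'" "negligible {x \<in> V. w x = 0}"
      "\<And>k \<alpha>. 0 < \<alpha> \<Longrightarrow> \<alpha> \<le> 1 \<Longrightarrow> Ck_holder_on k \<alpha> w O' \<or> CARD('n) = 1 \<Longrightarrow> is_Ck_holder_graph k \<alpha> {x \<in> V. w x = 0}"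
      by blast
    have w: "Ck_holder_on k \<alpha> w O'" if "0 < \<alpha>" "\<alpha> \<le> 1" "Ck_holder_on k \<alpha> v O'" for k \<alpha>
      using Ck_holder_on_mult[OF O(1,2) that(1,2) Ck_holder_on_const[of k \<alpha> "-1"] that(3)] by (simp add: w_def[abs_def])
    have eq: "{x \<in> V. w x = 0} = {x \<in> V. v x = 0}" by (simp add: w_def)
    show ?thesis
    proof (intro exI[of _ V] conjI allI impI)
      fix k :: nat and \<alpha> :: real assume *: "0 < \<alpha>" "\<alpha> \<le> 1" "Ck_holder_on k \<alpha> v O' \<or> CARD('n) = 1"
      then have "Ck_holder_on k \<alpha> w O' \<or> CARD('n) = 1" using w[OF *(1,2)] by blast
      then show "is_Ck_holder_graph k \<alpha> {x \<in> V. v x = 0}" using V(5)[OF *(1,2)] unfolding eq by blast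
    qed (use V eq in auto)
  qed
qed

section \<open>The fundamental lemma of the calculus of variations\<close>

text \<open>Products of steps of growing slope approximate the indicator of the open box from
  inside; the faces form a null set, so the limit is the integral over the closed box.\<close>

lemma weak_zero_imp_box_integral_zero:
  fixes f :: "'a::euclidean_space \<Rightarrow> 'b::euclidean_space"
  assumes int: "\<And>K. compact K \<Longrightarrow> K \<subseteq> U \<Longrightarrow> set_integrable lebesgue K f"
    and zero: "\<And>\<psi>. test_function U \<psi> \<Longrightarrow> (LINT z:U|lebesgue. \<psi> z *\<^sub>R f z) = 0"
    and sub: "cbox a b \<subseteq> U"
  shows "(LINT z:cbox a b|lebesgue. f z) = 0"
proof -
  define \<psi> where "\<psi> k z = (\<Prod>i\<in>Basis. smooth_step (real k * (z \<bullet> i - a \<bullet> i)) * smooth_step (real k * (b \<bullet> i - z \<bullet> i)))"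
    for k :: nat and z
  have box: "z \<in> box a b" if "\<psi> k z \<noteq> 0" for k z
  proof -
    have "0 < z \<bullet> i - a \<bullet> i \<and> 0 < b \<bullet> i - z \<bullet> i" if "i \<in> Basis" for i
    proof -
      have "smooth_step (real k * (z \<bullet> i - a \<bullet> i)) \<noteq> 0" "smooth_step (real k * (b \<bullet> i - z \<bullet> i)) \<noteq> 0"
        using \<open>\<psi> k z \<noteq> 0\<close> that by (auto simp: \<psi>_def)
      then have "\<not> real k * (z \<bullet> i - a \<bullet> i) \<le> 0" "\<not> real k * (b \<bullet> i - z \<bullet> i) \<le> 0"
        using smooth_step_0 by blast+
      then show ?thesis by (auto simp: not_le zero_less_mult_iff)
    qed
    then show ?thesis by (auto simp: mem_box)
  qed
  have \<psi>01: "0 \<le> \<psi> k z" "\<psi> k z \<le> 1" for k z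
    by (auto simp: \<psi>_def intro!: prod_nonneg prod_le_1 mult_le_one smooth_step_bounds mult_nonneg_nonneg)
  have cl: "closure {z. \<psi> k z \<noteq> 0} \<subseteq> cbox a b" for k
    using box[of k] box_subset_cbox[of a b] by (intro closure_minimal closed_cbox) blast
  have smooth: "Ck_on m (\<psi> k) UNIV" for m k
  proof -
    have "Ck_on m (\<lambda>z. smooth_step (real k * (z \<bullet> i - a \<bullet> i))) UNIV" "Ck_on m (\<lambda>z. smooth_step (real k * (b \<bullet> i - z \<bullet> i))) UNIV" for i
      by (intro Ck_on_compose_real[OF open_UNIV open_UNIV UNIV_I _ Ck_on_smooth_step] Ck_on_mult open_UNIV
          Ck_on_const Ck_on_diff Ck_on_linear bounded_linear_inner_left)+
    then show ?thesis unfolding \<psi>_def by (intro Ck_on_prod Ck_on_mult open_UNIV)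
  qed
  have test: "test_function U (\<psi> k)" for k
    using smooth cl[of k] sub by (auto simp: test_function_def smooth_on_def compact_eq_bounded_closed intro: bounded_subset[OF bounded_cbox])
  have intC: "integrable lebesgue (\<lambda>z. indicator (cbox a b) z *\<^sub>R f z)"
    using int[OF compact_cbox sub] by (simp add: set_integrable_def)
  have eq: "\<psi> k z *\<^sub>R f z = \<psi> k z *\<^sub>R (indicator (cbox a b) z *\<^sub>R f z)" for k z
    using box[of k z] box_subset_cbox[of a b] by (auto simp: indicator_def)
  have lim: "(\<lambda>k. \<psi> k z) \<longlonglongrightarrow> indicator (box a b) z" for z
  proof (cases "z \<in> box a b")
    case True
    have ev: "\<forall>\<^sub>F k in sequentially. smooth_step (real k * t) = 1" if "t > 0" for t :: real
    proof -
      have "\<forall>\<^sub>F k in sequentially. real k > 1 / t"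
        using filterlim_real_sequentially by (auto simp: filterlim_at_top_dense)
      then show ?thesis
        by eventually_elim (use that in \<open>auto intro!: smooth_step_1 simp: field_simps\<close>)
    qed
    have "\<forall>\<^sub>F k in sequentially. \<forall>i\<in>Basis. smooth_step (real k * (z \<bullet> i - a \<bullet> i)) * smooth_step (real k * (b \<bullet> i - z \<bullet> i)) = 1"
    proof (rule eventually_ball_finite[OF finite_Basis], rule)
      fix i :: 'a assume "i \<in> Basis"
      then have "0 < z \<bullet> i - a \<bullet> i" "0 < b \<bullet> i - z \<bullet> i" using True by (auto simp: mem_box)
      from ev[OF this(1)] ev[OF this(2)]
      show "\<forall>\<^sub>F k in sequentially. smooth_step (real k * (z \<bullet> i - a \<bullet> i)) * smooth_step (real k * (b \<bullet> i - z \<bullet> i)) = 1"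
        by eventually_elim simp
    qed
    then have "\<forall>\<^sub>F k in sequentially. \<psi> k z = indicator (box a b) z"
      by eventually_elim (use True in \<open>simp add: \<psi>_def\<close>)
    then show ?thesis by (rule tendsto_eventually)
  next
    case False
    then have "\<psi> k z = 0" for k using box by blast
    then show ?thesis using False by simp
  qed
  have meas: "\<psi> k \<in> borel_measurable lebesgue" for k
    using Ck_on_imp_continuous_on[OF smooth[of 0 k]] borel_measurable_continuous_onI
    by (intro measurable_completion) (simp add: borel_measurable_continuous_onI)
  have L: "(\<lambda>k. LINT z|lebesgue. \<psi> k z *\<^sub>R f z) \<longlonglongrightarrow> (LINT z|lebesgue. indicator (box a b) z *\<^sub>R (indicator (cbox a b) z *\<^sub>R f z))"
    unfolding eq
  proof (rule integral_dominated_convergence[where w = "\<lambda>z. norm (indicator (cbox a b) z *\<^sub>R f z)"])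
    show "AE z in lebesgue. (\<lambda>k. \<psi> k z *\<^sub>R indicator (cbox a b) z *\<^sub>R f z) \<longlonglongrightarrow> indicator (box a b) z *\<^sub>R indicator (cbox a b) z *\<^sub>R f z"
      by (intro AE_I2 tendsto_scaleR lim tendsto_const)
    show "AE z in lebesgue. norm (\<psi> k z *\<^sub>R indicator (cbox a b) z *\<^sub>R f z) \<le> norm (indicator (cbox a b) z *\<^sub>R f z)" for k
      unfolding norm_scaleR[of "\<psi> k _"] using \<psi>01 by (intro AE_I2 mult_left_le_one_le) auto
    show "(\<lambda>z. \<psi> k z *\<^sub>R indicator (cbox a b) z *\<^sub>R f z) \<in> borel_measurable lebesgue" for k
      by (rule borel_measurable_scaleR[OF meas borel_measurable_integrable[OF intC]])
    show "(\<lambda>z. indicator (box a b) z *\<^sub>R indicator (cbox a b) z *\<^sub>R f z) \<in> borel_measurable lebesgue"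
      by (rule borel_measurable_scaleR[OF borel_measurable_indicator borel_measurable_integrable[OF intC]]) auto
  qed (rule integrable_norm[OF intC])
  have Z: "(LINT z|lebesgue. \<psi> k z *\<^sub>R f z) = 0" for k
  proof -
    have "(\<lambda>z. indicator U z *\<^sub>R \<psi> k z *\<^sub>R f z) = (\<lambda>z. \<psi> k z *\<^sub>R f z)"
      using box[of k] box_subset_cbox[of a b] sub by (auto simp: indicator_def fun_eq_iff)
    then show ?thesis using zero[OF test[of k]] unfolding set_lebesgue_integral_def by metis
  qed
  have "(LINT z|lebesgue. indicator (box a b) z *\<^sub>R (indicator (cbox a b) z *\<^sub>R f z)) = 0"
    using L unfolding Z LIMSEQ_const_iff by (rule sym)
  moreover have "(LINT z|lebesgue. indicator (box a b) z *\<^sub>R (indicator (cbox a b) z *\<^sub>R f z)) = (LINT z|lebesgue. indicator (cbox a b) z *\<^sub>R f z)"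
  proof (rule integral_cong_AE)
    have "AE z in lebesgue. z \<notin> cbox a b - box a b"
      by (rule AE_not_in) (use negligible_frontier_interval[of a b] in \<open>simp only: negligible_iff_null_sets\<close>)
    then show "AE z in lebesgue. indicator (box a b) z *\<^sub>R indicator (cbox a b) z *\<^sub>R f z = indicator (cbox a b) z *\<^sub>R f z"
      by eventually_elim (auto simp: indicator_def)
    show "(\<lambda>z. indicator (box a b) z *\<^sub>R indicator (cbox a b) z *\<^sub>R f z) \<in> borel_measurable lebesgue"
      by (rule borel_measurable_scaleR[OF borel_measurable_indicator borel_measurable_integrable[OF intC]]) auto
  qed (use intC in auto)
  ultimately show ?thesis by (simp add: set_lebesgue_integral_def)
qed

text \<open>Vanishing integrals over all boxes in \<open>U\<close> mean vanishing averages over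
  shrinking cubes, and Lebesgue differentiation concludes. A countable cover of \<open>U\<close> by
  boxes makes the statement global.\<close>

lemma weak_zero_imp_AE_zero:
  fixes f :: "'a::euclidean_space \<Rightarrow> 'b::euclidean_space"
  assumes U: "open U" and int: "\<And>K. compact K \<Longrightarrow> K \<subseteq> U \<Longrightarrow> set_integrable lebesgue K f"
    and zero: "\<And>\<psi>. test_function U \<psi> \<Longrightarrow> (LINT z:U|lebesgue. \<psi> z *\<^sub>R f z) = 0"
  shows "AE z in lebesgue. z \<in> U \<longrightarrow> f z = 0"
proof -
  have box: "AE z in lebesgue. z \<in> cbox a b \<longrightarrow> f z = 0" if sub: "cbox a b \<subseteq> U" for a b
  proof -
    define F where "F z = indicator (cbox a b) z *\<^sub>R f z" for z
    have F: "integrable lebesgue F" using int[OF compact_cbox sub] by (simp add: set_integrable_def F_def[abs_def])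
    have F': "set_integrable lebesgue (cbox c d) F" for c d
      using F by (auto simp: set_integrable_def intro!: integrable_mult_indicator)
    have 1: "F integrable_on cbox c d" for c d
      using F' set_lebesgue_integral_eq_integral(1) by blast
    have 2: "integral (cbox c d) F = 0" for c d
    proof -
      \<comment> \<open>\<open>f\<close> was cut down to a fixed box to be integrable on the whole
        space. Two boxes meet in a box, so the previous lemma still evaluates its integrals.\<close>
      obtain p q where pq: "cbox c d \<inter> cbox a b = cbox p q" by (rule that) (rule Int_interval)
      have "integral (cbox c d) F = (LINT z:cbox c d|lebesgue. F z)"
        using F' set_lebesgue_integral_eq_integral(2) by metis
      also have "\<dots> = (LINT z:cbox p q|lebesgue. f z)"
        unfolding set_lebesgue_integral_def F_def pq[symmetric] by (simp add: indicator_inter_arith)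
      also have "\<dots> = 0" using pq sub by (intro weak_zero_imp_box_integral_zero[OF int zero]) auto
      finally show ?thesis .
    qed
    obtain N where N: "negligible N" "\<And>x e. \<lbrakk>x \<notin> N; 0 < e\<rbrakk> \<Longrightarrow>
         \<exists>d>0. \<forall>h. 0 < h \<and> h < d \<longrightarrow> norm(integral (cbox x (x + h *\<^sub>R One)) F /\<^sub>R h ^ DIM('a) - F x) < e"
      using integrable_ccontinuous_explicit[OF 1] by metis
    have Fz: "F x = 0" if xN: "x \<notin> N" for x
    proof (rule ccontr)
      assume "F x \<noteq> 0"
      then obtain d where "d > 0" "\<forall>h. 0 < h \<and> h < d \<longrightarrow> norm(integral (cbox x (x + h *\<^sub>R One)) F /\<^sub>R h ^ DIM('a) - F x) < norm (F x)"
        using N(2)[OF xN, of "norm (F x)"] by auto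
      then show False unfolding 2 by (metis dense scaleR_zero_right diff_0 norm_minus_cancel less_irrefl)
    qed
    have "AE z in lebesgue. z \<notin> N" using N(1) by (simp add: negligible_iff_null_sets AE_not_in)
    then show ?thesis
    proof eventually_elim
      case (elim z) then show ?case using Fz[of z] by (auto simp: F_def)
    qed
  qed
  obtain \<D> where \<D>: "countable \<D>" "\<D> \<subseteq> Pow U" "\<And>X. X \<in> \<D> \<Longrightarrow> \<exists>a b. X = cbox a b" "\<Union>\<D> = U"
    using open_countable_Union_open_cbox[OF U] by metis
  have "AE z in lebesgue. \<forall>X\<in>\<D>. z \<in> X \<longrightarrow> f z = 0"
    unfolding AE_ball_countable[OF \<D>(1)]
  proof
    fix X assume X: "X \<in> \<D>"
    then obtain a b where "X = cbox a b" using \<D>(3) by blast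
    then show "AE z in lebesgue. z \<in> X \<longrightarrow> f z = 0" using box \<D>(2) X by auto
  qed
  then show ?thesis by eventually_elim (use \<D>(4) in auto)
qed

lemma deriv_smooth_step_bounded: "\<exists>B>0. \<forall>t. deriv smooth_step t \<le> B"
proof -
  have "bounded (deriv smooth_step ` {0..1})"
    using Ck_on_imp_continuous_on[OF Ck_on_deriv_smooth_step[of 0]]
    by (intro compact_imp_bounded compact_continuous_image) (auto intro: continuous_on_subset)
  then obtain B where "\<forall>x\<in>deriv smooth_step ` {0..1}. norm x \<le> B" unfolding bounded_iff by blast
  then have B: "\<And>t. t \<in> {0..1} \<Longrightarrow> \<bar>deriv smooth_step t\<bar> \<le> B" by simp
  have "deriv smooth_step t \<le> \<bar>B\<bar> + 1" for t
    using B[of t] deriv_smooth_step_0[of t] by (cases "t \<in> {0..1}") auto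
  then show ?thesis by (intro exI[of _ "\<bar>B\<bar> + 1"]) auto
qed

section \<open>A smooth truncation of the fundamental solution\<close>

text \<open>In the variable \<open>t = \<bar>z\<bar>^2\<close> the fundamental solution is a
  multiple of \<open>t powr (- (p / 2))\<close>. The step is applied to the derivative and not to
  the function itself: it kills \<open>t \<le> 1/2\<close>, leaves \<open>t \<ge> 1\<close>
  unchanged, and one further differentiation of it yields a term of one sign.\<close>

definition kern' :: "real \<Rightarrow> real \<Rightarrow> real" where
  "kern' p t = - (t powr (- (p / 2) - 1)) * smooth_step (2 * t - 1)"

definition kern'' :: "real \<Rightarrow> real \<Rightarrow> real" where
  "kern'' p t = (p / 2 + 1) * t powr (- (p / 2) - 2) * smooth_step (2 * t - 1)
     - 2 * t powr (- (p / 2) - 1) * deriv smooth_step (2 * t - 1)"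

text \<open>The antiderivative is normalised at 1 so that it agrees with
  \<open>2 / p * t powr (- (p / 2))\<close> from there on.\<close>

definition kern :: "real \<Rightarrow> real \<Rightarrow> real" where
  "kern p = (SOME P. smooth_on P UNIV \<and> (\<forall>t. (P has_real_derivative kern' p t) (at t)) \<and> P 1 = 2 / p)"

text \<open>For \<open>p = n - 1 + a\<close> this is minus \<open>y^(-a) div (y^a \<nabla>P)\<close>
  for the function P that takes the value \<open>kern p t\<close> at points with
  \<open>\<bar>z\<bar>^2 = t\<close>.\<close>

definition bump :: "real \<Rightarrow> real \<Rightarrow> real" where
  "bump p t = 8 * t powr (- (p / 2)) * deriv smooth_step (2 * t - 1)"

text \<open>Meant for functions that vanish on one half line and are built from real powers on
  another, overlapping one; powers are smooth for positive arguments only.\<close>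

lemma smooth_on_local:
  assumes "\<And>k. Ck_on k f {..<b}" "\<And>k. Ck_on k f {a<..}" "a < (b::real)"
  shows "smooth_on f UNIV"
proof -
  have "{..<b} \<union> {a<..} = UNIV" using assms(3) by auto
  then show ?thesis using Ck_on_Un[of "{..<b}" "{a<..}"] assms by (metis open_lessThan open_greaterThan smooth_on_def)
qed

lemma Ck_on_affine: "Ck_on k (\<lambda>t::real. c * t + d) S"
proof (rule Ck_on_subset[OF _ subset_UNIV])
  show "Ck_on k (\<lambda>t::real. c * t + d) UNIV"
    by (intro Ck_on_add Ck_on_mult Ck_on_const Ck_on_linear bounded_linear_ident open_UNIV)
qed

lemma smooth_on_kern': "smooth_on (kern' p) UNIV"
proof (rule smooth_on_local)
  fix k
  have "Ck_on k (kern' p) {..<1/2::real} = Ck_on k (\<lambda>t. 0::real) {..<1/2::real}"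
    by (rule Ck_on_cong) (auto simp: kern'_def smooth_step_0)
  then show "Ck_on k (kern' p) {..<1/2::real}" by simp
  have "Ck_on k (\<lambda>t::real. smooth_step (2 * t + - 1)) {0<..}"
    by (rule Ck_on_compose_real[OF _ open_UNIV UNIV_I Ck_on_affine Ck_on_smooth_step]) auto
  then show "Ck_on k (kern' p) {0<..}" unfolding kern'_def
    by (intro Ck_on_mult Ck_on_uminus Ck_on_powr) auto
qed auto

lemma kern:
  shows smooth_on_kern: "smooth_on (kern p) UNIV"
    and DERIV_kern: "(kern p has_real_derivative kern' p t) (at t)"
    and kern_1: "kern p 1 = 2 / p"
proof -
  obtain F where F: "smooth_on F UNIV" "\<And>x. (F has_real_derivative kern' p x) (at x)"
    using smooth_on_antiderivative[OF smooth_on_kern'] by blast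
  define P where "P t = F t + (2 / p - F 1)" for t
  have "smooth_on P UNIV" using F(1) unfolding smooth_on_def P_def by (auto intro!: Ck_on_add simp del: Ck_on.simps)
  moreover have "(P has_real_derivative kern' p t) (at t)" for t unfolding P_def by (auto intro!: derivative_eq_intros F)
  ultimately have "smooth_on P UNIV \<and> (\<forall>t. (P has_real_derivative kern' p t) (at t)) \<and> P 1 = 2 / p" by (simp add: P_def)
  from someI[of "\<lambda>P. smooth_on P UNIV \<and> (\<forall>t. (P has_real_derivative kern' p t) (at t)) \<and> P 1 = 2 / p", OF this]
  have "smooth_on (kern p) UNIV \<and> (\<forall>t. (kern p has_real_derivative kern' p t) (at t)) \<and> kern p 1 = 2 / p"
    unfolding kern_def .
  then show "smooth_on (kern p) UNIV" "(kern p has_real_derivative kern' p t) (at t)" "kern p 1 = 2 / p" by auto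
qed

lemma DERIV_kern': "(kern' p has_real_derivative kern'' p t) (at t)"
proof (cases "t > 0")
  case True
  have "((\<lambda>t. - (t powr (- (p / 2) - 1)) * smooth_step (2 * t - 1)) has_real_derivative
     - (t powr (- (p / 2) - 1)) * (deriv smooth_step (2 * t - 1) * 2) +
      (- ((- (p / 2) - 1) * t powr (- (p / 2) - 1 - 1))) * smooth_step (2 * t - 1)) (at t)"
    using True by (auto intro!: derivative_eq_intros DERIV_chain2[OF DERIV_smooth_step])
  moreover have "- (p / 2) - 1 - 1 = - (p / 2) - 2" by simp
  ultimately show ?thesis unfolding kern'_def[abs_def] kern''_def by (simp add: algebra_simps)
next
  case False
  have "((\<lambda>t. 0) has_real_derivative kern'' p t) (at t)"
    using False by (auto simp: kern''_def smooth_step_0 deriv_smooth_step_0)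
  then show ?thesis
    by (rule has_field_derivative_transform_within_open[where S = "{..<1/2::real}"])
      (use False in \<open>auto simp: kern'_def smooth_step_0\<close>)
qed

text \<open>For a function P of \<open>t = \<bar>z\<bar>^2\<close>, the expression
  \<open>y^(-a) div (y^a \<nabla>P)\<close> is \<open>4 t P'' + 2 (n + 1 + a) P'\<close>, and
  \<open>n + 1 + a = p + 2\<close>. The pure power terms cancel because the untruncated kernel
  solves the equation; what remains is the derivative of the step.\<close>

lemma kern_identity: "4 * t * kern'' p t + 2 * (p + 2) * kern' p t = - bump p t"
proof (cases "t > 0")
  case True
  have *: "t * t powr (- (p / 2) - 2) = t powr (- (p / 2) - 1)" "t * t powr (- (p / 2) - 1) = t powr (- (p / 2))"
  proof -
    have e: "- (p / 2) - 1 = 1 + (- (p / 2) - 2)" "- (p / 2) = 1 + (- (p / 2) - 1)" by simp_all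
    show "t * t powr (- (p / 2) - 2) = t powr (- (p / 2) - 1)"
      by (subst e(1), subst powr_add) (use True in simp)
    show "t * t powr (- (p / 2) - 1) = t powr (- (p / 2))"
      by (subst (2) e(2), subst powr_add) (use True in simp)
  qed
  show ?thesis unfolding kern''_def kern'_def bump_def *(2)[symmetric] *(1)[symmetric]
    by (simp add: algebra_simps)
next
  case False
  then show ?thesis by (simp add: kern''_def kern'_def bump_def smooth_step_0 deriv_smooth_step_0)
qed

lemma bump_nonneg: "bump p t \<ge> 0"
  using deriv_smooth_step_nonneg by (simp add: bump_def)

lemma bump_pos: "1/2 < t \<Longrightarrow> t < 1 \<Longrightarrow> bump p t > 0"
  using deriv_smooth_step_pos by (simp add: bump_def)

lemma bump_0: "t \<le> 1/2 \<or> t \<ge> 1 \<Longrightarrow> bump p t = 0"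
  using deriv_smooth_step_0[of "2 * t - 1"] by (auto simp: bump_def)

lemma kern'_nonpos: "kern' p t \<le> 0"
  using smooth_step_bounds by (simp add: kern'_def)

lemma kern'_abs_le: "\<bar>kern' p t\<bar> \<le> t powr (- (p / 2) - 1)"
  using smooth_step_bounds by (simp add: kern'_def abs_mult mult_left_le)

lemma kern'_ge_1: "t \<ge> 1 \<Longrightarrow> kern' p t = - (t powr (- (p / 2) - 1))"
  by (simp add: kern'_def smooth_step_1)

lemma bump_bounded:
  assumes "p > 0" shows "\<exists>B>0. \<forall>t. bump p t \<le> B"
proof -
  obtain B where B: "B > 0" "\<And>t. deriv smooth_step t \<le> B" using deriv_smooth_step_bounded by blast
  have "bump p t \<le> 8 * (1/2) powr (- (p / 2)) * B" for t
  proof (cases "t \<le> 1/2 \<or> t \<ge> 1")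
    case True then show ?thesis using bump_0[OF True] B by simp
  next
    case False
    then have "t powr (- (p / 2)) \<le> (1/2) powr (- (p / 2))" using assms by (intro powr_mono2') auto
    then show ?thesis unfolding bump_def by (intro mult_mono B deriv_smooth_step_nonneg) auto
  qed
  then show ?thesis using B by (intro exI[of _ "8 * (1/2) powr (- (p / 2)) * B"]) auto
qed

text \<open>The power in \<open>bump\<close> is not continuous at 0, so continuity is read off from
  the identity, whose other side consists of smooth functions.\<close>

lemma continuous_on_bump: "p > 0 \<Longrightarrow> continuous_on UNIV (bump p)"
proof -
  have "Ck_on 0 (\<lambda>t. - (4 * t * kern'' p t + 2 * (p + 2) * kern' p t)) UNIV"
  proof (intro Ck_on_uminus Ck_on_add Ck_on_mult Ck_on_const open_UNIV)
    show "Ck_on 0 (\<lambda>t. t) (UNIV :: real set)" by (rule Ck_on_linear[OF bounded_linear_ident])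
    show "Ck_on 0 (kern'' p) UNIV"
      by (rule Ck_on_real_deriv[OF open_UNIV _ DERIV_kern']) (use smooth_on_kern' in \<open>simp add: smooth_on_def del: Ck_on.simps\<close>)
    show "Ck_on 0 (kern' p) UNIV" using smooth_on_kern' unfolding smooth_on_def by blast
  qed
  then show ?thesis unfolding kern_identity by simp
qed

lemma kern_antimono: "s \<le> t \<Longrightarrow> kern p t \<le> kern p s"
  by (rule DERIV_nonpos_imp_nonincreasing[of s t "kern p"]) (use DERIV_kern kern'_nonpos in blast)+

lemma kern_ge_1:
  assumes "p > 0" "t \<ge> 1" shows "kern p t = 2 / p * t powr (- (p / 2))"
proof -
  define D where "D t = kern p t - 2 / p * t powr (- (p / 2))" for t
  have der: "(D has_real_derivative 0) (at x)" if "x \<ge> 1" for x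
    unfolding D_def using that assms(1)
    by (auto intro!: derivative_eq_intros DERIV_kern simp: kern'_ge_1)
  have "D t = D 1"
  proof (cases "t = 1")
    case False
    have "\<exists>z. 1 < z \<and> z < t \<and> D t - D 1 = (t - 1) * 0"
      by (rule MVT2) (use False assms der in auto)
    then show ?thesis by auto
  qed simp
  then show ?thesis by (simp add: D_def kern_1)
qed

lemma kern_nonneg: assumes "p > 0" shows "kern p t \<ge> 0"
proof -
  have "0 \<le> 2 / p * max t 1 powr (- (p / 2))" using assms by simp
  then show ?thesis using kern_antimono[of t "max t 1" p] kern_ge_1[OF assms, of "max t 1"] by simp
qed

lemma kern_le: assumes "p > 0"
  shows "\<exists>C>0. \<forall>t>0. kern p t \<le> C * t powr (- (p / 2))"
proof (intro exI conjI allI impI)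
  show "kern p 0 + 2 / p > 0" using kern_nonneg[OF assms, of 0] assms by (simp add: add_nonneg_pos)
  fix t :: real assume t: "t > 0"
  show "kern p t \<le> (kern p 0 + 2 / p) * t powr (- (p / 2))"
  proof (cases "t \<ge> 1")
    case True then show ?thesis using kern_ge_1[OF assms True] kern_nonneg[OF assms, of 0] by (simp add: distrib_right)
  next
    case False
    have "1 powr (- (p / 2)) \<le> t powr (- (p / 2))" using False t assms by (intro powr_mono2') auto
    then have "kern p 0 * 1 \<le> (kern p 0 + 2 / p) * t powr (- (p / 2))"
      using kern_nonneg[OF assms, of 0] assms by (intro mult_mono) auto
    moreover have "kern p t \<le> kern p 0" using t by (intro kern_antimono) auto
    ultimately show ?thesis by simp
  qed
qed

text \<open>Truncation at radius \<epsilon>. The factor \<open>\<epsilon> powr (- p)\<close> matches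
  the homogeneity of the kernel, so nothing changes where \<open>t \<ge> \<epsilon>^2\<close>; every
  derivative in \<open>t\<close> costs another \<open>\<epsilon> powr (- 2)\<close>.\<close>

definition kernS :: "real \<Rightarrow> real \<Rightarrow> real \<Rightarrow> real" where
  "kernS p \<epsilon> t = \<epsilon> powr (- p) * kern p (t / \<epsilon>\<^sup>2)"
definition kernS' :: "real \<Rightarrow> real \<Rightarrow> real \<Rightarrow> real" where
  "kernS' p \<epsilon> t = \<epsilon> powr (- p - 2) * kern' p (t / \<epsilon>\<^sup>2)"
definition kernS'' :: "real \<Rightarrow> real \<Rightarrow> real \<Rightarrow> real" where
  "kernS'' p \<epsilon> t = \<epsilon> powr (- p - 4) * kern'' p (t / \<epsilon>\<^sup>2)"
definition bumpS :: "real \<Rightarrow> real \<Rightarrow> real \<Rightarrow> real" where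
  "bumpS p \<epsilon> t = \<epsilon> powr (- p - 2) * bump p (t / \<epsilon>\<^sup>2)"

context
  fixes p \<epsilon> :: real
  assumes p: "p > 0" and \<epsilon>: "\<epsilon> > 0"
begin

lemma eps_powr: "\<epsilon> powr (- p) / \<epsilon>\<^sup>2 = \<epsilon> powr (- p - 2)" "\<epsilon> powr (- p - 2) / \<epsilon>\<^sup>2 = \<epsilon> powr (- p - 4)"
proof -
  show "\<epsilon> powr (- p) / \<epsilon>\<^sup>2 = \<epsilon> powr (- p - 2)" using \<epsilon> powr_diff[of \<epsilon> "- p" 2] by simp
  have "- p - 4 = (- p - 2) - 2" by simp
  then show "\<epsilon> powr (- p - 2) / \<epsilon>\<^sup>2 = \<epsilon> powr (- p - 4)"
    by (subst \<open>- p - 4 = (- p - 2) - 2\<close>, subst powr_diff) (use \<epsilon> in simp)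
qed

lemma DERIV_kernS: "(kernS p \<epsilon> has_real_derivative kernS' p \<epsilon> t) (at t)"
  unfolding kernS_def[abs_def] kernS'_def eps_powr(1)[symmetric]
  using DERIV_cmult[OF DERIV_chain2[OF DERIV_kern DERIV_cdivide[OF DERIV_ident]], of "\<epsilon> powr - p" p "\<epsilon>\<^sup>2" t] by simp

lemma DERIV_kernS': "(kernS' p \<epsilon> has_real_derivative kernS'' p \<epsilon> t) (at t)"
  unfolding kernS'_def[abs_def] kernS''_def eps_powr(2)[symmetric]
  using DERIV_cmult[OF DERIV_chain2[OF DERIV_kern' DERIV_cdivide[OF DERIV_ident]], of "\<epsilon> powr (- p - 2)" p "\<epsilon>\<^sup>2" t] by simp

lemma Ck_on_kernS: "Ck_on k (kernS p \<epsilon>) UNIV"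
proof -
  have "Ck_on k (\<lambda>t. kern p ((1 / \<epsilon>\<^sup>2) * t + 0)) UNIV"
    by (rule Ck_on_compose_real[OF open_UNIV open_UNIV UNIV_I Ck_on_affine])
      (use smooth_on_kern in \<open>simp add: smooth_on_def\<close>)
  then show ?thesis unfolding kernS_def[abs_def] by (intro Ck_on_mult) auto
qed

lemma Ck_on_kernS': "Ck_on k (kernS' p \<epsilon>) UNIV"
  by (rule Ck_on_real_deriv[OF open_UNIV Ck_on_kernS DERIV_kernS])

lemma kernS_identity: "4 * t * kernS'' p \<epsilon> t + 2 * (p + 2) * kernS' p \<epsilon> t = - bumpS p \<epsilon> t"
proof -
  have "4 * t * kernS'' p \<epsilon> t + 2 * (p + 2) * kernS' p \<epsilon> t =
      \<epsilon> powr (- p - 2) * (4 * (t / \<epsilon>\<^sup>2) * kern'' p (t / \<epsilon>\<^sup>2) + 2 * (p + 2) * kern' p (t / \<epsilon>\<^sup>2))"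
    unfolding kernS''_def kernS'_def eps_powr(2)[symmetric] by (simp add: field_simps)
  then show ?thesis unfolding kern_identity bumpS_def by simp
qed

lemma scaled_powr: "t \<ge> 0 \<Longrightarrow> (t / \<epsilon>\<^sup>2) powr r = t powr r * \<epsilon> powr (- 2 * r)"
proof -
  assume t: "t \<ge> 0"
  have "(\<epsilon>\<^sup>2) powr r = \<epsilon> powr (2 * r)" using \<epsilon> powr_powr[of \<epsilon> 2 r] by simp
  then have "(t / \<epsilon>\<^sup>2) powr r = t powr r / \<epsilon> powr (2 * r)" using t by (simp add: powr_divide)
  also have "\<dots> = t powr r * \<epsilon> powr (- (2 * r))" by (simp add: powr_minus divide_inverse)
  finally show ?thesis by simp
qed

lemma kernS_eq: assumes "t \<ge> \<epsilon>\<^sup>2" shows "kernS p \<epsilon> t = 2 / p * t powr (- (p / 2))"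
proof -
  have "t / \<epsilon>\<^sup>2 \<ge> 1" using assms \<epsilon> by simp
  then have "kernS p \<epsilon> t = \<epsilon> powr (- p) * (2 / p * (t powr (- (p / 2)) * \<epsilon> powr p))"
    using kern_ge_1[OF p] scaled_powr[of t "- (p / 2)"] order_trans[OF _ assms, of 0] by (simp add: kernS_def)
  then show ?thesis using \<epsilon> by (simp add: powr_minus)
qed

lemma kernS'_eq: assumes "t \<ge> \<epsilon>\<^sup>2" shows "kernS' p \<epsilon> t = - (t powr (- (p / 2) - 1))"
proof -
  have "t / \<epsilon>\<^sup>2 \<ge> 1" using assms \<epsilon> by simp
  then have "kernS' p \<epsilon> t = - (\<epsilon> powr (- p - 2) * (t powr (- (p / 2) - 1) * \<epsilon> powr (p + 2)))"
    using kern'_ge_1[of "t / \<epsilon>\<^sup>2" p] scaled_powr[of t "- (p / 2) - 1"] order_trans[OF _ assms, of 0] by (simp add: kernS'_def add.commute)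
  moreover have "\<epsilon> powr (- p - 2) * \<epsilon> powr (p + 2) = 1" using \<epsilon> by (simp add: powr_add[symmetric])
  ultimately show ?thesis by (metis mult.assoc mult.commute mult.right_neutral)
qed

lemma kernS_nonneg: "kernS p \<epsilon> t \<ge> 0"
  using kern_nonneg[OF p] by (simp add: kernS_def)

lemma kernS'_abs_le: assumes "t > 0" shows "\<bar>kernS' p \<epsilon> t\<bar> \<le> t powr (- (p / 2) - 1)"
proof -
  have "\<bar>kernS' p \<epsilon> t\<bar> \<le> \<epsilon> powr (- p - 2) * (t / \<epsilon>\<^sup>2) powr (- (p / 2) - 1)"
    using kern'_abs_le by (simp add: kernS'_def abs_mult mult_left_mono)
  also have "\<dots> = t powr (- (p / 2) - 1) * (\<epsilon> powr (- p - 2) * \<epsilon> powr (p + 2))"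
    using scaled_powr[of t "- (p / 2) - 1"] assms by (simp add: add.commute)
  also have "\<epsilon> powr (- p - 2) * \<epsilon> powr (p + 2) = 1" using \<epsilon> by (simp add: powr_add[symmetric])
  finally show ?thesis by simp
qed

lemma bumpS_nonneg: "bumpS p \<epsilon> t \<ge> 0" by (simp add: bumpS_def bump_nonneg)

lemma bumpS_0: "t \<ge> \<epsilon>\<^sup>2 \<Longrightarrow> bumpS p \<epsilon> t = 0" using \<epsilon> by (simp add: bumpS_def bump_0)

end

text \<open>The constant does not depend on \<epsilon>, so the singular kernel is a majorant for
  dominated convergence as \<epsilon> tends to 0.\<close>

lemma kernS_le: assumes "p > 0"
  shows "\<exists>C>0. \<forall>\<epsilon>>0. \<forall>t>0. kernS p \<epsilon> t \<le> C * t powr (- (p / 2))"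
proof -
  obtain C where C: "C > 0" "\<And>t. t > 0 \<Longrightarrow> kern p t \<le> C * t powr (- (p / 2))" using kern_le[OF assms] by blast
  have "kernS p \<epsilon> t \<le> C * t powr (- (p / 2))" if "\<epsilon> > 0" "t > 0" for \<epsilon> t
  proof -
    have "kernS p \<epsilon> t \<le> \<epsilon> powr (- p) * (C * (t / \<epsilon>\<^sup>2) powr (- (p / 2)))"
      unfolding kernS_def using C(2)[of "t / \<epsilon>\<^sup>2"] that by (intro mult_left_mono) auto
    also have "\<dots> = C * t powr (- (p / 2)) * (\<epsilon> powr (- p) * \<epsilon> powr p)"
      using scaled_powr[OF assms that(1), of t "- (p / 2)"] that by simp
    also have "\<epsilon> powr (- p) * \<epsilon> powr p = 1" using that by (simp add: powr_minus)
    finally show ?thesis by simp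
  qed
  then show ?thesis using C(1) by blast
qed

lemma integrable_mult_bounded:
  fixes g :: "'a \<Rightarrow> 'b::{banach, second_countable_topology}" and f :: "'a \<Rightarrow> real"
  assumes f: "integrable M f" and g: "g \<in> borel_measurable M" "\<And>x. norm (g x) \<le> B"
  shows "integrable M (\<lambda>x. f x *\<^sub>R g x)"
proof (rule Bochner_Integration.integrable_bound[where f = "\<lambda>x. B * f x"])
  show "integrable M (\<lambda>x. B * f x)" using f by simp
  show "(\<lambda>x. f x *\<^sub>R g x) \<in> borel_measurable M" using f g by auto
  have "0 \<le> B" using g(2) norm_ge_zero order_trans by blast
  then show "AE x in M. norm (f x *\<^sub>R g x) \<le> norm (B * f x)"
    using g(2) mult_left_mono[OF g(2) abs_ge_zero] by (intro AE_I2) (simp add: abs_mult mult.commute[of B])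
qed

lemma continuous_compact_support_bounded:
  fixes g :: "'a::topological_space \<Rightarrow> 'b::real_normed_vector"
  assumes "continuous_on UNIV g" "compact K" "\<And>z. z \<notin> K \<Longrightarrow> g z = 0"
  obtains B where "\<And>z. norm (g z) \<le> B"
proof -
  have "bounded (g ` K)"
    using assms continuous_on_subset by (intro compact_imp_bounded compact_continuous_image) blast+
  then obtain B where "\<forall>x\<in>g ` K. norm x \<le> B" unfolding bounded_iff by blast
  then have "norm (g z) \<le> \<bar>B\<bar>" for z using assms(3)[of z] by (cases "z \<in> K") fastforce+
  then show ?thesis using that by blast
qed

section \<open>Weighted integration by parts\<close>

text \<open>\<open>grad\<close> is a definite description, so uniqueness of the gradient has to be
  supplied before its components can be read off from the derivative.\<close>

lemma grad_inner:
  fixes \<psi> :: "'a::euclidean_space \<Rightarrow> real"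
  assumes d: "(\<psi> has_derivative D) (at z)"
  shows "GDERIV \<psi> z :> grad \<psi> z" "grad \<psi> z \<bullet> b = D b" "grad \<psi> z = (\<Sum>b\<in>Basis. D b *\<^sub>R b)"
proof -
  have lin: "linear D" using d by (rule has_derivative_linear)
  define X where "X = (\<Sum>b\<in>Basis. D b *\<^sub>R b)"
  have DX: "D h = h \<bullet> X" for h
    using Linear_Algebra.linear_componentwise[OF lin, of h 1]
    by (simp add: X_def inner_sum_right mult.commute)
  then have DX': "D = (\<lambda>h. h \<bullet> X)" by (rule ext)
  have gX: "GDERIV \<psi> z :> X" using d unfolding gderiv_def DX' .
  have uniq: "Y = X" if "GDERIV \<psi> z :> Y" for Y
  proof -
    have "(\<lambda>h. h \<bullet> Y) = (\<lambda>h. h \<bullet> X)"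
      using that gX unfolding gderiv_def by (rule has_derivative_unique)
    then have "h \<bullet> Y = h \<bullet> X" for h by (rule fun_cong)
    then show ?thesis using vector_eq_ldot[of Y X] by blast
  qed
  have "grad \<psi> z = X" unfolding grad_def by (rule the_equality) (rule gX, rule uniq)
  then show "GDERIV \<psi> z :> grad \<psi> z" "grad \<psi> z = (\<Sum>b\<in>Basis. D b *\<^sub>R b)"
    using gX unfolding X_def[symmetric] by simp_all
  show "grad \<psi> z \<bullet> b = D b" unfolding \<open>grad \<psi> z = X\<close> DX by (rule inner_commute)
qed

lemma test_function_outside:
  assumes "z \<notin> closure {z. \<psi> z \<noteq> 0}"
  shows "\<psi> z = 0" "(\<psi> has_derivative (\<lambda>h. 0)) (at z)" "frechet_derivative \<psi> (at z) = (\<lambda>h. 0)"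
proof -
  define K where "K = closure {z. \<psi> z \<noteq> 0}"
  have zK: "z \<notin> K" using assms by (simp add: K_def)
  have "open (- K)" unfolding K_def by (intro open_Compl closed_closure)
  have out: "\<psi> z = 0" if "z \<notin> K" for z
    using that closure_subset[of "{z. \<psi> z \<noteq> 0}"] unfolding K_def by auto
  show "\<psi> z = 0" by (rule out[OF zK])
  have "((\<lambda>z. 0) has_derivative (\<lambda>h. 0)) (at z)" by simp
  then show d: "(\<psi> has_derivative (\<lambda>h. 0)) (at z)"
    by (rule has_derivative_transform_within_open[OF _ \<open>open (- K)\<close>]) (use zK out in auto)
  show "frechet_derivative \<psi> (at z) = (\<lambda>h. 0)" by (rule frechet_derivative_eq[OF d])
qed

lemma test_function_facts:
  fixes \<psi> :: "'a::euclidean_space \<Rightarrow> real"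
  assumes "test_function U \<psi>"
  shows "compact (closure {z. \<psi> z \<noteq> 0})" "closure {z. \<psi> z \<noteq> 0} \<subseteq> U"
    "(\<psi> has_derivative frechet_derivative \<psi> (at z)) (at z)"
    "Ck_on k \<psi> UNIV" "Ck_on k (\<lambda>z. frechet_derivative \<psi> (at z) b) UNIV"
proof -
  have *: "Ck_on k \<psi> UNIV" for k using assms by (simp add: test_function_def smooth_on_def)
  then show "Ck_on k \<psi> UNIV" .
  show "Ck_on k (\<lambda>z. frechet_derivative \<psi> (at z) b) UNIV" using *[of "Suc k"] by simp
  show "(\<psi> has_derivative frechet_derivative \<psi> (at z)) (at z)" by (rule Ck_on_has_derivative[OF *]) simp
qed (use assms in \<open>auto simp: test_function_def\<close>)

lemma borel_measurable_lebesgue_continuous: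
  fixes g :: "'a::euclidean_space \<Rightarrow> 'b::{second_countable_topology, topological_space}"
  shows "continuous_on UNIV g \<Longrightarrow> g \<in> borel_measurable lebesgue"
  by (intro measurable_completion) (simp add: borel_measurable_continuous_onI)

text \<open>Scalar components are what the divergence calls for, with a different test function for
  each basis direction. Integrability is part of the result because the components are summed under
  the integral later.\<close>

lemma weak_gradient_component:
  fixes f :: "'a::euclidean_space \<Rightarrow> real"
  assumes wg: "has_weak_gradient U f G" and \<zeta>: "test_function U \<zeta>"
  shows "set_integrable lebesgue U (\<lambda>z. f z * frechet_derivative \<zeta> (at z) b)"
    "set_integrable lebesgue U (\<lambda>z. \<zeta> z * (G z \<bullet> b))"
    "(LINT z:U|lebesgue. f z * frechet_derivative \<zeta> (at z) b) = - (LINT z:U|lebesgue. \<zeta> z * (G z \<bullet> b))"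
proof -
  let ?K = "closure {z. \<zeta> z \<noteq> 0}"
  note \<zeta>f = test_function_facts[OF \<zeta>]
  have int: "integrable lebesgue (\<lambda>z. indicator ?K z *\<^sub>R f z)" "integrable lebesgue (\<lambda>z. indicator ?K z *\<^sub>R G z)"
    using wg \<zeta>f(1,2) by (auto simp: has_weak_gradient_def set_integrable_def)
  have gr: "grad \<zeta> z = (\<Sum>b\<in>Basis. frechet_derivative \<zeta> (at z) b *\<^sub>R b)" for z
    by (rule grad_inner(3)[OF \<zeta>f(3)])
  have grb: "grad \<zeta> z \<bullet> b = frechet_derivative \<zeta> (at z) b" for z b by (rule grad_inner(2)[OF \<zeta>f(3)])
  have cg: "continuous_on UNIV (grad \<zeta>)" unfolding gr[abs_def]
    using \<zeta>f(5)[of 0] by (intro continuous_on_sum continuous_on_scaleR continuous_on_const) auto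
  have g0: "grad \<zeta> z = 0" if "z \<notin> ?K" for z using test_function_outside(3)[OF that] by (simp add: gr)
  obtain B where B: "\<And>z. norm (grad \<zeta> z) \<le> B"
    using continuous_compact_support_bounded[OF cg \<zeta>f(1) g0] by blast
  have "(\<lambda>z. indicator U z *\<^sub>R (f z *\<^sub>R grad \<zeta> z)) = (\<lambda>z. (indicator ?K z *\<^sub>R f z) *\<^sub>R grad \<zeta> z)"
  proof
    fix z show "indicator U z *\<^sub>R (f z *\<^sub>R grad \<zeta> z) = (indicator ?K z *\<^sub>R f z) *\<^sub>R grad \<zeta> z"
      using g0[of z] \<zeta>f(2) by (cases "z \<in> ?K") auto
  qed
  then have i1: "integrable lebesgue (\<lambda>z. indicator U z *\<^sub>R (f z *\<^sub>R grad \<zeta> z))"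
    using integrable_mult_bounded[OF int(1) borel_measurable_lebesgue_continuous[OF cg] B] by simp
  have c\<zeta>: "continuous_on UNIV \<zeta>" using \<zeta>f(4)[of 0] by simp
  have z0: "\<zeta> z = 0" if "z \<notin> ?K" for z by (rule test_function_outside(1)[OF that])
  obtain B' where B': "\<And>z. norm (\<zeta> z) \<le> B'" using continuous_compact_support_bounded[OF c\<zeta> \<zeta>f(1) z0] by blast
  have i2: "integrable lebesgue (\<lambda>z. indicator U z *\<^sub>R (\<zeta> z *\<^sub>R G z))"
  proof -
    have "(\<lambda>z. indicator U z *\<^sub>R (\<zeta> z *\<^sub>R G z)) = (\<lambda>z. \<zeta> z *\<^sub>R (indicator ?K z *\<^sub>R G z))"
    proof
      fix z show "indicator U z *\<^sub>R (\<zeta> z *\<^sub>R G z) = \<zeta> z *\<^sub>R (indicator ?K z *\<^sub>R G z)"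
        using z0[of z] \<zeta>f(2) by (cases "z \<in> ?K") auto
    qed
    moreover have "integrable lebesgue (\<lambda>z. \<zeta> z *\<^sub>R (indicator ?K z *\<^sub>R G z))"
    proof (rule Bochner_Integration.integrable_bound[where f = "\<lambda>z. B' *\<^sub>R (indicator ?K z *\<^sub>R G z)"])
      show "(\<lambda>z. \<zeta> z *\<^sub>R (indicator ?K z *\<^sub>R G z)) \<in> borel_measurable lebesgue"
        by (rule borel_measurable_scaleR[OF borel_measurable_lebesgue_continuous[OF c\<zeta>] borel_measurable_integrable[OF int(2)]])
      have "\<bar>\<zeta> z\<bar> \<le> \<bar>B'\<bar>" for z using B'[of z] by simp
      then show "AE z in lebesgue. norm (\<zeta> z *\<^sub>R (indicator ?K z *\<^sub>R G z)) \<le> norm (B' *\<^sub>R (indicator ?K z *\<^sub>R G z))"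
        unfolding norm_scaleR[of "\<zeta> _"] norm_scaleR[of B'] by (intro AE_I2 mult_right_mono) auto
    qed (rule integrable_scaleR_right, rule int(2))
    ultimately show ?thesis by simp
  qed
  have e1: "(\<lambda>z. indicator U z *\<^sub>R (f z * frechet_derivative \<zeta> (at z) b)) = (\<lambda>z. (indicator U z *\<^sub>R (f z *\<^sub>R grad \<zeta> z)) \<bullet> b)"
    by (simp add: grb fun_eq_iff)
  have e2: "(\<lambda>z. indicator U z *\<^sub>R (\<zeta> z * (G z \<bullet> b))) = (\<lambda>z. (indicator U z *\<^sub>R (\<zeta> z *\<^sub>R G z)) \<bullet> b)"
    by (simp add: fun_eq_iff)
  show "set_integrable lebesgue U (\<lambda>z. f z * frechet_derivative \<zeta> (at z) b)" "set_integrable lebesgue U (\<lambda>z. \<zeta> z * (G z \<bullet> b))"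
    unfolding set_integrable_def e1 e2 by (intro integrable_inner_left impI i1 i2)+
  have "(LINT z:U|lebesgue. f z *\<^sub>R grad \<zeta> z) \<bullet> b = - (LINT z:U|lebesgue. \<zeta> z *\<^sub>R G z) \<bullet> b"
    using wg \<zeta> by (simp add: has_weak_gradient_def)
  then show "(LINT z:U|lebesgue. f z * frechet_derivative \<zeta> (at z) b) = - (LINT z:U|lebesgue. \<zeta> z * (G z \<bullet> b))"
    unfolding set_lebesgue_integral_def e1 e2
    using integral_inner_left[of b lebesgue, OF i1] integral_inner_left[of b lebesgue, OF i2] by simp
qed

text \<open>The weight depends on y only, so a derivative falling on it contracts the gradient to
  its vertical component.\<close>

lemma sum_Basis_snd:
  fixes D :: "'a::euclidean_space \<times> real \<Rightarrow> real"
  assumes "linear D" shows "(\<Sum>b\<in>Basis. snd b * D b) = D (0, 1)"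
proof -
  have "D (0, 1) = (\<Sum>b\<in>Basis. ((0, 1) \<bullet> b) * D b)"
    using Linear_Algebra.linear_componentwise[OF assms, of "(0, 1)" 1] by simp
  then show ?thesis by (simp add: inner_prod_def)
qed

text \<open>\<open>y^a\<close> is not smooth at y = 0, where \<psi> need not vanish, so the weak
  gradient is tested with \<open>y^a\<close> times a derivative of \<psi> times a cutoff in y. The
  derivative of the cutoff has size k on a strip of height about 1/k; the hypothesis
  \<open>\<partial>_y \<psi> = y \<kappa>\<close>, typical of functions of \<open>y^2\<close>,
  compensates it, and no boundary term survives.\<close>

lemma weighted_integration_by_parts:
  fixes u \<psi> \<kappa> :: "'a::euclidean_space \<times> real \<Rightarrow> real"
  defines "D1 \<equiv> \<lambda>b z. frechet_derivative \<psi> (at z) b"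
  defines "D2 \<equiv> \<lambda>b z. frechet_derivative (\<lambda>z. frechet_derivative \<psi> (at z) b) (at z) b"
  assumes wg: "has_weak_gradient (\<Omega> \<times> {0<..<T}) u G"
    and iu: "set_integrable lebesgue (\<Omega> \<times> {0<..<T}) (\<lambda>z. snd z powr a * u z)"
    and iG: "set_integrable lebesgue (\<Omega> \<times> {0<..<T}) (\<lambda>z. snd z powr a *\<^sub>R G z)"
    and \<psi>: "test_function (\<Omega> \<times> {-T<..<T}) \<psi>"
    and \<kappa>: "\<And>z. frechet_derivative \<psi> (at z) (0, 1) = snd z * \<kappa> z" "continuous_on UNIV \<kappa>" "\<And>z. \<bar>\<kappa> z\<bar> \<le> B\<kappa>"
  shows "set_integrable lebesgue (\<Omega> \<times> {0<..<T}) (\<lambda>z. snd z powr a * (\<Sum>b\<in>Basis. D1 b z * (G z \<bullet> b)))"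
    and "set_integrable lebesgue (\<Omega> \<times> {0<..<T}) (\<lambda>z. snd z powr a * u z * ((\<Sum>b\<in>Basis. D2 b z) + a * \<kappa> z))"
    and "(LINT z:\<Omega> \<times> {0<..<T}|lebesgue. snd z powr a * (\<Sum>b\<in>Basis. D1 b z * (G z \<bullet> b))) =
      - (LINT z:\<Omega> \<times> {0<..<T}|lebesgue. snd z powr a * u z * ((\<Sum>b\<in>Basis. D2 b z) + a * \<kappa> z))"
proof -
  define U where "U = \<Omega> \<times> {0<..<T}"
  let ?K = "closure {z. \<psi> z \<noteq> 0}"
  note \<psi>f = test_function_facts[OF \<psi>]
  have sm1: "Ck_on k (D1 b) UNIV" for k b using \<psi>f(5) by (simp add: D1_def)
  have sm2: "Ck_on k (D2 b) UNIV" for k b using sm1[of "Suc k" b] unfolding D1_def D2_def Ck_on.simps(2) by blast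
  have out1: "D1 b z = 0" if "z \<notin> ?K" for b z using test_function_outside(3)[OF that] by (simp add: D1_def)
  have out2: "D2 b z = 0" if "z \<notin> ?K" for b z
  proof -
    have "frechet_derivative (D1 b) (at z) = frechet_derivative (\<lambda>z. 0) (at z)"
      by (rule frechet_derivative_cong_open[of "- ?K"]) (use that out1 in auto)
    also have "\<dots> = (\<lambda>h. 0)" by (rule frechet_derivative_eq) simp
    finally show ?thesis by (simp add: D2_def D1_def)
  qed
  have cont1: "continuous_on UNIV (D1 b)" for b using Ck_on_imp_continuous_on[OF sm1[of 0]] .
  have cont2: "continuous_on UNIV (D2 b)" for b using Ck_on_imp_continuous_on[OF sm2[of 0]] .
  have "\<exists>B. \<forall>z. \<bar>D1 b z\<bar> \<le> B" for b
    using continuous_compact_support_bounded[OF cont1 \<psi>f(1) out1] real_norm_def by metis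
  then obtain B1 where B1: "\<And>b z. \<bar>D1 b z\<bar> \<le> B1 b" by metis
  have "\<exists>B. \<forall>z. \<bar>D2 b z\<bar> \<le> B" for b
    using continuous_compact_support_bounded[OF cont2 \<psi>f(1) out2] real_norm_def by metis
  then obtain B2 where B2: "\<And>b z. \<bar>D2 b z\<bar> \<le> B2 b" by metis
  obtain Bs where Bs: "Bs > 0" "\<And>t. deriv smooth_step t \<le> Bs" using deriv_smooth_step_bounded by blast
  define Iu where "Iu z = indicator U z *\<^sub>R (snd z powr a * u z)" for z
  define IG where "IG z = indicator U z *\<^sub>R (snd z powr a *\<^sub>R G z)" for z
  have Iu: "integrable lebesgue Iu" and IG: "integrable lebesgue IG"
    using iu iG by (simp_all add: set_integrable_def U_def Iu_def[abs_def] IG_def[abs_def])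
  define L where "L z = (\<Sum>b\<in>Basis. D2 b z) + a * \<kappa> z" for z
  have Lm: "L \<in> borel_measurable lebesgue" unfolding L_def
    by (intro borel_measurable_lebesgue_continuous continuous_intros cont2 \<kappa>)
  have Lb: "\<bar>L z\<bar> \<le> (\<Sum>b\<in>Basis. B2 b) + \<bar>a\<bar> * B\<kappa>" for z
  proof -
    have "\<bar>\<Sum>b\<in>Basis. D2 b z\<bar> \<le> (\<Sum>b\<in>Basis. B2 b)" by (rule order_trans[OF sum_abs sum_mono[OF B2]])
    moreover have "\<bar>a * \<kappa> z\<bar> \<le> \<bar>a\<bar> * B\<kappa>" using \<kappa>(3) by (simp add: abs_mult mult_left_mono)
    ultimately show ?thesis unfolding L_def by linarith
  qed
  define H where "H z = (\<Sum>b\<in>Basis. (IG z \<bullet> b) *\<^sub>R D1 b z)" for z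
  have Hi: "integrable lebesgue H" unfolding H_def
    by (intro Bochner_Integration.integrable_sum integrable_mult_bounded[where B = "B1 _"] integrable_inner_left impI IG
        borel_measurable_lebesgue_continuous cont1) (use B1 in simp)
  have ILi: "integrable lebesgue (\<lambda>z. Iu z *\<^sub>R L z)" by (rule integrable_mult_bounded[OF Iu Lm]) (use Lb in simp)
  have eH: "(\<lambda>z. indicator U z *\<^sub>R (snd z powr a * (\<Sum>b\<in>Basis. D1 b z * (G z \<bullet> b)))) = H"
    by (auto simp: H_def IG_def fun_eq_iff sum_distrib_left algebra_simps)
  have eL: "(\<lambda>z. indicator U z *\<^sub>R (snd z powr a * u z * L z)) = (\<lambda>z. Iu z *\<^sub>R L z)"
    by (auto simp: Iu_def fun_eq_iff)
  show "set_integrable lebesgue (\<Omega> \<times> {0<..<T}) (\<lambda>z. snd z powr a * (\<Sum>b\<in>Basis. D1 b z * (G z \<bullet> b)))"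
    unfolding set_integrable_def U_def[symmetric] eH by (rule Hi)
  show "set_integrable lebesgue (\<Omega> \<times> {0<..<T}) (\<lambda>z. snd z powr a * u z * ((\<Sum>b\<in>Basis. D2 b z) + a * \<kappa> z))"
    unfolding set_integrable_def U_def[symmetric] L_def[symmetric] eL by (rule ILi)
  \<comment> \<open>The cutoff rises from 0 to 1 for y between \<open>1 / (k + 1)\<close> and
    \<open>2 / (k + 1)\<close>; \<open>Suc k\<close> keeps these bounds meaningful at k = 0.\<close>
  define \<eta> where "\<eta> k y = smooth_step (real (Suc k) * y - 1)" for k and y :: real
  \<comment> \<open>This is y times the derivative of \<eta>. The factor y comes from the vertical
    derivative of \<psi> and makes \<theta> bounded uniformly in k.\<close>
  define \<theta> where "\<theta> k y = real (Suc k) * y * deriv smooth_step (real (Suc k) * y - 1)" for k and y :: real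
  define m where "m k y = y powr a * \<eta> k y" for k and y :: real
  have \<eta>0: "\<eta> k y = 0" if "y \<le> 1 / real (Suc k)" for k y
    unfolding \<eta>_def using that by (intro smooth_step_0) (simp add: field_simps)
  have \<eta>b: "\<bar>\<eta> k y\<bar> \<le> 1" for k y unfolding \<eta>_def using smooth_step_bounds by auto
  have \<theta>b: "\<bar>\<theta> k y\<bar> \<le> 2 * Bs" for k y
  proof (cases "real (Suc k) * y - 1 \<le> 0 \<or> real (Suc k) * y - 1 \<ge> 1")
    case True then show ?thesis using deriv_smooth_step_0[OF True] Bs by (simp add: \<theta>_def)
  next
    case False
    then have "\<bar>real (Suc k) * y\<bar> \<le> 2" by linarith
    then show ?thesis using Bs(2) deriv_smooth_step_nonneg unfolding \<theta>_def abs_mult[of _ "deriv _ _"]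
      by (intro mult_mono) auto
  qed
  have \<eta>lim: "\<forall>\<^sub>F k in sequentially. \<eta> k y = 1 \<and> \<theta> k y = 0" if "y > 0" for y
  proof -
    have "\<forall>\<^sub>F k in sequentially. real k > 2 / y"
      using filterlim_real_sequentially by (auto simp: filterlim_at_top_dense)
    then show ?thesis
    proof eventually_elim
      case (elim k)
      then have "2 \<le> real (Suc k) * y" using that by (simp add: field_simps)
      then show ?case by (simp add: \<eta>_def \<theta>_def smooth_step_1 deriv_smooth_step_0)
    qed
  qed
  have affine: "Ck_on j (\<lambda>y::real. real (Suc k) * y + - 1) S" for j k S by (rule Ck_on_affine)
  have sm\<eta>: "Ck_on j (\<eta> k) S" if "open S" for j k S
    using Ck_on_compose_real[OF that open_UNIV UNIV_I affine Ck_on_smooth_step, of j k] by (simp add: \<eta>_def[abs_def])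
  have smm: "smooth_on (m k) UNIV" for k
  proof (rule smooth_on_local)
    fix j
    have "Ck_on j (m k) {..<1 / real (Suc k)} = Ck_on j (\<lambda>y. 0::real) {..<1 / real (Suc k)}"
      by (rule Ck_on_cong) (auto simp: m_def \<eta>0)
    then show "Ck_on j (m k) {..<1 / real (Suc k)}" by simp
    show "Ck_on j (m k) {0<..}" unfolding m_def[abs_def] by (intro Ck_on_mult Ck_on_powr sm\<eta>) auto
  qed auto
  have dm: "(m k has_real_derivative y powr (a - 1) * (a * \<eta> k y + \<theta> k y)) (at y)" if "y > 0" for k y
  proof -
    have "(m k has_real_derivative (a * y powr (a - 1)) * \<eta> k y + (deriv smooth_step (real (Suc k) * y - 1) * real (Suc k)) * y powr a) (at y)"
      unfolding m_def[abs_def] \<eta>_def[abs_def]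
    proof (rule DERIV_mult)
      show "((\<lambda>y. y powr a) has_real_derivative a * y powr (a - 1)) (at y)"
        using that by (auto intro!: derivative_eq_intros)
      show "((\<lambda>y. smooth_step (real (Suc k) * y - 1)) has_real_derivative deriv smooth_step (real (Suc k) * y - 1) * real (Suc k)) (at y)"
        by (rule DERIV_chain2[OF DERIV_smooth_step]) (auto intro!: derivative_eq_intros)
    qed
    moreover have "y powr a = y powr (a - 1) * y" using that powr_add[of y "a - 1" 1] by simp
    ultimately show ?thesis by (simp add: \<theta>_def algebra_simps)
  qed
  define \<zeta> where "\<zeta> k b z = m k (snd z) * D1 b z" for k b and z :: "'a \<times> real"
  have \<zeta>sm: "Ck_on j (\<zeta> k b) UNIV" for j k b
  proof -
    have "Ck_on j (\<lambda>z::'a \<times> real. m k (snd z)) UNIV"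
      by (rule Ck_on_compose_real[OF open_UNIV open_UNIV UNIV_I Ck_on_linear[OF bounded_linear_snd]])
        (use smm in \<open>simp add: smooth_on_def\<close>)
    then show ?thesis unfolding \<zeta>_def[abs_def] by (intro Ck_on_mult sm1) auto
  qed
  have \<zeta>supp: "closure {z. \<zeta> k b z \<noteq> 0} \<subseteq> ?K \<inter> {z. snd z \<ge> 1 / real (Suc k)}" for k b
  proof (rule closure_minimal)
    show "{z. \<zeta> k b z \<noteq> 0} \<subseteq> ?K \<inter> {z. snd z \<ge> 1 / real (Suc k)}"
    proof
      fix z assume "z \<in> {z. \<zeta> k b z \<noteq> 0}"
      then have "D1 b z \<noteq> 0" "\<eta> k (snd z) \<noteq> 0" by (auto simp: \<zeta>_def m_def)
      then show "z \<in> ?K \<inter> {z. snd z \<ge> 1 / real (Suc k)}" using out1 \<eta>0[of "snd z" k] by fastforce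
    qed
    show "closed (?K \<inter> {z. snd z \<ge> 1 / real (Suc k)})"
      by (intro closed_Int closed_closure closed_Collect_le continuous_intros)
  qed
  have \<zeta>test: "test_function U (\<zeta> k b)" for k b
    unfolding test_function_def smooth_on_def
  proof (intro conjI allI \<zeta>sm)
    have "bounded (closure {z. \<zeta> k b z \<noteq> 0})"
      using \<zeta>supp[of k b] \<psi>f(1) compact_imp_bounded bounded_subset by (metis le_inf_iff)
    then show "compact (closure {z. \<zeta> k b z \<noteq> 0})" by (simp add: compact_eq_bounded_closed)
    have "?K \<inter> {z. snd z \<ge> 1 / real (Suc k)} \<subseteq> U"
    proof
      fix z assume z: "z \<in> ?K \<inter> {z. snd z \<ge> 1 / real (Suc k)}"
      then have "z \<in> \<Omega> \<times> {-T<..<T}" "0 < snd z" using \<psi>f(2) less_le_trans[of 0 "1 / real (Suc k)" "snd z"] by auto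
      then show "z \<in> U" by (auto simp: U_def)
    qed
    then show "closure {z. \<zeta> k b z \<noteq> 0} \<subseteq> U" by (rule order_trans[OF \<zeta>supp])
  qed
  have \<zeta>der: "frechet_derivative (\<zeta> k b) (at z) b = m k (snd z) * D2 b z + snd z powr (a - 1) * (a * \<eta> k (snd z) + \<theta> k (snd z)) * (snd b * D1 b z)"
    if "snd z > 0" for k b z
  proof -
    let ?m' = "snd z powr (a - 1) * (a * \<eta> k (snd z) + \<theta> k (snd z))"
    have d1: "((\<lambda>z. m k (snd z)) has_derivative (\<lambda>h. ?m' * snd h)) (at z)"
      using has_derivative_compose[of snd snd z UNIV "m k", OF _ dm[OF that, unfolded has_field_derivative_def]]
      by (simp add: bounded_linear_imp_has_derivative[OF bounded_linear_snd])
    have d2: "(D1 b has_derivative frechet_derivative (D1 b) (at z)) (at z)"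
      by (rule Ck_on_has_derivative[OF sm1[of "Suc 0"]]) simp
    have "(\<zeta> k b has_derivative (\<lambda>h. m k (snd z) * frechet_derivative (D1 b) (at z) h + (?m' * snd h) * D1 b z)) (at z)"
      unfolding \<zeta>_def[abs_def] by (rule has_derivative_mult[OF d1 d2])
    then show ?thesis by (simp add: frechet_derivative_eq D1_def D2_def)
  qed
  have key: "(LINT z|lebesgue. Iu z *\<^sub>R (\<eta> k (snd z) * L z + \<theta> k (snd z) * \<kappa> z)) = - (LINT z|lebesgue. \<eta> k (snd z) * H z)" for k
  proof -
    note c = weak_gradient_component[OF wg[folded U_def] \<zeta>test]
    have "(LINT z:U|lebesgue. (\<Sum>b\<in>Basis. u z * frechet_derivative (\<zeta> k b) (at z) b)) = (\<Sum>b\<in>Basis. LINT z:U|lebesgue. u z * frechet_derivative (\<zeta> k b) (at z) b)"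
      unfolding set_lebesgue_integral_def scaleR_sum_right
      by (rule Bochner_Integration.integral_sum) (rule c(1)[unfolded set_integrable_def])
    also have "\<dots> = (\<Sum>b\<in>Basis. - (LINT z:U|lebesgue. \<zeta> k b z * (G z \<bullet> b)))" by (simp only: c(3))
    also have "\<dots> = - (LINT z:U|lebesgue. (\<Sum>b\<in>Basis. \<zeta> k b z * (G z \<bullet> b)))"
      unfolding set_lebesgue_integral_def scaleR_sum_right sum_negf
      by (subst Bochner_Integration.integral_sum) (rule c(2)[unfolded set_integrable_def], rule refl)
    finally have eq: "(LINT z:U|lebesgue. (\<Sum>b\<in>Basis. u z * frechet_derivative (\<zeta> k b) (at z) b)) = - (LINT z:U|lebesgue. (\<Sum>b\<in>Basis. \<zeta> k b z * (G z \<bullet> b)))" .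
    have l: "(\<lambda>z. indicator U z *\<^sub>R (\<Sum>b\<in>Basis. u z * frechet_derivative (\<zeta> k b) (at z) b)) =
       (\<lambda>z. Iu z *\<^sub>R (\<eta> k (snd z) * L z + \<theta> k (snd z) * \<kappa> z))"
    proof
      fix z show "indicator U z *\<^sub>R (\<Sum>b\<in>Basis. u z * frechet_derivative (\<zeta> k b) (at z) b) =
       Iu z *\<^sub>R (\<eta> k (snd z) * L z + \<theta> k (snd z) * \<kappa> z)"
      proof (cases "z \<in> U")
        case True
        then have y: "snd z > 0" by (auto simp: U_def)
        have "linear (frechet_derivative \<psi> (at z))" using \<psi>f(3) has_derivative_linear by blast
        then have s: "(\<Sum>b\<in>Basis. snd b * D1 b z) = snd z * \<kappa> z"
          unfolding D1_def using sum_Basis_snd \<kappa>(1) by metis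
        have "(\<Sum>b\<in>Basis. frechet_derivative (\<zeta> k b) (at z) b) =
          m k (snd z) * (\<Sum>b\<in>Basis. D2 b z) + snd z powr (a - 1) * (a * \<eta> k (snd z) + \<theta> k (snd z)) * (\<Sum>b\<in>Basis. snd b * D1 b z)"
          by (simp only: \<zeta>der[OF y] sum.distrib sum_distrib_left)
        also have "\<dots> = m k (snd z) * (\<Sum>b\<in>Basis. D2 b z) + (snd z powr (a - 1) * snd z) * (a * \<eta> k (snd z) + \<theta> k (snd z)) * \<kappa> z"
          by (simp add: s)
        \<comment> \<open>The factor y from the vertical derivative raises \<open>y^(a-1)\<close> to
          \<open>y^a\<close>, against which u is integrable.\<close>
        also have "snd z powr (a - 1) * snd z = snd z powr a" using y powr_add[of "snd z" "a - 1" 1] by simp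
        finally have "(\<Sum>b\<in>Basis. frechet_derivative (\<zeta> k b) (at z) b) = snd z powr a * (\<eta> k (snd z) * L z + \<theta> k (snd z) * \<kappa> z)"
          by (simp add: m_def L_def algebra_simps)
        then show ?thesis using True by (simp add: Iu_def sum_distrib_left[symmetric])
      qed (simp add: Iu_def)
    qed
    have r: "(\<lambda>z. indicator U z *\<^sub>R (\<Sum>b\<in>Basis. \<zeta> k b z * (G z \<bullet> b))) = (\<lambda>z. \<eta> k (snd z) * H z)"
      by (auto simp: fun_eq_iff H_def IG_def \<zeta>_def m_def sum_distrib_left algebra_simps)
    show ?thesis using eq unfolding set_lebesgue_integral_def l r .
  qed
  have Upos: "snd z > 0" if "z \<in> U" for z using that by (auto simp: U_def)
  have c\<eta>: "continuous_on UNIV (\<eta> k)" for k by (rule Ck_on_imp_continuous_on[OF sm\<eta>[OF open_UNIV, of 0]])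
  have \<eta>meas: "(\<lambda>z::'a \<times> real. \<eta> k (snd z)) \<in> borel_measurable lebesgue" for k
    by (rule borel_measurable_lebesgue_continuous, rule continuous_on_compose2[OF c\<eta>]) (auto intro: continuous_intros)
  have lim1: "(\<lambda>k. LINT z|lebesgue. \<eta> k (snd z) * H z) \<longlonglongrightarrow> (LINT z|lebesgue. H z)"
  proof (rule integral_dominated_convergence[where w = "\<lambda>z. norm (H z)"])
    show "AE z in lebesgue. (\<lambda>k. \<eta> k (snd z) * H z) \<longlonglongrightarrow> H z"
    proof (rule AE_I2)
      fix z show "(\<lambda>k. \<eta> k (snd z) * H z) \<longlonglongrightarrow> H z"
      proof (cases "z \<in> U")
        case True show ?thesis using \<eta>lim[OF Upos[OF True]] by (intro tendsto_eventually) (erule eventually_mono, simp)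
      qed (simp add: H_def IG_def)
    qed
    show "AE z in lebesgue. norm (\<eta> k (snd z) * H z) \<le> norm (H z)" for k
      using \<eta>b by (intro AE_I2) (simp add: abs_mult mult_left_le_one_le)
    show "(\<lambda>z. \<eta> k (snd z) * H z) \<in> borel_measurable lebesgue" for k
      by (rule borel_measurable_times[OF \<eta>meas borel_measurable_integrable[OF Hi]])
  qed (use Hi in auto)
  \<comment> \<open>At each fixed y > 0 eventually \<eta> = 1 and \<theta> = 0, so the term with
    \<theta> is dominated and disappears.\<close>
  have lim2: "(\<lambda>k. LINT z|lebesgue. Iu z *\<^sub>R (\<eta> k (snd z) * L z + \<theta> k (snd z) * \<kappa> z)) \<longlonglongrightarrow> (LINT z|lebesgue. Iu z *\<^sub>R L z)"
  proof (rule integral_dominated_convergence[where w = "\<lambda>z. \<bar>Iu z\<bar> * ((\<Sum>b\<in>Basis. B2 b) + \<bar>a\<bar> * B\<kappa> + 2 * Bs * B\<kappa>)"])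
    show "AE z in lebesgue. (\<lambda>k. Iu z *\<^sub>R (\<eta> k (snd z) * L z + \<theta> k (snd z) * \<kappa> z)) \<longlonglongrightarrow> Iu z *\<^sub>R L z"
    proof (rule AE_I2)
      fix z show "(\<lambda>k. Iu z *\<^sub>R (\<eta> k (snd z) * L z + \<theta> k (snd z) * \<kappa> z)) \<longlonglongrightarrow> Iu z *\<^sub>R L z"
      proof (cases "z \<in> U")
        case True show ?thesis using \<eta>lim[OF Upos[OF True]] by (intro tendsto_eventually) (erule eventually_mono, simp)
      qed (simp add: Iu_def)
    qed
    show "AE z in lebesgue. norm (Iu z *\<^sub>R (\<eta> k (snd z) * L z + \<theta> k (snd z) * \<kappa> z)) \<le> \<bar>Iu z\<bar> * ((\<Sum>b\<in>Basis. B2 b) + \<bar>a\<bar> * B\<kappa> + 2 * Bs * B\<kappa>)" for k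
    proof (intro AE_I2)
      fix z
      have "\<bar>\<eta> k (snd z) * L z\<bar> \<le> 1 * ((\<Sum>b\<in>Basis. B2 b) + \<bar>a\<bar> * B\<kappa>)"
        unfolding abs_mult by (intro mult_mono \<eta>b Lb) auto
      moreover have "\<bar>\<theta> k (snd z) * \<kappa> z\<bar> \<le> (2 * Bs) * B\<kappa>"
        unfolding abs_mult using Bs by (intro mult_mono \<theta>b \<kappa>(3)) auto
      ultimately have "\<bar>\<eta> k (snd z) * L z + \<theta> k (snd z) * \<kappa> z\<bar> \<le> (\<Sum>b\<in>Basis. B2 b) + \<bar>a\<bar> * B\<kappa> + 2 * Bs * B\<kappa>"
        using order_trans[OF abs_triangle_ineq add_mono] by (metis mult_1)
      then show "norm (Iu z *\<^sub>R (\<eta> k (snd z) * L z + \<theta> k (snd z) * \<kappa> z)) \<le> \<bar>Iu z\<bar> * ((\<Sum>b\<in>Basis. B2 b) + \<bar>a\<bar> * B\<kappa> + 2 * Bs * B\<kappa>)"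
        unfolding real_norm_def real_scaleR_def abs_mult[of "Iu z"] by (rule mult_left_mono) simp
    qed
    have "continuous_on UNIV (\<lambda>y. deriv smooth_step (real (Suc k) * y - 1))" for k
      by (rule continuous_on_compose2[OF Ck_on_imp_continuous_on[OF Ck_on_deriv_smooth_step[of 0]]]) (auto intro!: continuous_intros)
    then have c\<theta>: "continuous_on UNIV (\<theta> k)" for k unfolding \<theta>_def[abs_def] by (intro continuous_intros)
    have \<theta>meas: "(\<lambda>z::'a \<times> real. \<theta> k (snd z)) \<in> borel_measurable lebesgue" for k
      by (rule borel_measurable_lebesgue_continuous, rule continuous_on_compose2[OF c\<theta>]) (auto intro: continuous_intros)
    show "(\<lambda>z. Iu z *\<^sub>R (\<eta> k (snd z) * L z + \<theta> k (snd z) * \<kappa> z)) \<in> borel_measurable lebesgue" for k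
      by (rule borel_measurable_scaleR[OF borel_measurable_integrable[OF Iu] borel_measurable_add[OF
          borel_measurable_times[OF \<eta>meas Lm] borel_measurable_times[OF \<theta>meas borel_measurable_lebesgue_continuous[OF \<kappa>(2)]]]])
    show "(\<lambda>z. Iu z *\<^sub>R L z) \<in> borel_measurable lebesgue" using ILi by auto
    show "integrable lebesgue (\<lambda>z. \<bar>Iu z\<bar> * ((\<Sum>b\<in>Basis. B2 b) + \<bar>a\<bar> * B\<kappa> + 2 * Bs * B\<kappa>))" using Iu by (intro integrable_mult_left integrable_abs impI) auto
  qed
  have "(LINT z|lebesgue. H z) = - (LINT z|lebesgue. Iu z *\<^sub>R L z)"
    using LIMSEQ_unique[OF lim2[unfolded key] tendsto_minus[OF lim1]] by simp
  then show "(LINT z:\<Omega> \<times> {0<..<T}|lebesgue. snd z powr a * (\<Sum>b\<in>Basis. D1 b z * (G z \<bullet> b))) =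
      - (LINT z:\<Omega> \<times> {0<..<T}|lebesgue. snd z powr a * u z * ((\<Sum>b\<in>Basis. D2 b z) + a * \<kappa> z))"
    unfolding set_lebesgue_integral_def U_def[symmetric] L_def[symmetric] eH eL .
qed

section \<open>Riesz potentials\<close>

text \<open>Dyadic shells: between the radii \<open>a (Suc k)\<close> and \<open>a k\<close> the
  power is at most \<open>c k\<close>, its value at the inner radius. Multiplied by the volume of
  the ball of radius \<open>a k\<close> this is a geometric sequence of ratio
  \<open>2 powr (q - n) < 1\<close>.\<close>

lemma nn_integral_norm_powr_ball_finite:
  fixes q R :: real
  assumes q: "0 \<le> q" "q < DIM('a)" and R: "R > 0"
  shows "(\<integral>\<^sup>+z. ennreal (indicator (ball 0 R) z * norm z powr (- q)) \<partial>(lborel :: 'a::euclidean_space measure)) < \<infinity>"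
proof -
  define n where "n = DIM('a)"
  define a where "a k = R / 2 ^ k" for k :: nat
  have a: "a k > 0" "a (Suc k) = a k / 2" for k using R by (auto simp: a_def)
  define V where "V = unit_ball_vol (real n)"
  have V: "V \<ge> 0" by (simp add: V_def)
  define c where "c k = 2 powr q * a k powr (- q)" for k
  define \<rho> where "\<rho> = 2 powr (q - n)"
  have pw: "ennreal (indicator (ball 0 R) z * norm z powr (- q)) \<le> (\<Sum>k. ennreal (c k) * indicator (cball 0 (a k)) z)" for z :: 'a
  proof (cases "z = 0 \<or> norm z \<ge> R")
    case False
    then have z: "norm z > 0" "norm z < R" by auto
    have "\<exists>k. a (Suc k) < norm z"
    proof -
      obtain k where "(1/2::real) ^ k < norm z / R" using real_arch_pow_inv[of "norm z / R" "1/2"] z R by auto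
      then have "a k < norm z" using R by (simp add: a_def field_simps power_divide)
      then show ?thesis using a[of k] by (intro exI[of _ k]) auto
    qed
    define k where "k = (LEAST k. a (Suc k) < norm z)"
    have k1: "a (Suc k) < norm z" unfolding k_def by (rule LeastI_ex) fact
    have k2: "norm z \<le> a k"
    proof (cases k)
      case 0 then show ?thesis using z by (simp add: a_def)
    next
      case (Suc j)
      then have "\<not> a (Suc j) < norm z" using not_less_Least[of j "\<lambda>k. a (Suc k) < norm z"] by (simp add: k_def)
      then show ?thesis using Suc by simp
    qed
    have "norm z powr (- q) \<le> (a k / 2) powr (- q)" using k1 a q by (intro powr_mono2') (auto simp: less_imp_le)
    also have "\<dots> = c k" using a[of k] by (simp add: c_def powr_divide powr_minus_divide)
    finally have "ennreal (indicator (ball 0 R) z * norm z powr (- q)) \<le> ennreal (c k) * indicator (cball 0 (a k)) z"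
      using k2 z by (auto simp: ennreal_leI)
    also have "\<dots> \<le> (\<Sum>k. ennreal (c k) * indicator (cball 0 (a k)) z)"
    proof -
      define F where "F k = ennreal (c k) * indicator (cball 0 (a k)) z" for k
      have "F k \<le> (\<Sum>k. F k)" using sum_le_suminf[of F "{k}"] by simp
      then show ?thesis by (simp add: F_def[abs_def])
    qed
    finally show ?thesis .
  qed (auto simp: indicator_def)
  have "(\<integral>\<^sup>+z. ennreal (indicator (ball 0 R) z * norm z powr (- q)) \<partial>(lborel :: 'a measure)) \<le>
      (\<integral>\<^sup>+z. (\<Sum>k. ennreal (c k) * indicator (cball 0 (a k)) z) \<partial>(lborel :: 'a measure))"
    by (intro nn_integral_mono pw)
  also have "\<dots> = (\<Sum>k. \<integral>\<^sup>+z. ennreal (c k) * indicator (cball 0 (a k)) z \<partial>(lborel :: 'a measure))"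
  proof (rule nn_integral_suminf)
    fix k show "(\<lambda>z. ennreal (c k) * indicator (cball 0 (a k)) z) \<in> borel_measurable (lborel :: 'a measure)"
      by (intro borel_measurable_times_ennreal borel_measurable_const borel_measurable_indicator) simp
  qed
  also have "\<dots> = (\<Sum>k. ennreal (2 powr q * V * R powr (n - q) * \<rho> ^ k))"
  proof (intro suminf_cong)
    fix k
    have "(2 ^ k :: real) powr (real n - q) = (2 powr (real n - q)) ^ k"
      by (simp add: powr_realpow[symmetric] powr_powr mult.commute)
    then have "a k powr (real n - q) = R powr (real n - q) * inverse ((2 powr (real n - q)) ^ k)"
      by (simp add: a_def powr_divide divide_inverse[of "R powr _"])
    also have "inverse ((2 powr (real n - q)) ^ k) = \<rho> ^ k"
      using powr_minus[of 2 "real n - q"] by (simp add: \<rho>_def power_inverse)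
    finally have "a k powr (real n - q) = R powr (real n - q) * \<rho> ^ k" .
    moreover have "a k powr (real n - q) = a k powr (- q) * a k ^ n"
    proof -
      have "a k powr (real n + - q) = a k powr real n * a k powr (- q)" by (rule powr_add)
      then show ?thesis using a(1)[of k] by (simp add: powr_realpow)
    qed
    ultimately have e: "c k * (V * a k ^ n) = 2 powr q * V * R powr (n - q) * \<rho> ^ k"
      by (simp add: c_def)
    have "(\<integral>\<^sup>+z. ennreal (c k) * indicator (cball 0 (a k)) z \<partial>(lborel :: 'a measure)) = ennreal (c k) * emeasure lborel (cball (0::'a) (a k))"
      by (intro nn_integral_cmult_indicator) auto
    also have "\<dots> = ennreal (c k * (V * a k ^ n))"
      using a[of k] by (simp add: emeasure_cball V_def n_def ennreal_mult' c_def)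
    finally show "(\<integral>\<^sup>+z. ennreal (c k) * indicator (cball 0 (a k)) z \<partial>(lborel :: 'a measure)) = ennreal (2 powr q * V * R powr (n - q) * \<rho> ^ k)"
      unfolding e .
  qed
  also have "\<dots> < \<infinity>"
  proof -
    have "\<rho> < 2 powr 0" unfolding \<rho>_def using q by (intro powr_less_mono) (auto simp: n_def)
    then have "summable (\<lambda>k. 2 powr q * V * R powr (n - q) * \<rho> ^ k)"
      by (intro summable_mult summable_geometric) (auto simp: \<rho>_def)
    then have "(\<Sum>k. ennreal (2 powr q * V * R powr (n - q) * \<rho> ^ k)) \<noteq> top"
    proof (rule ennreal_suminf_neq_top)
      show "0 \<le> 2 powr q * V * R powr (n - q) * \<rho> ^ k" for k
        by (intro mult_nonneg_nonneg zero_le_power V) (simp_all add: \<rho>_def)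
    qed
    then show ?thesis unfolding infinity_ennreal_def by (rule top.not_eq_extremum[THEN iffD1])
  qed
  finally show ?thesis .
qed

lemma integrable_norm_powr_ball:
  fixes q R :: real
  assumes "0 \<le> q" "q < DIM('a)"
  shows "integrable lborel (\<lambda>z::'a::euclidean_space. indicator (ball 0 R) z * norm z powr (- q))"
proof (cases "R > 0")
  case True
  show ?thesis
  proof (rule integrableI_nonneg)
    have "indicator (ball 0 R) \<in> borel_measurable (borel :: 'a measure)" by (intro borel_measurable_indicator) simp
    then show "(\<lambda>z::'a. indicator (ball 0 R) z * norm z powr (- q)) \<in> borel_measurable lborel"
      by (intro borel_measurable_times) simp_all
  qed (use nn_integral_norm_powr_ball_finite[OF assms True] in auto)
qed (simp add: not_less ball_empty)

section \<open>Translation and differentiation of parameter integrals\<close>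

lemma integrable_lborel_translate:
  fixes h :: "'a::euclidean_space \<Rightarrow> real"
  assumes "integrable lborel h"
  shows "integrable lborel (\<lambda>x. h (x - c))" "(LINT x|lborel. h (x - c)) = (LINT x|lborel. h x)"
proof -
  have d: "distr lborel borel (\<lambda>x. x - c) = (lborel :: 'a measure)"
  proof -
    have "(\<lambda>x. x - c) = (+) (- c)" by (auto simp: fun_eq_iff)
    then show ?thesis using lborel_distr_plus[of "- c"] by simp
  qed
  have h: "h \<in> borel_measurable borel" using assms by auto
  show "integrable lborel (\<lambda>x. h (x - c))"
    using assms integrable_distr_eq[of "\<lambda>x. x - c" lborel borel h] h d by simp
  show "(LINT x|lborel. h (x - c)) = (LINT x|lborel. h x)"
    using integral_distr[of "\<lambda>x. x - c" lborel borel h] h d by simp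
qed

text \<open>Dominated convergence for the normalised remainder along sequences tending to
  \<open>x\<close> yields the full derivative and not only partial ones. Differentiability is asked
  at the single point \<open>x\<close> and for almost every \<open>z\<close>, which suits a
  Lipschitz source.\<close>

lemma has_derivative_integral_dominated:
  fixes k :: "'z \<Rightarrow> 'a::euclidean_space \<Rightarrow> real"
  assumes r: "r > 0"
    and int: "\<And>h. norm h < r \<Longrightarrow> integrable M (\<lambda>z. k z (x + h))"
    and der: "AE z in M. (k z has_derivative k' z) (at x)"
    and lip: "AE z in M. \<forall>h. norm h < r \<longrightarrow> \<bar>k z (x + h) - k z x\<bar> \<le> w z * norm h"
    and w: "integrable M w"
    and meas: "\<And>e. (\<lambda>z. k' z e) \<in> borel_measurable M"
  shows "integrable M (\<lambda>z. k' z e)" "((\<lambda>y. LINT z|M. k z y) has_derivative (\<lambda>e. LINT z|M. k' z e)) (at x)"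
proof -
  \<comment> \<open>As a limit of difference quotients the derivative inherits the bound
    \<open>w\<close>; increments and derivative together then give the majorant
    \<open>2 * w\<close>.\<close>
  have bound: "AE z in M. \<forall>e. \<bar>k' z e\<bar> \<le> w z * norm e"
    using der lip
  proof eventually_elim
    case (elim z)
    show ?case
    proof
      fix e
      have "bounded_linear (k' z)" using elim(1) has_derivative_bounded_linear by blast
      have "((\<lambda>t. k z (x + t *\<^sub>R e)) has_derivative (\<lambda>t. k' z (t *\<^sub>R e))) (at (0::real))"
        by (rule has_derivative_compose[where f = "\<lambda>t. x + t *\<^sub>R e" and f' = "\<lambda>t. t *\<^sub>R e"])
          (use elim(1) in \<open>auto intro!: derivative_eq_intros\<close>)
      moreover have "(\<lambda>t. k' z (t *\<^sub>R e)) = (\<lambda>t. k' z e * t)"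
        using linear_scale[OF has_derivative_linear[OF elim(1)]] by (auto simp: mult.commute)
      ultimately have "((\<lambda>t. k z (x + t *\<^sub>R e)) has_real_derivative k' z e) (at 0)"
        by (simp add: has_field_derivative_def)
      then have "((\<lambda>t. (k z (x + t *\<^sub>R e) - k z x) / t) \<longlongrightarrow> k' z e) (at 0)"
        by (simp add: has_field_derivative_iff)
      then have lim: "((\<lambda>t. \<bar>(k z (x + t *\<^sub>R e) - k z x) / t\<bar>) \<longlongrightarrow> \<bar>k' z e\<bar>) (at 0)" by (rule tendsto_rabs)
      have ev: "\<forall>\<^sub>F t in at (0::real). t \<in> ball 0 (r / (norm e + 1))"
        by (rule eventually_at_in_open') (use r in \<open>auto simp: add_nonneg_pos\<close>)
      show "\<bar>k' z e\<bar> \<le> w z * norm e"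
      proof (rule tendsto_upperbound[OF lim])
        show "\<forall>\<^sub>F t in at (0::real). \<bar>(k z (x + t *\<^sub>R e) - k z x) / t\<bar> \<le> w z * norm e"
          using ev eventually_neq_at_within[of 0 0 UNIV]
        proof eventually_elim
          case (elim t)
          then have "\<bar>t\<bar> < r / (norm e + 1)" by simp
          then have "\<bar>t\<bar> * (norm e + 1) < r"
            using pos_less_divide_eq[of "norm e + 1" "\<bar>t\<bar>" r] by (simp add: add_nonneg_pos)
          then have "norm (t *\<^sub>R e) < r" by (simp add: algebra_simps)
          then have "\<bar>k z (x + t *\<^sub>R e) - k z x\<bar> \<le> w z * (\<bar>t\<bar> * norm e)"
            using \<open>\<forall>h. norm h < r \<longrightarrow> \<bar>k z (x + h) - k z x\<bar> \<le> w z * norm h\<close> by (metis norm_scaleR real_norm_def)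
          then show ?case using elim(2) by (simp add: abs_divide divide_le_eq mult.commute mult.left_commute)
        qed
      qed simp
    qed
  qed
  show k'int: "integrable M (\<lambda>z. k' z e)" for e
  proof (rule Bochner_Integration.integrable_bound[where f = "\<lambda>z. w z * norm e"])
    show "AE z in M. norm (k' z e) \<le> norm (w z * norm e)" using bound by eventually_elim (use abs_ge_self order_trans in fastforce)
  qed (use w meas in auto)
  show "((\<lambda>y. LINT z|M. k z y) has_derivative (\<lambda>e. LINT z|M. k' z e)) (at x)"
    unfolding has_derivative_within
  proof
    have "linear (\<lambda>e. LINT z|M. k' z e)"
    proof (rule linearI)
      fix e1 e2
      have "(LINT z|M. k' z (e1 + e2)) = (LINT z|M. k' z e1 + k' z e2)"
        by (intro integral_cong_AE borel_measurable_add meas)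
          (use der in \<open>eventually_elim, use has_derivative_linear linear_add in blast\<close>)
      then show "(LINT z|M. k' z (e1 + e2)) = (LINT z|M. k' z e1) + (LINT z|M. k' z e2)" using k'int by simp
    next
      fix c e
      have "(LINT z|M. k' z (c *\<^sub>R e)) = (LINT z|M. c * k' z e)"
      proof (intro integral_cong_AE borel_measurable_times borel_measurable_const meas)
        show "AE z in M. k' z (c *\<^sub>R e) = c * k' z e"
          using der
        proof eventually_elim
          case (elim z) show ?case using linear_scale[OF has_derivative_linear[OF elim], of c e] by simp
        qed
      qed
      then show "(LINT z|M. k' z (c *\<^sub>R e)) = c *\<^sub>R (LINT z|M. k' z e)" by simp
    qed
    then show "bounded_linear (\<lambda>e. LINT z|M. k' z e)" by (simp add: linear_conv_bounded_linear)
    show "((\<lambda>y. (1 / norm (y - x)) *\<^sub>R ((LINT z|M. k z y) - ((LINT z|M. k z x) + (LINT z|M. k' z (y - x))))) \<longlongrightarrow> 0) (at x)"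
      unfolding tendsto_at_iff_sequentially comp_def
    proof (intro allI impI)
      fix X :: "nat \<Rightarrow> 'a" assume X: "\<forall>i. X i \<in> UNIV - {x}" "X \<longlonglongrightarrow> x"
      have "\<forall>\<^sub>F i in sequentially. dist (X i) x < r" using X(2) r by (rule tendstoD)
      then obtain m where m: "\<And>i. i \<ge> m \<Longrightarrow> norm (X i - x) < r" by (auto simp: eventually_sequentially dist_norm)
      \<comment> \<open>The tail of the sequence, inside the ball where integrability and the
        Lipschitz bound are available.\<close>
      define Y where "Y i = X (i + m)" for i
      have Y: "Y i \<noteq> x" "norm (Y i - x) < r" for i using X m by (auto simp: Y_def)
      have Ylim: "Y \<longlonglongrightarrow> x" using LIMSEQ_ignore_initial_segment[OF X(2)] by (simp add: Y_def[abs_def])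
      define Q where "Q i z = (1 / norm (Y i - x)) * (k z (Y i) - (k z x + k' z (Y i - x)))" for i z
      have intY: "integrable M (\<lambda>z. k z (Y i))" for i using int[OF Y(2)[of i]] by simp
      have intx: "integrable M (\<lambda>z. k z x)" using int[of 0] r by simp
      have Qint: "integrable M (Q i)" for i unfolding Q_def
        by (intro integrable_mult_right Bochner_Integration.integrable_diff Bochner_Integration.integrable_add impI intY intx k'int)
      have QI: "(LINT z|M. Q i z) = (1 / norm (Y i - x)) *\<^sub>R ((LINT z|M. k z (Y i)) - ((LINT z|M. k z x) + (LINT z|M. k' z (Y i - x))))" for i
        unfolding Q_def using intY intx k'int by simp
      have "(\<lambda>i. LINT z|M. Q i z) \<longlonglongrightarrow> (LINT z|M. 0)"
      proof (rule integral_dominated_convergence[where w = "\<lambda>z. 2 * w z"])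
        show "AE z in M. (\<lambda>i. Q i z) \<longlonglongrightarrow> 0"
          using der
        proof eventually_elim
          case (elim z)
          then have "((\<lambda>y. (1 / norm (y - x)) *\<^sub>R (k z y - (k z x + k' z (y - x)))) \<longlongrightarrow> 0) (at x)"
            unfolding has_derivative_within by blast
          then show ?case
            using Ylim Y(1) unfolding tendsto_at_iff_sequentially comp_def Q_def by auto
        qed
        show "AE z in M. norm (Q i z) \<le> 2 * w z" for i
          using lip bound
        proof eventually_elim
          case (elim z)
          have "\<bar>k z (Y i) - k z x\<bar> \<le> w z * norm (Y i - x)" using elim(1)[rule_format, OF Y(2)[of i]] by simp
          moreover have "\<bar>k' z (Y i - x)\<bar> \<le> w z * norm (Y i - x)" using elim(2) by blast
          ultimately have "\<bar>k z (Y i) - (k z x + k' z (Y i - x))\<bar> \<le> 2 * w z * norm (Y i - x)" by linarith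
          then show ?case using Y(1)[of i] unfolding Q_def by (simp add: abs_mult divide_le_eq)
        qed
      qed (use Qint w in auto)
      then have "(\<lambda>i. (1 / norm (X (i + m) - x)) *\<^sub>R ((LINT z|M. k z (X (i + m))) - ((LINT z|M. k z x) + (LINT z|M. k' z (X (i + m) - x))))) \<longlonglongrightarrow> 0"
        unfolding QI Y_def by simp
      then show "(\<lambda>i. (1 / norm (X i - x)) *\<^sub>R ((LINT z|M. k z (X i)) - ((LINT z|M. k z x) + (LINT z|M. k' z (X i - x))))) \<longlonglongrightarrow> 0"
        by (rule LIMSEQ_offset)
    qed
  qed
qed

section \<open>Hoelder estimates for potentials with a singular kernel\<close>

lemma powr_le_distance:
  assumes "0 < \<beta>" "0 < t" "t \<le> 2 * (d::real)" "d \<ge> 0" "\<beta> \<le> 1"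
  shows "t powr (- q) \<le> 2 * (d powr \<beta> * t powr (- q - \<beta>))"
proof -
  have "t powr (- q) = t powr \<beta> * t powr (- q - \<beta>)" using assms by (simp add: powr_add[symmetric])
  also have "t powr \<beta> \<le> (2 * d) powr \<beta>" using assms by (intro powr_mono2) auto
  also have "\<dots> = 2 powr \<beta> * d powr \<beta>" by (simp add: powr_mult)
  also have "2 powr \<beta> \<le> (2::real) powr 1" using assms by (intro powr_mono) auto
  finally show ?thesis by (simp add: mult_right_mono mult_ac)
qed

text \<open>Two regimes. If \<open>\<bar>z\<bar> \<le> 2 \<bar>z - w\<bar>\<close>, the sizes of the
  two values suffice, as a power of the norm may be exchanged for a power of the distance. Otherwise
  the segment from \<open>z\<close> to \<open>w\<close> keeps norm at least
  \<open>\<bar>z\<bar> / 2\<close> and the mean value bound applies, interpolated through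
  \<open>d = d powr \<beta> * d powr (1 - \<beta>)\<close>.\<close>

lemma singular_kernel_holder_aux:
  fixes k :: "'a::real_inner \<Rightarrow> real"
  assumes k: "\<And>z. z \<noteq> 0 \<Longrightarrow> \<bar>k z\<bar> \<le> M * norm z powr (- q)"
    and k': "\<And>z. z \<noteq> 0 \<Longrightarrow> (k has_derivative k' z) (at z)"
    and b: "\<And>z e. z \<noteq> 0 \<Longrightarrow> \<bar>k' z e\<bar> \<le> M * norm z powr (- q - 1) * norm e"
    and \<beta>: "0 < \<beta>" "\<beta> \<le> 1" and q: "q \<ge> 0" and zw: "z \<noteq> 0" "w \<noteq> 0" "norm w \<le> norm z" and M: "M \<ge> 0"
  shows "\<bar>k z - k w\<bar> \<le> (M * 2 powr (q + 3)) * norm (z - w) powr \<beta> * (norm z powr (- q - \<beta>) + norm w powr (- q - \<beta>))"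
proof (cases "norm z \<le> 2 * norm (z - w)")
  case True
  have "\<bar>k z\<bar> + \<bar>k w\<bar> \<le> M * norm z powr (- q) + M * norm w powr (- q)" by (intro add_mono k zw)
  also have "\<dots> \<le> M * (2 * (norm (z - w) powr \<beta> * norm z powr (- q - \<beta>))) + M * (2 * (norm (z - w) powr \<beta> * norm w powr (- q - \<beta>)))"
    using zw True \<beta> M by (intro add_mono mult_left_mono powr_le_distance) auto
  also have "\<dots> = (M * 2) * norm (z - w) powr \<beta> * (norm z powr (- q - \<beta>) + norm w powr (- q - \<beta>))"
    by (simp add: algebra_simps)
  also have "\<dots> \<le> (M * 2 powr (q + 3)) * norm (z - w) powr \<beta> * (norm z powr (- q - \<beta>) + norm w powr (- q - \<beta>))"
  proof (intro mult_right_mono mult_left_mono M)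
    show "2 \<le> (2::real) powr (q + 3)" using powr_mono[of 1 "q + 3" "2::real"] q by simp
  qed auto
  finally show ?thesis by linarith
next
  case False
  define d where "d = norm (z - w)"
  have seg: "norm x \<ge> norm z / 2" if "x \<in> closed_segment z w" for x
  proof -
    have "norm (x - z) \<le> norm (w - z)" using segment_bound[OF that] by auto
    then show ?thesis using False norm_triangle_ineq2[of z x] by (simp add: norm_minus_commute)
  qed
  have seg0: "x \<noteq> 0" if "x \<in> closed_segment z w" for x using seg[OF that] zw(1) by auto
  have on: "onorm (k' x) \<le> M * (norm z / 2) powr (- q - 1)" if "x \<in> closed_segment z w" for x
  proof (rule onorm_bound)
    fix e
    have "\<bar>k' x e\<bar> \<le> M * norm x powr (- q - 1) * norm e" by (rule b[OF seg0[OF that]])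
    also have "\<dots> \<le> M * (norm z / 2) powr (- q - 1) * norm e"
      using seg[OF that] zw q M by (intro mult_right_mono mult_left_mono powr_mono2') auto
    finally show "norm (k' x e) \<le> M * (norm z / 2) powr (- q - 1) * norm e" by simp
  qed (use M in auto)
  have d: "0 \<le> d" "d \<le> norm z" using False norm_ge_zero[of "z - w"] unfolding d_def by linarith+
  have "norm (k z - k w) \<le> (M * (norm z / 2) powr (- q - 1)) * norm (z - w)"
    by (rule differentiable_bound[OF convex_closed_segment[of z w] _ on])
      (auto intro!: has_derivative_at_withinI k' seg0)
  also have "(norm z / 2) powr (- q - 1) = 2 powr (q + 1) * norm z powr (- q - 1)"
  proof -
    have e: "- q - 1 = - (q + 1)" by simp
    show ?thesis unfolding e by (simp only: powr_divide powr_minus_divide) simp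
  qed
  also have "M * (2 powr (q + 1) * norm z powr (- q - 1)) * norm (z - w) = M * 2 powr (q + 1) * (norm z powr (- q - 1) * d)"
    by (simp add: d_def)
  also have "\<dots> \<le> M * 2 powr (q + 1) * (d powr \<beta> * norm z powr (- q - \<beta>))"
  proof (intro mult_left_mono)
    have "d = d powr \<beta> * d powr (1 - \<beta>)" using d \<beta> by (cases "d = 0") (auto simp: powr_add[symmetric])
    also have "\<dots> \<le> d powr \<beta> * norm z powr (1 - \<beta>)" using d \<beta> by (intro mult_left_mono powr_mono2) auto
    finally have "norm z powr (- q - 1) * d \<le> norm z powr (- q - 1) * (d powr \<beta> * norm z powr (1 - \<beta>))"
      by (intro mult_left_mono) auto
    also have "\<dots> = d powr \<beta> * (norm z powr (- q - 1) * norm z powr (1 - \<beta>))" by simp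
    also have "norm z powr (- q - 1) * norm z powr (1 - \<beta>) = norm z powr (- q - \<beta>)" using zw by (simp add: powr_add[symmetric])
    finally show "norm z powr (- q - 1) * d \<le> d powr \<beta> * norm z powr (- q - \<beta>)" .
  qed (use M in auto)
  also have "\<dots> \<le> M * 2 powr (q + 3) * (d powr \<beta> * (norm z powr (- q - \<beta>) + norm w powr (- q - \<beta>)))"
    using M by (intro mult_mono mult_left_mono powr_mono) auto
  finally show ?thesis by (simp add: d_def mult.assoc)
qed

lemma singular_kernel_holder:
  fixes k :: "'a::real_inner \<Rightarrow> real"
  assumes k: "\<And>z. z \<noteq> 0 \<Longrightarrow> \<bar>k z\<bar> \<le> M * norm z powr (- q)"
    and k': "\<And>z. z \<noteq> 0 \<Longrightarrow> (k has_derivative k' z) (at z)"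
    and b: "\<And>z e. z \<noteq> 0 \<Longrightarrow> \<bar>k' z e\<bar> \<le> M * norm z powr (- q - 1) * norm e"
    and \<beta>: "0 < \<beta>" "\<beta> \<le> 1" and q: "q \<ge> 0" and zw: "z \<noteq> 0" "w \<noteq> 0" and M: "M \<ge> 0"
  shows "\<bar>k z - k w\<bar> \<le> (M * 2 powr (q + 3)) * norm (z - w) powr \<beta> * (norm z powr (- q - \<beta>) + norm w powr (- q - \<beta>))"
  using singular_kernel_holder_aux[OF k k' b \<beta> q zw _ M] singular_kernel_holder_aux[OF k k' b \<beta> q zw(2,1) _ M]
  by (cases "norm w \<le> norm z") (simp_all add: norm_minus_commute abs_minus_commute add.commute)

lemma powr_add_eq: "a + b = c \<Longrightarrow> x powr a * x powr b = x powr (c::real)"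
  by (metis powr_add)

lemma integrable_kernel_translate:
  fixes g k :: "'a::euclidean_space \<Rightarrow> real" and q :: real
  assumes k: "k \<in> borel_measurable borel" "k 0 = 0" "\<And>z. z \<noteq> 0 \<Longrightarrow> \<bar>k z\<bar> \<le> M * norm z powr (- q)"
    and q: "0 \<le> q" "q < DIM('a)"
    and g: "g \<in> borel_measurable borel" "\<And>x. \<bar>g x\<bar> \<le> B" "\<And>x. x \<notin> ball x0 R \<Longrightarrow> g x = 0"
  shows "integrable lborel (\<lambda>x. g x * k (x - c))"
proof (rule Bochner_Integration.integrable_bound)
  define R' where "R' = R + dist x0 c"
  show "integrable lborel (\<lambda>x. (B * M) * (indicator (ball 0 R') (x - c) * norm (x - c) powr (- q)))"
    by (intro integrable_mult_right impI integrable_lborel_translate(1)[OF integrable_norm_powr_ball[OF q]])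
  show "(\<lambda>x. g x * k (x - c)) \<in> borel_measurable lborel" using g(1) k(1) by simp
  have "norm (g x * k (x - c)) \<le> norm ((B * M) * (indicator (ball 0 R') (x - c) * norm (x - c) powr (- q)))" for x
  proof (cases "x = c \<or> x \<notin> ball x0 R")
    case True then show ?thesis using k(2) g(3)[of x] by auto
  next
    case False
    then have "dist c x < R'" using dist_triangle[of c x x0] by (auto simp: R'_def dist_commute)
    then have i: "indicator (ball 0 R') (x - c) = (1::real)" by (auto simp: dist_norm norm_minus_commute)
    have "\<bar>g x\<bar> * \<bar>k (x - c)\<bar> \<le> B * (M * norm (x - c) powr (- q))"
      using g(2)[of x] k(3)[of "x - c"] False by (intro mult_mono) (auto intro: order_trans[OF abs_ge_zero])
    then show ?thesis unfolding i by (simp add: abs_mult) (metis abs_ge_self abs_mult order_trans powr_ge_zero abs_of_nonneg mult.assoc)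
  qed
  then show "AE x in lborel. norm (g x * k (x - c)) \<le> norm ((B * M) * (indicator (ball 0 R') (x - c) * norm (x - c) powr (- q)))"
    by (rule AE_I2)
qed

text \<open>The difference of two kernels trades \<beta> additional orders of singularity for the
  factor \<open>\<bar>x1 - x2\<bar> powr \<beta>\<close>, and a kernel of order
  \<open>q + \<beta>\<close> is still integrable. The radius \<open>2 * R\<close> in
  \<open>J\<close> contains all differences of points of \<open>ball x0 R\<close>, which makes the
  constant uniform.\<close>

lemma potential_holder:
  fixes g k :: "'a::euclidean_space \<Rightarrow> real" and q \<beta> :: real
  assumes k: "k \<in> borel_measurable borel" "k 0 = 0" "\<And>z. z \<noteq> 0 \<Longrightarrow> \<bar>k z\<bar> \<le> M * norm z powr (- q)"
    and k': "\<And>z. z \<noteq> 0 \<Longrightarrow> (k has_derivative k' z) (at z)"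
      "\<And>z e. z \<noteq> 0 \<Longrightarrow> \<bar>k' z e\<bar> \<le> M * norm z powr (- q - 1) * norm e" and M: "M \<ge> 0"
    and q: "0 \<le> q" "0 < \<beta>" "\<beta> \<le> 1" "q + \<beta> < DIM('a)"
    and g: "g \<in> borel_measurable borel" "\<And>x. \<bar>g x\<bar> \<le> B" "\<And>x. x \<notin> ball x0 R \<Longrightarrow> g x = 0"
  shows "Ck_holder_on 0 \<beta> (\<lambda>x'. LINT x|lborel. g x * k (x - x')) (ball x0 R)"
proof -
  define F where "F x' = (LINT x|lborel. g x * k (x - x'))" for x'
  define J where "J z = indicator (ball 0 (2 * R)) z * norm z powr (- q - \<beta>)" for z :: 'a
  have Ji: "integrable lborel J"
    using integrable_norm_powr_ball[of "q + \<beta>", where R = "2 * R" and 'a = 'a] q by (simp add: J_def[abs_def])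
  define C where "C = B * (M * 2 powr (q + 3)) * (2 * (LINT z|lborel. J z))"
  have B: "B \<ge> 0" using g(2)[of x0] by simp
  have int: "integrable lborel (\<lambda>x. g x * k (x - c))" for c
    by (rule integrable_kernel_translate[OF k _ _ g]) (use q in auto)
  have hol: "\<bar>F x1 - F x2\<bar> \<le> C * norm (x1 - x2) powr \<beta>" if x12: "x1 \<in> ball x0 R" "x2 \<in> ball x0 R" for x1 x2
  proof -
    define A where "A = B * (M * 2 powr (q + 3)) * norm (x1 - x2) powr \<beta>"
    have "F x1 - F x2 = (LINT x|lborel. g x * k (x - x1) - g x * k (x - x2))" using int by (simp add: F_def)
    also have "\<bar>\<dots>\<bar> \<le> (LINT x|lborel. A * (J (x - x1) + J (x - x2)))"
    proof (rule order_trans[OF integral_abs_bound integral_mono_AE])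
      show "integrable lborel (\<lambda>x. \<bar>g x * k (x - x1) - g x * k (x - x2)\<bar>)"
        by (intro integrable_abs Bochner_Integration.integrable_diff int)
      show "integrable lborel (\<lambda>x. A * (J (x - x1) + J (x - x2)))"
        by (intro integrable_mult_right impI Bochner_Integration.integrable_add integrable_lborel_translate(1) Ji)
      show "AE x in lborel. \<bar>g x * k (x - x1) - g x * k (x - x2)\<bar> \<le> A * (J (x - x1) + J (x - x2))"
        using AE_lborel_singleton[of x1] AE_lborel_singleton[of x2]
      proof eventually_elim
        case (elim x)
        show ?case
        proof (cases "x \<in> ball x0 R")
          case False
          have "0 \<le> A * (J (x - x1) + J (x - x2))" using B M by (auto simp: A_def J_def)
          then show ?thesis using g(3)[OF False] by simp
        next
          case True
          have in2: "c \<in> ball x0 R \<Longrightarrow> indicator (ball 0 (2 * R)) (x - c) = (1::real)" for c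
          proof -
            assume "c \<in> ball x0 R"
            then have "norm (x - c) < 2 * R"
              using True norm_triangle_ineq[of "x - x0" "x0 - c"] by (simp add: dist_norm norm_minus_commute[of x0 x])
            then show ?thesis by (simp add: indicator_def)
          qed
          have "\<bar>g x * k (x - x1) - g x * k (x - x2)\<bar> = \<bar>g x\<bar> * \<bar>k (x - x1) - k (x - x2)\<bar>"
            by (simp add: abs_mult[symmetric] algebra_simps)
          also have "\<dots> \<le> B * ((M * 2 powr (q + 3)) * norm ((x - x1) - (x - x2)) powr \<beta> *
              (norm (x - x1) powr (- q - \<beta>) + norm (x - x2) powr (- q - \<beta>)))"
            by (intro mult_mono g(2) B singular_kernel_holder[OF k(3) k' q(2,3,1) _ _ M]) (use elim in auto)
          also have "norm ((x - x1) - (x - x2)) = norm (x1 - x2)" by (simp add: norm_minus_commute)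
          finally show ?thesis using in2[OF x12(1)] in2[OF x12(2)] by (simp add: A_def J_def algebra_simps)
        qed
      qed
    qed
    also have "\<dots> = A * (2 * (LINT z|lborel. J z))"
      using integrable_lborel_translate[OF Ji] by simp
    also have "\<dots> = C * norm (x1 - x2) powr \<beta>" by (simp add: A_def C_def)
    finally show ?thesis .
  qed
  have "bounded (F ` ball x0 R)"
  proof (cases "R > 0")
    case True
    have "\<bar>F x\<bar> \<le> \<bar>F x0\<bar> + \<bar>C\<bar> * R powr \<beta>" if "x \<in> ball x0 R" for x
    proof -
      have "\<bar>F x - F x0\<bar> \<le> C * norm (x - x0) powr \<beta>" using that True by (intro hol) auto
      also have "\<dots> \<le> \<bar>C\<bar> * R powr \<beta>" using that q by (intro mult_mono powr_mono2) (auto simp: dist_norm norm_minus_commute)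
      finally show ?thesis by linarith
    qed
    then show ?thesis by (auto simp: bounded_iff intro!: exI[of _ "\<bar>F x0\<bar> + \<bar>C\<bar> * R powr \<beta>"])
  qed (simp add: not_less ball_empty)
  then show ?thesis using hol unfolding F_def[abs_def] Ck_holder_on.simps by blast
qed

section \<open>The Riesz kernel and derivatives of its potentials\<close>

lemma riesz_kernel:
  fixes p :: real
  assumes p: "p > 0"
  defines "k0 \<equiv> \<lambda>z::'a::euclidean_space. norm z powr (- p)"
    and "k0' \<equiv> \<lambda>z e::'a. - p * (z \<bullet> e) * norm z powr (- p - 2)"
  shows "k0 \<in> borel_measurable borel" "k0 0 = 0" "\<bar>k0 z\<bar> \<le> (p + 3) * norm z powr (- p)"
    "z \<noteq> 0 \<Longrightarrow> (k0 has_derivative k0' z) (at z)"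
    "\<bar>k0' z e\<bar> \<le> p * norm z powr (- p - 1) * norm e"
proof -
  show "k0 \<in> borel_measurable borel" "k0 0 = 0" by (auto simp: k0_def)
  have "1 * norm z powr (- p) \<le> (p + 3) * norm z powr (- p)" using p by (intro mult_right_mono) auto
  then show "\<bar>k0 z\<bar> \<le> (p + 3) * norm z powr (- p)" by (simp add: k0_def)
  show "(k0 has_derivative k0' z) (at z)" if "z \<noteq> 0"
  proof -
    have e: "norm z powr (- p - 1) * (1 / norm z) = norm z powr (- p - 2)"
    proof -
      have "norm z powr (- p - 2) * norm z powr 1 = norm z powr (- p - 1)" by (rule powr_add_eq) simp
      then show ?thesis using that by (simp add: field_simps)
    qed
    have "((\<lambda>z. norm z powr (- p)) has_derivative (\<lambda>e. - p * norm z powr (- p - 1) * (e \<bullet> sgn z))) (at z)"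
    proof (rule has_derivative_compose[OF has_derivative_norm[OF that]])
      have "((\<lambda>t. t powr (- p)) has_real_derivative (- p * norm z powr (- p - 1))) (at (norm z))"
        using has_real_derivative_powr[of "norm z" "- p"] that by simp
      then show "((\<lambda>t. t powr (- p)) has_derivative (\<lambda>h. - p * norm z powr (- p - 1) * h)) (at (norm z))"
        unfolding has_field_derivative_def .
    qed
    moreover have "(\<lambda>e. - p * norm z powr (- p - 1) * (e \<bullet> sgn z)) = k0' z"
      unfolding k0'_def e[symmetric] by (simp add: sgn_div_norm fun_eq_iff inner_commute divide_inverse)
    ultimately show ?thesis by (simp add: k0_def)
  qed
  show "\<bar>k0' z e\<bar> \<le> p * norm z powr (- p - 1) * norm e"
  proof (cases "z = 0")
    case False
    have "\<bar>k0' z e\<bar> = p * norm z powr (- p - 2) * \<bar>z \<bullet> e\<bar>" using p by (simp add: k0'_def abs_mult)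
    also have "\<dots> \<le> p * norm z powr (- p - 2) * (norm z * norm e)" using p by (intro mult_left_mono Cauchy_Schwarz_ineq2) auto
    also have "\<dots> = p * (norm z powr (- p - 2) * norm z powr 1) * norm e" by simp
    also have "norm z powr (- p - 2) * norm z powr 1 = norm z powr (- p - 1)" by (rule powr_add_eq) simp
    finally show ?thesis .
  qed (simp add: k0'_def)
qed

text \<open>The gradient kernel has order \<open>p + 1\<close>. The constant \<open>p + 3\<close> is
  1 from the linear factor plus \<open>p + 2\<close> from the power; it bounds value and derivative
  at once, as \<open>potential_holder\<close> works with a single \<open>M\<close>.\<close>

lemma riesz_kernel':
  fixes p :: real and d :: "'a::euclidean_space"
  assumes p: "p > 0"
  defines "k1 \<equiv> \<lambda>z::'a. (z \<bullet> d) * norm z powr (- p - 2)"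
    and "k1' \<equiv> \<lambda>z e::'a. (e \<bullet> d) * norm z powr (- p - 2) + (z \<bullet> d) * (- (p + 2) * (z \<bullet> e) * norm z powr (- (p + 2) - 2))"
  shows "k1 \<in> borel_measurable borel" "k1 0 = 0" "\<bar>k1 z\<bar> \<le> ((p + 3) * norm d) * norm z powr (- (p + 1))"
    "z \<noteq> 0 \<Longrightarrow> (k1 has_derivative k1' z) (at z)"
    "\<bar>k1' z e\<bar> \<le> ((p + 3) * norm d) * norm z powr (- (p + 1) - 1) * norm e"
proof -
  show "k1 \<in> borel_measurable borel" "k1 0 = 0" by (auto simp: k1_def)
  have n1: "norm z * norm z powr (- p - 2) = norm z powr (- (p + 1))"
  proof -
    have "norm z powr 1 * norm z powr (- p - 2) = norm z powr (- (p + 1))" by (rule powr_add_eq) simp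
    then show ?thesis by simp
  qed
  have zd: "\<bar>z \<bullet> d\<bar> \<le> norm z * norm d" by (rule Cauchy_Schwarz_ineq2)
  have "\<bar>k1 z\<bar> \<le> (norm z * norm d) * norm z powr (- p - 2)"
    unfolding k1_def abs_mult using zd by (simp add: mult_right_mono)
  also have "\<dots> = norm d * norm z powr (- (p + 1))" using n1 by (metis mult.assoc mult.commute)
  also have "\<dots> \<le> ((p + 3) * norm d) * norm z powr (- (p + 1))"
    using p mult_right_mono[of 1 "p + 3" "norm d"] by (intro mult_right_mono) auto
  finally show "\<bar>k1 z\<bar> \<le> ((p + 3) * norm d) * norm z powr (- (p + 1))" .
  show "(k1 has_derivative k1' z) (at z)" if "z \<noteq> 0"
  proof -
    have "((\<lambda>z. norm z powr (- (p + 2))) has_derivative (\<lambda>e. - (p + 2) * (z \<bullet> e) * norm z powr (- (p + 2) - 2))) (at z)"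
      by (rule riesz_kernel(4)[of "p + 2"]) (use p that in auto)
    then have d: "((\<lambda>z. norm z powr (- p - 2)) has_derivative (\<lambda>e. - (p + 2) * (z \<bullet> e) * norm z powr (- (p + 2) - 2))) (at z)" by simp
    have "((\<lambda>z. (z \<bullet> d) * norm z powr (- p - 2)) has_derivative (\<lambda>e. (z \<bullet> d) * (- (p + 2) * (z \<bullet> e) * norm z powr (- (p + 2) - 2)) + (e \<bullet> d) * norm z powr (- p - 2))) (at z)"
      by (rule has_derivative_mult[OF bounded_linear_imp_has_derivative[OF bounded_linear_inner_left] d])
    then show ?thesis by (simp add: k1_def k1'_def add.commute)
  qed
  show "\<bar>k1' z e\<bar> \<le> ((p + 3) * norm d) * norm z powr (- (p + 1) - 1) * norm e"
  proof -
    have e2: "- (p + 1) - 1 = - p - 2" by simp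
    have "\<bar>- (p + 2) * (z \<bullet> e) * norm z powr (- (p + 2) - 2)\<bar> \<le> (p + 2) * norm z powr (- (p + 2) - 1) * norm e"
      by (rule riesz_kernel(5)[of "p + 2"]) (use p in auto)
    then have "\<bar>(z \<bullet> d) * (- (p + 2) * (z \<bullet> e) * norm z powr (- (p + 2) - 2))\<bar> \<le> (norm z * norm d) * ((p + 2) * norm z powr (- (p + 2) - 1) * norm e)"
      unfolding abs_mult[of "z \<bullet> d"] by (intro mult_mono zd) auto
    also have "\<dots> = (p + 2) * norm d * (norm z powr 1 * norm z powr (- (p + 2) - 1)) * norm e" by simp
    also have "norm z powr 1 * norm z powr (- (p + 2) - 1) = norm z powr (- p - 2)" by (rule powr_add_eq) simp
    finally have 2: "\<bar>(z \<bullet> d) * (- (p + 2) * (z \<bullet> e) * norm z powr (- (p + 2) - 2))\<bar> \<le> (p + 2) * norm d * norm z powr (- p - 2) * norm e" .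
    have "\<bar>(e \<bullet> d) * norm z powr (- p - 2)\<bar> \<le> (norm e * norm d) * norm z powr (- p - 2)"
      unfolding abs_mult using Cauchy_Schwarz_ineq2[of e d] by (simp add: mult_right_mono)
    with 2 have "\<bar>k1' z e\<bar> \<le> (norm e * norm d) * norm z powr (- p - 2) + (p + 2) * norm d * norm z powr (- p - 2) * norm e"
      unfolding k1'_def by (intro order_trans[OF abs_triangle_ineq add_mono])
    then show ?thesis unfolding e2 by (simp add: algebra_simps)
  qed
qed

text \<open>After the substitution \<open>z = x - x'\<close> the parameter sits in \<open>f\<close>,
  so the Lipschitz source is differentiated while the kernel is merely integrated; this works for
  all \<open>p\<close> below the dimension. \<open>g e\<close> is a Borel version of the derivative
  of \<open>f\<close> in direction \<open>e\<close>.\<close>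

lemma riesz_potential_derivative_Lipschitz:
  fixes f :: "'a::euclidean_space \<Rightarrow> real" and p L :: real
  assumes p: "0 < p" "p < DIM('a)"
    and L: "\<And>x y. \<bar>f x - f y\<bar> \<le> L * norm (x - y)"
    and supp: "\<And>x. x \<notin> cball x0 R1 \<Longrightarrow> f x = 0" "0 < R1" "R1 < R"
    and N: "negligible N" "\<And>x. x \<notin> N \<Longrightarrow> f differentiable (at x)"
  obtains g where "\<And>e. g e \<in> borel_measurable borel" "\<And>e x. \<bar>g e x\<bar> \<le> L * norm e"
    "\<And>e x. x \<notin> ball x0 R \<Longrightarrow> g e x = 0"
    "\<And>x'. ((\<lambda>x'. LINT x|lborel. f x * norm (x - x') powr (- p)) has_derivative
       (\<lambda>e. LINT x|lborel. g e x * norm (x - x') powr (- p))) (at x')"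
proof -
  define Q where "Q e m x = real (Suc m) * (f (x + (1 / real (Suc m)) *\<^sub>R e) - f x)" for e m x
  have L0: "L \<ge> 0"
  proof -
    obtain b :: 'a where "b \<in> Basis" using nonempty_Basis by blast
    then show ?thesis using L[of b 0] by (simp add: order_trans[OF abs_ge_zero])
  qed
  have cf: "continuous_on UNIV f"
  proof (rule continuous_onI)
    fix x e assume "e > (0::real)"
    then show "\<exists>d>0. \<forall>y\<in>UNIV. dist y x < d \<longrightarrow> dist (f y) (f x) \<le> e"
    proof (intro exI[of _ "e / (L + 1)"] conjI ballI impI)
      fix y assume "dist y x < e / (L + 1)"
      then have "L * norm (y - x) \<le> L * (e / (L + 1))" using L0 by (intro mult_left_mono) (auto simp: dist_norm)
      also have "\<dots> \<le> e" using L0 \<open>e > 0\<close> by (simp add: field_simps)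
      finally show "dist (f y) (f x) \<le> e" using L[of y x] by (simp add: dist_real_def)
    qed (use L0 in auto)
  qed
  then have fm: "f \<in> borel_measurable borel" by (rule borel_measurable_continuous_onI)
  have Qm: "Q e m \<in> borel_measurable borel" for e m
    unfolding Q_def using fm by (intro borel_measurable_times borel_measurable_diff) (auto intro: measurable_compose[OF _ fm])
  \<comment> \<open>Clipping makes the bound hold at every point, also where the quotients do not
    converge and \<open>lim\<close> is an unspecified value. Where they do converge it changes
    nothing, since the quotients obey the same bound.\<close>
  define g where "g e x = max (- (L * norm e)) (min (L * norm e) (lim (\<lambda>m. Q e m x)))" for e x
  have gm: "g e \<in> borel_measurable borel" for e
    unfolding g_def by (intro borel_measurable_max borel_measurable_min borel_measurable_const borel_measurable_lim_metric Qm)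
  have gb: "\<bar>g e x\<bar> \<le> L * norm e" for e x
  proof -
    have "\<bar>max (- c) (min c t)\<bar> \<le> c" if "c \<ge> 0" for c t :: real using that by auto
    then show ?thesis using L0 by (simp add: g_def)
  qed
  have Qb: "\<bar>Q e m x\<bar> \<le> L * norm e" for e m x
  proof -
    have "\<bar>f (x + (1 / real (Suc m)) *\<^sub>R e) - f x\<bar> \<le> L * norm ((1 / real (Suc m)) *\<^sub>R e)"
      using L[of "x + (1 / real (Suc m)) *\<^sub>R e" x] by simp
    then have "real (Suc m) * \<bar>f (x + (1 / real (Suc m)) *\<^sub>R e) - f x\<bar> \<le> real (Suc m) * (L * norm ((1 / real (Suc m)) *\<^sub>R e))"
      by (intro mult_left_mono) auto
    also have "\<dots> = L * norm e" by simp
    finally show ?thesis by (simp add: Q_def abs_mult)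
  qed
  have g_lim: "g e x = l" if "(\<lambda>m. Q e m x) \<longlonglongrightarrow> l" for e x l
  proof -
    have "\<bar>l\<bar> \<le> L * norm e" using tendsto_rabs[OF that] Qb by (intro tendsto_upperbound[of "\<lambda>m. \<bar>Q e m x\<bar>"]) auto
    then show ?thesis using limI[OF that] by (auto simp: g_def)
  qed
  have g_der: "g e x = D e" if D: "(f has_derivative D) (at x)" for e x D
  proof (rule g_lim)
    have "((\<lambda>t. f (x + t *\<^sub>R e)) has_derivative (\<lambda>t. D (t *\<^sub>R e))) (at (0::real))"
      by (rule has_derivative_compose[where f = "\<lambda>t. x + t *\<^sub>R e" and f' = "\<lambda>t. t *\<^sub>R e"])
        (use D in \<open>auto intro!: derivative_eq_intros\<close>)
    moreover have "(\<lambda>t. D (t *\<^sub>R e)) = (\<lambda>t. D e * t)"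
      using linear_scale[OF has_derivative_linear[OF D]] by (auto simp: mult.commute)
    ultimately have "((\<lambda>t. f (x + t *\<^sub>R e)) has_real_derivative D e) (at 0)" by (simp add: has_field_derivative_def)
    then have "((\<lambda>t. (f (x + t *\<^sub>R e) - f x) / t) \<longlongrightarrow> D e) (at 0)" by (simp add: has_field_derivative_iff)
    then have "(\<lambda>m. (f (x + (1 / real (Suc m)) *\<^sub>R e) - f x) / (1 / real (Suc m))) \<longlonglongrightarrow> D e"
      unfolding tendsto_at_iff_sequentially comp_def
      by (elim allE[of _ "\<lambda>m. 1 / real (Suc m)"]) (use LIMSEQ_inverse_real_of_nat in \<open>simp add: inverse_eq_divide\<close>)
    then show "(\<lambda>m. Q e m x) \<longlonglongrightarrow> D e" by (simp add: Q_def[abs_def] mult.commute)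
  qed
  have gout: "g e x = 0" if "x \<notin> ball x0 R" for e x
  proof -
    have "((\<lambda>x. 0) has_derivative (\<lambda>h. 0)) (at x)" by simp
    then have "(f has_derivative (\<lambda>h. 0)) (at x)"
      by (rule has_derivative_transform_within_open[where s = "- cball x0 R1"])
        (use that supp in \<open>auto simp: open_Compl\<close>)
    then show ?thesis by (rule g_der)
  qed
  define k0 where "k0 z = norm z powr (- p)" for z :: 'a
  have k0m: "k0 \<in> borel_measurable borel" by (simp add: k0_def[abs_def])
  obtain Bf where Bf: "\<And>x. \<bar>f x\<bar> \<le> Bf"
    using continuous_compact_support_bounded[OF cf compact_cball[of x0 R1] supp(1)] by auto
  have intf: "integrable lborel (\<lambda>x. f x * k0 (x - c))" for c
    unfolding k0_def
    by (rule integrable_kernel_translate[where M = 1 and q = p and B = Bf and R = R and ?x0.0 = x0]) (use p fm Bf supp in auto)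
  have tr: "(LINT x|lborel. F x * k0 (x - c)) = (LINT z|lborel. F (c + z) * k0 z)"
    "integrable lborel (\<lambda>z. F (c + z) * k0 z)" if "integrable lborel (\<lambda>x. F x * k0 (x - c))" for F c
    using integrable_lborel_translate[OF that, of "- c"] by (simp_all add: add.commute)
  have intg: "integrable lborel (\<lambda>x. g e x * k0 (x - c))" for e c
    unfolding k0_def
    by (rule integrable_kernel_translate[where M = 1 and q = p and B = "L * norm e" and R = R and ?x0.0 = x0]) (use p gm gb gout in auto)
  have der: "((\<lambda>x'. LINT x|lborel. f x * k0 (x - x')) has_derivative (\<lambda>e. LINT x|lborel. g e x * k0 (x - x'))) (at x')" for x'
    unfolding tr(1)[OF intf] tr(1)[OF intg]
  \<comment> \<open>For \<open>\<bar>h\<bar> < 1\<close> and \<open>z\<close> beyond radius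
    \<open>R + dist x0 x' + 1\<close> both arguments of \<open>f\<close> lie outside its
    support.\<close>
  proof (rule has_derivative_integral_dominated(2)[where r = 1 and w = "\<lambda>z. L * (indicator (ball 0 (R + dist x0 x' + 1)) z * norm z powr (- p))"])
    show "integrable lborel (\<lambda>z. f (x' + h + z) * k0 z)" for h using tr(2)[OF intf] by simp
    have "AE x in lborel. x \<notin> N"
    proof -
      have "AE x in lebesgue. x \<notin> N" using N(1) AE_not_in negligible_iff_null_sets by blast
      then show ?thesis by (simp add: AE_completion_iff)
    qed
    \<comment> \<open>Translation invariance of Lebesgue measure carries the exceptional set
      \<open>N\<close> to the shifted variable.\<close>
    then have "AE z in lborel. x' + z \<notin> N"
    proof -
      assume a: "AE x in lborel. x \<notin> N"
      have "AE x in distr lborel borel ((+) x'). x \<notin> N" unfolding lborel_distr_plus by (rule a)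
      then show ?thesis by (rule AE_distrD[rotated]) simp
    qed
    then show "AE z in lborel. ((\<lambda>y. f (y + z) * k0 z) has_derivative (\<lambda>e. g e (x' + z) * k0 z)) (at x')"
    proof eventually_elim
      case (elim z)
      then obtain D where D: "(f has_derivative D) (at (x' + z))" using N(2) by (auto simp: differentiable_def)
      have "((\<lambda>y. f (y + z)) has_derivative (\<lambda>e. D e)) (at x')"
        by (rule has_derivative_compose[where f = "\<lambda>y. y + z" and f' = "\<lambda>e. e"]) (use D in \<open>auto intro!: derivative_eq_intros\<close>)
      then have "((\<lambda>y. f (y + z) * k0 z) has_derivative (\<lambda>e. D e * k0 z)) (at x')" by (rule has_derivative_mult_left)
      then show ?case using g_der[OF D] by simp
    qed
    show "AE z in lborel. \<forall>h. norm h < 1 \<longrightarrow> \<bar>f (x' + h + z) * k0 z - f (x' + z) * k0 z\<bar> \<le>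
        L * (indicator (ball 0 (R + dist x0 x' + 1)) z * norm z powr (- p)) * norm h"
    proof (intro AE_I2 allI impI)
      fix z h :: 'a assume h: "norm h < 1"
      show "\<bar>f (x' + h + z) * k0 z - f (x' + z) * k0 z\<bar> \<le>
        L * (indicator (ball 0 (R + dist x0 x' + 1)) z * norm z powr (- p)) * norm h"
      proof (cases "norm z < R + dist x0 x' + 1")
        case True
        have "\<bar>f (x' + h + z) * k0 z - f (x' + z) * k0 z\<bar> = \<bar>f (x' + h + z) - f (x' + z)\<bar> * k0 z"
          by (simp add: left_diff_distrib[symmetric] abs_mult k0_def)
        also have "\<dots> \<le> (L * norm h) * k0 z" using L[of "x' + h + z" "x' + z"] by (intro mult_right_mono) (auto simp: k0_def)
        finally show ?thesis using True by (simp add: k0_def mult_ac)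
      next
        case False
        have "norm z \<le> norm (x' + h + z - x0) + norm (x' - x0) + norm h"
          using norm_triangle_ineq4[of "x' + h + z - x0" "x' - x0 + h"] norm_triangle_ineq[of "x' - x0" h] by simp
        moreover have "norm z \<le> norm (x' + z - x0) + norm (x' - x0)"
          using norm_triangle_ineq4[of "x' + z - x0" "x' - x0"] by simp
        ultimately have "x' + h + z \<notin> cball x0 R1" "x' + z \<notin> cball x0 R1"
          using False h supp(3) by (auto simp: dist_norm norm_minus_commute[of x0])
        then have "f (x' + h + z) = 0" "f (x' + z) = 0" using supp(1) by blast+
        then show ?thesis using L0 by simp
      qed
    qed
    show "integrable lborel (\<lambda>z::'a. L * (indicator (ball 0 (R + dist x0 x' + 1)) z * norm z powr (- p)))"
      by (intro integrable_mult_right impI integrable_norm_powr_ball) (use p in auto)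
    show "(\<lambda>z. g e (x' + z) * k0 z) \<in> borel_measurable lborel" for e using tr(2)[OF intg] by auto
  qed simp
  show ?thesis
    by (rule that[of g]) (use gm gb gout der in \<open>auto simp: k0_def\<close>)
qed

lemma Lipschitz_by_derivative_bound:
  fixes f :: "'a::real_normed_vector \<Rightarrow> real"
  assumes "convex S" "\<And>x. x \<in> S \<Longrightarrow> (f has_derivative f' x) (at x)" "\<And>x e. x \<in> S \<Longrightarrow> \<bar>f' x e\<bar> \<le> B * norm e"
    "B \<ge> 0" "x \<in> S" "y \<in> S"
  shows "\<bar>f x - f y\<bar> \<le> B * norm (x - y)"
proof -
  have "onorm (f' x) \<le> B" if "x \<in> S" for x
    by (rule onorm_bound) (use that assms(3,4) in auto)
  then have "norm (f x - f y) \<le> B * norm (x - y)"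
    by (intro differentiable_bound[OF assms(1) has_derivative_at_withinI[OF assms(2)] _ assms(5,6)]) auto
  then show ?thesis by simp
qed

text \<open>The factor \<open>p / 2\<close> undoes the normalisation of \<open>kern\<close>, so that
  outside radius \<epsilon> the function is exactly \<open>\<bar>z\<bar> powr (- p)\<close>. The
  third bound is global and depends on \<epsilon>: the gradient vanishes for
  \<open>\<bar>z\<bar> < \<epsilon> / 2\<close>, and beyond that the singular bound is at most its
  value at \<open>\<epsilon> / 2\<close>.\<close>

lemma kernS_norm_derivative:
  fixes z :: "'a::euclidean_space"
  assumes p: "p > 0" and \<epsilon>: "\<epsilon> > 0"
  shows "((\<lambda>z. p / 2 * kernS p \<epsilon> ((norm z)\<^sup>2)) has_derivative (\<lambda>e. p * kernS' p \<epsilon> ((norm z)\<^sup>2) * (z \<bullet> e))) (at z)"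
    "\<bar>p * kernS' p \<epsilon> ((norm z)\<^sup>2) * (z \<bullet> e)\<bar> \<le> p * norm z powr (- (p + 1)) * norm e"
    "\<bar>p * kernS' p \<epsilon> ((norm z)\<^sup>2) * (z \<bullet> e)\<bar> \<le> (p * (\<epsilon> / 2) powr (- (p + 1))) * norm e"
    "norm z \<ge> \<epsilon> \<Longrightarrow> p / 2 * kernS p \<epsilon> ((norm z)\<^sup>2) = norm z powr (- p)"
    "norm z \<ge> \<epsilon> \<Longrightarrow> kernS' p \<epsilon> ((norm z)\<^sup>2) = - (norm z powr (- p - 2))"
proof -
  have sq: "((norm z)\<^sup>2) powr r = norm z powr (2 * r)" for r
    using powr_powr[of "norm z" 2 r] by simp
  have "((\<lambda>z. (norm z)\<^sup>2) has_derivative (\<lambda>e. 2 * (z \<bullet> e))) (at z)"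
    unfolding power2_norm_eq_inner by (auto intro!: derivative_eq_intros simp: inner_commute)
  from has_derivative_compose[OF this DERIV_kernS[OF p \<epsilon>, unfolded has_field_derivative_def]]
  have "((\<lambda>z. p / 2 * kernS p \<epsilon> ((norm z)\<^sup>2)) has_derivative (\<lambda>e. p / 2 * (kernS' p \<epsilon> ((norm z)\<^sup>2) * (2 * (z \<bullet> e))))) (at z)"
    by (rule has_derivative_mult_right)
  then show "((\<lambda>z. p / 2 * kernS p \<epsilon> ((norm z)\<^sup>2)) has_derivative (\<lambda>e. p * kernS' p \<epsilon> ((norm z)\<^sup>2) * (z \<bullet> e))) (at z)"
    by (simp add: mult_ac)
  have 2: "\<bar>p * kernS' p \<epsilon> ((norm z)\<^sup>2) * (z \<bullet> e)\<bar> \<le> p * norm z powr (- (p + 1)) * norm e" if "z \<noteq> 0"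
  proof -
    have "\<bar>kernS' p \<epsilon> ((norm z)\<^sup>2)\<bar> \<le> norm z powr (- p - 2)"
      using kernS'_abs_le[OF p \<epsilon>, of "(norm z)\<^sup>2"] that sq[of "- (p / 2) - 1"] by simp
    then have "\<bar>p * kernS' p \<epsilon> ((norm z)\<^sup>2) * (z \<bullet> e)\<bar> \<le> (p * norm z powr (- p - 2)) * (norm z * norm e)"
      unfolding abs_mult using p by (intro mult_mono Cauchy_Schwarz_ineq2) auto
    also have "\<dots> = p * (norm z powr (- p - 2) * norm z powr 1) * norm e" by simp
    also have "norm z powr (- p - 2) * norm z powr 1 = norm z powr (- (p + 1))" by (rule powr_add_eq) simp
    finally show ?thesis .
  qed
  then show "\<bar>p * kernS' p \<epsilon> ((norm z)\<^sup>2) * (z \<bullet> e)\<bar> \<le> p * norm z powr (- (p + 1)) * norm e"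
    by (cases "z = 0") auto
  show "\<bar>p * kernS' p \<epsilon> ((norm z)\<^sup>2) * (z \<bullet> e)\<bar> \<le> (p * (\<epsilon> / 2) powr (- (p + 1))) * norm e"
  proof (cases "norm z \<ge> \<epsilon> / 2")
    case True
    then have "z \<noteq> 0" using \<epsilon> by auto
    have "norm z powr (- (p + 1)) \<le> (\<epsilon> / 2) powr (- (p + 1))" using True p \<epsilon> by (intro powr_mono2') auto
    then have "p * norm z powr (- (p + 1)) * norm e \<le> (p * (\<epsilon> / 2) powr (- (p + 1))) * norm e"
      using p by (intro mult_right_mono mult_left_mono) auto
    then show ?thesis using 2[OF \<open>z \<noteq> 0\<close>] by linarith
  next
    case False
    then have "(norm z)\<^sup>2 \<le> (\<epsilon> / 2)\<^sup>2" using \<epsilon> by (intro power_mono) auto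
    then have "(norm z)\<^sup>2 \<le> \<epsilon>\<^sup>2 / 4" by (simp add: power_divide)
    then have "2 * (norm z)\<^sup>2 \<le> \<epsilon>\<^sup>2" using zero_le_power2[of "norm z"] by linarith
    then have "2 * ((norm z)\<^sup>2 / \<epsilon>\<^sup>2) - 1 \<le> 0" using \<epsilon> by (simp add: field_simps)
    then have "kernS' p \<epsilon> ((norm z)\<^sup>2) = 0" by (simp add: kernS'_def kern'_def smooth_step_0)
    then show ?thesis using p by simp
  qed
  assume "norm z \<ge> \<epsilon>"
  then have e: "(norm z)\<^sup>2 \<ge> \<epsilon>\<^sup>2" using \<epsilon> by (intro power_mono) auto
  show "p / 2 * kernS p \<epsilon> ((norm z)\<^sup>2) = norm z powr (- p)"
    using kernS_eq[OF p \<epsilon> e] p sq[of "- (p / 2)"] by simp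
  show "kernS' p \<epsilon> ((norm z)\<^sup>2) = - (norm z powr (- p - 2))"
    using kernS'_eq[OF p \<epsilon> e] sq[of "- (p / 2) - 1"] by simp
qed

lemma continuous_kernS:
  assumes "p > 0" "\<epsilon> > 0" shows "continuous_on UNIV (kernS p \<epsilon>)" "continuous_on UNIV (kernS' p \<epsilon>)"
  using Ck_on_imp_continuous_on[OF Ck_on_kernS[OF assms, of 0]] Ck_on_imp_continuous_on[OF Ck_on_kernS'[OF assms, of 0]] by auto

text \<open>The singular kernel is replaced by \<^const>\<open>kernS\<close>, whose gradient differs from the singular one
  only on a shrinking ball; the gradients of the potentials therefore converge uniformly.\<close>

lemma riesz_potential_derivative:
  fixes g :: "'a::euclidean_space \<Rightarrow> real" and p :: real
  assumes p: "0 < p" "p + 1 < DIM('a)"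
    and g: "g \<in> borel_measurable borel" "\<And>x. \<bar>g x\<bar> \<le> B" "\<And>x. x \<notin> ball x0 R \<Longrightarrow> g x = 0"
    and x': "x' \<in> ball x0 R"
  shows "((\<lambda>x'. LINT x|lborel. g x * norm (x - x') powr (- p)) has_derivative
       (\<lambda>e. p * (LINT x|lborel. g x * (((x - x') \<bullet> e) * norm (x - x') powr (- p - 2))))) (at x')"
proof -
  define F where "F y = (LINT x|lborel. g x * norm (x - y) powr (- p))" for y
  define F' where "F' y e = p * (LINT x|lborel. g x * (((x - y) \<bullet> e) * norm (x - y) powr (- p - 2)))" for y e
  define \<epsilon> where "\<epsilon> m = 1 / real (Suc m)" for m
  have \<epsilon>: "\<epsilon> m > 0" for m by (simp add: \<epsilon>_def)
  have \<epsilon>0: "\<epsilon> \<longlonglongrightarrow> 0" unfolding \<epsilon>_def[abs_def] using LIMSEQ_inverse_real_of_nat by (simp add: inverse_eq_divide)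
  define K where "K m z = p / 2 * kernS p (\<epsilon> m) ((norm z)\<^sup>2)" for m and z :: 'a
  define K' where "K' m z e = p * kernS' p (\<epsilon> m) ((norm z)\<^sup>2) * (z \<bullet> e)" for m and z e :: 'a
  have kd: "(K m has_derivative K' m z) (at z)" "\<bar>K' m z e\<bar> \<le> p * norm z powr (- (p + 1)) * norm e"
    "\<bar>K' m z e\<bar> \<le> (p * (\<epsilon> m / 2) powr (- (p + 1))) * norm e" "norm z \<ge> \<epsilon> m \<Longrightarrow> K m z = norm z powr (- p)" for m z e
    unfolding K_def[abs_def] K'_def[abs_def] using kernS_norm_derivative[OF p(1) \<epsilon>[of m]] by blast+
  have Km: "K m \<in> borel_measurable borel" for m
    unfolding K_def by (intro borel_measurable_continuous_onI continuous_intros continuous_on_compose2[OF continuous_kernS(1)[OF p(1) \<epsilon>]]) auto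
  have K'm: "(\<lambda>z. K' m z e) \<in> borel_measurable borel" for m e
    unfolding K'_def by (intro borel_measurable_continuous_onI continuous_intros continuous_on_compose2[OF continuous_kernS(2)[OF p(1) \<epsilon>]]) auto
  have KmT: "(\<lambda>x. K m (x - y)) \<in> borel_measurable borel" for m y by (rule measurable_compose[OF _ Km]) simp
  have K'mT: "(\<lambda>x. K' m (x - y) e) \<in> borel_measurable borel" for m y e
    by (rule measurable_compose[where g = "\<lambda>z. K' m z e", OF _ K'm]) simp
  obtain C where C: "C > 0" "\<And>\<epsilon> t. \<epsilon> > 0 \<Longrightarrow> t > 0 \<Longrightarrow> kernS p \<epsilon> t \<le> C * t powr (- (p / 2))"
    using kernS_le[OF p(1)] by blast
  have B: "B \<ge> 0" using g(2)[of x0] by simp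
  have Kb: "\<bar>K m z\<bar> \<le> (p * C) * norm z powr (- p)" if "z \<noteq> 0" for m z
  proof -
    have "(norm z)\<^sup>2 powr (- (p / 2)) = norm z powr (- p)" using powr_powr[of "norm z" 2 "- (p / 2)"] by simp
    then have "kernS p (\<epsilon> m) ((norm z)\<^sup>2) \<le> C * norm z powr (- p)" using C(2)[OF \<epsilon>[of m], of "(norm z)\<^sup>2"] that by simp
    then have "p / 2 * kernS p (\<epsilon> m) ((norm z)\<^sup>2) \<le> p * (C * norm z powr (- p))"
      using p kernS_nonneg[OF p(1) \<epsilon>[of m]] by (intro mult_mono) auto
    then show ?thesis using p kernS_nonneg[OF p(1) \<epsilon>[of m]] by (simp add: K_def)
  qed
  have lipK: "\<bar>K m z - K m w\<bar> \<le> (p * (\<epsilon> m / 2) powr (- (p + 1))) * norm (z - w)" for m z w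
    by (rule Lipschitz_by_derivative_bound[where S = UNIV and f' = "K' m"]) (use kd(1,3) p in auto)
  have intg: "integrable lborel g"
  proof (rule Bochner_Integration.integrable_bound[where f = "\<lambda>x. B * indicator (ball x0 R) x"])
    show "integrable lborel (\<lambda>x. B * indicator (ball x0 R) x)"
      by (intro integrable_mult_right impI integrable_real_indicator) (use emeasure_bounded_finite[OF bounded_ball, of x0 R] in auto)
    have "norm (g x) \<le> norm (B * indicator (ball x0 R) x)" for x
      using g(2)[of x] g(3)[of x] B by (cases "x \<in> ball x0 R") auto
    then show "AE x in lborel. norm (g x) \<le> norm (B * indicator (ball x0 R) x)" by (rule AE_I2)
  qed (use g in simp)
  have intK: "integrable lborel (\<lambda>x. g x * K m (x - y))" for m y
  proof -
    have b: "\<bar>K m (x - y)\<bar> \<le> \<bar>K m 0\<bar> + (p * (\<epsilon> m / 2) powr (- (p + 1))) * (norm (x0 - y) + R)" if "x \<in> ball x0 R" for x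
    proof -
      have "norm (x - y) \<le> norm (x0 - y) + R"
        using that norm_triangle_ineq[of "x - x0" "x0 - y"] by (simp add: dist_norm norm_minus_commute[of x0 x])
      then have "(p * (\<epsilon> m / 2) powr (- (p + 1))) * norm (x - y) \<le> (p * (\<epsilon> m / 2) powr (- (p + 1))) * (norm (x0 - y) + R)"
        using p by (intro mult_left_mono) auto
      then show ?thesis using lipK[of m "x - y" 0] by simp
    qed
    define M where "M = \<bar>K m 0\<bar> + (p * (\<epsilon> m / 2) powr (- (p + 1))) * (norm (x0 - y) + R)"
    show ?thesis
    proof (rule Bochner_Integration.integrable_bound[where f = "\<lambda>x. g x * M"])
      have "norm (g x * K m (x - y)) \<le> norm (g x * M)" for x
      proof (cases "x \<in> ball x0 R")
        case True
        then have "\<bar>K m (x - y)\<bar> \<le> \<bar>M\<bar>" using b[OF True] by (simp add: M_def)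
        then show ?thesis by (simp add: abs_mult mult_left_mono)
      qed (simp add: g(3))
      then show "AE x in lborel. norm (g x * K m (x - y)) \<le> norm (g x * M)" by (rule AE_I2)
      show "(\<lambda>x. g x * K m (x - y)) \<in> borel_measurable lborel" using borel_measurable_times[OF g(1) KmT] by simp
    qed (use intg in simp)
  qed
  define Fm where "Fm m y = (LINT x|lborel. g x * K m (x - y))" for m y
  define Fm' where "Fm' m y e = (LINT x|lborel. g x * (- K' m (x - y) e))" for m y e
  have derFm: "(Fm m has_derivative Fm' m y) (at y)" and intK': "integrable lborel (\<lambda>x. g x * (- K' m (x - y) e))" for m y e
  proof -
    have A: "AE x in lborel. ((\<lambda>y. g x * K m (x - y)) has_derivative (\<lambda>e. g x * (- K' m (x - y) e))) (at y)"
    proof (rule AE_I2)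
      fix x
      have "((\<lambda>y. K m (x - y)) has_derivative (\<lambda>e. K' m (x - y) (- e))) (at y)"
        by (rule has_derivative_compose[where f = "\<lambda>y. x - y" and f' = "\<lambda>e. - e"]) (auto intro!: derivative_eq_intros kd(1))
      then have "((\<lambda>y. K m (x - y)) has_derivative (\<lambda>e. - K' m (x - y) e)) (at y)" by (simp add: K'_def)
      then show "((\<lambda>y. g x * K m (x - y)) has_derivative (\<lambda>e. g x * (- K' m (x - y) e))) (at y)" by (rule has_derivative_mult_right)
    qed
    have L: "AE x in lborel. \<forall>h. norm h < 1 \<longrightarrow> \<bar>g x * K m (x - (y + h)) - g x * K m (x - y)\<bar> \<le> (\<bar>g x\<bar> * (p * (\<epsilon> m / 2) powr (- (p + 1)))) * norm h"
    proof (intro AE_I2 allI impI)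
      fix x h :: 'a
      have "\<bar>g x * K m (x - (y + h)) - g x * K m (x - y)\<bar> = \<bar>g x\<bar> * \<bar>K m (x - (y + h)) - K m (x - y)\<bar>"
        by (simp add: abs_mult[symmetric] right_diff_distrib)
      also have "\<dots> \<le> \<bar>g x\<bar> * ((p * (\<epsilon> m / 2) powr (- (p + 1))) * norm h)"
        using lipK[of m "x - (y + h)" "x - y"] by (intro mult_left_mono) auto
      finally show "\<bar>g x * K m (x - (y + h)) - g x * K m (x - y)\<bar> \<le> (\<bar>g x\<bar> * (p * (\<epsilon> m / 2) powr (- (p + 1)))) * norm h" by simp
    qed
    have W: "integrable lborel (\<lambda>x. \<bar>g x\<bar> * (p * (\<epsilon> m / 2) powr (- (p + 1))))" using intg by (intro integrable_mult_left impI integrable_abs)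
    have Me: "(\<lambda>x. g x * (- K' m (x - y) e)) \<in> borel_measurable lborel" for e
      using borel_measurable_times[OF g(1) borel_measurable_uminus[OF K'mT]] by simp
    show "(Fm m has_derivative Fm' m y) (at y)" unfolding Fm_def[abs_def] Fm'_def[abs_def]
      by (rule has_derivative_integral_dominated(2)[OF zero_less_one intK A L W Me])
    show "integrable lborel (\<lambda>x. g x * (- K' m (x - y) e))"
      by (rule has_derivative_integral_dominated(1)[OF zero_less_one intK A L W Me])
  qed
  have intF': "integrable lborel (\<lambda>x. g x * (((x - y) \<bullet> e) * norm (x - y) powr (- p - 2)))" for y e
    by (rule integrable_kernel_translate[OF riesz_kernel'(1-3)[OF p(1)] _ _ g]) (use p in auto)
  define J where "J m = (LINT z|lborel. indicator (ball 0 (\<epsilon> m)) z * norm (z::'a) powr (- (p + 1)))" for m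
  have Ji: "integrable lborel (\<lambda>z. indicator (ball 0 r) z * norm (z::'a) powr (- (p + 1)))" for r
    by (rule integrable_norm_powr_ball) (use p in auto)
  have J0: "J \<longlonglongrightarrow> 0"
  proof -
    have "J \<longlonglongrightarrow> (LINT z|(lborel :: 'a measure). (0::real))" unfolding J_def[abs_def]
    proof (rule integral_dominated_convergence[where w = "\<lambda>z. indicator (ball 0 1) z * norm (z::'a) powr (- (p + 1))"])
      show "AE z in lborel. (\<lambda>m. indicator (ball 0 (\<epsilon> m)) z * norm (z::'a) powr (- (p + 1))) \<longlonglongrightarrow> 0"
      proof (rule AE_I2)
        fix z :: 'a
        show "(\<lambda>m. indicator (ball 0 (\<epsilon> m)) z * norm z powr (- (p + 1))) \<longlonglongrightarrow> 0"
        proof (cases "z = 0")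
          case False
          then have "\<forall>\<^sub>F m in sequentially. \<epsilon> m < norm z" using order_tendstoD(2)[OF \<epsilon>0, of "norm z"] by simp
          then show ?thesis by (intro tendsto_eventually) (erule eventually_mono, auto simp: indicator_def)
        qed simp
      qed
      have "\<epsilon> m \<le> 1" for m by (simp add: \<epsilon>_def)
      then show "AE z in lborel. norm (indicator (ball 0 (\<epsilon> m)) z * norm (z::'a) powr (- (p + 1))) \<le> indicator (ball 0 1) z * norm z powr (- (p + 1))" for m
        by (intro AE_I2) (auto simp: indicator_def intro: less_le_trans)
    qed (use Ji in auto)
    then show ?thesis by simp
  qed
  \<comment> \<open>Outside the ball of radius \<open>\<epsilon> m\<close> the two gradients agree;
    inside, each is at most \<open>p\<close> times the kernel of order \<open>p + 1\<close>. Hence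
    the factor \<open>2 * p\<close>, and an error that does not depend on \<open>y\<close>.\<close>
  have diffb: "\<bar>Fm' m y e - F' y e\<bar> \<le> (B * (2 * p) * J m) * norm e" for m y e
  proof -
    have "Fm' m y e - F' y e = (LINT x|lborel. g x * (- K' m (x - y) e) - p * (g x * (((x - y) \<bullet> e) * norm (x - y) powr (- p - 2))))"
      unfolding Fm'_def F'_def using intK' intF' by simp
    also have "\<bar>\<dots>\<bar> \<le> (LINT x|lborel. (B * (2 * p) * norm e) * (indicator (ball 0 (\<epsilon> m)) (x - y) * norm (x - y) powr (- (p + 1))))"
    proof (rule order_trans[OF integral_abs_bound integral_mono_AE])
      show "integrable lborel (\<lambda>x. \<bar>g x * (- K' m (x - y) e) - p * (g x * (((x - y) \<bullet> e) * norm (x - y) powr (- p - 2)))\<bar>)"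
        by (intro integrable_abs Bochner_Integration.integrable_diff intK' integrable_mult_right impI intF')
      show "integrable lborel (\<lambda>x. (B * (2 * p) * norm e) * (indicator (ball 0 (\<epsilon> m)) (x - y) * norm (x - y) powr (- (p + 1))))"
        by (intro integrable_mult_right impI integrable_lborel_translate(1)[OF Ji])
      show "AE x in lborel. \<bar>g x * (- K' m (x - y) e) - p * (g x * (((x - y) \<bullet> e) * norm (x - y) powr (- p - 2)))\<bar> \<le>
          (B * (2 * p) * norm e) * (indicator (ball 0 (\<epsilon> m)) (x - y) * norm (x - y) powr (- (p + 1)))"
      proof (rule AE_I2)
        fix x
        define z where "z = x - y"
        have eq: "g x * (- K' m z e) - p * (g x * ((z \<bullet> e) * norm z powr (- p - 2))) = g x * (- K' m z e - p * (z \<bullet> e) * norm z powr (- p - 2))"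
          by (simp add: algebra_simps)
        show "\<bar>g x * (- K' m (x - y) e) - p * (g x * (((x - y) \<bullet> e) * norm (x - y) powr (- p - 2)))\<bar> \<le>
          (B * (2 * p) * norm e) * (indicator (ball 0 (\<epsilon> m)) (x - y) * norm (x - y) powr (- (p + 1)))"
          unfolding z_def[symmetric] eq
        proof (cases "norm z \<ge> \<epsilon> m")
          case True
          then show "\<bar>g x * (- K' m z e - p * (z \<bullet> e) * norm z powr (- p - 2))\<bar> \<le>
            (B * (2 * p) * norm e) * (indicator (ball 0 (\<epsilon> m)) z * norm z powr (- (p + 1)))"
            using kernS_norm_derivative(5)[OF p(1) \<epsilon> True] by (simp add: K'_def indicator_def)
        next
          case False
          have "\<bar>- K' m z e - p * (z \<bullet> e) * norm z powr (- p - 2)\<bar> \<le> \<bar>K' m z e\<bar> + \<bar>- p * (z \<bullet> e) * norm z powr (- p - 2)\<bar>" by simp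
          also have "\<dots> \<le> p * norm z powr (- (p + 1)) * norm e + p * norm z powr (- p - 1) * norm e"
            by (intro add_mono kd(2) riesz_kernel(5) p)
          also have "- p - 1 = - (p + 1)" by simp
          finally have "\<bar>- K' m z e - p * (z \<bullet> e) * norm z powr (- p - 2)\<bar> \<le> 2 * p * norm z powr (- (p + 1)) * norm e" by (simp add: mult_ac)
          then have "\<bar>g x\<bar> * \<bar>- K' m z e - p * (z \<bullet> e) * norm z powr (- p - 2)\<bar> \<le> B * (2 * p * norm z powr (- (p + 1)) * norm e)"
            using g(2) B by (intro mult_mono) auto
          then show "\<bar>g x * (- K' m z e - p * (z \<bullet> e) * norm z powr (- p - 2))\<bar> \<le>
            (B * (2 * p) * norm e) * (indicator (ball 0 (\<epsilon> m)) z * norm z powr (- (p + 1)))"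
            using False by (simp add: abs_mult[of "g x"] mult_ac)
        qed
      qed
    qed
    also have "\<dots> = (B * (2 * p) * J m) * norm e"
      using integrable_lborel_translate(2)[OF Ji, of "\<epsilon> m" y] by (simp add: J_def)
    finally show ?thesis .
  qed
  have limF: "(\<lambda>m. Fm m y) \<longlonglongrightarrow> F y" for y
    unfolding Fm_def F_def
  proof (rule integral_dominated_convergence[where w = "\<lambda>x. \<bar>g x * ((p * C) * norm (x - y) powr (- p))\<bar>"])
    have i: "integrable lborel (\<lambda>x. g x * norm (x - y) powr (- p))"
      by (rule integrable_kernel_translate[OF riesz_kernel(1-3)[OF p(1)] _ _ g]) (use p in auto)
    then show "(\<lambda>x. g x * norm (x - y) powr (- p)) \<in> borel_measurable lborel" by auto
    have "integrable lborel (\<lambda>x. (p * C) * (g x * norm (x - y) powr (- p)))" using i by simp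
    then show "integrable lborel (\<lambda>x. \<bar>g x * ((p * C) * norm (x - y) powr (- p))\<bar>)"
      by (intro integrable_abs) (simp add: mult_ac)
    show "(\<lambda>x. g x * K m (x - y)) \<in> borel_measurable lborel" for m using intK by auto
    show "AE x in lborel. (\<lambda>m. g x * K m (x - y)) \<longlonglongrightarrow> g x * norm (x - y) powr (- p)"
      using AE_lborel_singleton[of y]
    proof eventually_elim
      case (elim x)
      then have "\<forall>\<^sub>F m in sequentially. \<epsilon> m < norm (x - y)" using order_tendstoD(2)[OF \<epsilon>0, of "norm (x - y)"] by simp
      then have "\<forall>\<^sub>F m in sequentially. g x * K m (x - y) = g x * norm (x - y) powr (- p)"
        by (rule eventually_mono) (use kd(4) in auto)
      then show ?case by (rule tendsto_eventually)
    qed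
    show "AE x in lborel. norm (g x * K m (x - y)) \<le> \<bar>g x * ((p * C) * norm (x - y) powr (- p))\<bar>" for m
      using AE_lborel_singleton[of y]
    proof eventually_elim
      case (elim x)
      have "\<bar>K m (x - y)\<bar> \<le> \<bar>(p * C) * norm (x - y) powr (- p)\<bar>" using Kb[of "x - y" m] elim by simp
      then show ?case unfolding real_norm_def abs_mult[of "g x"] by (rule mult_left_mono) simp
    qed
  qed
  have "\<exists>G. \<forall>y\<in>ball x0 R. (\<lambda>m. Fm m y) \<longlonglongrightarrow> G y \<and> (G has_derivative F' y) (at y within ball x0 R)"
  proof (rule has_derivative_sequence[OF convex_ball _ _ x' limF])
    show "(Fm m has_derivative Fm' m y) (at y within ball x0 R)" for m y using derFm has_derivative_at_withinI by blast
    fix e :: real assume e: "e > 0"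
    have "(\<lambda>m. B * (2 * p) * J m) \<longlonglongrightarrow> B * (2 * p) * 0" by (intro tendsto_intros J0)
    then have "\<forall>\<^sub>F m in sequentially. B * (2 * p) * J m < e" using e by (intro order_tendstoD(2)) auto
    then show "\<forall>\<^sub>F m in sequentially. \<forall>y\<in>ball x0 R. \<forall>h. norm (Fm' m y h - F' y h) \<le> e * norm h"
    proof eventually_elim
      case (elim m)
      have "norm (Fm' m y h - F' y h) \<le> e * norm h" for y h
        using diffb[of m y h] mult_right_mono[of "B * (2 * p) * J m" e "norm h"] elim by simp
      then show ?case by blast
    qed
  qed
  then obtain G where G: "\<And>y. y \<in> ball x0 R \<Longrightarrow> (\<lambda>m. Fm m y) \<longlonglongrightarrow> G y" "(G has_derivative F' x') (at x' within ball x0 R)"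
    using x' by blast
  have "G y = F y" if "y \<in> ball x0 R" for y using LIMSEQ_unique[OF G(1)[OF that] limF] .
  moreover have "(G has_derivative F' x') (at x')" using G(2) x' by (simp add: at_within_open[OF x' open_ball])
  ultimately have "(F has_derivative F' x') (at x')"
    by (intro has_derivative_transform_within_open[of G _ x' UNIV "ball x0 R" F]) (use x' in auto)
  then show ?thesis by (simp add: F_def[abs_def] F'_def[abs_def])
qed

text \<open>The first derivative falls on the source; the second has to fall on the kernel, since
  \<open>g e\<close> is merely bounded, and this needs \<open>p + 1\<close> below the dimension.
  Either way a potential with bounded density results, and \<open>potential_holder\<close> applies
  with order \<open>p\<close> or \<open>p + 1\<close>.\<close>

lemma Ck_holder_on_riesz_potential:
  fixes f :: "'a::euclidean_space \<Rightarrow> real" and p L \<alpha> :: real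
  assumes p: "0 < p" "p < DIM('a)"
    and L: "\<And>x y. \<bar>f x - f y\<bar> \<le> L * norm (x - y)"
    and supp: "\<And>x. x \<notin> cball x0 R1 \<Longrightarrow> f x = 0" "0 < R1" "R1 < R"
    and N: "negligible N" "\<And>x. x \<notin> N \<Longrightarrow> f differentiable (at x)"
    and \<alpha>: "0 < \<alpha>" "\<alpha> \<le> 1"
  defines "W \<equiv> \<lambda>x'. LINT x|lborel. f x * norm (x - x') powr (- p)"
  shows "p + \<alpha> < DIM('a) \<Longrightarrow> Ck_holder_on 1 \<alpha> W (ball x0 R)"
    "p + 1 + \<alpha> < DIM('a) \<Longrightarrow> Ck_holder_on 2 \<alpha> W (ball x0 R)"
proof -
  obtain g where g: "\<And>e. g e \<in> borel_measurable borel" "\<And>e x. \<bar>g e x\<bar> \<le> L * norm e"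
    "\<And>e x. x \<notin> ball x0 R \<Longrightarrow> g e x = 0"
    and "\<And>x'. ((\<lambda>x'. LINT x|lborel. f x * norm (x - x') powr (- p)) has_derivative
       (\<lambda>e. LINT x|lborel. g e x * norm (x - x') powr (- p))) (at x')"
    by (rule riesz_potential_derivative_Lipschitz[where ?x0.0 = x0, OF p L supp N]) (assumption | (rule that; assumption))+
  then have W': "\<And>x'. (W has_derivative (\<lambda>e. LINT x|lborel. g e x * norm (x - x') powr (- p))) (at x')"
    by (simp add: W_def)
  have bdW: "bounded (W ` ball x0 R)"
  proof -
    have "continuous_on (cball x0 R) W"
      by (rule continuous_at_imp_continuous_on) (use has_derivative_continuous[OF W'] in simp)
    then have "bounded (W ` cball x0 R)" by (intro compact_imp_bounded compact_continuous_image) auto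
    then show ?thesis by (rule bounded_subset) auto
  qed
  have k5: "\<bar>- p * (z \<bullet> e) * norm z powr (- p - 2)\<bar> \<le> (p + 3) * norm z powr (- p - 1) * norm e" for z e :: 'a
  proof -
    have "p * norm z powr (- p - 1) * norm e \<le> (p + 3) * norm z powr (- p - 1) * norm e" by (intro mult_right_mono) auto
    then show ?thesis using riesz_kernel(5)[OF p(1), of z e] by linarith
  qed
  have one: "Ck_holder_on 0 \<alpha> (\<lambda>x'. LINT x|lborel. g e x * norm (x - x') powr (- p)) (ball x0 R)"
    if "p + \<alpha> < DIM('a)" for e
    by (rule potential_holder[where k = "\<lambda>z. norm z powr (- p)" and q = p and M = "p + 3" and g = "g e" and B = "L * norm e",
        OF riesz_kernel(1,2,3,4)[OF p(1)] _ _ _ \<alpha> that g])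
      (use p k5 in auto)
  show "Ck_holder_on 1 \<alpha> W (ball x0 R)" if "p + \<alpha> < DIM('a)"
    unfolding One_nat_def by (rule Ck_holder_on_SucI[OF open_ball bdW W' one[OF that]])
  show "Ck_holder_on 2 \<alpha> W (ball x0 R)" if p2: "p + 1 + \<alpha> < DIM('a)"
    unfolding numeral_2_eq_2
  proof (rule Ck_holder_on_SucI[OF open_ball bdW W'])
    fix e
    have p1: "p + 1 < DIM('a)" using p2 \<alpha> by linarith
    have bd: "bounded ((\<lambda>x'. LINT x|lborel. g e x * norm (x - x') powr (- p)) ` ball x0 R)"
      using one[of e] p2 by simp
    have two: "Ck_holder_on 0 \<alpha> (\<lambda>x'. LINT x|lborel. g e x * (((x - x') \<bullet> d) * norm (x - x') powr (- p - 2))) (ball x0 R)" for d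
      by (rule potential_holder[where k = "\<lambda>z. (z \<bullet> d) * norm z powr (- p - 2)" and q = "p + 1" and M = "(p + 3) * norm d" and g = "g e" and B = "L * norm e",
          OF riesz_kernel'(1-5)[OF p(1)] _ _ \<alpha> p2 g]) (use p in auto)
    have c: "Ck_holder_on 0 \<alpha> (\<lambda>x'. p) (ball x0 R)" by (rule Ck_holder_on_const)
    show "Ck_holder_on (Suc 0) \<alpha> (\<lambda>x'. LINT x|lborel. g e x * norm (x - x') powr (- p)) (ball x0 R)"
      by (rule Ck_holder_on_SucI[OF open_ball bd riesz_potential_derivative[OF p(1) p1 g]])
        (auto simp del: Ck_holder_on.simps intro!: Ck_holder_on_mult[OF open_ball convex_ball \<alpha> c two])
  qed
qed

text \<open>Sources at distance at least \<delta> allow arbitrarily many derivatives of the kernel.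
  One derivative raises the exponent by 2 and brings the factor
  \<open>fst z \<bullet> e - y \<bullet> e\<close>; the first summand is absorbed into the density,
  the second is linear in \<open>y\<close> and leaves the integral, so the class is closed under the
  induction. The bound \<open>R\<close> keeps the new density integrable.\<close>

lemma Ck_on_regular_potential:
  fixes w :: "'a::euclidean_space \<times> real \<Rightarrow> real"
  assumes \<delta>: "\<delta> > 0" and q: "q > 0"
    and w: "integrable lebesgue w"
    and far: "\<And>z y. w z \<noteq> 0 \<Longrightarrow> y \<in> ball x0 r \<Longrightarrow> \<delta> \<le> norm (z - (y, 0))"
    and bd: "\<And>z. w z \<noteq> 0 \<Longrightarrow> norm (fst z) \<le> R"
  shows "Ck_on k (\<lambda>y. LINT z|lebesgue. w z * norm (z - (y, 0)) powr (- q)) (ball x0 r)"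
  using q w far bd
proof (induction k arbitrary: w q)
  have key: "integrable lebesgue (\<lambda>z. w z * (q * (fst z \<bullet> e - y \<bullet> e) * norm (z - (y, 0)) powr (- (q + 2))))"
    "((\<lambda>y. LINT z|lebesgue. w z * norm (z - (y, 0)) powr (- q)) has_derivative
      (\<lambda>e. LINT z|lebesgue. w z * (q * (fst z \<bullet> e - y \<bullet> e) * norm (z - (y, 0)) powr (- (q + 2))))) (at y)"
    if q: "q > 0" and w: "integrable lebesgue w" and far: "\<And>z y. w z \<noteq> 0 \<Longrightarrow> y \<in> ball x0 r \<Longrightarrow> \<delta> \<le> norm (z - (y, 0))"
      and y: "y \<in> ball x0 r" for q and w :: "'a \<times> real \<Rightarrow> real" and y e
  proof -
    obtain \<rho> where \<rho>: "\<rho> > 0" "ball y \<rho> \<subseteq> ball x0 r" using y open_contains_ball open_ball by metis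
    have in_ball: "y + h \<in> ball x0 r" if "norm h < \<rho>" for h
      by (rule subsetD[OF \<rho>(2)]) (use that in \<open>simp add: dist_norm\<close>)
    have nm: "(\<lambda>z::'a \<times> real. norm (z - c) powr s) \<in> borel_measurable lebesgue" for c s
      by (intro measurable_completion) simp
    have int: "integrable lebesgue (\<lambda>z. w z * norm (z - (y, 0)) powr (- s))" if "s > 0" "y \<in> ball x0 r" for y s
    proof (rule Bochner_Integration.integrable_bound[where f = "\<lambda>z. w z * \<delta> powr (- s)"])
      show "(\<lambda>z. w z * norm (z - (y, 0)) powr (- s)) \<in> borel_measurable lebesgue"
        using borel_measurable_integrable[OF w] nm by (rule borel_measurable_times)
      have "norm (w z * norm (z - (y, 0)) powr (- s)) \<le> norm (w z * \<delta> powr (- s))" for z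
      proof (cases "w z = 0")
        case False
        have "norm (z - (y, 0)) powr (- s) \<le> \<delta> powr (- s)" using far[OF False that(2)] \<delta> that(1) by (intro powr_mono2') auto
        then show ?thesis by (simp add: abs_mult mult_left_mono)
      qed simp
      then show "AE z in lebesgue. norm (w z * norm (z - (y, 0)) powr (- s)) \<le> norm (w z * \<delta> powr (- s))" by (rule AE_I2)
    qed (use w in simp)
    have der: "((\<lambda>y. norm (z - (y, 0)) powr (- q)) has_derivative (\<lambda>e. q * (fst z \<bullet> e - y \<bullet> e) * norm (z - (y, 0)) powr (- (q + 2)))) (at y)"
      if "z \<noteq> (y, 0)" for z :: "'a \<times> real" and y
    proof -
      have d1: "((\<lambda>y. z - (y, 0)) has_derivative (\<lambda>e. - (e, 0))) (at y)" by (auto intro!: derivative_eq_intros)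
      have d2: "((\<lambda>z. norm z powr (- q)) has_derivative (\<lambda>e. - q * ((z - (y, 0)) \<bullet> e) * norm (z - (y, 0)) powr (- q - 2))) (at (z - (y, 0)))"
        by (rule riesz_kernel(4)[OF q]) (use that in auto)
      have eq: "(\<lambda>e. q * (fst z \<bullet> e - y \<bullet> e) * norm (z - (y, 0)) powr (- (q + 2))) =
          (\<lambda>e. - q * ((z - (y, 0)) \<bullet> (- (e, 0))) * norm (z - (y, 0)) powr (- q - 2))"
      proof
        fix e
        have A: "- (q + 2) = - q - 2" by simp
        have B: "(z - (y, 0)) \<bullet> (- (e, 0)) = - (fst z \<bullet> e - y \<bullet> e)" by (simp add: inner_prod_def inner_diff_left)
        show "q * (fst z \<bullet> e - y \<bullet> e) * norm (z - (y, 0)) powr (- (q + 2)) =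
          - q * ((z - (y, 0)) \<bullet> (- (e, 0))) * norm (z - (y, 0)) powr (- q - 2)"
          unfolding A B by (simp only: mult_minus_left mult_minus_right minus_minus)
      qed
      show ?thesis unfolding eq by (rule has_derivative_compose[OF d1 d2])
    qed
    have bound: "\<bar>q * (fst z \<bullet> e - y \<bullet> e) * norm (z - (y, 0)) powr (- (q + 2))\<bar> \<le> (q * \<delta> powr (- q - 1)) * norm e"
      if "\<delta> \<le> norm (z - (y, 0))" for z :: "'a \<times> real" and y e :: 'a
    proof -
      have "\<bar>- q * ((z - (y, 0)) \<bullet> (e, 0)) * norm (z - (y, 0)) powr (- q - 2)\<bar> \<le> q * norm (z - (y, 0)) powr (- q - 1) * norm (e, 0::real)"
        by (rule riesz_kernel(5)[OF q])
      also have "\<dots> \<le> q * \<delta> powr (- q - 1) * norm e"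
        using q \<delta> that by (intro mult_mono powr_mono2') (auto simp: norm_Pair)
      finally have *: "\<bar>- q * ((z - (y, 0)) \<bullet> (e, 0)) * norm (z - (y, 0)) powr (- q - 2)\<bar> \<le> q * \<delta> powr (- q - 1) * norm e" .
      have e1: "(z - (y, 0)) \<bullet> (e, 0) = fst z \<bullet> e - y \<bullet> e" by (simp add: inner_prod_def inner_diff_left)
      have e2: "- (q + 2) = - q - 2" by simp
      show ?thesis using * unfolding e1 e2 by (simp add: abs_mult)
    qed
    have I: "integrable lebesgue (\<lambda>z. w z * norm (z - (y + h, 0)) powr (- q))" if "norm h < \<rho>" for h
      by (rule int[OF q in_ball[OF that]])
    have A: "AE z in lebesgue. ((\<lambda>y. w z * norm (z - (y, 0)) powr (- q)) has_derivative (\<lambda>e. w z * (q * (fst z \<bullet> e - y \<bullet> e) * norm (z - (y, 0)) powr (- (q + 2))))) (at y)"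
    proof (rule AE_I2)
      fix z show "((\<lambda>y. w z * norm (z - (y, 0)) powr (- q)) has_derivative (\<lambda>e. w z * (q * (fst z \<bullet> e - y \<bullet> e) * norm (z - (y, 0)) powr (- (q + 2))))) (at y)"
      proof (cases "w z = 0")
        case False
        then have "z \<noteq> (y, 0)" using far[OF False y] \<delta> by auto
        then show ?thesis by (intro has_derivative_mult_right der)
      qed simp
    qed
    have L: "AE z in lebesgue. \<forall>h. norm h < \<rho> \<longrightarrow> \<bar>w z * norm (z - (y + h, 0)) powr (- q) - w z * norm (z - (y, 0)) powr (- q)\<bar> \<le> (\<bar>w z\<bar> * (q * \<delta> powr (- q - 1))) * norm h"
    proof (intro AE_I2 allI impI)
      fix z :: "'a \<times> real" and h :: 'a assume h: "norm h < \<rho>"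
      show "\<bar>w z * norm (z - (y + h, 0)) powr (- q) - w z * norm (z - (y, 0)) powr (- q)\<bar> \<le> (\<bar>w z\<bar> * (q * \<delta> powr (- q - 1))) * norm h"
      proof (cases "w z = 0")
        case False
        have ne: "z \<noteq> (y', 0)" if "y' \<in> ball x0 r" for y' using far[OF False that] \<delta> by auto
        have "\<bar>norm (z - (y + h, 0)) powr (- q) - norm (z - (y, 0)) powr (- q)\<bar> \<le> (q * \<delta> powr (- q - 1)) * norm ((y + h) - y)"
          by (rule Lipschitz_by_derivative_bound[OF convex_ball der bound _ in_ball[OF h] y])
            (use ne far[OF False] q in auto)
        then have "\<bar>w z\<bar> * \<bar>norm (z - (y + h, 0)) powr (- q) - norm (z - (y, 0)) powr (- q)\<bar> \<le> \<bar>w z\<bar> * ((q * \<delta> powr (- q - 1)) * norm h)"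
          by (intro mult_left_mono) auto
        then show ?thesis by (simp add: abs_mult[symmetric] right_diff_distrib mult.assoc)
      qed simp
    qed
    have W: "integrable lebesgue (\<lambda>z. \<bar>w z\<bar> * (q * \<delta> powr (- q - 1)))" using w by (intro integrable_mult_left impI integrable_abs)
    have fm: "(\<lambda>z::'a \<times> real. q * (fst z \<bullet> e - y \<bullet> e) * norm (z - (y, 0)) powr (- (q + 2))) \<in> borel_measurable lebesgue" for e
    proof (rule borel_measurable_times[OF _ nm])
      show "(\<lambda>z::'a \<times> real. q * (fst z \<bullet> e - y \<bullet> e)) \<in> borel_measurable lebesgue"
        by (intro borel_measurable_lebesgue_continuous continuous_intros)
    qed
    have Me: "(\<lambda>z. w z * (q * (fst z \<bullet> e - y \<bullet> e) * norm (z - (y, 0)) powr (- (q + 2)))) \<in> borel_measurable lebesgue" for e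
      by (rule borel_measurable_times[OF borel_measurable_integrable[OF w] fm])
    show "integrable lebesgue (\<lambda>z. w z * (q * (fst z \<bullet> e - y \<bullet> e) * norm (z - (y, 0)) powr (- (q + 2))))"
      by (rule has_derivative_integral_dominated(1)[OF \<rho>(1) I A L W Me])
    show "((\<lambda>y. LINT z|lebesgue. w z * norm (z - (y, 0)) powr (- q)) has_derivative
      (\<lambda>e. LINT z|lebesgue. w z * (q * (fst z \<bullet> e - y \<bullet> e) * norm (z - (y, 0)) powr (- (q + 2))))) (at y)"
      by (rule has_derivative_integral_dominated(2)[OF \<rho>(1) I A L W Me])
  qed
  {
    case 0
    show ?case
      by (auto intro!: continuous_at_imp_continuous_on has_derivative_continuous[OF key(2)[OF 0(1,2,3)]])
  next
    case (Suc k)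
    have we: "integrable lebesgue (\<lambda>z. w z * (fst z \<bullet> e))" for e
    proof (rule Bochner_Integration.integrable_bound[where f = "\<lambda>z. w z * (R * norm e)"])
      show "(\<lambda>z. w z * (fst z \<bullet> e)) \<in> borel_measurable lebesgue"
        by (rule borel_measurable_times[OF borel_measurable_integrable[OF Suc.prems(2)]])
          (intro borel_measurable_lebesgue_continuous continuous_intros)
      have "norm (w z * (fst z \<bullet> e)) \<le> norm (w z * (R * norm e))" for z
      proof (cases "w z = 0")
        case False
        have "\<bar>fst z \<bullet> e\<bar> \<le> R * norm e"
          using Cauchy_Schwarz_ineq2[of "fst z" e] mult_right_mono[OF Suc.prems(4)[OF False] norm_ge_zero[of e]] by linarith
        then have "\<bar>fst z \<bullet> e\<bar> \<le> \<bar>R * norm e\<bar>" by linarith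
        then show ?thesis unfolding real_norm_def abs_mult[of "w z"] by (rule mult_left_mono) simp
      qed simp
      then show "AE z in lebesgue. norm (w z * (fst z \<bullet> e)) \<le> norm (w z * (R * norm e))" by (rule AE_I2)
    qed (use Suc.prems in simp)
    define F where "F w y = (LINT z|lebesgue. w z * norm (z - (y, 0)) powr (- (q + 2)))" for w :: "'a \<times> real \<Rightarrow> real" and y
    have q2: "q + 2 > 0" using Suc.prems by simp
    have F1: "Ck_on k (F w) (ball x0 r)" unfolding F_def by (rule Suc.IH[OF q2 Suc.prems(2,3,4)])
    have F2: "Ck_on k (F (\<lambda>z. w z * (fst z \<bullet> e))) (ball x0 r)" for e
      unfolding F_def by (rule Suc.IH[OF q2 we]) (use Suc.prems(3,4) in auto)
    show ?case
    proof (rule Ck_on_SucI[OF open_ball])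
      fix y assume y: "y \<in> ball x0 r"
      have eq: "(LINT z|lebesgue. w z * (q * (fst z \<bullet> e - y \<bullet> e) * norm (z - (y, 0)) powr (- (q + 2)))) =
          q * F (\<lambda>z. w z * (fst z \<bullet> e)) y - q * (y \<bullet> e) * F w y" for e
      proof -
        have nm: "(\<lambda>z::'a \<times> real. norm (z - c) powr s) \<in> borel_measurable lebesgue" for c s
          by (intro measurable_completion) simp
        have i: "integrable lebesgue (\<lambda>z. W z * norm (z - (y, 0)) powr (- (q + 2)))"
          if "integrable lebesgue W" "\<And>z. W z \<noteq> 0 \<Longrightarrow> w z \<noteq> 0" for W
        proof (rule Bochner_Integration.integrable_bound[where f = "\<lambda>z. W z * \<delta> powr (- (q + 2))"])
          have "norm (W z * norm (z - (y, 0)) powr (- (q + 2))) \<le> norm (W z * \<delta> powr (- (q + 2)))" for z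
          proof (cases "W z = 0")
            case False
            have "norm (z - (y, 0)) powr (- (q + 2)) \<le> \<delta> powr (- (q + 2))"
              using Suc.prems(3)[OF that(2)[OF False] y] \<delta> q2 by (intro powr_mono2') auto
            then show ?thesis by (simp add: abs_mult mult_left_mono)
          qed simp
          then show "AE z in lebesgue. norm (W z * norm (z - (y, 0)) powr (- (q + 2))) \<le> norm (W z * \<delta> powr (- (q + 2)))" by (rule AE_I2)
          show "(\<lambda>z. W z * norm (z - (y, 0)) powr (- (q + 2))) \<in> borel_measurable lebesgue"
            using borel_measurable_integrable[OF that(1)] nm by (rule borel_measurable_times)
        qed (use that in simp)
        have "(LINT z|lebesgue. w z * (q * (fst z \<bullet> e - y \<bullet> e) * norm (z - (y, 0)) powr (- (q + 2)))) =
          (LINT z|lebesgue. q * ((w z * (fst z \<bullet> e)) * norm (z - (y, 0)) powr (- (q + 2))) - (q * (y \<bullet> e)) * (w z * norm (z - (y, 0)) powr (- (q + 2))))"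
          by (simp add: algebra_simps)
        also have "\<dots> = q * F (\<lambda>z. w z * (fst z \<bullet> e)) y - q * (y \<bullet> e) * F w y"
          unfolding F_def using i[OF we] i[OF Suc.prems(2)] by simp
        finally show ?thesis .
      qed
      show "((\<lambda>y. LINT z|lebesgue. w z * norm (z - (y, 0)) powr (- q)) has_derivative
        (\<lambda>e. q * F (\<lambda>z. w z * (fst z \<bullet> e)) y - q * (y \<bullet> e) * F w y)) (at y)"
        using key(2)[OF Suc.prems(1,2,3) y] unfolding eq .
    next
      fix e
      show "Ck_on k (\<lambda>y. q * F (\<lambda>z. w z * (fst z \<bullet> e)) y - q * (y \<bullet> e) * F w y) (ball x0 r)"
        by (intro Ck_on_diff Ck_on_mult Ck_on_const F1 F2 Ck_on_linear bounded_linear_inner_left open_ball)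
    qed
  }
qed

section \<open>Weighted traces\<close>

lemma nn_integral_powr_Ioo:
  assumes "a > -1" "\<epsilon> > 0"
  shows "(\<integral>\<^sup>+y. ennreal (indicator {0<..<\<epsilon>} y * y powr a) \<partial>lborel) = ennreal (\<epsilon> powr (a + 1) / (a + 1))"
proof -
  have "((\<lambda>x. x powr a) has_integral (\<epsilon> powr (a + 1) / (a + 1))) {0..\<epsilon>}"
    by (rule has_integral_powr_from_0) (use assms in auto)
  then have "(\<integral>\<^sup>+y. ennreal (indicator {0..\<epsilon>} y * y powr a) \<partial>lborel) = ennreal (\<epsilon> powr (a + 1) / (a + 1))"
    using nn_integral_has_integral_lebesgue[of "{0..\<epsilon>}" "\<lambda>x. x powr a"] by (simp add: nn_integral_completion)
  moreover have "(\<integral>\<^sup>+y. ennreal (indicator {0<..<\<epsilon>} y * y powr a) \<partial>lborel) = (\<integral>\<^sup>+y. ennreal (indicator {0..\<epsilon>} y * y powr a) \<partial>lborel)"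
  proof (rule nn_integral_cong_AE)
    show "AE y in lborel. ennreal (indicator {0<..<\<epsilon>} y * y powr a) = ennreal (indicator {0..\<epsilon>} y * y powr a)"
      using AE_lborel_singleton[of "0::real"] AE_lborel_singleton[of \<epsilon>]
      by eventually_elim (auto simp: indicator_def)
  qed
  ultimately show ?thesis by simp
qed

lemma borel_measurable_fst: "fst \<in> borel_measurable (borel :: ('a::topological_space \<times> 'b::topological_space) measure)"
  and borel_measurable_snd: "snd \<in> borel_measurable (borel :: ('a \<times> 'b) measure)"
  by (auto intro!: borel_measurable_continuous_onI continuous_intros)

lemma nn_integral_lborel_Times:
  fixes f :: "'a::euclidean_space \<times> real \<Rightarrow> ennreal"
  assumes "f \<in> borel_measurable borel"
  shows "(\<integral>\<^sup>+z. f z \<partial>lborel) = (\<integral>\<^sup>+x. (\<integral>\<^sup>+y. f (x, y) \<partial>lborel) \<partial>lborel)"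
proof -
  have "f \<in> borel_measurable (lborel \<Otimes>\<^sub>M lborel)" using assms by (simp add: lborel_prod)
  from lborel.nn_integral_fst[OF this] show ?thesis by (simp add: lborel_prod)
qed

lemma nn_integral_weight_product:
  fixes h :: "'a::euclidean_space \<Rightarrow> real"
  assumes "a > -1" "\<epsilon> > 0" and h: "h \<in> borel_measurable borel" "\<And>x. h x \<ge> 0"
  shows "(\<integral>\<^sup>+z. ennreal (h (fst z) * (indicator {0<..<\<epsilon>} (snd z) * snd z powr a)) \<partial>lborel) =
    ennreal (\<epsilon> powr (a + 1) / (a + 1)) * (\<integral>\<^sup>+x. ennreal (h x) \<partial>lborel)"
proof -
  have i: "indicator {0<..<\<epsilon>} \<in> borel_measurable (borel :: real measure)" by (intro borel_measurable_indicator) simp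
  have m: "(\<lambda>z::'a \<times> real. ennreal (h (fst z) * (indicator {0<..<\<epsilon>} (snd z) * snd z powr a))) \<in> borel_measurable borel"
    by (intro measurable_compose[OF _ measurable_ennreal] borel_measurable_times measurable_compose[OF borel_measurable_fst h(1)]
        measurable_compose[OF borel_measurable_snd i] measurable_compose[OF borel_measurable_snd, of "\<lambda>y. y powr a"]) simp
  have "(\<integral>\<^sup>+z. ennreal (h (fst z) * (indicator {0<..<\<epsilon>} (snd z) * snd z powr a)) \<partial>lborel) =
      (\<integral>\<^sup>+x. (\<integral>\<^sup>+y. ennreal (h x) * ennreal (indicator {0<..<\<epsilon>} y * y powr a) \<partial>lborel) \<partial>lborel)"
    unfolding nn_integral_lborel_Times[OF m] using h(2) by (simp add: ennreal_mult)
  also have "\<dots> = (\<integral>\<^sup>+x. ennreal (h x) * ennreal (\<epsilon> powr (a + 1) / (a + 1)) \<partial>lborel)"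
    using i by (subst nn_integral_cmult) (simp_all add: nn_integral_powr_Ioo[OF assms(1,2)])
  also have "\<dots> = (\<integral>\<^sup>+x. ennreal (h x) \<partial>lborel) * ennreal (\<epsilon> powr (a + 1) / (a + 1))"
    using h(1) by (intro nn_integral_multc) simp
  finally show ?thesis by (simp only: mult.commute)
qed

lemma ennreal_power2_le_imp_le:
  assumes "x\<^sup>2 \<le> (ennreal r)\<^sup>2" "r \<ge> 0" shows "x \<le> ennreal r"
proof (cases x)
  case (real s)
  then have "ennreal (s\<^sup>2) \<le> ennreal (r\<^sup>2)" using assms by (simp add: ennreal_power)
  then have "s\<^sup>2 \<le> r\<^sup>2" by simp
  then show ?thesis using real assms(2) power2_le_imp_le by (auto intro: ennreal_leI)
next
  case top
  then have "x\<^sup>2 = top" by (simp add: power2_eq_square)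
  then have "top \<le> ennreal (r\<^sup>2)" using assms(1) by (simp only: ennreal_power[OF assms(2)])
  then show ?thesis by (simp add: top_unique)
qed

text \<open>Cauchy-Schwarz against a weight that is square integrable on \<open>U\<close>. In
  \<open>ennreal\<close> the inequality makes sense before the product is known to be
  integrable.\<close>

lemma L2_tendsto_imp_L1_weighted:
  fixes F :: "nat \<Rightarrow> 'a::euclidean_space \<Rightarrow> 'b::euclidean_space"
  assumes F: "L2_tendsto U F f" and w: "w \<in> borel_measurable lebesgue" "\<And>z. w z \<ge> 0"
    and fin: "(\<integral>\<^sup>+z. ennreal (indicator U z * (w z)\<^sup>2) \<partial>lebesgue) < \<infinity>" and U: "U \<in> sets lebesgue"
  shows "(\<lambda>k. \<integral>\<^sup>+z. ennreal (indicator U z * (w z * norm (F k z - f z))) \<partial>lebesgue) \<longlonglongrightarrow> 0"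
proof -
  define W where "W = (\<integral>\<^sup>+z. ennreal (indicator U z * (w z)\<^sup>2) \<partial>lebesgue)"
  define D where "D k z = indicator U z *\<^sub>R (F k z - f z)" for k z
  define e where "e k = (LINT z:U|lebesgue. (norm (F k z - f z))\<^sup>2)" for k
  have Dm: "D k \<in> borel_measurable lebesgue" for k
    using F by (simp add: L2_tendsto_def L2_on_def set_borel_measurable_def D_def[abs_def])
  have e0: "e \<longlonglongrightarrow> 0" using F by (simp add: L2_tendsto_def e_def[abs_def])
  have Ui: "indicator U \<in> borel_measurable lebesgue" using U by simp
  have sq: "(norm (D k z))\<^sup>2 = indicator U z * (norm (F k z - f z))\<^sup>2" for k z
    by (auto simp: D_def indicator_def)
  have De: "(\<integral>\<^sup>+z. ennreal ((norm (D k z))\<^sup>2) \<partial>lebesgue) = ennreal (e k)" for k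
  proof -
    have "integrable lebesgue (\<lambda>z. (norm (D k z))\<^sup>2)"
      using F unfolding sq by (simp add: L2_tendsto_def L2_on_def set_integrable_def)
    then have "(\<integral>\<^sup>+z. ennreal ((norm (D k z))\<^sup>2) \<partial>lebesgue) = ennreal (LINT z|lebesgue. (norm (D k z))\<^sup>2)"
      by (intro nn_integral_eq_integral) auto
    then show ?thesis unfolding sq e_def set_lebesgue_integral_def by simp
  qed
  have bound: "(\<integral>\<^sup>+z. ennreal (indicator U z * (w z * norm (F k z - f z))) \<partial>lebesgue)\<^sup>2 \<le> W * ennreal (e k)" for k
  proof -
    have eq: "ennreal (indicator U z * (w z * norm (F k z - f z))) = ennreal (indicator U z * w z) * ennreal (norm (D k z))" for z
      using w(2)[of z] by (auto simp: D_def indicator_def ennreal_mult)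
    have "(\<integral>\<^sup>+z. ennreal (indicator U z * w z) * ennreal (norm (D k z)) \<partial>lebesgue)\<^sup>2 \<le>
        (\<integral>\<^sup>+z. (ennreal (indicator U z * w z))\<^sup>2 \<partial>lebesgue) * (\<integral>\<^sup>+z. (ennreal (norm (D k z)))\<^sup>2 \<partial>lebesgue)"
      using borel_measurable_times[OF Ui w(1)] Dm by (intro Cauchy_Schwarz_nn_integral) auto
    also have "(\<integral>\<^sup>+z. (ennreal (indicator U z * w z))\<^sup>2 \<partial>lebesgue) = W"
      unfolding W_def using w(2) by (intro nn_integral_cong) (auto simp: ennreal_power indicator_def)
    also have "(\<integral>\<^sup>+z. (ennreal (norm (D k z)))\<^sup>2 \<partial>lebesgue) = ennreal (e k)"
      by (simp add: ennreal_power De)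
    finally show ?thesis unfolding eq .
  qed
  define c where "c = enn2real W"
  have W: "W = ennreal c" "c \<ge> 0" using fin by (simp_all add: c_def W_def less_top)
  have e_nn: "e k \<ge> 0" for k unfolding e_def set_lebesgue_integral_def by (intro integral_nonneg_AE AE_I2) (simp add: indicator_def)
  have le: "(\<integral>\<^sup>+z. ennreal (indicator U z * (w z * norm (F k z - f z))) \<partial>lebesgue) \<le> ennreal (sqrt (c * e k))" for k
  proof -
    have "(\<integral>\<^sup>+z. ennreal (indicator U z * (w z * norm (F k z - f z))) \<partial>lebesgue)\<^sup>2 \<le> (ennreal (sqrt (c * e k)))\<^sup>2"
      using bound[of k] W e_nn[of k] by (simp add: ennreal_power ennreal_mult)
    then show ?thesis by (rule ennreal_power2_le_imp_le) (use W e_nn in simp)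
  qed
  have "(\<lambda>k. ennreal (sqrt (c * e k))) \<longlonglongrightarrow> ennreal (sqrt (c * 0))"
    by (intro tendsto_ennrealI tendsto_real_sqrt tendsto_mult tendsto_const e0)
  then have "(\<lambda>k. ennreal (sqrt (c * e k))) \<longlonglongrightarrow> 0" by simp
  then show ?thesis by (rule tendsto_sandwich[OF _ _ tendsto_const, rotated 2]) (use le in auto)
qed

lemma set_integrable_weight:
  fixes \<Omega> :: "'a::euclidean_space set"
  assumes \<Omega>: "open \<Omega>" "bounded \<Omega>" and b: "b > -1" and T: "T > 0"
  shows "(\<integral>\<^sup>+z. ennreal (indicator (\<Omega> \<times> {0<..<T}) z * snd z powr b) \<partial>lborel) < \<infinity>"
proof -
  have "(\<integral>\<^sup>+z. ennreal (indicator (\<Omega> \<times> {0<..<T}) z * snd z powr b) \<partial>(lborel :: ('a \<times> real) measure)) =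
      (\<integral>\<^sup>+z. ennreal (indicator \<Omega> (fst z) * (indicator {0<..<T} (snd z) * snd z powr b)) \<partial>lborel)"
    by (intro nn_integral_cong) (auto simp: indicator_def)
  also have "\<dots> = ennreal (T powr (b + 1) / (b + 1)) * (\<integral>\<^sup>+x. ennreal (indicator \<Omega> x) \<partial>lborel)"
    by (rule nn_integral_weight_product[OF b T]) (use \<Omega> in auto)
  also have "(\<integral>\<^sup>+x. ennreal (indicator \<Omega> x) \<partial>lborel) = emeasure lborel \<Omega>"
    using \<Omega> by (simp add: ennreal_indicator)
  finally show ?thesis using emeasure_bounded_finite[OF \<Omega>(2)] by (simp add: ennreal_mult_less_top)
qed

lemma weighted_norm: "snd z powr (a / 2) * norm (f z - g z) = norm (weighted a f z - weighted a g z)"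
  by (cases z) (simp add: weighted_def scaleR_diff_right[symmetric])

lemma weighted_norm': 
  assumes "snd z > 0" shows "snd z powr b * norm (f z - g z) = snd z powr (b - a / 2) * norm (weighted a f z - weighted a g z)"
proof -
  have "snd z powr b = snd z powr (b - a / 2) * snd z powr (a / 2)" by (rule powr_add_eq[symmetric]) simp
  then show ?thesis by (simp add: weighted_norm[symmetric] mult.assoc)
qed

text \<open>Split \<open>y^b = y^(b - a/2) y^(a/2)\<close>: the second factor belongs to the
  weighted \<open>L^2\<close> convergence, the first is square integrable near y = 0 when
  \<open>2 b - a > -1\<close>. Two choices matter later, \<open>b = a\<close> and
  \<open>b = 0\<close>; for the latter the condition reads \<open>a < 1\<close>.\<close>

lemma weighted_L1:
  fixes \<Omega> :: "'a::euclidean_space set" and f :: "'a \<times> real \<Rightarrow> 'b::euclidean_space"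
  assumes \<Omega>: "open \<Omega>" "bounded \<Omega>" and T: "T > 0" and b: "b > -1" "2 * b - a > -1"
  defines "U \<equiv> \<Omega> \<times> {0<..<T}"
  assumes F: "L2_tendsto U (\<lambda>k. weighted a (F k)) (weighted a f)" "\<And>k. continuous_on UNIV (F k)"
  shows "(\<lambda>z. indicator U z *\<^sub>R f z) \<in> borel_measurable lebesgue"
    "(\<lambda>k. \<integral>\<^sup>+z. ennreal (indicator U z * (snd z powr b * norm (F k z - f z))) \<partial>lebesgue) \<longlonglongrightarrow> 0"
    "(\<integral>\<^sup>+z. ennreal (indicator U z * (snd z powr b * norm (f z))) \<partial>lebesgue) < \<infinity>"
proof -
  have U: "open U" unfolding U_def using \<Omega> by (intro open_Times) auto
  have Ui: "indicator U \<in> borel_measurable lebesgue" using U by (intro borel_measurable_indicator) auto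
  have pw: "(\<lambda>z::'a \<times> real. snd z powr c) \<in> borel_measurable lebesgue" for c
    by (intro measurable_completion) (simp add: measurable_compose[OF borel_measurable_snd, of "\<lambda>y. y powr c"])
  have pos: "snd z > 0" if "z \<in> U" for z using that by (auto simp: U_def)
  have Fm: "F k \<in> borel_measurable lebesgue" for k by (rule borel_measurable_lebesgue_continuous[OF F(2)])
  show fm: "(\<lambda>z. indicator U z *\<^sub>R f z) \<in> borel_measurable lebesgue"
  proof -
    have "(\<lambda>z. indicator U z *\<^sub>R (weighted a (F 0) z - weighted a f z)) \<in> borel_measurable lebesgue"
      using F(1) by (simp add: L2_tendsto_def L2_on_def set_borel_measurable_def)
    then have "(\<lambda>z. indicator U z *\<^sub>R F 0 z - (snd z powr (- (a / 2))) *\<^sub>R (indicator U z *\<^sub>R (weighted a (F 0) z - weighted a f z))) \<in> borel_measurable lebesgue"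
      by (intro borel_measurable_diff borel_measurable_scaleR[OF Ui Fm] borel_measurable_scaleR[OF pw])
    moreover have "indicator U z *\<^sub>R F 0 z - (snd z powr (- (a / 2))) *\<^sub>R (indicator U z *\<^sub>R (weighted a (F 0) z - weighted a f z)) = indicator U z *\<^sub>R f z" for z
    proof (cases "z \<in> U")
      case True
      have "snd z powr (- (a / 2)) * snd z powr (a / 2) = 1" using pos[OF True] by (simp add: powr_add[symmetric])
      then show ?thesis using True by (cases z) (simp add: weighted_def scaleR_diff_right[symmetric])
    qed simp
    ultimately show ?thesis by simp
  qed
  have eq: "ennreal (indicator U z * (snd z powr b * norm (F k z - f z))) =
     ennreal (indicator U z * (snd z powr (b - a / 2) * norm (weighted a (F k) z - weighted a f z)))" for k z
    using weighted_norm'[OF pos, of z b "F k" f a] by (cases "z \<in> U") auto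
  show lim: "(\<lambda>k. \<integral>\<^sup>+z. ennreal (indicator U z * (snd z powr b * norm (F k z - f z))) \<partial>lebesgue) \<longlonglongrightarrow> 0"
    unfolding eq
  proof (rule L2_tendsto_imp_L1_weighted[OF F(1) pw])
    have "(\<integral>\<^sup>+z. ennreal (indicator U z * (snd z powr (b - a / 2))\<^sup>2) \<partial>lebesgue) = (\<integral>\<^sup>+z. ennreal (indicator U z * snd z powr (2 * b - a)) \<partial>lborel)"
    proof (subst nn_integral_completion, intro nn_integral_cong)
      fix z :: "'a \<times> real"
      have "(snd z powr (b - a / 2))\<^sup>2 = snd z powr (2 * b - a)"
        unfolding power2_eq_square by (rule powr_add_eq) simp
      then show "ennreal (indicator U z * (snd z powr (b - a / 2))\<^sup>2) = ennreal (indicator U z * snd z powr (2 * b - a))" by simp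
    qed
    then show "(\<integral>\<^sup>+z. ennreal (indicator U z * (snd z powr (b - a / 2))\<^sup>2) \<partial>lebesgue) < \<infinity>"
      using set_integrable_weight[OF \<Omega> b(2) T] by (simp add: U_def)
  qed (use U in auto)
  have "\<forall>\<^sub>F k in sequentially. (\<integral>\<^sup>+z. ennreal (indicator U z * (snd z powr b * norm (F k z - f z))) \<partial>lebesgue) < 1"
    using order_tendstoD(2)[OF lim, of 1] by simp
  \<comment> \<open>For finiteness one smooth approximant at distance below 1 is enough, because it
    is bounded on the bounded set \<open>U\<close>.\<close>
  then obtain k where k: "(\<integral>\<^sup>+z. ennreal (indicator U z * (snd z powr b * norm (F k z - f z))) \<partial>lebesgue) < 1"
    by (auto simp: eventually_sequentially)
  have "bounded (F k ` closure U)"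
  proof (rule compact_imp_bounded, rule compact_continuous_image)
    have "bounded U" unfolding U_def using \<Omega> by (intro bounded_Times) auto
    then show "compact (closure U)" by (simp add: compact_closure)
  qed (rule continuous_on_subset[OF F(2)], simp)
  then obtain M where "\<forall>x\<in>F k ` closure U. norm x \<le> M" unfolding bounded_iff by blast
  then have M: "norm (F k z) \<le> \<bar>M\<bar>" if "z \<in> U" for z using that closure_subset[of U] by force
  have "(\<integral>\<^sup>+z. ennreal (indicator U z * (snd z powr b * norm (f z))) \<partial>lebesgue) \<le>
      (\<integral>\<^sup>+z. ennreal (indicator U z * (snd z powr b * norm (F k z - f z))) + ennreal \<bar>M\<bar> * ennreal (indicator U z * snd z powr b) \<partial>lebesgue)"
  proof (rule nn_integral_mono)
    fix z
    show "ennreal (indicator U z * (snd z powr b * norm (f z))) \<le> ennreal (indicator U z * (snd z powr b * norm (F k z - f z))) + ennreal \<bar>M\<bar> * ennreal (indicator U z * snd z powr b)"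
    proof (cases "z \<in> U")
      case True
      have "norm (f z) \<le> norm (F k z - f z) + \<bar>M\<bar>" using M[OF True] norm_triangle_sub[of "f z" "F k z"] by (simp add: norm_minus_commute)
      then have "snd z powr b * norm (f z) \<le> snd z powr b * norm (F k z - f z) + \<bar>M\<bar> * snd z powr b"
        using mult_left_mono[of "norm (f z)" "norm (F k z - f z) + \<bar>M\<bar>" "snd z powr b"] by (simp add: algebra_simps)
      then have "ennreal (snd z powr b * norm (f z)) \<le> ennreal (snd z powr b * norm (F k z - f z) + \<bar>M\<bar> * snd z powr b)" by (rule ennreal_leI)
      then show ?thesis using True by (simp add: ennreal_mult)
    qed simp
  qed
  also have "\<dots> = (\<integral>\<^sup>+z. ennreal (indicator U z * (snd z powr b * norm (F k z - f z))) \<partial>lebesgue) + ennreal \<bar>M\<bar> * (\<integral>\<^sup>+z. ennreal (indicator U z * snd z powr b) \<partial>lebesgue)"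
  proof (subst nn_integral_add)
    have m: "(\<lambda>z. indicator U z *\<^sub>R F k z - indicator U z *\<^sub>R f z) \<in> borel_measurable lebesgue"
      by (intro borel_measurable_diff borel_measurable_scaleR[OF Ui Fm] fm)
    have "indicator U z * (snd z powr b * norm (F k z - f z)) = snd z powr b * norm (indicator U z *\<^sub>R F k z - indicator U z *\<^sub>R f z)" for z
      by (cases "z \<in> U") auto
    then have e: "(\<lambda>z. indicator U z * (snd z powr b * norm (F k z - f z))) = (\<lambda>z. snd z powr b * norm (indicator U z *\<^sub>R F k z - indicator U z *\<^sub>R f z))"
      by (rule ext)
    have "(\<lambda>z. indicator U z * (snd z powr b * norm (F k z - f z))) \<in> borel_measurable lebesgue"
      unfolding e by (rule borel_measurable_times[OF pw[of b] measurable_compose[OF m borel_measurable_norm]])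
    then show "(\<lambda>z. ennreal (indicator U z * (snd z powr b * norm (F k z - f z)))) \<in> borel_measurable lebesgue"
      by (rule measurable_compose[OF _ measurable_ennreal])
    have m2: "(\<lambda>z. ennreal (indicator U z * snd z powr b)) \<in> borel_measurable lebesgue"
      using borel_measurable_times[OF Ui pw] by simp
    then show "(\<lambda>z. ennreal \<bar>M\<bar> * ennreal (indicator U z * snd z powr b)) \<in> borel_measurable lebesgue" by simp
    show "(\<integral>\<^sup>+z. ennreal (indicator U z * (snd z powr b * norm (F k z - f z))) \<partial>lebesgue) + (\<integral>\<^sup>+z. ennreal \<bar>M\<bar> * ennreal (indicator U z * snd z powr b) \<partial>lebesgue) =
      (\<integral>\<^sup>+z. ennreal (indicator U z * (snd z powr b * norm (F k z - f z))) \<partial>lebesgue) + ennreal \<bar>M\<bar> * (\<integral>\<^sup>+z. ennreal (indicator U z * snd z powr b) \<partial>lebesgue)"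
      by (subst nn_integral_cmult[OF m2]) (rule refl)
  qed
  also have "\<dots> < \<infinity>"
  proof -
    have "(\<integral>\<^sup>+z. ennreal (indicator U z * snd z powr b) \<partial>lebesgue) < \<infinity>"
      unfolding nn_integral_completion U_def by (rule set_integrable_weight[OF \<Omega> b(1) T])
    then have "ennreal \<bar>M\<bar> * (\<integral>\<^sup>+z. ennreal (indicator U z * snd z powr b) \<partial>lebesgue) < \<infinity>"
      by (simp add: ennreal_mult_less_top)
    moreover have "(\<integral>\<^sup>+z. ennreal (indicator U z * (snd z powr b * norm (F k z - f z))) \<partial>lebesgue) < \<infinity>"
      using k by (rule less_trans) simp
    ultimately show ?thesis by simp
  qed
  finally show "(\<integral>\<^sup>+z. ennreal (indicator U z * (snd z powr b * norm (f z))) \<partial>lebesgue) < \<infinity>" .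
qed

section \<open>Comparison with the trace in thin strips\<close>

lemma vertical_increment_le:
  fixes \<phi> :: "'a::euclidean_space \<times> real \<Rightarrow> real"
  assumes sm: "smooth_on \<phi> UNIV" and y: "0 < y" "y < \<epsilon>"
  shows "ennreal \<bar>\<phi> (x, y) - \<phi> (x, 0)\<bar> \<le> (\<integral>\<^sup>+t. ennreal (indicator {0<..<\<epsilon>} t * norm (grad \<phi> (x, t))) \<partial>lborel)"
proof -
  have C1: "Ck_on (Suc 0) \<phi> UNIV" using sm by (simp add: smooth_on_def del: Ck_on.simps)
  define h where "h t = frechet_derivative \<phi> (at (x, t)) (0, 1)" for t
  have d: "(\<phi> has_derivative frechet_derivative \<phi> (at z)) (at z)" for z by (rule Ck_on_has_derivative[OF C1]) simp
  have hg: "\<bar>h t\<bar> \<le> norm (grad \<phi> (x, t))" for t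
    using grad_inner(2)[OF d, of "(x, t)" "(0, 1)"] Cauchy_Schwarz_ineq2[of "grad \<phi> (x, t)" "(0, 1)"] by (simp add: h_def norm_Pair)
  have ch: "continuous_on UNIV h"
  proof -
    have "continuous_on UNIV (\<lambda>z. frechet_derivative \<phi> (at z) (0, 1))" using C1 by simp
    then show ?thesis unfolding h_def by (rule continuous_on_compose2) (auto intro!: continuous_intros)
  qed
  have "((\<lambda>t. \<phi> (x, t)) has_vector_derivative h t) (at t within {0..y})" for t
  proof -
    have "((\<lambda>t. \<phi> (x, t)) has_derivative (\<lambda>s. frechet_derivative \<phi> (at (x, t)) (0, s))) (at t within {0..y})"
      by (rule has_derivative_compose[where f = "\<lambda>t. (x, t)" and f' = "\<lambda>s. (0, s)"]) (auto intro!: derivative_eq_intros d)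
    moreover have "frechet_derivative \<phi> (at (x, t)) (0, s) = s *\<^sub>R h t" for s
      using linear_scale[OF has_derivative_linear[OF d], of "(x, t)" s "(0, 1)"] by (simp add: h_def)
    ultimately show ?thesis by (simp add: has_vector_derivative_def)
  qed
  then have FTC: "(h has_integral (\<phi> (x, y) - \<phi> (x, 0))) {0..y}"
    using y by (intro fundamental_theorem_of_calculus) auto
  have ih: "(\<lambda>t. \<bar>h t\<bar>) integrable_on {0..y}"
    by (intro integrable_continuous_interval continuous_intros continuous_on_subset[OF ch]) auto
  have "\<bar>\<phi> (x, y) - \<phi> (x, 0)\<bar> \<le> integral {0..y} (\<lambda>t. \<bar>h t\<bar>)"
  proof -
    have "\<phi> (x, y) - \<phi> (x, 0) = integral {0..y} h" using FTC by (simp add: integral_unique)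
    then show ?thesis using integral_norm_bound_integral[OF has_integral_integrable[OF FTC] ih] by auto
  qed
  then have "ennreal \<bar>\<phi> (x, y) - \<phi> (x, 0)\<bar> \<le> ennreal (integral {0..y} (\<lambda>t. \<bar>h t\<bar>))" by (rule ennreal_leI)
  also have "\<dots> = (\<integral>\<^sup>+t. ennreal (indicator {0..y} t * \<bar>h t\<bar>) \<partial>lborel)"
    by (rule nn_integral_has_integral_lebesgue[symmetric]) (use ih in auto)
  also have "\<dots> \<le> (\<integral>\<^sup>+t. ennreal (indicator {0<..<\<epsilon>} t * norm (grad \<phi> (x, t))) \<partial>lborel)"
  proof (rule nn_integral_mono_AE)
    show "AE t in lborel. ennreal (indicator {0..y} t * \<bar>h t\<bar>) \<le> ennreal (indicator {0<..<\<epsilon>} t * norm (grad \<phi> (x, t)))"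
      using AE_lborel_singleton[of "0::real"]
      by eventually_elim (use hg y in \<open>auto simp: indicator_def intro!: ennreal_leI\<close>)
  qed
  finally show ?thesis .
qed

lemma smooth_grad_continuous:
  fixes \<phi> :: "'a::euclidean_space \<Rightarrow> real"
  assumes "smooth_on \<phi> UNIV" shows "continuous_on UNIV (grad \<phi>)" "continuous_on UNIV \<phi>"
proof -
  have C1: "Ck_on (Suc 0) \<phi> UNIV" using assms by (simp add: smooth_on_def del: Ck_on.simps)
  have d: "(\<phi> has_derivative frechet_derivative \<phi> (at z)) (at z)" for z by (rule Ck_on_has_derivative[OF C1]) simp
  have "grad \<phi> = (\<lambda>z. \<Sum>b\<in>Basis. frechet_derivative \<phi> (at z) b *\<^sub>R b)" using grad_inner(3)[OF d] by auto
  then show "continuous_on UNIV (grad \<phi>)" using C1 by (auto intro!: continuous_intros)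
  show "continuous_on UNIV \<phi>" by (rule Ck_on_imp_continuous_on[OF C1])
qed

text \<open>The vertical increment is bounded by the integral \<open>I x\<close> of the gradient
  over the whole height of the strip. This no longer depends on y, so the weight integrates
  separately to \<open>\<epsilon> powr (a + 1) / (a + 1)\<close>.\<close>

lemma smooth_trace_increment:
  fixes \<phi> :: "'a::euclidean_space \<times> real \<Rightarrow> real"
  assumes \<Omega>: "open \<Omega>" and a: "a > -1" and \<epsilon>: "\<epsilon> > 0" and sm: "smooth_on \<phi> UNIV"
  shows "(\<integral>\<^sup>+z. ennreal (indicator (\<Omega> \<times> {0<..<\<epsilon>}) z * (snd z powr a * \<bar>\<phi> z - \<phi> (fst z, 0)\<bar>)) \<partial>lborel) \<le>
    ennreal (\<epsilon> powr (a + 1) / (a + 1)) * (\<integral>\<^sup>+z. ennreal (indicator (\<Omega> \<times> {0<..<\<epsilon>}) z * norm (grad \<phi> z)) \<partial>lborel)"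
proof -
  note cont = smooth_grad_continuous[OF sm]
  define U where "U = \<Omega> \<times> {0<..<\<epsilon>}"
  have U: "open U" unfolding U_def using \<Omega> by (intro open_Times) auto
  have Ui: "indicator U \<in> borel_measurable borel" using U by (intro borel_measurable_indicator) auto
  have pw: "(\<lambda>z::'a \<times> real. snd z powr c) \<in> borel_measurable borel" for c
    by (simp add: measurable_compose[OF borel_measurable_snd, of "\<lambda>y. y powr c"])
  have "(\<lambda>z. \<bar>\<phi> z - \<phi> (fst z, 0)\<bar>) \<in> borel_measurable borel"
    by (intro borel_measurable_continuous_onI continuous_intros cont(2) continuous_on_compose2[OF cont(2)]) auto
  then have m1: "(\<lambda>z. ennreal (indicator U z * (snd z powr a * \<bar>\<phi> z - \<phi> (fst z, 0)\<bar>))) \<in> borel_measurable borel"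
    using borel_measurable_times[OF Ui borel_measurable_times[OF pw[of a]]] by simp
  have m2: "(\<lambda>z. ennreal (indicator U z * norm (grad \<phi> z))) \<in> borel_measurable borel"
    using borel_measurable_times[OF Ui measurable_compose[OF borel_measurable_continuous_onI[OF cont(1)] borel_measurable_norm]] by simp
  define I where "I x = (\<integral>\<^sup>+t. ennreal (indicator U (x, t) * norm (grad \<phi> (x, t))) \<partial>lborel)" for x
  have Im: "I \<in> borel_measurable lborel"
    unfolding I_def using lborel.borel_measurable_nn_integral_fst[of "\<lambda>z. ennreal (indicator U z * norm (grad \<phi> z))" lborel] m2
    by (simp add: lborel_prod)
  have "(\<integral>\<^sup>+z. ennreal (indicator U z * (snd z powr a * \<bar>\<phi> z - \<phi> (fst z, 0)\<bar>)) \<partial>lborel) =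
     (\<integral>\<^sup>+x. (\<integral>\<^sup>+y. ennreal (indicator U (x, y) * (y powr a * \<bar>\<phi> (x, y) - \<phi> (x, 0)\<bar>)) \<partial>lborel) \<partial>lborel)"
    using nn_integral_lborel_Times[OF m1] by simp
  also have "\<dots> \<le> (\<integral>\<^sup>+x. (\<integral>\<^sup>+y. ennreal (indicator {0<..<\<epsilon>} y * y powr a) * I x \<partial>lborel) \<partial>lborel)"
  proof (intro nn_integral_mono)
    fix x y
    show "ennreal (indicator U (x, y) * (y powr a * \<bar>\<phi> (x, y) - \<phi> (x, 0)\<bar>)) \<le> ennreal (indicator {0<..<\<epsilon>} y * y powr a) * I x"
    proof (cases "(x, y) \<in> U")
      case True
      then have x: "x \<in> \<Omega>" and y: "0 < y" "y < \<epsilon>" by (auto simp: U_def)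
      have "I x = (\<integral>\<^sup>+t. ennreal (indicator {0<..<\<epsilon>} t * norm (grad \<phi> (x, t))) \<partial>lborel)"
        unfolding I_def by (intro nn_integral_cong) (auto simp: U_def x indicator_def)
      then have "ennreal \<bar>\<phi> (x, y) - \<phi> (x, 0)\<bar> \<le> I x" using vertical_increment_le[OF sm y] by simp
      then show ?thesis using True y by (simp add: ennreal_mult mult_left_mono)
    qed simp
  qed
  also have "\<dots> = (\<integral>\<^sup>+x. ennreal (\<epsilon> powr (a + 1) / (a + 1)) * I x \<partial>lborel)"
  proof (intro nn_integral_cong)
    fix x
    have "(\<lambda>y. ennreal (indicator {0<..<\<epsilon>} y * y powr a)) \<in> borel_measurable lborel"
      using borel_measurable_times[OF borel_measurable_indicator[of "{0<..<\<epsilon>}" lborel], of "\<lambda>y. y powr a"] by simp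
    then show "(\<integral>\<^sup>+y. ennreal (indicator {0<..<\<epsilon>} y * y powr a) * I x \<partial>lborel) = ennreal (\<epsilon> powr (a + 1) / (a + 1)) * I x"
      by (subst nn_integral_multc) (simp_all add: nn_integral_powr_Ioo[OF a \<epsilon>])
  qed
  also have "\<dots> = ennreal (\<epsilon> powr (a + 1) / (a + 1)) * (\<integral>\<^sup>+x. I x \<partial>lborel)"
    using Im by (intro nn_integral_cmult)
  also have "(\<integral>\<^sup>+x. I x \<partial>lborel) = (\<integral>\<^sup>+z. ennreal (indicator U z * norm (grad \<phi> z)) \<partial>lborel)"
    unfolding I_def by (rule nn_integral_lborel_Times[OF m2, symmetric])
  finally show ?thesis unfolding U_def .
qed

text \<open>The strip estimate for smooth functions passes to \<open>u\<close> along the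
  approximations contained in \<open>has_trace\<close>. Its strength lies in the unweighted gradient
  integral over the strip, which tends to 0 with \<epsilon>: in the mean, u approaches its trace
  faster than the order \<open>\<epsilon> powr (a + 1)\<close> of the weight.\<close>

lemma trace_estimate:
  fixes \<Omega> :: "'a::euclidean_space set" and u :: "'a \<times> real \<Rightarrow> real"
  assumes \<Omega>: "open \<Omega>" "bounded \<Omega>" and T: "T > 0" and a: "a > -1" "a < 1"
    and tr: "has_trace a \<Omega> T u v" and cv: "continuous_on \<Omega> v"
  defines "U \<equiv> \<Omega> \<times> {0<..<T}"
  obtains G where "has_weak_gradient U u G"
    "(\<lambda>z. indicator U z *\<^sub>R u z) \<in> borel_measurable lebesgue" "(\<lambda>z. indicator U z *\<^sub>R G z) \<in> borel_measurable lebesgue"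
    "(\<integral>\<^sup>+z. ennreal (indicator U z * (snd z powr a * norm (u z))) \<partial>lebesgue) < \<infinity>"
    "(\<integral>\<^sup>+z. ennreal (indicator U z * (snd z powr a * norm (G z))) \<partial>lebesgue) < \<infinity>"
    "(\<integral>\<^sup>+z. ennreal (indicator U z * (snd z powr 0 * norm (G z))) \<partial>lebesgue) < \<infinity>"
    "\<And>\<epsilon>. 0 < \<epsilon> \<Longrightarrow> \<epsilon> \<le> T \<Longrightarrow>
      (\<integral>\<^sup>+z. ennreal (indicator (\<Omega> \<times> {0<..<\<epsilon>}) z * (snd z powr a * \<bar>u z - v (fst z)\<bar>)) \<partial>lebesgue) \<le>
      ennreal (\<epsilon> powr (a + 1) / (a + 1)) * (\<integral>\<^sup>+z. ennreal (indicator (\<Omega> \<times> {0<..<\<epsilon>}) z * norm (G z)) \<partial>lebesgue)"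
proof -
  obtain G \<phi> where G: "has_weak_gradient U u G" and sm: "\<And>k. smooth_on (\<phi> k) UNIV"
    and L1: "L2_tendsto U (\<lambda>k. weighted a (\<phi> k)) (weighted a u)"
    and L2: "L2_tendsto U (\<lambda>k. weighted a (grad (\<phi> k))) (weighted a G)"
    and L3: "L2_tendsto \<Omega> (\<lambda>k x. \<phi> k (x, 0)) v"
    using tr unfolding has_trace_def U_def by blast
  note cont = smooth_grad_continuous[OF sm]
  note W1 = weighted_L1[OF \<Omega> T a(1) _ L1[unfolded U_def] cont(2), folded U_def]
  note W2 = weighted_L1[OF \<Omega> T a(1) _ L2[unfolded U_def] cont(1), folded U_def]
  note W3 = weighted_L1[OF \<Omega> T _ _ L2[unfolded U_def] cont(1), of 0, folded U_def]
  \<comment> \<open>\<open>a > -1\<close> serves the weight \<open>b = a\<close>, and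
    \<open>a < 1\<close> the unweighted gradient, \<open>b = 0\<close>.\<close>
  have aa: "2 * a - a > -1" "2 * 0 - a > -1" "(0::real) > -1" using a by auto
  have lim3: "(\<lambda>k. \<integral>\<^sup>+x. ennreal (indicator \<Omega> x * (1 * norm (\<phi> k (x, 0) - v x))) \<partial>lebesgue) \<longlonglongrightarrow> 0"
  proof (rule L2_tendsto_imp_L1_weighted[OF L3])
    have "(\<integral>\<^sup>+z. ennreal (indicator \<Omega> z * 1\<^sup>2) \<partial>lebesgue) = emeasure lborel \<Omega>"
      using \<Omega> by (simp add: nn_integral_completion ennreal_indicator)
    then show "(\<integral>\<^sup>+z. ennreal (indicator \<Omega> z * 1\<^sup>2) \<partial>lebesgue) < \<infinity>" using emeasure_bounded_finite[OF \<Omega>(2)] by simp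
  qed (use \<Omega> in auto)
  show ?thesis
  proof (rule that[OF G W1(1)[OF aa(1)] W2(1)[OF aa(1)] W1(3)[OF aa(1)] W2(3)[OF aa(1)] W3(3)[OF aa(3,2)]])
    fix \<epsilon> :: real assume \<epsilon>: "0 < \<epsilon>" "\<epsilon> \<le> T"
    define U\<epsilon> where "U\<epsilon> = \<Omega> \<times> {0<..<\<epsilon>}"
    have U\<epsilon>_U: "U\<epsilon> \<subseteq> U" using \<epsilon> by (auto simp: U\<epsilon>_def U_def)
    have opn: "open U" "open U\<epsilon>" unfolding U_def U\<epsilon>_def using \<Omega> by (auto intro!: open_Times)
    have Ui: "indicator U \<in> borel_measurable lebesgue" "indicator U\<epsilon> \<in> borel_measurable lebesgue"
      using opn by (auto intro!: borel_measurable_indicator)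
    have Uib: "indicator U\<epsilon> \<in> borel_measurable borel" "indicator \<Omega> \<in> borel_measurable borel"
      using opn \<Omega> by (auto intro!: borel_measurable_indicator)
    have pw: "(\<lambda>z::'a \<times> real. snd z powr c) \<in> borel_measurable borel" for c
      by (simp add: measurable_compose[OF borel_measurable_snd, of "\<lambda>y. y powr c"])
    have pwl: "(\<lambda>z::'a \<times> real. snd z powr c) \<in> borel_measurable lebesgue" for c
      using pw by (intro measurable_completion) simp
    define c where "c = ennreal (\<epsilon> powr (a + 1) / (a + 1))"
    define A where "A k = (\<integral>\<^sup>+z. ennreal (indicator U z * (snd z powr a * norm (\<phi> k z - u z))) \<partial>lebesgue)" for k
    define D where "D k = (\<integral>\<^sup>+z. ennreal (indicator U z * (snd z powr 0 * norm (grad (\<phi> k) z - G z))) \<partial>lebesgue)" for k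
    define C where "C k = (\<integral>\<^sup>+x. ennreal (indicator \<Omega> x * (1 * norm (\<phi> k (x, 0) - v x))) \<partial>lebesgue)" for k
    define I where "I = (\<integral>\<^sup>+z. ennreal (indicator U\<epsilon> z * norm (G z)) \<partial>lebesgue)"
    define M where "M = (\<integral>\<^sup>+z. ennreal (indicator U\<epsilon> z * (snd z powr a * \<bar>u z - v (fst z)\<bar>)) \<partial>lebesgue)"
    have lims: "A \<longlonglongrightarrow> 0" "D \<longlonglongrightarrow> 0" "C \<longlonglongrightarrow> 0"
      using W1(2)[OF aa(1)] W3(2)[OF aa(3,2)] lim3 unfolding A_def D_def C_def by auto
    have \<phi>0: "continuous_on UNIV (\<lambda>x. \<phi> k (x, 0))" for k
      by (rule continuous_on_compose2[OF cont(2)]) (auto intro!: continuous_intros)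
    \<comment> \<open>\<open>A k\<close>, \<open>D k\<close> and \<open>C k\<close> are the
      approximation errors of the function, of its gradient and of its trace; the last two enter
      through integrals over the strip and carry the factor \<open>c\<close>.\<close>
    have bound: "M \<le> A k + (c * (I + D k) + c * C k)" for k
    proof -
      define m1 where "m1 z = ennreal (indicator U z * (snd z powr a * norm (\<phi> k z - u z)))" for z
      define m2 where "m2 z = ennreal (indicator U\<epsilon> z * (snd z powr a * \<bar>\<phi> k z - \<phi> k (fst z, 0)\<bar>))" for z
      define h where "h x = indicator \<Omega> x * \<bar>\<phi> k (x, 0) - v x\<bar>" for x
      define m3 where "m3 z = ennreal (h (fst z) * (indicator {0<..<\<epsilon>} (snd z) * snd z powr a))" for z
      have hm: "h \<in> borel_measurable borel"
      proof -
        have "(\<lambda>x. indicator \<Omega> x *\<^sub>R (\<phi> k (x, 0) - v x)) \<in> borel_measurable borel"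
          by (rule borel_measurable_continuous_on_indicator)
            (use \<Omega> in \<open>auto intro!: continuous_intros cv continuous_on_subset[OF \<phi>0]\<close>)
        from measurable_compose[OF this borel_measurable_norm]
        have "(\<lambda>x. norm (indicator \<Omega> x *\<^sub>R (\<phi> k (x, 0) - v x))) \<in> borel_measurable borel" .
        moreover have "norm (indicator \<Omega> x *\<^sub>R (\<phi> k (x, 0) - v x)) = h x" for x by (simp add: h_def indicator_def)
        ultimately show ?thesis by simp
      qed
      have h0: "h x \<ge> 0" for x by (simp add: h_def)
      have m1m: "m1 \<in> borel_measurable lebesgue"
      proof -
        have m: "(\<lambda>z. indicator U z *\<^sub>R \<phi> k z - indicator U z *\<^sub>R u z) \<in> borel_measurable lebesgue"
          by (intro borel_measurable_diff borel_measurable_scaleR[OF Ui(1) borel_measurable_lebesgue_continuous[OF cont(2)]] W1(1)[OF aa(1)])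
        have "m1 z = ennreal (snd z powr a * norm (indicator U z *\<^sub>R \<phi> k z - indicator U z *\<^sub>R u z))" for z
          by (cases "z \<in> U") (auto simp: m1_def)
        then have e: "m1 = (\<lambda>z. ennreal (snd z powr a * norm (indicator U z *\<^sub>R \<phi> k z - indicator U z *\<^sub>R u z)))" by (rule ext)
        show ?thesis unfolding e
          by (rule measurable_compose[OF borel_measurable_times[OF pwl measurable_compose[OF m borel_measurable_norm]] measurable_ennreal])
      qed
      have m2b: "m2 \<in> borel_measurable borel"
      proof -
        have "(\<lambda>z. \<bar>\<phi> k z - \<phi> k (fst z, 0)\<bar>) \<in> borel_measurable borel"
          by (intro borel_measurable_continuous_onI continuous_intros cont(2) continuous_on_compose2[OF cont(2)]) auto
        from borel_measurable_times[OF Uib(1) borel_measurable_times[OF pw[of a] this]]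
        show ?thesis unfolding m2_def by (rule measurable_compose[OF _ measurable_ennreal])
      qed
      have m3b: "m3 \<in> borel_measurable borel"
        unfolding m3_def
        by (intro measurable_compose[OF _ measurable_ennreal] borel_measurable_times measurable_compose[OF borel_measurable_fst hm]
            measurable_compose[OF borel_measurable_snd borel_measurable_indicator] pw) simp
      have le: "M \<le> (\<integral>\<^sup>+z. m1 z + (m2 z + m3 z) \<partial>lebesgue)"
        unfolding M_def
      proof (rule nn_integral_mono)
        fix z
        show "ennreal (indicator U\<epsilon> z * (snd z powr a * \<bar>u z - v (fst z)\<bar>)) \<le> m1 z + (m2 z + m3 z)"
        proof (cases "z \<in> U\<epsilon>")
          case True
          then have z: "z \<in> U" "fst z \<in> \<Omega>" "snd z \<in> {0<..<\<epsilon>}" using U\<epsilon>_U by (auto simp: U\<epsilon>_def)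
          have "\<bar>u z - v (fst z)\<bar> \<le> norm (\<phi> k z - u z) + (\<bar>\<phi> k z - \<phi> k (fst z, 0)\<bar> + \<bar>\<phi> k (fst z, 0) - v (fst z)\<bar>)" by simp
          then have "snd z powr a * \<bar>u z - v (fst z)\<bar> \<le> snd z powr a * (norm (\<phi> k z - u z) + (\<bar>\<phi> k z - \<phi> k (fst z, 0)\<bar> + \<bar>\<phi> k (fst z, 0) - v (fst z)\<bar>))"
            by (rule mult_left_mono) simp
          then have "ennreal (snd z powr a * \<bar>u z - v (fst z)\<bar>) \<le> ennreal (snd z powr a * norm (\<phi> k z - u z) + (snd z powr a * \<bar>\<phi> k z - \<phi> k (fst z, 0)\<bar> + \<bar>\<phi> k (fst z, 0) - v (fst z)\<bar> * snd z powr a))"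
            by (intro ennreal_leI) (simp add: algebra_simps)
          also have "\<dots> = m1 z + (m2 z + m3 z)" using z True by (simp add: m1_def m2_def m3_def h_def)
          finally show ?thesis using True by simp
        qed simp
      qed
      have m2l: "m2 \<in> borel_measurable lebesgue" and m3l: "m3 \<in> borel_measurable lebesgue"
        using m2b m3b by (auto intro!: measurable_completion)
      have "(\<integral>\<^sup>+z. m1 z + (m2 z + m3 z) \<partial>lebesgue) = A k + ((\<integral>\<^sup>+z. m2 z \<partial>lebesgue) + (\<integral>\<^sup>+z. m3 z \<partial>lebesgue))"
      proof -
        have "A k = (\<integral>\<^sup>+z. m1 z \<partial>lebesgue)" by (simp only: A_def m1_def)
        then show ?thesis using m1m m2l m3l by (simp add: nn_integral_add)
      qed
      moreover have "(\<integral>\<^sup>+z. m3 z \<partial>lebesgue) = c * C k"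
      proof -
        have "(\<integral>\<^sup>+x. ennreal (h x) \<partial>lborel) = C k"
          unfolding C_def nn_integral_completion by (intro nn_integral_cong) (simp add: h_def)
        then show ?thesis
          unfolding m3_def nn_integral_completion c_def using nn_integral_weight_product[OF a(1) \<epsilon>(1) hm h0] by simp
      qed
      moreover have "(\<integral>\<^sup>+z. m2 z \<partial>lebesgue) \<le> c * (I + D k)"
      proof -
        have "(\<integral>\<^sup>+z. m2 z \<partial>lebesgue) \<le> c * (\<integral>\<^sup>+z. ennreal (indicator U\<epsilon> z * norm (grad (\<phi> k) z)) \<partial>lborel)"
          unfolding m2_def nn_integral_completion c_def U\<epsilon>_def by (rule smooth_trace_increment[OF \<Omega>(1) a(1) \<epsilon>(1) sm])
        also have "(\<integral>\<^sup>+z. ennreal (indicator U\<epsilon> z * norm (grad (\<phi> k) z)) \<partial>lborel) \<le> I + D k"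
        proof -
          have mG: "(\<lambda>z. ennreal (indicator U\<epsilon> z * norm (G z))) \<in> borel_measurable lebesgue"
          proof -
            have "indicator U\<epsilon> z * norm (G z) = indicator U\<epsilon> z * norm (indicator U z *\<^sub>R G z)" for z
              using U\<epsilon>_U by (cases "z \<in> U\<epsilon>") auto
            then have e: "(\<lambda>z. indicator U\<epsilon> z * norm (G z)) = (\<lambda>z. indicator U\<epsilon> z * norm (indicator U z *\<^sub>R G z))" by (rule ext)
            have "(\<lambda>z. indicator U\<epsilon> z * norm (G z)) \<in> borel_measurable lebesgue"
              unfolding e by (rule borel_measurable_times[OF Ui(2) measurable_compose[OF W2(1)[OF aa(1)] borel_measurable_norm]])
            then show ?thesis by (rule measurable_compose[OF _ measurable_ennreal])
          qed
          have mD: "(\<lambda>z. ennreal (indicator U z * (snd z powr 0 * norm (grad (\<phi> k) z - G z)))) \<in> borel_measurable lebesgue"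
          proof -
            have m: "(\<lambda>z. indicator U z *\<^sub>R grad (\<phi> k) z - indicator U z *\<^sub>R G z) \<in> borel_measurable lebesgue"
              by (intro borel_measurable_diff borel_measurable_scaleR[OF Ui(1) borel_measurable_lebesgue_continuous[OF cont(1)]] W2(1)[OF aa(1)])
            have "indicator U z * (snd z powr 0 * norm (grad (\<phi> k) z - G z)) = snd z powr 0 * norm (indicator U z *\<^sub>R grad (\<phi> k) z - indicator U z *\<^sub>R G z)" for z
              by (cases "z \<in> U") auto
            then have e: "(\<lambda>z. indicator U z * (snd z powr 0 * norm (grad (\<phi> k) z - G z))) = (\<lambda>z. snd z powr 0 * norm (indicator U z *\<^sub>R grad (\<phi> k) z - indicator U z *\<^sub>R G z))" by (rule ext)
            have "(\<lambda>z. indicator U z * (snd z powr 0 * norm (grad (\<phi> k) z - G z))) \<in> borel_measurable lebesgue"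
              unfolding e by (rule borel_measurable_times[OF pwl measurable_compose[OF m borel_measurable_norm]])
            then show ?thesis by (rule measurable_compose[OF _ measurable_ennreal])
          qed
          have "(\<integral>\<^sup>+z. ennreal (indicator U\<epsilon> z * norm (grad (\<phi> k) z)) \<partial>lborel) = (\<integral>\<^sup>+z. ennreal (indicator U\<epsilon> z * norm (grad (\<phi> k) z)) \<partial>lebesgue)"
            by (simp add: nn_integral_completion)
          also have "\<dots> \<le> (\<integral>\<^sup>+z. ennreal (indicator U\<epsilon> z * norm (G z)) + ennreal (indicator U z * (snd z powr 0 * norm (grad (\<phi> k) z - G z))) \<partial>lebesgue)"
          proof (rule nn_integral_mono)
            fix z
            show "ennreal (indicator U\<epsilon> z * norm (grad (\<phi> k) z)) \<le> ennreal (indicator U\<epsilon> z * norm (G z)) + ennreal (indicator U z * (snd z powr 0 * norm (grad (\<phi> k) z - G z)))"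
            proof (cases "z \<in> U\<epsilon>")
              case True
              then have z: "z \<in> U" "snd z > 0" using U\<epsilon>_U by (auto simp: U\<epsilon>_def)
              have "ennreal (norm (grad (\<phi> k) z)) \<le> ennreal (norm (G z) + norm (grad (\<phi> k) z - G z))"
                by (rule ennreal_leI) (use norm_triangle_sub[of "grad (\<phi> k) z" "G z"] in simp)
              then show ?thesis using True z by simp
            qed simp
          qed
          also have "\<dots> = I + D k" unfolding I_def D_def by (rule nn_integral_add[OF mG mD])
          finally show ?thesis .
        qed
        finally show ?thesis by (simp add: mult_left_mono)
      qed
      ultimately show ?thesis using le by (simp add: add_mono order_trans[OF le])
    qed
    have "(\<lambda>k. A k + (c * (I + D k) + c * C k)) \<longlonglongrightarrow> 0 + (c * (I + 0) + c * 0)"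
      by (intro tendsto_add ennreal_tendsto_cmult tendsto_const lims) (auto simp: c_def)
    then have "M \<le> c * I" using bound by (auto intro: LIMSEQ_le_const)
    then show "(\<integral>\<^sup>+z. ennreal (indicator (\<Omega> \<times> {0<..<\<epsilon>}) z * (snd z powr a * \<bar>u z - v (fst z)\<bar>)) \<partial>lebesgue) \<le>
      ennreal (\<epsilon> powr (a + 1) / (a + 1)) * (\<integral>\<^sup>+z. ennreal (indicator (\<Omega> \<times> {0<..<\<epsilon>}) z * norm (G z)) \<partial>lebesgue)"
      by (simp add: M_def c_def I_def U\<epsilon>_def)
  qed
qed

section \<open>The representation formula\<close>

lemma bumpS_supp:
  assumes p: "p > 0" and \<epsilon>: "\<epsilon> > 0" and nz: "bumpS p \<epsilon> ((norm (z - (x', 0)))\<^sup>2) \<noteq> 0"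
  shows "dist (fst z) x' < \<epsilon>" "\<bar>snd z\<bar> < \<epsilon>"
proof -
  have "\<not> (norm (z - (x', 0)))\<^sup>2 \<ge> \<epsilon>\<^sup>2" using bumpS_0[OF p \<epsilon>] nz by blast
  then have "norm (z - (x', 0)) < \<epsilon>" using \<epsilon> power2_less_imp_less by (metis less_imp_le not_le)
  moreover have "norm (fst (z - (x', 0))) \<le> norm (z - (x', 0))" "norm (snd (z - (x', 0))) \<le> norm (z - (x', 0))"
    using norm_fst_le[of "fst z - x'" "snd z"] norm_snd_le[of "snd z" "fst z - x'"] by (cases z; simp)+
  ultimately show "dist (fst z) x' < \<epsilon>" "\<bar>snd z\<bar> < \<epsilon>" by (auto simp: dist_norm)
qed

lemma continuous_bumpS:
  assumes "p > 0" shows "continuous_on UNIV (bumpS p \<epsilon>)"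
  unfolding bumpS_def[abs_def] divide_inverse
  by (intro continuous_intros continuous_on_compose2[OF continuous_on_bump[OF assms]]) auto

text \<open>Tonelli in the centre \<open>x'\<close>: for fixed \<open>z\<close> the bump is at most
  \<open>B * \<epsilon> powr (- p - 2)\<close>, lives on a ball of radius \<epsilon> in
  \<open>x'\<close>, and vanishes unless \<open>\<bar>snd z\<bar> < \<epsilon>\<close>. Integrating
  over the centres is what makes an \<open>L^1\<close> estimate on strips usable for the
  averages.\<close>

lemma averaging_bound:
  fixes f :: "'a::euclidean_space \<times> real \<Rightarrow> ennreal" and p :: real
  assumes f: "f \<in> borel_measurable lebesgue" and p: "p > 0"
  obtains Q where "Q \<ge> 0"
    "\<And>\<epsilon>. \<epsilon> > 0 \<Longrightarrow> (\<lambda>x'. \<integral>\<^sup>+z. f z * ennreal (bumpS p \<epsilon> ((norm (z - (x', 0)))\<^sup>2)) \<partial>lebesgue) \<in> borel_measurable lborel"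
    "\<And>\<epsilon>. \<epsilon> > 0 \<Longrightarrow> (\<integral>\<^sup>+x'. (\<integral>\<^sup>+z. f z * ennreal (bumpS p \<epsilon> ((norm (z - (x', 0)))\<^sup>2)) \<partial>lebesgue) \<partial>lborel) \<le>
      ennreal (Q * \<epsilon> powr (DIM('a) - p - 2)) * (\<integral>\<^sup>+z. f z * indicator {z. \<bar>snd z\<bar> < \<epsilon>} z \<partial>lebesgue)"
proof -
  obtain B where B: "B > 0" "\<And>t. bump p t \<le> B" using bump_bounded[OF p] by blast
  define V where "V = unit_ball_vol (real DIM('a))"
  \<comment> \<open>Tonelli is applied to Borel measures, whose product is again
    \<open>lborel\<close>; so \<open>f\<close>, measurable for the completion, is replaced by a
    Borel version equal to it almost everywhere.\<close>
  obtain f' where f': "f' \<in> borel_measurable lborel" "AE z in lborel. f z = f' z"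
    using completion_ex_borel_measurable[OF f] by blast
  have eq: "(\<integral>\<^sup>+z. f z * g z \<partial>lebesgue) = (\<integral>\<^sup>+z. f' z * g z \<partial>lborel)" for g
    unfolding nn_integral_completion by (rule nn_integral_cong_AE) (use f'(2) in auto)
  define b where "b \<epsilon> x' z = ennreal (bumpS p \<epsilon> ((norm (z - (x', 0)))\<^sup>2))" for \<epsilon> x' and z :: "'a \<times> real"
  have jm: "(\<lambda>(x', z). f' z * b \<epsilon> x' z) \<in> borel_measurable (lborel \<Otimes>\<^sub>M lborel)" for \<epsilon>
  proof -
    have "(\<lambda>w::'a \<times> ('a \<times> real). bumpS p \<epsilon> ((norm (snd w - (fst w, 0)))\<^sup>2)) \<in> borel_measurable borel"
      by (intro borel_measurable_continuous_onI continuous_on_compose2[OF continuous_bumpS[OF p]] continuous_intros) auto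
    from measurable_compose[OF this measurable_ennreal]
    have 1: "(\<lambda>w::'a \<times> ('a \<times> real). b \<epsilon> (fst w) (snd w)) \<in> borel_measurable (lborel \<Otimes>\<^sub>M lborel)"
      by (simp add: b_def lborel_prod)
    have 2: "(\<lambda>w::'a \<times> ('a \<times> real). f' (snd w)) \<in> borel_measurable (lborel \<Otimes>\<^sub>M lborel)"
      by (rule measurable_compose[OF measurable_snd f'(1)])
    show ?thesis using borel_measurable_times_ennreal[OF 2 1] by (simp add: case_prod_beta')
  qed
  show ?thesis
  proof (rule that[of "B * V"])
    show "B * V \<ge> 0" using B by (simp add: V_def)
    fix \<epsilon> :: real assume \<epsilon>: "\<epsilon> > 0"
    show "(\<lambda>x'. \<integral>\<^sup>+z. f z * ennreal (bumpS p \<epsilon> ((norm (z - (x', 0)))\<^sup>2)) \<partial>lebesgue) \<in> borel_measurable lborel"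
      unfolding eq b_def[symmetric] using lborel.borel_measurable_nn_integral_fst[OF jm[of \<epsilon>]] by simp
    have bb: "(\<integral>\<^sup>+x'. b \<epsilon> x' z \<partial>lborel) \<le> ennreal (B * V * \<epsilon> powr (DIM('a) - p - 2)) * indicator {z. \<bar>snd z\<bar> < \<epsilon>} z" for z
    proof -
      have "(\<integral>\<^sup>+x'. b \<epsilon> x' z \<partial>lborel) \<le> (\<integral>\<^sup>+x'. (ennreal (\<epsilon> powr (- p - 2) * B) * indicator {z. \<bar>snd z\<bar> < \<epsilon>} z) * indicator (ball (fst z) \<epsilon>) x' \<partial>lborel)"
      proof (rule nn_integral_mono)
        fix x'
        show "b \<epsilon> x' z \<le> (ennreal (\<epsilon> powr (- p - 2) * B) * indicator {z. \<bar>snd z\<bar> < \<epsilon>} z) * indicator (ball (fst z) \<epsilon>) x'"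
        proof (cases "bumpS p \<epsilon> ((norm (z - (x', 0)))\<^sup>2) = 0")
          case False
          have "bumpS p \<epsilon> ((norm (z - (x', 0)))\<^sup>2) \<le> \<epsilon> powr (- p - 2) * B"
            unfolding bumpS_def by (intro mult_left_mono B) auto
          then show ?thesis using bumpS_supp[OF p \<epsilon> False] by (simp add: b_def ennreal_leI indicator_def)
        qed (simp add: b_def)
      qed
      also have "\<dots> = (ennreal (\<epsilon> powr (- p - 2) * B) * indicator {z. \<bar>snd z\<bar> < \<epsilon>} z) * emeasure lborel (ball (fst z) \<epsilon>)"
        by (intro nn_integral_cmult_indicator) simp
      also have "\<dots> = (ennreal (\<epsilon> powr (- p - 2) * B) * ennreal (V * \<epsilon> ^ DIM('a))) * indicator {z. \<bar>snd z\<bar> < \<epsilon>} z"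
        using \<epsilon> by (simp add: emeasure_ball V_def mult_ac)
      also have "ennreal (\<epsilon> powr (- p - 2) * B) * ennreal (V * \<epsilon> ^ DIM('a)) = ennreal (B * V * \<epsilon> powr (DIM('a) - p - 2))"
      proof -
        have "\<epsilon> powr real DIM('a) * \<epsilon> powr (- p - 2) = \<epsilon> powr (DIM('a) - p - 2)" by (rule powr_add_eq) simp
        then have "\<epsilon> ^ DIM('a) * \<epsilon> powr (- p - 2) = \<epsilon> powr (DIM('a) - p - 2)" using \<epsilon> by (simp add: powr_realpow)
        then have "(\<epsilon> powr (- p - 2) * B) * (V * \<epsilon> ^ DIM('a)) = B * V * \<epsilon> powr (DIM('a) - p - 2)" by (simp add: mult_ac)
        then show ?thesis using B \<epsilon> by (simp add: ennreal_mult[symmetric] V_def)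
      qed
      finally show ?thesis .
    qed
    have "(\<integral>\<^sup>+x'. (\<integral>\<^sup>+z. f z * ennreal (bumpS p \<epsilon> ((norm (z - (x', 0)))\<^sup>2)) \<partial>lebesgue) \<partial>lborel) =
        (\<integral>\<^sup>+x'. (\<integral>\<^sup>+z. f' z * b \<epsilon> x' z \<partial>lborel) \<partial>lborel)" unfolding eq b_def ..
    also have "\<dots> = (\<integral>\<^sup>+z. (\<integral>\<^sup>+x'. f' z * b \<epsilon> x' z \<partial>lborel) \<partial>lborel)"
      using lborel_pair.Fubini'[OF jm[of \<epsilon>]] by simp
    also have "\<dots> = (\<integral>\<^sup>+z. f' z * (\<integral>\<^sup>+x'. b \<epsilon> x' z \<partial>lborel) \<partial>lborel)"
    proof (intro nn_integral_cong nn_integral_cmult)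
      fix z :: "'a \<times> real"
      have "(\<lambda>x'. bumpS p \<epsilon> ((norm (z - (x', 0)))\<^sup>2)) \<in> borel_measurable borel"
        by (intro borel_measurable_continuous_onI continuous_on_compose2[OF continuous_bumpS[OF p]] continuous_intros) auto
      from measurable_compose[OF this measurable_ennreal] show "(\<lambda>x'. b \<epsilon> x' z) \<in> borel_measurable lborel" by (simp add: b_def)
    qed
    also have "\<dots> \<le> (\<integral>\<^sup>+z. f' z * (ennreal (B * V * \<epsilon> powr (DIM('a) - p - 2)) * indicator {z. \<bar>snd z\<bar> < \<epsilon>} z) \<partial>lborel)"
      by (intro nn_integral_mono mult_left_mono bb) simp
    also have "\<dots> = (\<integral>\<^sup>+z. ennreal (B * V * \<epsilon> powr (DIM('a) - p - 2)) * (f' z * indicator {z. \<bar>snd z\<bar> < \<epsilon>} z) \<partial>lborel)"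
      by (simp add: mult_ac)
    also have "\<dots> = ennreal (B * V * \<epsilon> powr (DIM('a) - p - 2)) * (\<integral>\<^sup>+z. f' z * indicator {z. \<bar>snd z\<bar> < \<epsilon>} z \<partial>lborel)"
    proof (rule nn_integral_cmult)
      have "open {z :: 'a \<times> real. \<bar>snd z\<bar> < \<epsilon>}" by (intro open_Collect_less continuous_intros)
      then show "(\<lambda>z. f' z * indicator {z. \<bar>snd z\<bar> < \<epsilon>} z) \<in> borel_measurable lborel"
        by (intro borel_measurable_times_ennreal f'(1) borel_measurable_indicator) simp
    qed
    finally show "(\<integral>\<^sup>+x'. (\<integral>\<^sup>+z. f z * ennreal (bumpS p \<epsilon> ((norm (z - (x', 0)))\<^sup>2)) \<partial>lebesgue) \<partial>lborel) \<le>
      ennreal (B * V * \<epsilon> powr (DIM('a) - p - 2)) * (\<integral>\<^sup>+z. f z * indicator {z. \<bar>snd z\<bar> < \<epsilon>} z \<partial>lebesgue)"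
      unfolding eq .
  qed
qed

text \<open>Substituting \<open>z = (x', 0) + \<epsilon> w\<close> produces the powers
  \<open>n + 1\<close> from the volume, \<open>a\<close> from the weight and \<open>- p - 2\<close>
  from the bump, and these add up to 0 precisely for \<open>p = n - 1 + a\<close>. Hence one
  constant serves all widths and centres; it becomes the factor of the trace in the limit.\<close>

lemma bump_mass:
  fixes p a :: real
  assumes p: "p > 0" and a: "a > -1" and n: "p = real DIM('a::euclidean_space) - 1 + a"
  obtains c where "c > 0"
    "\<And>\<epsilon> x'. \<epsilon> > 0 \<Longrightarrow> (\<integral>\<^sup>+z. ennreal (indicator {z. snd z > 0} z * (snd z powr a * bumpS p \<epsilon> ((norm (z - (x'::'a, 0)))\<^sup>2))) \<partial>lborel) = ennreal c"
proof -
  define h where "h z = indicator {z. snd z > 0} z * (snd z powr a * bump p ((norm z)\<^sup>2))" for z :: "'a \<times> real"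
  have opn: "open {z :: 'a \<times> real. snd z > 0}" by (intro open_Collect_less continuous_intros)
  have hm: "h \<in> borel_measurable borel"
  proof -
    have "(\<lambda>z::'a \<times> real. bump p ((norm z)\<^sup>2)) \<in> borel_measurable borel"
      by (intro borel_measurable_continuous_onI continuous_on_compose2[OF continuous_on_bump[OF p]] continuous_intros) auto
    from borel_measurable_times[OF _ this, of "\<lambda>z. snd z powr a"] opn
    show ?thesis unfolding h_def
      by (intro borel_measurable_times[OF borel_measurable_indicator]) (auto simp: measurable_compose[OF borel_measurable_snd, of "\<lambda>y. y powr a"])
  qed
  have h0: "h z \<ge> 0" for z using bump_nonneg by (simp add: h_def)
  define I where "I = (\<integral>\<^sup>+z. ennreal (h z) \<partial>lborel)"
  obtain B where B: "B > 0" "\<And>t. bump p t \<le> B" using bump_bounded[OF p] by blast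
  have fin: "I < \<infinity>"
  proof -
    have "I \<le> (\<integral>\<^sup>+z. ennreal B * ennreal (indicator (ball (0::'a) 1 \<times> {0<..<1}) z * snd z powr a) \<partial>lborel)"
      unfolding I_def
    proof (rule nn_integral_mono)
      fix z :: "'a \<times> real"
      show "ennreal (h z) \<le> ennreal B * ennreal (indicator (ball (0::'a) 1 \<times> {0<..<1}) z * snd z powr a)"
      proof (cases "h z = 0")
        case False
        then have y: "snd z > 0" and b: "bump p ((norm z)\<^sup>2) \<noteq> 0" by (auto simp: h_def indicator_def)
        then have "bumpS p 1 ((norm (z - (0, 0)))\<^sup>2) \<noteq> 0" by (simp add: bumpS_def zero_prod_def[symmetric])
        then have "dist (fst z) 0 < 1" "\<bar>snd z\<bar> < 1" using bumpS_supp[OF p, of 1 z 0] by auto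
        then have "z \<in> ball 0 1 \<times> {0<..<1}" using y by (cases z) auto
        moreover have "h z \<le> B * snd z powr a" using B(2)[of "(norm z)\<^sup>2"] y
          by (simp add: h_def mult.commute mult_left_mono)
        ultimately show ?thesis using B by (simp add: ennreal_mult[symmetric] ennreal_leI)
      qed simp
    qed
    also have "\<dots> = ennreal B * (\<integral>\<^sup>+z. ennreal (indicator (ball (0::'a) 1 \<times> {0<..<1}) z * snd z powr a) \<partial>lborel)"
    proof (rule nn_integral_cmult)
      have "indicator (ball (0::'a) 1 \<times> {0<..<1::real}) \<in> borel_measurable (borel :: ('a \<times> real) measure)"
        by (intro borel_measurable_indicator borel_open open_Times) auto
      from borel_measurable_times[OF this, of "\<lambda>z. snd z powr a"]
      show "(\<lambda>z::'a \<times> real. ennreal (indicator (ball (0::'a) 1 \<times> {0<..<1}) z * snd z powr a)) \<in> borel_measurable lborel"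
        by (simp add: measurable_compose[OF borel_measurable_snd, of "\<lambda>y. y powr a"])
    qed
    also have "\<dots> < \<infinity>"
      using set_integrable_weight[OF open_ball bounded_ball a zero_less_one, of "0::'a" 1] by (simp add: ennreal_mult_less_top)
    finally show ?thesis .
  qed
  have pos: "I > 0"
  proof (rule ccontr)
    assume "\<not> I > 0"
    then have "I = 0" by simp
    then have ae: "AE z in lborel. h z = 0"
      unfolding I_def using hm h0 by (simp add: nn_integral_0_iff_AE)
    define O1 where "O1 = {z :: 'a \<times> real. snd z > 0} \<inter> {z. norm z < 1} \<inter> {z. 1/2 < (norm z)\<^sup>2}"
    have "open O1" unfolding O1_def by (intro open_Int open_Collect_less continuous_intros)
    \<comment> \<open>A witness on the y axis: its squared norm \<open>81/100\<close> lies in (1/2,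
      1), where the bump is positive.\<close>
    moreover have "(0, 9/10) \<in> O1" by (simp add: O1_def norm_Pair power2_eq_square)
    ultimately have "\<not> negligible O1" using open_not_negligible by blast
    moreover have "h z \<noteq> 0" if "z \<in> O1" for z
    proof -
      have "(norm z)\<^sup>2 < 1" using that by (auto simp: O1_def power_less_one_iff abs_square_less_1)
      then have "bump p ((norm z)\<^sup>2) > 0" using that by (intro bump_pos) (auto simp: O1_def)
      then show ?thesis using that by (auto simp: h_def O1_def)
    qed
    then have "AE z in lebesgue. z \<notin> O1" using AE_completion[OF ae] by (auto elim!: eventually_mono)
    then have "negligible O1" using \<open>open O1\<close> by (simp add: negligible_iff_null_sets AE_iff_null_sets)
    ultimately show False by blast
  qed
  have scale: "(\<integral>\<^sup>+z. ennreal (indicator {z. snd z > 0} z * (snd z powr a * bumpS p \<epsilon> ((norm (z - (x', 0)))\<^sup>2))) \<partial>lborel) = I"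
    if \<epsilon>: "\<epsilon> > 0" for \<epsilon> and x' :: 'a
  proof -
    define H where "H z = indicator {z. snd z > 0} z * (snd z powr a * bumpS p \<epsilon> ((norm (z - (x', 0)))\<^sup>2))" for z :: "'a \<times> real"
    have Hh: "ennreal (H ((x', 0) + \<epsilon> *\<^sub>R w)) * ennreal (\<epsilon> ^ DIM('a \<times> real)) = ennreal (h w)" for w
    proof (cases "snd w > 0")
      case True
      have "(\<epsilon> * snd w) powr a = \<epsilon> powr a * snd w powr a" by (rule powr_mult)
      moreover have "(norm (\<epsilon> *\<^sub>R w))\<^sup>2 / \<epsilon>\<^sup>2 = (norm w)\<^sup>2" using \<epsilon> by (simp add: power_mult_distrib)
      ultimately have "H ((x', 0) + \<epsilon> *\<^sub>R w) = (\<epsilon> powr a * \<epsilon> powr (- p - 2)) * h w"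
        using True \<epsilon> by (simp add: H_def h_def bumpS_def mult_ac)
      also have "\<epsilon> powr a * \<epsilon> powr (- p - 2) = \<epsilon> powr (- (DIM('a) + 1))" by (rule powr_add_eq) (simp add: n)
      finally have "H ((x', 0) + \<epsilon> *\<^sub>R w) * \<epsilon> ^ DIM('a \<times> real) = (\<epsilon> powr (- (DIM('a) + 1)) * \<epsilon> powr (DIM('a) + 1)) * h w"
        using \<epsilon> powr_realpow[OF \<epsilon>, of "DIM('a) + 1"] by (simp add: mult_ac add.commute)
      also have "\<epsilon> powr (- (DIM('a) + 1)) * \<epsilon> powr (DIM('a) + 1) = 1" using \<epsilon> by (simp add: powr_add[symmetric] del: of_nat_add)
      finally show ?thesis using \<epsilon> by (simp add: ennreal_mult''[symmetric] del: DIM_prod)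
    qed (use \<epsilon> in \<open>auto simp: H_def h_def indicator_def zero_less_mult_iff\<close>)
    have Hm: "H \<in> borel_measurable borel"
    proof -
      have "(\<lambda>z::'a \<times> real. bumpS p \<epsilon> ((norm (z - (x', 0)))\<^sup>2)) \<in> borel_measurable borel"
        by (intro borel_measurable_continuous_onI continuous_on_compose2[OF continuous_bumpS[OF p]] continuous_intros) auto
      from borel_measurable_times[OF _ this, of "\<lambda>z. snd z powr a"] opn
      show ?thesis unfolding H_def
        by (intro borel_measurable_times[OF borel_measurable_indicator]) (auto simp: measurable_compose[OF borel_measurable_snd, of "\<lambda>y. y powr a"])
    qed
    have aff: "lborel = density (distr lborel borel (\<lambda>w. (x', 0::real) + \<epsilon> *\<^sub>R w)) (\<lambda>_. ennreal (\<bar>\<epsilon>\<bar> ^ DIM('a \<times> real)))"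
      using lborel_affine[of \<epsilon> "(x', 0::real)"] \<epsilon> by simp
    have "(\<integral>\<^sup>+z. ennreal (H z) \<partial>lborel) = (\<integral>\<^sup>+w. ennreal (\<epsilon> ^ DIM('a \<times> real)) * ennreal (H ((x', 0) + \<epsilon> *\<^sub>R w)) \<partial>lborel)"
      using Hm \<epsilon> by (subst aff) (simp add: nn_integral_density nn_integral_distr del: DIM_prod)
    also have "\<dots> = I" unfolding I_def using Hh by (simp add: mult.commute del: DIM_prod)
    finally show ?thesis by (simp add: H_def)
  qed
  show ?thesis
  proof (rule that[of "enn2real I"])
    show "enn2real I > 0" using pos fin by (simp add: enn2real_positive_iff)
  qed (use scale fin in \<open>simp add: less_top\<close>)
qed

section \<open>Radial cutoffs and the equation tested with radial products\<close>

lemma radial_cutoff_exists: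
  assumes \<rho>: "\<rho> > (0::real)"
  obtains S S1 S2 :: "real \<Rightarrow> real" where
    "\<And>k. Ck_on k S UNIV" "\<And>k. Ck_on k S1 UNIV" "continuous_on UNIV S2"
    "\<And>t. (S has_real_derivative S1 t) (at t)" "\<And>t. (S1 has_real_derivative S2 t) (at t)"
    "\<And>t. 0 \<le> S t" "\<And>t. S t \<le> 1" "\<And>t. t \<le> \<rho>\<^sup>2 \<Longrightarrow> S t = 1" "\<And>t. t \<ge> 2 * \<rho>\<^sup>2 \<Longrightarrow> S t = 0"
    "\<And>t. S1 t \<noteq> 0 \<or> S2 t \<noteq> 0 \<Longrightarrow> \<rho>\<^sup>2 \<le> t \<and> t \<le> 2 * \<rho>\<^sup>2"
proof -
  \<comment> \<open>With this scaling the step runs over \<open>t\<close> from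
    \<open>\<rho>^2\<close> to \<open>2 * \<rho>^2\<close>, where \<open>t\<close> stands for a
    squared distance.\<close>
  define \<alpha> where "\<alpha> = 1 / \<rho>\<^sup>2"
  have \<alpha>: "\<alpha> > 0" "\<And>t. \<alpha> * t = t / \<rho>\<^sup>2" using \<rho> by (auto simp: \<alpha>_def)
  define S where "S t = 1 - smooth_step (\<alpha> * t + - 1)" for t
  define S1 where "S1 t = - (deriv smooth_step (\<alpha> * t + - 1) * \<alpha>)" for t
  have cS: "Ck_on k S UNIV" for k unfolding S_def[abs_def]
    by (intro Ck_on_diff Ck_on_const Ck_on_compose_real[OF open_UNIV open_UNIV UNIV_I Ck_on_affine Ck_on_smooth_step] open_UNIV)
  have dS: "(S has_real_derivative S1 t) (at t)" for t
  proof -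
    have "((\<lambda>t. smooth_step (\<alpha> * t + - 1)) has_real_derivative deriv smooth_step (\<alpha> * t + - 1) * \<alpha>) (at t)"
      by (rule DERIV_chain2[OF DERIV_smooth_step]) (auto intro!: derivative_eq_intros)
    from DERIV_diff[OF DERIV_const[of 1] this] show ?thesis by (simp add: S_def[abs_def] S1_def)
  qed
  have cS1: "Ck_on k S1 UNIV" for k by (rule Ck_on_real_deriv[OF open_UNIV cS dS])
  define S2 where "S2 t = frechet_derivative S1 (at t) 1" for t
  have dS1: "(S1 has_real_derivative S2 t) (at t)" for t
  proof -
    have d: "(S1 has_derivative frechet_derivative S1 (at t)) (at t)" by (rule Ck_on_has_derivative[OF cS1[of "Suc 0"]]) simp
    have "frechet_derivative S1 (at t) h = S2 t * h" for h
      using linear_scale[OF has_derivative_linear[OF d], of h 1] by (simp add: S2_def mult.commute)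
    then have "frechet_derivative S1 (at t) = (*) (S2 t)" by (rule ext)
    then show ?thesis using d by (simp add: has_field_derivative_def)
  qed
  have cS2: "continuous_on UNIV S2" using cS1[of "Suc 0"] by (simp add: S2_def[abs_def])
  have z1: "S1 t = 0" if "t \<le> \<rho>\<^sup>2 \<or> t \<ge> 2 * \<rho>\<^sup>2" for t
  proof -
    have "\<alpha> * t + - 1 \<le> 0 \<or> \<alpha> * t + - 1 \<ge> 1" using that \<rho> unfolding \<alpha>(2) by (auto simp: field_simps)
    then show ?thesis by (simp add: S1_def deriv_smooth_step_0)
  qed
  \<comment> \<open>\<open>S2\<close> differentiates a function that vanishes on an open set, so the
    end points of the shell stay undecided; the closed inequalities of the conclusion allow for
    that.\<close>
  have z2: "S2 t = 0" if "t < \<rho>\<^sup>2 \<or> t > 2 * \<rho>\<^sup>2" for t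
  proof -
    have "((\<lambda>t. 0) has_real_derivative 0) (at t)" by simp
    then have "(S1 has_real_derivative 0) (at t)"
      by (rule has_field_derivative_transform_within_open[where S = "{..<\<rho>\<^sup>2} \<union> {2 * \<rho>\<^sup>2<..}"]) (use that z1 in auto)
    then show ?thesis using DERIV_unique[OF dS1] by blast
  qed
  show ?thesis
  proof (rule that[OF cS cS1 cS2 dS dS1])
    show "0 \<le> S t" "S t \<le> 1" for t using smooth_step_bounds by (auto simp: S_def)
    show "S t = 1" if "t \<le> \<rho>\<^sup>2" for t unfolding S_def using that \<rho> by (simp add: smooth_step_0 \<alpha>(2))
    show "S t = 0" if "t \<ge> 2 * \<rho>\<^sup>2" for t unfolding S_def using that \<rho> by (simp add: smooth_step_1 \<alpha>(2) field_simps)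
    show "\<rho>\<^sup>2 \<le> t \<and> t \<le> 2 * \<rho>\<^sup>2" if "S1 t \<noteq> 0 \<or> S2 t \<noteq> 0" for t
      using that z1[of t] z2[of t] by force
  qed
qed

lemma set_integral_cong_support:
  fixes f :: "'a \<Rightarrow> 'b::{banach, second_countable_topology}"
  assumes "\<And>z. z \<in> A \<Longrightarrow> z \<notin> B \<Longrightarrow> f z = 0" "B \<subseteq> A"
  shows "(LINT z:A|M. f z) = (LINT z:B|M. f z)"
proof -
  have "(\<lambda>z. indicator A z *\<^sub>R f z) = (\<lambda>z. indicator B z *\<^sub>R f z)"
    using assms by (auto simp: indicator_def fun_eq_iff)
  then show ?thesis by (simp add: set_lebesgue_integral_def)
qed

text \<open>The equation comes with a weak gradient on the infinite cylinder, the trace with one on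
  a bounded cylinder. The fundamental lemma identifies the two almost everywhere on the smaller
  set.\<close>

lemma weak_gradient_unique:
  fixes f :: "'a::euclidean_space \<Rightarrow> real"
  assumes U: "open U" "U \<subseteq> U'" and G: "has_weak_gradient U f G" "has_weak_gradient U' f G'"
  shows "AE z in lebesgue. z \<in> U \<longrightarrow> G' z = G z"
proof -
  have "AE z in lebesgue. z \<in> U \<longrightarrow> G' z - G z = 0"
  proof (rule weak_zero_imp_AE_zero[OF U(1)])
    fix K assume "compact K" "K \<subseteq> U"
    then show "set_integrable lebesgue K (\<lambda>z. G' z - G z)"
      using G U(2) unfolding has_weak_gradient_def by (intro set_integral_diff(1)) auto
  next
    fix \<psi> assume \<psi>: "test_function U \<psi>"
    then have \<psi>': "test_function U' \<psi>" using U(2) by (auto simp: test_function_def)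
    note tf = test_function_facts[OF \<psi>]
    let ?K = "closure {z. \<psi> z \<noteq> 0}"
    have out: "\<psi> z = 0" "grad \<psi> z = 0" if "z \<notin> U" for z
    proof -
      have z: "z \<notin> ?K" using that tf(2) by blast
      show "\<psi> z = 0" by (rule test_function_outside(1)[OF z])
      show "grad \<psi> z = 0" using grad_inner(3)[OF test_function_outside(2)[OF z]] by simp
    qed
    have e: "(LINT z:U'|lebesgue. f z *\<^sub>R grad \<psi> z) = (LINT z:U|lebesgue. f z *\<^sub>R grad \<psi> z)"
      "(LINT z:U'|lebesgue. \<psi> z *\<^sub>R G' z) = (LINT z:U|lebesgue. \<psi> z *\<^sub>R G' z)"
      by (rule set_integral_cong_support, use out U(2) in auto)+
    have iG: "integrable lebesgue (\<lambda>z. indicator U z *\<^sub>R \<psi> z *\<^sub>R H z)" if "set_integrable lebesgue ?K H" for H :: "'a \<Rightarrow> 'a"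
    proof -
      have c\<psi>: "continuous_on UNIV \<psi>" using tf(4)[of 0] by simp
      have z0: "\<psi> z = 0" if "z \<notin> ?K" for z by (rule test_function_outside(1)[OF that])
      obtain B where B: "\<And>z. norm (\<psi> z) \<le> B" using continuous_compact_support_bounded[OF c\<psi> tf(1) z0] by blast
      have eq: "(\<lambda>z. indicator U z *\<^sub>R \<psi> z *\<^sub>R H z) = (\<lambda>z. \<psi> z *\<^sub>R (indicator ?K z *\<^sub>R H z))"
      proof
        fix z show "indicator U z *\<^sub>R \<psi> z *\<^sub>R H z = \<psi> z *\<^sub>R (indicator ?K z *\<^sub>R H z)"
          using z0[of z] tf(2) by (cases "z \<in> ?K") auto
      qed
      show ?thesis unfolding eq
      proof (rule Bochner_Integration.integrable_bound[where f = "\<lambda>z. B *\<^sub>R (indicator ?K z *\<^sub>R H z)"])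
        show "integrable lebesgue (\<lambda>z. B *\<^sub>R (indicator ?K z *\<^sub>R H z))"
          using that unfolding set_integrable_def by (rule integrable_scaleR_right)
        show "(\<lambda>z. \<psi> z *\<^sub>R (indicator ?K z *\<^sub>R H z)) \<in> borel_measurable lebesgue"
          using that unfolding set_integrable_def
          by (intro borel_measurable_scaleR[OF borel_measurable_lebesgue_continuous[OF c\<psi>]] borel_measurable_integrable)
        have "\<bar>\<psi> z\<bar> \<le> \<bar>B\<bar>" for z using B[of z] by simp
        then show "AE z in lebesgue. norm (\<psi> z *\<^sub>R (indicator ?K z *\<^sub>R H z)) \<le> norm (B *\<^sub>R (indicator ?K z *\<^sub>R H z))"
          unfolding norm_scaleR[of "\<psi> _"] norm_scaleR[of B] by (intro AE_I2 mult_right_mono) auto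
      qed
    qed
    have i: "integrable lebesgue (\<lambda>z. indicator U z *\<^sub>R \<psi> z *\<^sub>R G z)" "integrable lebesgue (\<lambda>z. indicator U z *\<^sub>R \<psi> z *\<^sub>R G' z)"
    proof -
      have "?K \<subseteq> U'" using tf(2) U(2) by simp
      then have sG: "set_integrable lebesgue ?K G" "set_integrable lebesgue ?K G'"
        using G tf(1,2) unfolding has_weak_gradient_def by blast+
      show "integrable lebesgue (\<lambda>z. indicator U z *\<^sub>R \<psi> z *\<^sub>R G z)" by (rule iG[OF sG(1)])
      show "integrable lebesgue (\<lambda>z. indicator U z *\<^sub>R \<psi> z *\<^sub>R G' z)" by (rule iG[OF sG(2)])
    qed
    have "(LINT z:U|lebesgue. \<psi> z *\<^sub>R (G' z - G z)) = (LINT z:U|lebesgue. \<psi> z *\<^sub>R G' z) - (LINT z:U|lebesgue. \<psi> z *\<^sub>R G z)"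
      unfolding set_lebesgue_integral_def scaleR_diff_right by (rule Bochner_Integration.integral_diff[OF i(2,1)])
    also have "\<dots> = 0" using G \<psi> \<psi>' e by (simp add: has_weak_gradient_def)
    finally show "(LINT z:U|lebesgue. \<psi> z *\<^sub>R (G' z - G z)) = 0" .
  qed
  then show ?thesis by eventually_elim simp
qed

lemma integrable_of_nn_finite:
  fixes f :: "'a::euclidean_space \<times> real \<Rightarrow> 'b::euclidean_space"
  assumes m: "(\<lambda>z. indicator U z *\<^sub>R f z) \<in> borel_measurable lebesgue"
    and fin: "(\<integral>\<^sup>+z. ennreal (indicator U z * (snd z powr a * norm (f z))) \<partial>lebesgue) < \<infinity>"
  shows "set_integrable lebesgue U (\<lambda>z. snd z powr a *\<^sub>R f z)"
  unfolding set_integrable_def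
proof (rule integrableI_bounded)
  have pw: "(\<lambda>z::'a \<times> real. snd z powr c) \<in> borel_measurable lebesgue" for c
    by (intro measurable_completion) (simp add: measurable_compose[OF borel_measurable_snd, of "\<lambda>y. y powr c"])
  have "(\<lambda>z. snd z powr a *\<^sub>R (indicator U z *\<^sub>R f z)) \<in> borel_measurable lebesgue"
    by (rule borel_measurable_scaleR[OF pw m])
  then show "(\<lambda>z. indicator U z *\<^sub>R snd z powr a *\<^sub>R f z) \<in> borel_measurable lebesgue" by (simp add: mult.commute)
  have "(\<integral>\<^sup>+z. ennreal (norm (indicator U z *\<^sub>R snd z powr a *\<^sub>R f z)) \<partial>lebesgue) = (\<integral>\<^sup>+z. ennreal (indicator U z * (snd z powr a * norm (f z))) \<partial>lebesgue)"
    by (intro nn_integral_cong) (auto simp: indicator_def)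
  then show "(\<integral>\<^sup>+z. ennreal (norm (indicator U z *\<^sub>R snd z powr a *\<^sub>R f z)) \<partial>lebesgue) < \<infinity>" using fin by simp
qed

text \<open>With even-in-\<open>y\<close> test functions the conormal derivative term vanishes, so the weak equation can
  be integrated by parts once more without a boundary term.\<close>

lemma thin_eigen_identity:
  fixes u \<psi> \<kappa> :: "'a::euclidean_space \<times> real \<Rightarrow> real"
  assumes \<Omega>: "open \<Omega>"
    and Gs: "has_weak_gradient (\<Omega> \<times> {0<..}) u Gs"
    and eqn: "\<And>\<psi>. test_function (\<Omega> \<times> UNIV) \<psi> \<Longrightarrow>
           (LINT z:\<Omega> \<times> {0<..}|lebesgue. snd z powr a * (Gs z \<bullet> grad \<psi> z)) =
           lam * (LINT x:\<Omega>|lebesgue. max (u (x, 0)) 0 * \<psi> (x, 0))"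
    and G: "has_weak_gradient (\<Omega> \<times> {0<..<1}) u G"
    and iu: "set_integrable lebesgue (\<Omega> \<times> {0<..<1}) (\<lambda>z. snd z powr a * u z)"
    and iG: "set_integrable lebesgue (\<Omega> \<times> {0<..<1}) (\<lambda>z. snd z powr a *\<^sub>R G z)"
    and \<psi>: "test_function (\<Omega> \<times> {-1<..<1}) \<psi>"
    and \<kappa>: "\<And>z. frechet_derivative \<psi> (at z) (0, 1) = snd z * \<kappa> z" "continuous_on UNIV \<kappa>" "\<And>z. \<bar>\<kappa> z\<bar> \<le> B\<kappa>"
  shows "lam * (LINT x:\<Omega>|lebesgue. max (u (x, 0)) 0 * \<psi> (x, 0)) =
    - (LINT z:\<Omega> \<times> {0<..<1}|lebesgue. snd z powr a * u z *
        ((\<Sum>b\<in>Basis. frechet_derivative (\<lambda>z. frechet_derivative \<psi> (at z) b) (at z) b) + a * \<kappa> z))"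
proof -
  define U where "U = \<Omega> \<times> {0<..<1::real}"
  have U: "open U" unfolding U_def using \<Omega> by (intro open_Times) auto
  have \<psi>': "test_function (\<Omega> \<times> UNIV) \<psi>" using \<psi> by (auto simp: test_function_def)
  note tf = test_function_facts[OF \<psi>]
  have ibp: "set_integrable lebesgue U (\<lambda>z. snd z powr a * (\<Sum>b\<in>Basis. frechet_derivative \<psi> (at z) b * (G z \<bullet> b)))"
    "(LINT z:U|lebesgue. snd z powr a * (\<Sum>b\<in>Basis. frechet_derivative \<psi> (at z) b * (G z \<bullet> b))) =
      - (LINT z:U|lebesgue. snd z powr a * u z *
        ((\<Sum>b\<in>Basis. frechet_derivative (\<lambda>z. frechet_derivative \<psi> (at z) b) (at z) b) + a * \<kappa> z))"
    using weighted_integration_by_parts(1,3)[OF G iu iG, of \<psi> \<kappa> B\<kappa>] \<psi> \<kappa> by (simp_all add: U_def)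
  have gr: "grad \<psi> z = (\<Sum>b\<in>Basis. frechet_derivative \<psi> (at z) b *\<^sub>R b)" for z by (rule grad_inner(3)[OF tf(3)])
  have dot: "X \<bullet> grad \<psi> z = (\<Sum>b\<in>Basis. frechet_derivative \<psi> (at z) b * (X \<bullet> b))" for X z
    by (simp add: gr inner_sum_right)
  have "(LINT z:\<Omega> \<times> {0<..}|lebesgue. snd z powr a * (Gs z \<bullet> grad \<psi> z)) = (LINT z:U|lebesgue. snd z powr a * (Gs z \<bullet> grad \<psi> z))"
  proof (rule set_integral_cong_support)
    fix z assume "z \<in> \<Omega> \<times> {0<..}" "z \<notin> U"
    then have "z \<notin> closure {z. \<psi> z \<noteq> 0}" using tf(2) by (force simp: U_def)
    then have "grad \<psi> z = 0" using grad_inner(3)[OF test_function_outside(2)] by simp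
    then show "snd z powr a * (Gs z \<bullet> grad \<psi> z) = 0" by simp
  qed (auto simp: U_def)
  also have "\<dots> = (LINT z:U|lebesgue. snd z powr a * (G z \<bullet> grad \<psi> z))"
  proof -
    \<comment> \<open>Integrability of the products with \<open>Gs\<close> up to y = 0 is not given;
      it is inherited from \<open>G\<close>, with which \<open>Gs\<close> agrees off a null
      set.\<close>
    have AEG: "AE z in lebesgue. z \<in> U \<longrightarrow> Gs z = G z"
      by (rule weak_gradient_unique[OF U _ _ Gs]) (use G in \<open>auto simp: U_def\<close>)
    obtain N where N: "N \<in> null_sets lebesgue" "{z \<in> space lebesgue. \<not> (z \<in> U \<longrightarrow> Gs z = G z)} \<subseteq> N"
      using AEG unfolding eventually_ae_filter by blast
    have spike: "snd z powr a * (Gs z \<bullet> grad \<psi> z) = snd z powr a * (G z \<bullet> grad \<psi> z)" if "z \<in> U - N" for z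
      using that N(2) by auto
    have neg: "negligible N" using N(1) by (simp add: negligible_iff_null_sets)
    have iF: "set_integrable lebesgue U (\<lambda>z. snd z powr a * (G z \<bullet> grad \<psi> z))" using ibp(1) by (simp add: dot)
    have iFs: "set_integrable lebesgue U (\<lambda>z. snd z powr a * (Gs z \<bullet> grad \<psi> z))"
      by (rule absolutely_integrable_spike[OF iF neg spike])
    show ?thesis unfolding set_lebesgue_integral_eq_integral(2)[OF iF] set_lebesgue_integral_eq_integral(2)[OF iFs]
      by (rule integral_spike[OF neg]) (simp add: spike)
  qed
  also have "\<dots> = (LINT z:U|lebesgue. snd z powr a * (\<Sum>b\<in>Basis. frechet_derivative \<psi> (at z) b * (G z \<bullet> b)))"
    by (simp add: dot)
  finally show ?thesis using eqn[OF \<psi>'] ibp(2) by (simp add: U_def)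
qed

text \<open>The centres differ because the cutoff stays at \<open>z0\<close> while the kernel
  follows its pole \<open>z1\<close>. Summed over the basis, the quadratic terms become squared
  distances and one mixed inner product, and the second derivatives of the squared norms contribute
  the dimension.\<close>

lemma second_derivatives_radial_product:
  fixes z0 z1 :: "'b::euclidean_space" and S S1 S2 P P1 P2 :: "real \<Rightarrow> real"
  assumes dS: "\<And>t. (S has_real_derivative S1 t) (at t)" "\<And>t. (S1 has_real_derivative S2 t) (at t)"
    and dP: "\<And>t. (P has_real_derivative P1 t) (at t)" "\<And>t. (P1 has_real_derivative P2 t) (at t)"
  defines "A \<equiv> \<lambda>z. (norm (z - z0))\<^sup>2" and "B \<equiv> \<lambda>z. (norm (z - z1))\<^sup>2"
  defines "\<psi> \<equiv> \<lambda>z. S (A z) * P (B z)"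
  shows "frechet_derivative \<psi> (at z) h = 2 * (S1 (A z) * P (B z) * ((z - z0) \<bullet> h) + S (A z) * P1 (B z) * ((z - z1) \<bullet> h))"
    "(\<Sum>b\<in>Basis. frechet_derivative (\<lambda>z. frechet_derivative \<psi> (at z) b) (at z) b) =
      4 * S2 (A z) * P (B z) * A z + 8 * S1 (A z) * P1 (B z) * ((z - z0) \<bullet> (z - z1)) + 4 * S (A z) * P2 (B z) * B z +
      2 * DIM('b) * (S1 (A z) * P (B z) + S (A z) * P1 (B z))"
proof -
  have dA: "(A has_derivative (\<lambda>h. 2 * ((z - z0) \<bullet> h))) (at z)" for z unfolding A_def power2_norm_eq_inner
    by (auto intro!: derivative_eq_intros simp: inner_commute)
  have dB: "(B has_derivative (\<lambda>h. 2 * ((z - z1) \<bullet> h))) (at z)" for z unfolding B_def power2_norm_eq_inner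
    by (auto intro!: derivative_eq_intros simp: inner_commute)
  have comp: "((\<lambda>z. F (C z)) has_derivative (\<lambda>h. F' (C z) * C' h)) (at z)"
    if "\<And>t. (F has_real_derivative F' t) (at t)" "(C has_derivative C') (at z)" for F F' :: "real \<Rightarrow> real" and C C' and z :: 'b
    by (rule has_derivative_compose[OF that(2) that(1)[unfolded has_field_derivative_def]])
  have 1: "frechet_derivative \<psi> (at z) h = 2 * (S1 (A z) * P (B z) * ((z - z0) \<bullet> h) + S (A z) * P1 (B z) * ((z - z1) \<bullet> h))" for z h
  proof -
    have "(\<psi> has_derivative (\<lambda>h. S (A z) * (P1 (B z) * (2 * ((z - z1) \<bullet> h))) + S1 (A z) * (2 * ((z - z0) \<bullet> h)) * P (B z))) (at z)"
      unfolding \<psi>_def by (rule has_derivative_mult[OF comp[OF dS(1) dA] comp[OF dP(1) dB]])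
    then show ?thesis by (simp add: frechet_derivative_eq algebra_simps)
  qed
  then show "frechet_derivative \<psi> (at z) h = 2 * (S1 (A z) * P (B z) * ((z - z0) \<bullet> h) + S (A z) * P1 (B z) * ((z - z1) \<bullet> h))" .
  have 2: "frechet_derivative (\<lambda>z. frechet_derivative \<psi> (at z) b) (at z) b =
     4 * S2 (A z) * P (B z) * ((z - z0) \<bullet> b)\<^sup>2 + 8 * S1 (A z) * P1 (B z) * (((z - z0) \<bullet> b) * ((z - z1) \<bullet> b)) +
     4 * S (A z) * P2 (B z) * ((z - z1) \<bullet> b)\<^sup>2 + 2 * (S1 (A z) * P (B z) + S (A z) * P1 (B z))" if b: "b \<in> Basis" for b
  proof -
    have l: "((\<lambda>z. (z - c) \<bullet> b) has_derivative (\<lambda>h. h \<bullet> b)) (at z)" for c z by (auto intro!: derivative_eq_intros)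
    have d1: "((\<lambda>z. S1 (A z) * P (B z)) has_derivative (\<lambda>h. S1 (A z) * (P1 (B z) * (2 * ((z - z1) \<bullet> h))) + S2 (A z) * (2 * ((z - z0) \<bullet> h)) * P (B z))) (at z)"
      by (rule has_derivative_mult[OF comp[OF dS(2) dA] comp[OF dP(1) dB]])
    have d2: "((\<lambda>z. S (A z) * P1 (B z)) has_derivative (\<lambda>h. S (A z) * (P2 (B z) * (2 * ((z - z1) \<bullet> h))) + S1 (A z) * (2 * ((z - z0) \<bullet> h)) * P1 (B z))) (at z)"
      by (rule has_derivative_mult[OF comp[OF dS(1) dA] comp[OF dP(2) dB]])
    have "((\<lambda>z. 2 * (S1 (A z) * P (B z) * ((z - z0) \<bullet> b) + S (A z) * P1 (B z) * ((z - z1) \<bullet> b))) has_derivative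
      (\<lambda>h. 2 * ((S1 (A z) * P (B z) * (h \<bullet> b) + (S1 (A z) * (P1 (B z) * (2 * ((z - z1) \<bullet> h))) + S2 (A z) * (2 * ((z - z0) \<bullet> h)) * P (B z)) * ((z - z0) \<bullet> b)) +
        (S (A z) * P1 (B z) * (h \<bullet> b) + (S (A z) * (P2 (B z) * (2 * ((z - z1) \<bullet> h))) + S1 (A z) * (2 * ((z - z0) \<bullet> h)) * P1 (B z)) * ((z - z1) \<bullet> b))))) (at z)"
      by (intro has_derivative_mult_right has_derivative_add has_derivative_mult[OF d1 l] has_derivative_mult[OF d2 l])
    from frechet_derivative_eq[OF this] show ?thesis unfolding 1
      using b by (simp add: inner_same_Basis power2_eq_square algebra_simps)
  qed
  have nA: "(\<Sum>b\<in>Basis. ((z - z0) \<bullet> b)\<^sup>2) = A z" unfolding A_def power2_norm_eq_inner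
    by (subst euclidean_inner[of "z - z0"]) (simp add: power2_eq_square)
  have nB: "(\<Sum>b\<in>Basis. ((z - z1) \<bullet> b)\<^sup>2) = B z" unfolding B_def power2_norm_eq_inner
    by (subst euclidean_inner[of "z - z1"]) (simp add: power2_eq_square)
  have nC: "(\<Sum>b\<in>Basis. ((z - z0) \<bullet> b) * ((z - z1) \<bullet> b)) = (z - z0) \<bullet> (z - z1)" by (rule euclidean_inner[symmetric])
  show "(\<Sum>b\<in>Basis. frechet_derivative (\<lambda>z. frechet_derivative \<psi> (at z) b) (at z) b) =
      4 * S2 (A z) * P (B z) * A z + 8 * S1 (A z) * P1 (B z) * ((z - z0) \<bullet> (z - z1)) + 4 * S (A z) * P2 (B z) * B z +
      2 * DIM('b) * (S1 (A z) * P (B z) + S (A z) * P1 (B z))"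
    unfolding nA[symmetric] nC[symmetric]
    by (simp add: 2 sum.distrib sum_distrib_left[symmetric] nA nB nC)
qed

section \<open>The limit of vanishing width\<close>

lemma tendsto_inverse_Suc: "(\<lambda>m. 1 / real (Suc m)) \<longlonglongrightarrow> 0"
  using LIMSEQ_inverse_real_of_nat by (simp add: inverse_eq_divide)

text \<open>The averages of \<open>u\<close> converge to a multiple of the trace only in \<open>L\<^sup>1\<close>, hence almost everywhere
  along the sequence by Fatou; continuity of both sides upgrades this to every point.\<close>

lemma trace_average_limit:
  fixes u :: "'a::euclidean_space \<times> real \<Rightarrow> real" and v L :: "'a \<Rightarrow> real" and a p \<rho> :: real
    and G :: "'a \<times> real \<Rightarrow> 'a \<times> real"
  defines "\<epsilon> \<equiv> \<lambda>m. 1 / real (Suc m)"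
  assumes \<Omega>: "open \<Omega>" and v: "continuous_on \<Omega> v" and a: "a > -1" and p: "p > 0" "p = real DIM('a) - 1 + a"
    and um: "(\<lambda>z. indicator (\<Omega> \<times> {0<..<1}) z *\<^sub>R u z) \<in> borel_measurable lebesgue"
    and iu: "set_integrable lebesgue (\<Omega> \<times> {0<..<1}) (\<lambda>z. snd z powr a * u z)"
    and Gm: "(\<lambda>z. indicator (\<Omega> \<times> {0<..<1}) z *\<^sub>R G z) \<in> borel_measurable lebesgue"
    and Gfin: "(\<integral>\<^sup>+z. ennreal (indicator (\<Omega> \<times> {0<..<1}) z * (snd z powr 0 * norm (G z))) \<partial>lebesgue) < \<infinity>"
    and tr: "\<And>\<epsilon>. 0 < \<epsilon> \<Longrightarrow> \<epsilon> \<le> 1 \<Longrightarrow>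
      (\<integral>\<^sup>+z. ennreal (indicator (\<Omega> \<times> {0<..<\<epsilon>}) z * (snd z powr a * \<bar>u z - v (fst z)\<bar>)) \<partial>lebesgue) \<le>
      ennreal (\<epsilon> powr (a + 1) / (a + 1)) * (\<integral>\<^sup>+z. ennreal (indicator (\<Omega> \<times> {0<..<\<epsilon>}) z * norm (G z)) \<partial>lebesgue)"
    and ctf: "\<And>z. norm (z - (x0, 0)) \<le> \<rho> \<Longrightarrow> ctf z = 1" and \<rho>: "\<rho> > 0" "ball x0 \<rho> \<subseteq> \<Omega>"
    and L: "\<And>x'. x' \<in> ball x0 (\<rho> / 2) \<Longrightarrow>
      (\<lambda>m. LINT z:\<Omega> \<times> {0<..<1}|lebesgue. snd z powr a * u z * (ctf z * bumpS p (\<epsilon> m) ((norm (z - (x', 0)))\<^sup>2))) \<longlonglongrightarrow> L x'"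
    and cL: "continuous_on (ball x0 (\<rho> / 2)) L"
  obtains c where "c > 0" "\<And>x'. x' \<in> ball x0 (\<rho> / 2) \<Longrightarrow> L x' = c * v x'"
proof -
  define U where "U = \<Omega> \<times> {0<..<1::real}"
  have U: "open U" unfolding U_def using \<Omega> by (intro open_Times) auto
  have \<epsilon>: "\<epsilon> m > 0" "\<epsilon> m \<le> 1" for m by (auto simp: \<epsilon>_def)
  have \<epsilon>0: "\<epsilon> \<longlonglongrightarrow> 0" unfolding \<epsilon>_def by (rule tendsto_inverse_Suc)
  have pw: "(\<lambda>z::'a \<times> real. snd z powr c) \<in> borel_measurable lebesgue" for c
    by (intro measurable_completion) (simp add: measurable_compose[OF borel_measurable_snd, of "\<lambda>y. y powr c"])
  have Ui: "indicator U \<in> borel_measurable lebesgue" using U by (intro borel_measurable_indicator) auto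
  obtain c where c: "c > 0" "\<And>\<epsilon> x'. \<epsilon> > 0 \<Longrightarrow>
      (\<integral>\<^sup>+z. ennreal (indicator {z. snd z > 0} z * (snd z powr a * bumpS p \<epsilon> ((norm (z - (x'::'a, 0)))\<^sup>2))) \<partial>lborel) = ennreal c"
    using bump_mass[OF p(1) a p(2)] by blast
  define f where "f z = ennreal (indicator U z * (snd z powr a * \<bar>u z - v (fst z)\<bar>))" for z
  have fm: "f \<in> borel_measurable lebesgue"
  proof -
    have "(\<lambda>z. indicator U z *\<^sub>R v (fst z)) \<in> borel_measurable borel"
      by (rule borel_measurable_continuous_on_indicator)
        (use U in \<open>auto simp: U_def intro!: continuous_on_compose2[OF v] continuous_intros\<close>)
    then have "(\<lambda>z. indicator U z *\<^sub>R v (fst z)) \<in> borel_measurable lebesgue" by (intro measurable_completion) simp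
    with um have m: "(\<lambda>z. indicator U z *\<^sub>R u z - indicator U z *\<^sub>R v (fst z)) \<in> borel_measurable lebesgue"
      unfolding U_def by (rule borel_measurable_diff)
    have "f z = ennreal (snd z powr a * norm (indicator U z *\<^sub>R u z - indicator U z *\<^sub>R v (fst z)))" for z
      by (cases "z \<in> U") (auto simp: f_def)
    then have e: "f = (\<lambda>z. ennreal (snd z powr a * norm (indicator U z *\<^sub>R u z - indicator U z *\<^sub>R v (fst z))))" by (rule ext)
    show ?thesis unfolding e
      by (rule measurable_compose[OF borel_measurable_times[OF pw measurable_compose[OF m borel_measurable_norm]] measurable_ennreal])
  qed
  define b where "b m x' z = bumpS p (\<epsilon> m) ((norm (z - (x', 0)))\<^sup>2)" for m x' and z :: "'a \<times> real"
  have b0: "b m x' z \<ge> 0" for m x' z unfolding b_def by (rule bumpS_nonneg[OF p(1) \<epsilon>(1)])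
  define D where "D m x' = (\<integral>\<^sup>+z. f z * ennreal (b m x' z) \<partial>lebesgue)" for m x'
  define E where "E m = (\<integral>\<^sup>+z. ennreal (indicator (\<Omega> \<times> {0<..<\<epsilon> m}) z * norm (G z)) \<partial>lebesgue)" for m
  \<comment> \<open>The strips shrink to the empty set, and the gradient on the unit cylinder is an
    integrable majorant.\<close>
  have E0: "E \<longlonglongrightarrow> 0"
  proof -
    have "E \<longlonglongrightarrow> (\<integral>\<^sup>+z. 0 \<partial>(lebesgue :: ('a \<times> real) measure))" unfolding E_def[abs_def]
    proof (rule nn_integral_dominated_convergence[where w = "\<lambda>z. ennreal (indicator U z * (snd z powr 0 * norm (G z)))"])
      have nG: "(\<lambda>z. norm (indicator U z *\<^sub>R G z)) \<in> borel_measurable lebesgue"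
        using measurable_compose[OF Gm borel_measurable_norm] by (simp add: U_def)
      show "(\<lambda>z. ennreal (indicator (\<Omega> \<times> {0<..<\<epsilon> m}) z * norm (G z))) \<in> borel_measurable lebesgue" for m
      proof -
        have "indicator (\<Omega> \<times> {0<..<\<epsilon> m}) z * norm (G z) = indicator (\<Omega> \<times> {0<..<\<epsilon> m}) z * norm (indicator U z *\<^sub>R G z)" for z
          using \<epsilon>(2)[of m] by (auto simp: indicator_def U_def)
        then have e: "(\<lambda>z. indicator (\<Omega> \<times> {0<..<\<epsilon> m}) z * norm (G z)) = (\<lambda>z. indicator (\<Omega> \<times> {0<..<\<epsilon> m}) z * norm (indicator U z *\<^sub>R G z))" by (rule ext)
        have "open (\<Omega> \<times> {0<..<\<epsilon> m})" using \<Omega> by (intro open_Times) auto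
        then have "indicator (\<Omega> \<times> {0<..<\<epsilon> m}) \<in> borel_measurable lebesgue" by (intro borel_measurable_indicator) auto
        from borel_measurable_times[OF this nG] show ?thesis unfolding e[symmetric] by (rule measurable_compose[OF _ measurable_ennreal])
      qed
      have "indicator U z * (snd z powr 0 * norm (G z)) = snd z powr 0 * norm (indicator U z *\<^sub>R G z)" for z
        by (cases "z \<in> U") auto
      then have e: "(\<lambda>z. indicator U z * (snd z powr 0 * norm (G z))) = (\<lambda>z. snd z powr 0 * norm (indicator U z *\<^sub>R G z))" by (rule ext)
      from borel_measurable_times[OF pw[of 0] nG]
      show "(\<lambda>z. ennreal (indicator U z * (snd z powr 0 * norm (G z)))) \<in> borel_measurable lebesgue"
        unfolding e[symmetric] by (rule measurable_compose[OF _ measurable_ennreal])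
      show "AE z in lebesgue. ennreal (indicator (\<Omega> \<times> {0<..<\<epsilon> m}) z * norm (G z)) \<le> ennreal (indicator U z * (snd z powr 0 * norm (G z)))" for m
        using \<epsilon>(2)[of m] by (intro AE_I2 ennreal_leI) (auto simp: indicator_def U_def)
      show "(\<integral>\<^sup>+z. ennreal (indicator U z * (snd z powr 0 * norm (G z))) \<partial>lebesgue) < \<infinity>" using Gfin by (simp only: U_def)
      show "AE z in lebesgue. (\<lambda>m. ennreal (indicator (\<Omega> \<times> {0<..<\<epsilon> m}) z * norm (G z))) \<longlonglongrightarrow> 0"
      proof (rule AE_I2)
        fix z :: "'a \<times> real"
        have "\<forall>\<^sub>F m in sequentially. z \<notin> \<Omega> \<times> {0<..<\<epsilon> m}"
        proof (cases "snd z > 0")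
          case True
          then have "\<forall>\<^sub>F m in sequentially. \<epsilon> m < snd z" using order_tendstoD(2)[OF \<epsilon>0] by blast
          then show ?thesis by eventually_elim (cases z, auto)
        next
          case False
          then have "z \<notin> \<Omega> \<times> {0<..<\<epsilon> m}" for m by (cases z) auto
          then show ?thesis by simp
        qed
        then show "(\<lambda>m. ennreal (indicator (\<Omega> \<times> {0<..<\<epsilon> m}) z * norm (G z))) \<longlonglongrightarrow> 0"
          by (intro tendsto_eventually) (erule eventually_mono, simp)
      qed
    qed simp
    then show ?thesis by simp
  qed
  obtain Q where Q: "Q \<ge> 0" and Dm: "\<And>m. D m \<in> borel_measurable lborel"
    and DQ: "\<And>m. (\<integral>\<^sup>+x'. D m x' \<partial>lborel) \<le> ennreal (Q * \<epsilon> m powr (DIM('a) - p - 2)) * (\<integral>\<^sup>+z. f z * indicator {z. \<bar>snd z\<bar> < \<epsilon> m} z \<partial>lebesgue)"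
  proof (rule averaging_bound[OF fm p(1)])
    fix Q :: real assume "Q \<ge> 0"
      "\<And>\<epsilon>. \<epsilon> > 0 \<Longrightarrow> (\<lambda>x'. \<integral>\<^sup>+z. f z * ennreal (bumpS p \<epsilon> ((norm (z - (x', 0)))\<^sup>2)) \<partial>lebesgue) \<in> borel_measurable lborel"
      "\<And>\<epsilon>. \<epsilon> > 0 \<Longrightarrow> (\<integral>\<^sup>+x'. (\<integral>\<^sup>+z. f z * ennreal (bumpS p \<epsilon> ((norm (z - (x', 0)))\<^sup>2)) \<partial>lebesgue) \<partial>lborel) \<le>
      ennreal (Q * \<epsilon> powr (DIM('a) - p - 2)) * (\<integral>\<^sup>+z. f z * indicator {z. \<bar>snd z\<bar> < \<epsilon>} z \<partial>lebesgue)"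
    then show thesis using \<epsilon>(1) by (intro that[of Q]) (auto simp: D_def[abs_def] b_def)
  qed
  \<comment> \<open>The power \<open>n - p - 2\<close> from averaging and \<open>a + 1\<close> from
    the strip cancel for \<open>p = n - 1 + a\<close>, so \<open>E m\<close> alone decides.\<close>
  have DE: "(\<integral>\<^sup>+x'. D m x' \<partial>lborel) \<le> ennreal (Q / (a + 1)) * E m" for m
  proof -
    have "(\<integral>\<^sup>+z. f z * indicator {z. \<bar>snd z\<bar> < \<epsilon> m} z \<partial>lebesgue) = (\<integral>\<^sup>+z. ennreal (indicator (\<Omega> \<times> {0<..<\<epsilon> m}) z * (snd z powr a * \<bar>u z - v (fst z)\<bar>)) \<partial>lebesgue)"
      using \<epsilon>(2)[of m] by (intro nn_integral_cong) (auto simp: f_def U_def indicator_def)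
    also have "\<dots> \<le> ennreal (\<epsilon> m powr (a + 1) / (a + 1)) * E m" unfolding E_def by (rule tr[OF \<epsilon>])
    finally have "(\<integral>\<^sup>+x'. D m x' \<partial>lborel) \<le> ennreal (Q * \<epsilon> m powr (DIM('a) - p - 2)) * (ennreal (\<epsilon> m powr (a + 1) / (a + 1)) * E m)"
      using DQ[of m] by (meson mult_left_mono order_trans zero_le)
    also have "\<dots> = ennreal ((Q * \<epsilon> m powr (DIM('a) - p - 2)) * (\<epsilon> m powr (a + 1) / (a + 1))) * E m"
    proof -
      have "ennreal ((Q * \<epsilon> m powr (DIM('a) - p - 2)) * (\<epsilon> m powr (a + 1) / (a + 1))) =
          ennreal (Q * \<epsilon> m powr (DIM('a) - p - 2)) * ennreal (\<epsilon> m powr (a + 1) / (a + 1))"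
        by (rule ennreal_mult) (use Q a in auto)
      then show ?thesis by (simp only: mult.assoc)
    qed
    also have "(Q * \<epsilon> m powr (DIM('a) - p - 2)) * (\<epsilon> m powr (a + 1) / (a + 1)) = Q / (a + 1) * (\<epsilon> m powr (DIM('a) - p - 2) * \<epsilon> m powr (a + 1))" by simp
    also have "\<epsilon> m powr (DIM('a) - p - 2) * \<epsilon> m powr (a + 1) = \<epsilon> m powr 0" by (rule powr_add_eq) (simp add: p(2))
    finally show ?thesis using \<epsilon>(1)[of m] by simp
  qed
  \<comment> \<open>A liminf of 0 suffices: the averages of \<open>u\<close> are known to converge
    at every \<open>x'\<close>, so their limit may be computed along infinitely many indices
    only.\<close>
  have liminf0: "AE x' in lborel. liminf (\<lambda>m. D m x') = 0"
  proof -
    have lim: "(\<lambda>m. \<integral>\<^sup>+x'. D m x' \<partial>lborel) \<longlonglongrightarrow> 0"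
    proof (rule tendsto_sandwich[OF _ _ tendsto_const])
      have "(\<lambda>m. ennreal (Q / (a + 1)) * E m) \<longlonglongrightarrow> ennreal (Q / (a + 1)) * 0" by (intro ennreal_tendsto_cmult E0) simp
      then show "(\<lambda>m. ennreal (Q / (a + 1)) * E m) \<longlonglongrightarrow> 0" by simp
    qed (use DE in auto)
    have "(\<integral>\<^sup>+x'. liminf (\<lambda>m. D m x') \<partial>lborel) \<le> liminf (\<lambda>m. \<integral>\<^sup>+x'. D m x' \<partial>lborel)" by (rule nn_integral_liminf[OF Dm])
    also have "\<dots> = 0" by (rule lim_imp_Liminf[OF _ lim]) simp
    finally have "(\<integral>\<^sup>+x'. liminf (\<lambda>m. D m x') \<partial>lborel) = 0" by simp
    moreover have "(\<lambda>x'. liminf (\<lambda>m. D m x')) \<in> borel_measurable lborel" using Dm by (intro borel_measurable_liminf)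
    ultimately show ?thesis by (simp add: nn_integral_0_iff_AE)
  qed
  have point: "L x' = c * v x'" if x': "x' \<in> ball x0 (\<rho> / 2)" and l0: "liminf (\<lambda>m. D m x') = 0" for x'
  proof -
    define M where "M m = (LINT z:U|lebesgue. snd z powr a * u z * (ctf z * b m x' z))" for m
    have Mlim: "M \<longlonglongrightarrow> L x'" using L[OF x'] unfolding M_def b_def U_def .
    have x'\<Omega>: "x' \<in> \<Omega>" using x' \<rho> by (auto intro!: subsetD[OF \<rho>(2)])
    \<comment> \<open>Three errors: \<open>M m\<close> against its limit, \<open>u\<close> against
      its trace (\<open>D m x'\<close>), and the oscillation of \<open>v\<close> near
      \<open>x'\<close>, which is weighted with the mass \<open>c\<close>. Together they give
      \<open>2 + c\<close>.\<close>
    have est: "\<bar>L x' - c * v x'\<bar> \<le> \<eta> * (2 + c)" if \<eta>: "\<eta> > 0" for \<eta>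
    proof -
      have "isCont v x'" using v \<Omega> x'\<Omega> by (simp add: continuous_on_eq_continuous_at)
      then obtain \<delta>1 where \<delta>1: "\<delta>1 > 0" "\<And>x. dist x x' < \<delta>1 \<Longrightarrow> \<bar>v x - v x'\<bar> < \<eta>"
        using \<eta> unfolding continuous_at_eps_delta by (auto simp: dist_real_def)
      obtain \<delta>2 where \<delta>2: "\<delta>2 > 0" "ball x' \<delta>2 \<subseteq> \<Omega>" using \<Omega> x'\<Omega> open_contains_ball by blast
      have "\<forall>\<^sub>F m in sequentially. \<epsilon> m < min (min \<delta>1 \<delta>2) (\<rho> / 4)"
        using order_tendstoD(2)[OF \<epsilon>0, of "min (min \<delta>1 \<delta>2) (\<rho> / 4)"] \<delta>1 \<delta>2 \<rho> by simp
      moreover have "\<forall>\<^sub>F m in sequentially. dist (M m) (L x') < \<eta>" by (rule tendstoD[OF Mlim \<eta>])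
      ultimately have ev: "\<forall>\<^sub>F m in sequentially. \<epsilon> m < min (min \<delta>1 \<delta>2) (\<rho> / 4) \<and> dist (M m) (L x') < \<eta>" by (rule eventually_conj)
      have "\<exists>\<^sub>F m in sequentially. D m x' < ennreal \<eta>"
      proof (rule ccontr)
        assume "\<not> (\<exists>\<^sub>F m in sequentially. D m x' < ennreal \<eta>)"
        then have "\<forall>\<^sub>F m in sequentially. ennreal \<eta> \<le> D m x'" by (simp add: not_frequently not_less)
        then have "ennreal \<eta> \<le> liminf (\<lambda>m. D m x')" by (rule Liminf_bounded)
        then show False using l0 \<eta> by simp
      qed
      then have "\<exists>m. D m x' < ennreal \<eta> \<and> \<epsilon> m < min (min \<delta>1 \<delta>2) (\<rho> / 4) \<and> dist (M m) (L x') < \<eta>"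
        using frequently_eventually_frequently[OF _ ev] frequently_ex by fastforce
      then obtain m where m: "D m x' < ennreal \<eta>" "\<epsilon> m < min (min \<delta>1 \<delta>2) (\<rho> / 4)" "dist (M m) (L x') < \<eta>" by blast
      have supp: "dist (fst z) x' < \<epsilon> m" "\<bar>snd z\<bar> < \<epsilon> m" "ctf z = 1" "fst z \<in> \<Omega>" "\<bar>v (fst z) - v x'\<bar> \<le> \<eta>" if "b m x' z \<noteq> 0" for z
      proof -
        show 1: "dist (fst z) x' < \<epsilon> m" "\<bar>snd z\<bar> < \<epsilon> m" using bumpS_supp[OF p(1) \<epsilon>(1)[of m] that[unfolded b_def]] .
        show "fst z \<in> \<Omega>" using 1(1) m(2) by (intro subsetD[OF \<delta>2(2)]) (simp add: dist_commute)
        show "\<bar>v (fst z) - v x'\<bar> \<le> \<eta>" using \<delta>1(2)[of "fst z"] 1(1) m(2) by simp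
        have "norm (z - (x0, 0)) \<le> norm (fst z - x0) + norm (snd z)"
          using norm_Pair_le[of "fst z - x0" "snd z"] by (cases z) simp
        also have "norm (fst z - x0) \<le> dist (fst z) x' + dist x' x0" using dist_triangle[of "fst z" x0 x'] by (simp add: dist_norm)
        finally have "norm (z - (x0, 0)) \<le> \<rho>" using 1 m(2) x' by (simp add: dist_commute)
        then show "ctf z = 1" by (rule ctf)
      qed
      have bm: "b m x' \<in> borel_measurable lebesgue" unfolding b_def
        by (intro borel_measurable_lebesgue_continuous continuous_on_compose2[OF continuous_bumpS[OF p(1)]] continuous_intros) auto
      have mass: "(\<integral>\<^sup>+z. ennreal (indicator {z. snd z > 0} z * (snd z powr a * b m x' z)) \<partial>lebesgue) = ennreal c"
        unfolding nn_integral_completion b_def by (rule c(2)[OF \<epsilon>(1)])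
      define W where "W z = indicator U z * (snd z powr a * b m x' z)" for z
      \<comment> \<open>On the support of the bump the cylinder and the half space coincide, so the
        bump has its full mass \<open>c\<close> inside the cylinder.\<close>
      have WU: "W z = indicator {z. snd z > 0} z * (snd z powr a * b m x' z)" for z
        using supp(2,4)[of z] \<epsilon>(2)[of m] by (cases "b m x' z = 0"; cases z) (auto simp: W_def U_def indicator_def)
      have W0: "W z \<ge> 0" for z using b0 by (simp add: W_def)
      have Wm: "W \<in> borel_measurable lebesgue" unfolding W_def[abs_def]
        by (rule borel_measurable_times[OF Ui borel_measurable_times[OF pw bm]])
      have massW: "(\<integral>\<^sup>+z. ennreal (W z) \<partial>lebesgue) = ennreal c" unfolding WU by (rule mass)
      have Wi: "integrable lebesgue W" by (rule integrableI_nonneg[OF Wm]) (use W0 massW in auto)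
      have WI: "(LINT z|lebesgue. W z) = c"
        using nn_integral_eq_integral[OF Wi] W0 massW c(1) by (simp add: integral_nonneg_AE)
      have MW: "(\<lambda>z. indicator U z *\<^sub>R (snd z powr a * u z * (ctf z * b m x' z))) = (\<lambda>z. W z * u z)"
      proof
        fix z show "indicator U z *\<^sub>R (snd z powr a * u z * (ctf z * b m x' z)) = W z * u z"
          using supp(3)[of z] by (cases "b m x' z = 0") (simp_all add: W_def)
      qed
      obtain Bb where Bb: "Bb > 0" "\<And>t. bump p t \<le> Bb" using bump_bounded[OF p(1)] by blast
      have Wu: "integrable lebesgue (\<lambda>z. W z * u z)"
      proof -
        have "integrable lebesgue (\<lambda>z. (indicator U z *\<^sub>R (snd z powr a * u z)) *\<^sub>R b m x' z)"
        proof (rule integrable_mult_bounded[OF _ bm])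
          show "integrable lebesgue (\<lambda>z. indicator U z *\<^sub>R (snd z powr a * u z))" using iu by (simp add: set_integrable_def U_def)
          show "norm (b m x' z) \<le> \<epsilon> m powr (- p - 2) * Bb" for z
            using b0[of m x' z] Bb(2) by (simp add: b_def bumpS_def mult_left_mono)
        qed
        then show ?thesis by (simp add: W_def mult_ac)
      qed
      have "M m - c * v x' = (LINT z|lebesgue. W z * u z - v x' * W z)"
        unfolding M_def set_lebesgue_integral_def MW using Wu Wi WI by simp
      then have "ennreal \<bar>M m - c * v x'\<bar> \<le> (\<integral>\<^sup>+z. ennreal (norm (W z * u z - v x' * W z)) \<partial>lebesgue)"
        using integral_norm_bound_ennreal[of lebesgue "\<lambda>z. W z * u z - v x' * W z"] Wu Wi by simp
      also have "\<dots> \<le> (\<integral>\<^sup>+z. f z * ennreal (b m x' z) + ennreal \<eta> * ennreal (W z) \<partial>lebesgue)"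
      proof (rule nn_integral_mono)
        fix z
        show "ennreal (norm (W z * u z - v x' * W z)) \<le> f z * ennreal (b m x' z) + ennreal \<eta> * ennreal (W z)"
        proof (cases "b m x' z = 0 \<or> z \<notin> U")
          case False
          have "norm (W z * u z - v x' * W z) = W z * \<bar>u z - v x'\<bar>"
          proof -
            have "W z * u z - v x' * W z = W z * (u z - v x')" by (simp add: algebra_simps)
            then show ?thesis using W0[of z] by (simp add: abs_mult)
          qed
          also have "\<dots> \<le> W z * (\<bar>u z - v (fst z)\<bar> + \<eta>)" using supp(5)[of z] False W0[of z] by (intro mult_left_mono) auto
          finally have "norm (W z * u z - v x' * W z) \<le> W z * \<bar>u z - v (fst z)\<bar> + \<eta> * W z" by (simp add: algebra_simps)
          then have "ennreal (norm (W z * u z - v x' * W z)) \<le> ennreal (W z * \<bar>u z - v (fst z)\<bar> + \<eta> * W z)" by (rule ennreal_leI)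
          also have "\<dots> = ennreal (W z * \<bar>u z - v (fst z)\<bar>) + ennreal \<eta> * ennreal (W z)"
            using W0[of z] \<eta> by (simp add: ennreal_mult)
          also have "ennreal (W z * \<bar>u z - v (fst z)\<bar>) = f z * ennreal (b m x' z)"
            using False b0[of m x' z] by (simp add: f_def W_def ennreal_mult[symmetric] mult_ac)
          finally show ?thesis .
        qed (auto simp: W_def)
      qed
      also have "\<dots> = D m x' + ennreal \<eta> * ennreal c"
      proof -
        have "(\<lambda>z. f z * ennreal (b m x' z)) \<in> borel_measurable lebesgue"
          using measurable_compose[OF bm measurable_ennreal] by (rule borel_measurable_times_ennreal[OF fm])
        moreover have We: "(\<lambda>z. ennreal (W z)) \<in> borel_measurable lebesgue" by (rule measurable_compose[OF Wm measurable_ennreal])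
        ultimately show ?thesis
          by (subst nn_integral_add) (auto simp: D_def nn_integral_cmult[OF We] massW)
      qed
      also have "\<dots> \<le> ennreal \<eta> + ennreal \<eta> * ennreal c" using m(1) by (intro add_right_mono) simp
      also have "\<dots> = ennreal (\<eta> + \<eta> * c)" using \<eta> c(1) by (simp add: ennreal_mult)
      finally have e: "ennreal \<bar>M m - c * v x'\<bar> \<le> ennreal (\<eta> + \<eta> * c)" .
      have "0 \<le> \<eta> + \<eta> * c" using \<eta> c(1) by simp
      from e[unfolded ennreal_le_iff[OF this]] have "\<bar>M m - c * v x'\<bar> \<le> \<eta> + \<eta> * c" .
      then show ?thesis using m(3) by (simp add: dist_real_def algebra_simps)
    qed
    show ?thesis
    proof (rule ccontr)
      assume ne: "L x' \<noteq> c * v x'"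
      define d where "d = \<bar>L x' - c * v x'\<bar>"
      have d: "d > 0" using ne by (simp add: d_def)
      have "d \<le> d / (2 * (2 + c)) * (2 + c)" unfolding d_def by (rule est) (use d c(1) in \<open>simp add: d_def\<close>)
      also have "\<dots> = d / 2" using c(1) by (simp add: field_simps)
      finally show False using d by simp
    qed
  qed
  show ?thesis
  proof (rule that[OF c(1)])
    fix x' assume x': "x' \<in> ball x0 (\<rho> / 2)"
    \<comment> \<open>Two continuous functions differ on an open set; here it is null, hence
      empty.\<close>
    define O1 where "O1 = ball x0 (\<rho> / 2) \<inter> (\<lambda>x. L x - c * v x) -` (- {0})"
    have "continuous_on (ball x0 (\<rho> / 2)) v" by (rule continuous_on_subset[OF v]) (use \<rho> in auto)
    then have "open O1" unfolding O1_def by (intro continuous_open_preimage continuous_intros cL) auto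
    moreover have "AE x in lebesgue. x \<notin> O1"
      using AE_completion[OF liminf0] by eventually_elim (use point in \<open>auto simp: O1_def\<close>)
    then have "negligible O1" using \<open>open O1\<close> by (simp add: negligible_iff_null_sets AE_iff_null_sets)
    ultimately have "O1 = {}" using open_not_negligible by blast
    then show "L x' = c * v x'" using x' by (auto simp: O1_def)
  qed
qed

text \<open>The test function is the cutoff times the truncated kernel with pole
  \<open>(x', 0)\<close>. Its weighted Laplacian consists of minus the cut off bump, whose pairing
  with u tends to \<open>c * u (x', 0)\<close>, and of terms containing a derivative of the cutoff.
  These live on the shell, where the kernel is the exact power, and make up
  \<open>E\<close>.\<close>

lemma thin_eigen_representation:
  fixes \<Omega> :: "'a::euclidean_space set" and u :: "'a \<times> real \<Rightarrow> real" and s a p lam \<rho> :: real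
  assumes \<Omega>: "open \<Omega>" "bounded \<Omega>" and s: "0 < s" "s < 1" "a = 1 - 2 * s"
    and sol: "thin_eigen_solution a lam \<Omega> u" and cv: "continuous_on \<Omega> (\<lambda>x. u (x, 0))"
    and p: "p = real DIM('a) - 2 * s" "p > 0"
    and \<rho>: "0 < \<rho>" "2 * \<rho> < 1" "cball x0 (2 * \<rho>) \<subseteq> \<Omega>"
  obtains S c E where "\<And>k. Ck_on k S UNIV" "\<And>t. 0 \<le> S t" "\<And>t. S t \<le> 1" "\<And>t. t \<ge> 2 * \<rho>\<^sup>2 \<Longrightarrow> S t = 0" "c > 0"
    "\<And>k. Ck_on k E (ball x0 (\<rho> / 2))"
    "\<And>x'. x' \<in> ball x0 (\<rho> / 2) \<Longrightarrow> c * u (x', 0) =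
      lam * (2 / p) * (LINT x|lborel. (max (u (x, 0)) 0 * S ((norm (x - x0))\<^sup>2)) * norm (x - x') powr (- p)) + E x'"
proof -
  define U where "U = \<Omega> \<times> {0<..<1::real}"
  define v where "v x = u (x, 0)" for x
  define z0 where "z0 = (x0, 0::real)"
  have a: "a > -1" "a < 1" and pa: "p = real DIM('a) - 1 + a" using s p by auto
  have U: "open U" unfolding U_def using \<Omega> by (intro open_Times) auto
  have tr: "has_trace a \<Omega> 1 u v" using sol by (simp add: thin_eigen_solution_def v_def[abs_def])
  have cv': "continuous_on \<Omega> v" using cv by (simp add: v_def[abs_def])
  obtain G where G: "has_weak_gradient U u G"
    and um: "(\<lambda>z. indicator U z *\<^sub>R u z) \<in> borel_measurable lebesgue" and Gm: "(\<lambda>z. indicator U z *\<^sub>R G z) \<in> borel_measurable lebesgue"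
    and uf: "(\<integral>\<^sup>+z. ennreal (indicator U z * (snd z powr a * norm (u z))) \<partial>lebesgue) < \<infinity>"
    and Gf: "(\<integral>\<^sup>+z. ennreal (indicator U z * (snd z powr a * norm (G z))) \<partial>lebesgue) < \<infinity>"
    and Gf0: "(\<integral>\<^sup>+z. ennreal (indicator U z * (snd z powr 0 * norm (G z))) \<partial>lebesgue) < \<infinity>"
    and trb: "\<And>\<epsilon>. 0 < \<epsilon> \<Longrightarrow> \<epsilon> \<le> 1 \<Longrightarrow>
      (\<integral>\<^sup>+z. ennreal (indicator (\<Omega> \<times> {0<..<\<epsilon>}) z * (snd z powr a * \<bar>u z - v (fst z)\<bar>)) \<partial>lebesgue) \<le>
      ennreal (\<epsilon> powr (a + 1) / (a + 1)) * (\<integral>\<^sup>+z. ennreal (indicator (\<Omega> \<times> {0<..<\<epsilon>}) z * norm (G z)) \<partial>lebesgue)"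
    by (rule trace_estimate[OF \<Omega> zero_less_one a tr cv', folded U_def]) (rule that; assumption)
  have iu: "set_integrable lebesgue U (\<lambda>z. snd z powr a * u z)" using integrable_of_nn_finite[OF um uf] by simp
  have iG: "set_integrable lebesgue U (\<lambda>z. snd z powr a *\<^sub>R G z)" by (rule integrable_of_nn_finite[OF Gm Gf])
  obtain Gs where Gs: "has_weak_gradient (\<Omega> \<times> {0<..}) u Gs"
    and eqn: "\<And>\<psi>. test_function (\<Omega> \<times> UNIV) \<psi> \<Longrightarrow>
           (LINT z:\<Omega> \<times> {0<..}|lebesgue. snd z powr a * (Gs z \<bullet> grad \<psi> z)) =
           lam * (LINT x:\<Omega>|lebesgue. max (u (x, 0)) 0 * \<psi> (x, 0))"
    using sol unfolding thin_eigen_solution_def by blast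
  obtain S S1 S2 :: "real \<Rightarrow> real" where Sk: "\<And>k. Ck_on k S UNIV" "\<And>k. Ck_on k S1 UNIV" "continuous_on UNIV S2"
    and dS: "\<And>t. (S has_real_derivative S1 t) (at t)" "\<And>t. (S1 has_real_derivative S2 t) (at t)"
    and S01: "\<And>t. 0 \<le> S t" "\<And>t. S t \<le> 1" and Sin: "\<And>t. t \<le> \<rho>\<^sup>2 \<Longrightarrow> S t = 1" and Sout: "\<And>t. t \<ge> 2 * \<rho>\<^sup>2 \<Longrightarrow> S t = 0"
    and Sshell: "\<And>t. S1 t \<noteq> 0 \<or> S2 t \<noteq> 0 \<Longrightarrow> \<rho>\<^sup>2 \<le> t \<and> t \<le> 2 * \<rho>\<^sup>2"
    by (rule radial_cutoff_exists[OF \<rho>(1)]) (rule that; assumption)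
  have cS: "continuous_on UNIV S" "continuous_on UNIV S1" using Ck_on_imp_continuous_on[OF Sk(1)[of 0]] Ck_on_imp_continuous_on[OF Sk(2)[of 0]] by auto
  define A where "A z = (norm (z - z0))\<^sup>2" for z
  have cA: "continuous_on UNIV A" unfolding A_def by (intro continuous_intros)
  have comp: "continuous_on UNIV (\<lambda>z. F (A z))" if "continuous_on UNIV F" for F :: "real \<Rightarrow> real"
    by (rule continuous_on_compose2[OF that cA]) auto
  \<comment> \<open>The radius \<open>sqrt 2 * \<rho>\<close> is rounded up to
    \<open>2 * \<rho>\<close>; since this is below 1, the supports stay in the cylinder of height
    1.\<close>
  have Aball: "z \<in> cball z0 (2 * \<rho>)" if "A z \<le> 2 * \<rho>\<^sup>2" for z
  proof -
    have "A z \<le> (2 * \<rho>)\<^sup>2" using that by (simp add: power_mult_distrib) (use zero_le_power2[of \<rho>] in linarith)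
    then have "norm (z - z0) \<le> 2 * \<rho>" unfolding A_def by (rule power2_le_imp_le) (use \<rho> in auto)
    then show ?thesis by (simp add: dist_norm norm_minus_commute)
  qed
  have cbU: "cball z0 (2 * \<rho>) \<subseteq> \<Omega> \<times> {-1<..<1}"
  proof
    fix z assume "z \<in> cball z0 (2 * \<rho>)"
    then have n: "norm (z - z0) \<le> 2 * \<rho>" by (simp add: dist_norm norm_minus_commute)
    have "norm (fst z - x0) \<le> norm (z - z0)" "\<bar>snd z\<bar> \<le> norm (z - z0)"
      using norm_fst_le[of "fst z - x0" "snd z"] norm_snd_le[of "snd z" "fst z - x0"] by (cases z; simp add: z0_def)+
    then have "fst z \<in> cball x0 (2 * \<rho>)" "\<bar>snd z\<bar> < 1" using n \<rho> by (auto simp: dist_norm norm_minus_commute)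
    then show "z \<in> \<Omega> \<times> {-1<..<1}" using \<rho>(3) by (cases z) auto
  qed
  define Iu where "Iu z = indicator U z *\<^sub>R (snd z powr a * u z)" for z
  have Iu: "integrable lebesgue Iu" using iu by (simp add: set_integrable_def Iu_def[abs_def])
  \<comment> \<open>The shell terms, sorted by their dependence on \<open>x'\<close>. Polarisation
    replaces the mixed inner product by \<open>(A z + B z - d2) / 2\<close> with
    \<open>d2 = \<bar>x' - x0\<bar>^2\<close>, so that \<open>x'\<close> is left only in powers of
    the distance to the pole and in the factor \<open>d2\<close>. The coefficient
    \<open>8 / p\<close> of \<open>S1\<close> is \<open>4 * (p + 2) / p - 4\<close>.\<close>
  define w1 where "w1 z = (8 / p) * (S2 (A z) * A z + S1 (A z))" for z
  define w2 where "w2 z = - 4 * S1 (A z) * A z" for z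
  define w3 where "w3 z = 4 * S1 (A z)" for z
  have wc: "continuous_on UNIV w1" "continuous_on UNIV w2" "continuous_on UNIV w3"
    unfolding w1_def w2_def w3_def by (intro continuous_intros comp Sk(3) cS cA)+
  have wshell: "\<rho>\<^sup>2 \<le> A z \<and> A z \<le> 2 * \<rho>\<^sup>2" if "w1 z \<noteq> 0 \<or> w2 z \<noteq> 0 \<or> w3 z \<noteq> 0" for z
    by (rule Sshell) (use that in \<open>auto simp: w1_def w2_def w3_def\<close>)
  \<comment> \<open>The shell starts at distance \<rho> from \<open>z0\<close> and the poles stay
    within \<open>\<rho> / 2\<close> of it, so the shell is uniformly away from all poles.\<close>
  have far: "\<rho> / 2 \<le> norm (z - (y, 0))" if "\<rho>\<^sup>2 \<le> A z" "y \<in> ball x0 (\<rho> / 2)" for z y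
  proof -
    have "\<rho> \<le> norm (z - z0)" using that(1) unfolding A_def by (rule power2_le_imp_le) simp
    moreover have "norm (z - z0) \<le> norm (z - (y, 0)) + norm ((y, 0) - z0)" using norm_triangle_ineq[of "z - (y, 0)" "(y, 0) - z0"] by simp
    moreover have "norm ((y, 0) - z0) = dist x0 y" by (simp add: z0_def norm_Pair dist_norm norm_minus_commute)
    ultimately show ?thesis using that(2) by simp
  qed
  have wint: "integrable lebesgue (\<lambda>z. Iu z * w z)" "\<And>k q. q > 0 \<Longrightarrow> Ck_on k (\<lambda>y. LINT z|lebesgue. (Iu z * w z) * norm (z - (y, 0)) powr (- q)) (ball x0 (\<rho> / 2))"
    "\<And>q y. q > 0 \<Longrightarrow> y \<in> ball x0 (\<rho> / 2) \<Longrightarrow> integrable lebesgue (\<lambda>z. (Iu z * w z) * norm (z - (y, 0)) powr (- q))"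
    if cw: "continuous_on UNIV w" and sw: "\<And>z. w z \<noteq> 0 \<Longrightarrow> \<rho>\<^sup>2 \<le> A z \<and> A z \<le> 2 * \<rho>\<^sup>2" for w
  proof -
    have "w z = 0" if "z \<notin> cball z0 (2 * \<rho>)" for z using sw[of z] Aball[of z] that by blast
    then obtain B where B: "\<And>z. norm (w z) \<le> B" using continuous_compact_support_bounded[OF cw compact_cball] by blast
    show iw: "integrable lebesgue (\<lambda>z. Iu z * w z)"
      using integrable_mult_bounded[OF Iu borel_measurable_lebesgue_continuous[OF cw] B] by simp
    have fst_bd: "norm (fst z) \<le> norm x0 + 2 * \<rho>" if "Iu z * w z \<noteq> 0" for z
    proof -
      have "z \<in> cball z0 (2 * \<rho>)" using sw[of z] that Aball by auto
      then have "norm (z - z0) \<le> 2 * \<rho>" by (simp add: dist_norm norm_minus_commute)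
      then have "norm (fst z - x0) \<le> 2 * \<rho>" using norm_fst_le[of "fst z - x0" "snd z"] by (cases z) (simp add: z0_def)
      then show ?thesis using norm_triangle_sub[of "fst z" x0] by simp
    qed
    show "Ck_on k (\<lambda>y. LINT z|lebesgue. (Iu z * w z) * norm (z - (y, 0)) powr (- q)) (ball x0 (\<rho> / 2))" if "q > 0" for k q
      by (rule Ck_on_regular_potential[where \<delta> = "\<rho> / 2" and R = "norm x0 + 2 * \<rho>", OF _ that iw])
        (use \<rho> sw far fst_bd in auto)
    fix q y assume q: "q > (0::real)" and y: "y \<in> ball x0 (\<rho> / 2)"
    have "integrable lebesgue (\<lambda>z. Iu z *\<^sub>R (w z * norm (z - (y, 0)) powr (- q)))"
    proof (rule integrable_mult_bounded[OF Iu])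
      have "(\<lambda>z::'a \<times> real. norm (z - (y, 0)) powr (- q)) \<in> borel_measurable lebesgue" by (intro measurable_completion) simp
      then show "(\<lambda>z. w z * norm (z - (y, 0)) powr (- q)) \<in> borel_measurable lebesgue"
        by (rule borel_measurable_times[OF borel_measurable_lebesgue_continuous[OF cw]])
      show "norm (w z * norm (z - (y, 0)) powr (- q)) \<le> B * (\<rho> / 2) powr (- q)" for z
      proof (cases "w z = 0")
        case True
        have "0 \<le> B" using B[of z] norm_ge_zero order_trans by blast
        then show ?thesis using True by simp
      next
        case False
        have "norm (z - (y, 0)) powr (- q) \<le> (\<rho> / 2) powr (- q)" using far[OF _ y] sw[OF False] \<rho> q by (intro powr_mono2') auto
        then show ?thesis using B[of z] by (simp add: abs_mult) (intro mult_mono, auto intro: order_trans[OF abs_ge_zero])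
      qed
    qed
    then show "integrable lebesgue (\<lambda>z. (Iu z * w z) * norm (z - (y, 0)) powr (- q))" by (simp add: mult.assoc)
  qed
  define F where "F q w y = (LINT z|lebesgue. (Iu z * w z) * norm (z - (y, 0)) powr (- q))" for q w y
  define E where "E y = F p w1 y + F (p + 2) w2 y + (norm (y - x0))\<^sup>2 * F (p + 2) w3 y" for y
  have W1: "\<And>z. w1 z \<noteq> 0 \<Longrightarrow> \<rho>\<^sup>2 \<le> A z \<and> A z \<le> 2 * \<rho>\<^sup>2" "\<And>z. w2 z \<noteq> 0 \<Longrightarrow> \<rho>\<^sup>2 \<le> A z \<and> A z \<le> 2 * \<rho>\<^sup>2"
    "\<And>z. w3 z \<noteq> 0 \<Longrightarrow> \<rho>\<^sup>2 \<le> A z \<and> A z \<le> 2 * \<rho>\<^sup>2" using wshell by blast+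
  have p2: "p + 2 > 0" using p by simp
  have Ek: "Ck_on k E (ball x0 (\<rho> / 2))" for k
    unfolding E_def[abs_def] F_def
    by (intro Ck_on_add Ck_on_mult open_ball Ck_on_subset[OF Ck_on_norm_sq subset_UNIV]
        wint(2)[OF wc(1) W1(1) p(2)] wint(2)[OF wc(2) W1(2) p2] wint(2)[OF wc(3) W1(3) p2])
  define f where "f x = max (v x) 0 * S ((norm (x - x0))\<^sup>2)" for x
  have f0: "f x = 0" if "x \<notin> cball x0 (2 * \<rho>)" for x
  proof -
    have "(2 * \<rho>)\<^sup>2 \<le> (norm (x - x0))\<^sup>2" using that \<rho> by (intro power_mono) (auto simp: dist_norm norm_minus_commute)
    moreover have "(2 * \<rho>)\<^sup>2 = 4 * \<rho>\<^sup>2" by (simp add: power2_eq_square)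
    ultimately have "2 * \<rho>\<^sup>2 \<le> (norm (x - x0))\<^sup>2" using zero_le_power2[of \<rho>] by linarith
    then show ?thesis by (simp add: f_def Sout)
  qed
  have f\<Omega>: "f x = indicator \<Omega> x *\<^sub>R f x" for x by (metis f0 subsetD[OF \<rho>(3)] indicator_simps scaleR_one scaleR_zero_right)
  have cf: "continuous_on \<Omega> f" unfolding f_def
    by (intro continuous_intros cv' continuous_on_compose2[OF cS(1)]) auto
  have fm: "f \<in> borel_measurable borel"
  proof -
    have "(\<lambda>x. indicator \<Omega> x *\<^sub>R f x) \<in> borel_measurable borel"
      by (rule borel_measurable_continuous_on_indicator[OF _ cf]) (use \<Omega> in simp)
    moreover have "(\<lambda>x. indicator \<Omega> x *\<^sub>R f x) = f" by (rule ext) (rule f\<Omega>[symmetric])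
    ultimately show ?thesis by simp
  qed
  obtain Bf where Bf: "\<And>x. \<bar>f x\<bar> \<le> Bf"
  proof -
    have "bounded (f ` cball x0 (2 * \<rho>))"
      by (intro compact_imp_bounded compact_continuous_image continuous_on_subset[OF cf] \<rho>(3) compact_cball)
    then obtain B where "\<forall>y\<in>f ` cball x0 (2 * \<rho>). norm y \<le> B" unfolding bounded_iff by blast
    then have B: "norm (f x) \<le> B" if "x \<in> cball x0 (2 * \<rho>)" for x using that by blast
    have "\<bar>f x\<bar> \<le> \<bar>B\<bar>" for x
    proof (cases "x \<in> cball x0 (2 * \<rho>)")
      case True show ?thesis using B[OF True] by simp
    next
      case False show ?thesis by (simp add: f0[OF False])
    qed
    then show ?thesis by (rule that)
  qed
  have fR: "f x = 0" if "x \<notin> ball x0 (3 * \<rho>)" for x using that \<rho>(1) by (intro f0) auto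
  define W where "W x' = (LINT x|lborel. f x * norm (x - x') powr (- p))" for x'
  have fk: "integrable lborel (\<lambda>x. f x * norm (x - x') powr (- p))" for x'
    by (rule integrable_kernel_translate[OF riesz_kernel(1-3)[OF p(2)] _ _ fm Bf fR]) (use p s in auto)
  have cW: "continuous_on (ball x0 (\<rho> / 2)) W"
  proof -
    have k5: "\<bar>- p * (z \<bullet> e) * norm z powr (- p - 2)\<bar> \<le> (p + 3) * norm z powr (- p - 1) * norm e" for z e :: 'a
    proof -
      have "p * norm z powr (- p - 1) * norm e \<le> (p + 3) * norm z powr (- p - 1) * norm e" by (intro mult_right_mono) auto
      then show ?thesis using riesz_kernel(5)[OF p(2), of z e] by linarith
    qed
    \<comment> \<open>Only continuity is wanted; the exponent \<open>s\<close> is admissible because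
      \<open>p + s = n - s\<close> is below n.\<close>
    have "Ck_holder_on 0 s W (ball x0 (3 * \<rho>))" unfolding W_def
      by (rule potential_holder[where k = "\<lambda>z. norm z powr (- p)" and q = p and M = "p + 3" and B = Bf,
          OF riesz_kernel(1,2,3,4)[OF p(2)] _ _ _ s(1) _ _ fm Bf fR]) (use p s k5 in auto)
    then obtain C where C: "\<And>x y. x \<in> ball x0 (3 * \<rho>) \<Longrightarrow> y \<in> ball x0 (3 * \<rho>) \<Longrightarrow> \<bar>W x - W y\<bar> \<le> C * norm (x - y) powr s"
      unfolding Ck_holder_on.simps by blast
    show ?thesis
    proof (rule continuous_on_subset[of "ball x0 (3 * \<rho>)"])
      show "continuous_on (ball x0 (3 * \<rho>)) W"
        unfolding continuous_on_def
      proof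
        fix x assume x: "x \<in> ball x0 (3 * \<rho>)"
        have "((\<lambda>y. C * norm (y - x) powr s) \<longlongrightarrow> C * norm (x - x) powr s) (at x within ball x0 (3 * \<rho>))"
          using s by (intro tendsto_intros) auto
        then have "((\<lambda>y. C * norm (y - x) powr s) \<longlongrightarrow> 0) (at x within ball x0 (3 * \<rho>))" by simp
        then have "((\<lambda>y. W y - W x) \<longlongrightarrow> 0) (at x within ball x0 (3 * \<rho>))"
          by (rule Lim_null_comparison[rotated]) (use C x in \<open>auto simp: eventually_at_filter\<close>)
        then show "(W \<longlongrightarrow> W x) (at x within ball x0 (3 * \<rho>))" by (simp add: LIM_zero_iff)
      qed
    qed (use \<rho> in auto)
  qed
  obtain C where C: "C > 0" "\<And>\<epsilon> t. \<epsilon> > 0 \<Longrightarrow> t > 0 \<Longrightarrow> kernS p \<epsilon> t \<le> C * t powr (- (p / 2))"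
    using kernS_le[OF p(2)] by blast
  have identity: "(LINT z:U|lebesgue. snd z powr a * u z * (S (A z) * bumpS p \<epsilon> ((norm (z - (x', 0)))\<^sup>2))) =
      lam * (LINT x|lebesgue. f x * kernS p \<epsilon> ((norm (x - x'))\<^sup>2)) + E x'"
    if x': "x' \<in> ball x0 (\<rho> / 2)" and \<epsilon>: "0 < \<epsilon>" "\<epsilon> \<le> \<rho> / 2" for x' \<epsilon>
  proof -
    define B where "B z = (norm (z - (x', 0)))\<^sup>2" for z :: "'a \<times> real"
    have cB: "continuous_on UNIV B" unfolding B_def by (intro continuous_intros)
    have compB: "continuous_on UNIV (\<lambda>z. F (B z))" if "continuous_on UNIV F" for F :: "real \<Rightarrow> real"
      by (rule continuous_on_compose2[OF that cB]) auto
    note cK = continuous_kernS[OF p(2) \<epsilon>(1)]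
    define \<psi> where "\<psi> z = S (A z) * kernS p \<epsilon> (B z)" for z
    define \<kappa> where "\<kappa> z = 2 * (S1 (A z) * kernS p \<epsilon> (B z) + S (A z) * kernS' p \<epsilon> (B z))" for z
    note sd = second_derivatives_radial_product[OF dS DERIV_kernS[OF p(2) \<epsilon>(1)] DERIV_kernS'[OF p(2) \<epsilon>(1)], where ?z0.0 = z0 and ?z1.0 = "(x', 0)",
        folded A_def B_def, folded \<psi>_def]
    have \<psi>sm: "Ck_on k \<psi> UNIV" for k unfolding \<psi>_def[abs_def] A_def B_def
      by (intro Ck_on_mult open_UNIV Ck_on_compose_real[OF open_UNIV open_UNIV UNIV_I Ck_on_norm_sq Sk(1)]
          Ck_on_compose_real[OF open_UNIV open_UNIV UNIV_I Ck_on_norm_sq Ck_on_kernS[OF p(2) \<epsilon>(1)]])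
    have cl: "closure {z. \<psi> z \<noteq> 0} \<subseteq> cball z0 (2 * \<rho>)"
    proof (rule closure_minimal)
      show "{z. \<psi> z \<noteq> 0} \<subseteq> cball z0 (2 * \<rho>)"
      proof
        fix z assume "z \<in> {z. \<psi> z \<noteq> 0}"
        then have "\<not> A z \<ge> 2 * \<rho>\<^sup>2" using Sout by (auto simp: \<psi>_def)
        then show "z \<in> cball z0 (2 * \<rho>)" by (intro Aball) simp
      qed
    qed simp
    have test: "test_function (\<Omega> \<times> {-1<..<1}) \<psi>"
      unfolding test_function_def smooth_on_def
    proof (intro conjI allI \<psi>sm)
      have "bounded (closure {z. \<psi> z \<noteq> 0})" using cl bounded_cball bounded_subset by blast
      then show "compact (closure {z. \<psi> z \<noteq> 0})" unfolding compact_eq_bounded_closed by simp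
      show "closure {z. \<psi> z \<noteq> 0} \<subseteq> \<Omega> \<times> {-1<..<1}" by (rule order_trans[OF cl cbU])
    qed
    have \<kappa>1: "frechet_derivative \<psi> (at z) (0, 1) = snd z * \<kappa> z" for z
    proof -
      have "(z - z0) \<bullet> (0, 1) = snd z" "(z - (x', 0)) \<bullet> (0, 1) = snd z" by (cases z; simp add: z0_def)+
      then show ?thesis unfolding sd(1) \<kappa>_def by (simp add: algebra_simps)
    qed
    have \<kappa>2: "continuous_on UNIV \<kappa>" unfolding \<kappa>_def by (intro continuous_intros comp compB cS cK)
    have "\<kappa> z = 0" if "z \<notin> cball z0 (2 * \<rho>)" for z
    proof -
      have "\<not> A z \<le> 2 * \<rho>\<^sup>2" using Aball that by blast
      then have "S (A z) = 0" "S1 (A z) = 0" using Sout Sshell[of "A z"] by auto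
      then show ?thesis by (simp add: \<kappa>_def)
    qed
    then obtain B\<kappa> where "\<And>z. norm (\<kappa> z) \<le> B\<kappa>" using continuous_compact_support_bounded[OF \<kappa>2 compact_cball] by blast
    then have \<kappa>3: "\<And>z. \<bar>\<kappa> z\<bar> \<le> B\<kappa>" by simp
    define d2 where "d2 = (norm (x' - x0))\<^sup>2"
    define N where "N z = norm (z - (x', 0))" for z :: "'a \<times> real"
    define Wt where "Wt z = w1 z * N z powr (- p) + w2 z * N z powr (- (p + 2)) + d2 * (w3 z * N z powr (- (p + 2)))" for z
    have lap: "(\<Sum>b\<in>Basis. frechet_derivative (\<lambda>z. frechet_derivative \<psi> (at z) b) (at z) b) + a * \<kappa> z = Wt z - S (A z) * bumpS p \<epsilon> (B z)" for z
    proof -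
      \<comment> \<open>The dimension \<open>n + 1\<close> of the extended space, written through
        \<open>p\<close>; combined with \<open>a * \<kappa>\<close> it turns the coefficient of the
        first derivatives into \<open>2 * (p + 2)\<close>, as in
        \<open>kernS_identity\<close>.\<close>
      have D: "real DIM('a \<times> real) = p + 1 - a + 1" using pa by simp
      have alg: "4 * s2 * k * Aa + 8 * s1 * k1 * dt + 4 * s0 * k2 * b + 2 * (p + 1 - a + 1) * (s1 * k + s0 * k1) + a * (2 * (s1 * k + s0 * k1)) =
          (4 * s2 * k * Aa + 8 * s1 * k1 * dt + 2 * (p + 2) * s1 * k) + s0 * (4 * b * k2 + 2 * (p + 2) * k1)"
        for s2 k Aa s1 k1 dt s0 k2 b :: real by algebra
      have kid: "4 * B z * kernS'' p \<epsilon> (B z) + 2 * (p + 2) * kernS' p \<epsilon> (B z) = - bumpS p \<epsilon> (B z)" by (rule kernS_identity[OF p(2) \<epsilon>(1)])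
      have "(\<Sum>b\<in>Basis. frechet_derivative (\<lambda>z. frechet_derivative \<psi> (at z) b) (at z) b) + a * \<kappa> z =
         (4 * S2 (A z) * kernS p \<epsilon> (B z) * A z + 8 * S1 (A z) * kernS' p \<epsilon> (B z) * ((z - z0) \<bullet> (z - (x', 0))) + 2 * (p + 2) * S1 (A z) * kernS p \<epsilon> (B z))
         + S (A z) * (4 * B z * kernS'' p \<epsilon> (B z) + 2 * (p + 2) * kernS' p \<epsilon> (B z))"
        unfolding sd(2) \<kappa>_def of_nat_mult of_nat_numeral D by (rule alg)
      also have "4 * S2 (A z) * kernS p \<epsilon> (B z) * A z + 8 * S1 (A z) * kernS' p \<epsilon> (B z) * ((z - z0) \<bullet> (z - (x', 0))) + 2 * (p + 2) * S1 (A z) * kernS p \<epsilon> (B z) = Wt z"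
      proof (cases "S1 (A z) = 0 \<and> S2 (A z) = 0")
        case True then show ?thesis by (simp add: Wt_def w1_def w2_def w3_def)
      next
        case False
        then have sh: "\<rho>\<^sup>2 \<le> A z" using Sshell[of "A z"] by blast
        \<comment> \<open>Here \<open>\<epsilon> \<le> \<rho> / 2\<close> enters: the truncation
          does not reach the shell, so the shell terms are independent of \<epsilon>.\<close>
        then have Nz: "N z \<ge> \<epsilon>" using far[OF sh x'] \<epsilon> by (simp add: N_def)
        note kd = kernS_norm_derivative(4,5)[OF p(2) \<epsilon>(1), of "z - (x', 0)", folded N_def, OF Nz]
        have BN: "B z = (N z)\<^sup>2" by (simp add: B_def N_def)
        have k1: "kernS p \<epsilon> (B z) = 2 / p * N z powr (- p)" using kd(1) p(2) unfolding BN by (simp add: field_simps)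
        have e: "- (p + 2) = - p - 2" by simp
        have k2: "kernS' p \<epsilon> (B z) = - (N z powr (- (p + 2)))" using kd(2) unfolding BN e .
        have "d2 = A z + B z - 2 * ((z - z0) \<bullet> (z - (x', 0)))"
        proof -
          have "d2 = (norm ((z - z0) - (z - (x', 0))))\<^sup>2" by (simp add: d2_def z0_def norm_Pair)
          also have "\<dots> = A z + B z - 2 * ((z - z0) \<bullet> (z - (x', 0)))"
            unfolding A_def B_def power2_norm_eq_inner inner_diff_left[of "z - z0" "z - (x', 0)"] inner_diff_right[of _ "z - z0" "z - (x', 0)"]
            by (simp add: inner_commute)
          finally show ?thesis .
        qed
        then have dot: "(z - z0) \<bullet> (z - (x', 0)) = (A z + B z - d2) / 2" by simp
        have BNp: "B z * N z powr (- (p + 2)) = N z powr (- p)"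
        proof -
          have "N z powr 2 * N z powr (- (p + 2)) = N z powr (- p)" by (rule powr_add_eq) simp
          moreover have "N z powr 2 = B z" unfolding BN by (simp add: N_def)
          ultimately show ?thesis by simp
        qed
        have alg2: "8 * s1 * - n * ((aa + b - d) / 2) = - 4 * s1 * aa * n - 4 * s1 * (b * n) + d * (4 * s1 * n)" for s1 n aa b d :: real
          by (simp add: field_simps)
        have "8 * S1 (A z) * kernS' p \<epsilon> (B z) * ((z - z0) \<bullet> (z - (x', 0))) =
          - 4 * S1 (A z) * A z * N z powr (- (p + 2)) - 4 * S1 (A z) * (B z * N z powr (- (p + 2))) + d2 * (4 * S1 (A z) * N z powr (- (p + 2)))"
          unfolding k2 dot by (rule alg2)
        then have "4 * S2 (A z) * kernS p \<epsilon> (B z) * A z + 8 * S1 (A z) * kernS' p \<epsilon> (B z) * ((z - z0) \<bullet> (z - (x', 0))) + 2 * (p + 2) * S1 (A z) * kernS p \<epsilon> (B z) =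
          4 * S2 (A z) * (2 / p * N z powr (- p)) * A z + (- 4 * S1 (A z) * A z * N z powr (- (p + 2)) - 4 * S1 (A z) * N z powr (- p) + d2 * (4 * S1 (A z) * N z powr (- (p + 2))))
          + 2 * (p + 2) * S1 (A z) * (2 / p * N z powr (- p))" unfolding k1 BNp by simp
        also have "\<dots> = Wt z" unfolding Wt_def w1_def w2_def w3_def using p(2) by (simp add: field_simps)
        finally show ?thesis .
      qed
      finally show ?thesis unfolding kid by simp
    qed
    have tei: "lam * (LINT x:\<Omega>|lebesgue. max (u (x, 0)) 0 * \<psi> (x, 0)) =
      - (LINT z:U|lebesgue. snd z powr a * u z * ((\<Sum>b\<in>Basis. frechet_derivative (\<lambda>z. frechet_derivative \<psi> (at z) b) (at z) b) + a * \<kappa> z))"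
      unfolding U_def by (rule thin_eigen_identity[OF \<Omega>(1) Gs eqn G[unfolded U_def] iu[unfolded U_def] iG[unfolded U_def] test \<kappa>1 \<kappa>2 \<kappa>3])
    have left: "(LINT x:\<Omega>|lebesgue. max (u (x, 0)) 0 * \<psi> (x, 0)) = (LINT x|lebesgue. f x * kernS p \<epsilon> ((norm (x - x'))\<^sup>2))"
    proof -
      have "indicator \<Omega> x *\<^sub>R (max (u (x, 0)) 0 * \<psi> (x, 0)) = f x * kernS p \<epsilon> ((norm (x - x'))\<^sup>2)" for x
      proof -
        have "max (u (x, 0)) 0 * \<psi> (x, 0) = f x * kernS p \<epsilon> ((norm (x - x'))\<^sup>2)"
          by (simp add: f_def v_def \<psi>_def A_def B_def z0_def norm_Pair)
        then show ?thesis
        proof (cases "x \<in> \<Omega>")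
          case False
          then have "f x = 0" using f\<Omega>[of x] by simp
          then show ?thesis using False by simp
        qed simp
      qed
      then show ?thesis by (simp only: set_lebesgue_integral_def)
    qed
    have iW: "integrable lebesgue (\<lambda>z. (Iu z * w1 z) * N z powr (- p))" "integrable lebesgue (\<lambda>z. (Iu z * w2 z) * N z powr (- (p + 2)))"
      "integrable lebesgue (\<lambda>z. (Iu z * w3 z) * N z powr (- (p + 2)))"
      unfolding N_def by (assumption | rule wint(3)[OF wc(1) W1(1) p(2) x'] wint(3)[OF wc(2) W1(2) p2 x'] wint(3)[OF wc(3) W1(3) p2 x'])+
    have eW: "(\<lambda>z. Iu z * Wt z) = (\<lambda>z. (Iu z * w1 z) * N z powr (- p) + (Iu z * w2 z) * N z powr (- (p + 2)) + d2 * ((Iu z * w3 z) * N z powr (- (p + 2))))"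
      by (simp add: Wt_def fun_eq_iff algebra_simps)
    have iWt: "integrable lebesgue (\<lambda>z. Iu z * Wt z)" unfolding eW
      by (intro Bochner_Integration.integrable_add integrable_mult_right impI iW)
    have EWt: "(LINT z|lebesgue. Iu z * Wt z) = E x'"
      unfolding eW using iW by (simp add: E_def F_def N_def d2_def)
    have iSb: "integrable lebesgue (\<lambda>z. Iu z * (S (A z) * bumpS p \<epsilon> (B z)))"
    proof -
      have cSb: "continuous_on UNIV (\<lambda>z. S (A z) * bumpS p \<epsilon> (B z))"
        by (intro continuous_intros comp compB cS continuous_bumpS p)
      have "S (A z) * bumpS p \<epsilon> (B z) = 0" if "z \<notin> cball z0 (2 * \<rho>)" for z
        using Aball[of z] that Sout[of "A z"] by fastforce
      then obtain Bb where "\<And>z. norm (S (A z) * bumpS p \<epsilon> (B z)) \<le> Bb" using continuous_compact_support_bounded[OF cSb compact_cball] by blast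
      from integrable_mult_bounded[OF Iu borel_measurable_lebesgue_continuous[OF cSb] this] show ?thesis by simp
    qed
    have "(LINT z:U|lebesgue. snd z powr a * u z * (Wt z - S (A z) * bumpS p \<epsilon> (B z))) = (LINT z|lebesgue. Iu z * Wt z - Iu z * (S (A z) * bumpS p \<epsilon> (B z)))"
      unfolding set_lebesgue_integral_def by (intro Bochner_Integration.integral_cong) (auto simp: Iu_def algebra_simps)
    also have "\<dots> = E x' - (LINT z|lebesgue. Iu z * (S (A z) * bumpS p \<epsilon> (B z)))" using iWt iSb EWt by simp
    also have "(LINT z|lebesgue. Iu z * (S (A z) * bumpS p \<epsilon> (B z))) = (LINT z:U|lebesgue. snd z powr a * u z * (S (A z) * bumpS p \<epsilon> (B z)))"
      unfolding set_lebesgue_integral_def by (intro Bochner_Integration.integral_cong) (auto simp: Iu_def)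
    finally show ?thesis using tei unfolding lap left by (simp add: B_def)
  qed
  define \<epsilon> where "\<epsilon> m = 1 / real (Suc m)" for m
  have \<epsilon>: "\<epsilon> m > 0" for m by (simp add: \<epsilon>_def)
  have \<epsilon>0: "\<epsilon> \<longlonglongrightarrow> 0" unfolding \<epsilon>_def[abs_def] by (rule tendsto_inverse_Suc)
  have sq: "((norm z)\<^sup>2) powr (- (p / 2)) = norm z powr (- p)" for z :: 'a using powr_powr[of "norm z" 2 "- (p / 2)"] by simp
  have limK: "(\<lambda>m. LINT x|lebesgue. f x * kernS p (\<epsilon> m) ((norm (x - x'))\<^sup>2)) \<longlonglongrightarrow> 2 / p * W x'" for x'
  proof -
    have "(\<lambda>m. LINT x|lborel. f x * kernS p (\<epsilon> m) ((norm (x - x'))\<^sup>2)) \<longlonglongrightarrow> (LINT x|lborel. 2 / p * (f x * norm (x - x') powr (- p)))"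
    proof (rule integral_dominated_convergence[where w = "\<lambda>x. C * \<bar>f x * norm (x - x') powr (- p)\<bar>"])
      show "(\<lambda>x. 2 / p * (f x * norm (x - x') powr (- p))) \<in> borel_measurable lborel" using fk by auto
      show "integrable lborel (\<lambda>x. C * \<bar>f x * norm (x - x') powr (- p)\<bar>)" using fk by (intro integrable_mult_right impI integrable_abs)
      have "(\<lambda>x::'a. kernS p (\<epsilon> m) ((norm (x - x'))\<^sup>2)) \<in> borel_measurable borel" for m
        by (intro borel_measurable_continuous_onI continuous_on_compose2[OF continuous_kernS(1)[OF p(2) \<epsilon>]] continuous_intros) auto
      from borel_measurable_times[OF fm this]
      show "(\<lambda>x. f x * kernS p (\<epsilon> m) ((norm (x - x'))\<^sup>2)) \<in> borel_measurable lborel" for m by simp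
      show "AE x in lborel. (\<lambda>m. f x * kernS p (\<epsilon> m) ((norm (x - x'))\<^sup>2)) \<longlonglongrightarrow> 2 / p * (f x * norm (x - x') powr (- p))"
        using AE_lborel_singleton[of x']
      proof eventually_elim
        case (elim x)
        then have "\<forall>\<^sub>F m in sequentially. \<epsilon> m < norm (x - x')" using order_tendstoD(2)[OF \<epsilon>0, of "norm (x - x')"] by simp
        then have "\<forall>\<^sub>F m in sequentially. f x * kernS p (\<epsilon> m) ((norm (x - x'))\<^sup>2) = 2 / p * (f x * norm (x - x') powr (- p))"
        proof (rule eventually_mono)
          fix m assume "\<epsilon> m < norm (x - x')"
          then have "p / 2 * kernS p (\<epsilon> m) ((norm (x - x'))\<^sup>2) = norm (x - x') powr (- p)"
            by (intro kernS_norm_derivative(4)[OF p(2) \<epsilon>]) simp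
          then show "f x * kernS p (\<epsilon> m) ((norm (x - x'))\<^sup>2) = 2 / p * (f x * norm (x - x') powr (- p))"
            using p(2) by (simp add: field_simps)
        qed
        then show ?case by (rule tendsto_eventually)
      qed
      show "AE x in lborel. norm (f x * kernS p (\<epsilon> m) ((norm (x - x'))\<^sup>2)) \<le> C * \<bar>f x * norm (x - x') powr (- p)\<bar>" for m
        using AE_lborel_singleton[of x']
      proof eventually_elim
        case (elim x)
        have "kernS p (\<epsilon> m) ((norm (x - x'))\<^sup>2) \<le> C * norm (x - x') powr (- p)"
          using C(2)[OF \<epsilon>, of "(norm (x - x'))\<^sup>2" m] elim unfolding sq by simp
        then have "\<bar>f x\<bar> * kernS p (\<epsilon> m) ((norm (x - x'))\<^sup>2) \<le> \<bar>f x\<bar> * (C * norm (x - x') powr (- p))" by (intro mult_left_mono) auto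
        then show ?case using kernS_nonneg[OF p(2) \<epsilon>] by (simp add: abs_mult mult_ac)
      qed
    qed
    moreover have "(LINT x|lborel. 2 / p * (f x * norm (x - x') powr (- p))) = 2 / p * W x'" by (simp add: W_def)
    moreover have "(LINT x|lebesgue. f x * kernS p (\<epsilon> m) ((norm (x - x'))\<^sup>2)) = (LINT x|lborel. f x * kernS p (\<epsilon> m) ((norm (x - x'))\<^sup>2))" for m
    proof (rule integral_completion)
      have "(\<lambda>x::'a. kernS p (\<epsilon> m) ((norm (x - x'))\<^sup>2)) \<in> borel_measurable borel"
        by (intro borel_measurable_continuous_onI continuous_on_compose2[OF continuous_kernS(1)[OF p(2) \<epsilon>]] continuous_intros) auto
      from borel_measurable_times[OF fm this]
      show "(\<lambda>x. f x * kernS p (\<epsilon> m) ((norm (x - x'))\<^sup>2)) \<in> borel_measurable lborel" by simp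
    qed
    ultimately show ?thesis by (simp only:)
  qed
  define Lf where "Lf x' = lam * (2 / p * W x') + E x'" for x'
  have lim: "(\<lambda>m. LINT z:U|lebesgue. snd z powr a * u z * (S (A z) * bumpS p (\<epsilon> m) ((norm (z - (x', 0)))\<^sup>2))) \<longlonglongrightarrow> Lf x'"
    if x': "x' \<in> ball x0 (\<rho> / 2)" for x'
  proof (rule Lim_transform_eventually)
    show "(\<lambda>m. lam * (LINT x|lebesgue. f x * kernS p (\<epsilon> m) ((norm (x - x'))\<^sup>2)) + E x') \<longlonglongrightarrow> Lf x'"
      unfolding Lf_def by (intro tendsto_intros limK)
    have "\<forall>\<^sub>F m in sequentially. \<epsilon> m < \<rho> / 2" using order_tendstoD(2)[OF \<epsilon>0, of "\<rho> / 2"] \<rho> by simp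
    then show "\<forall>\<^sub>F m in sequentially. lam * (LINT x|lebesgue. f x * kernS p (\<epsilon> m) ((norm (x - x'))\<^sup>2)) + E x' =
        (LINT z:U|lebesgue. snd z powr a * u z * (S (A z) * bumpS p (\<epsilon> m) ((norm (z - (x', 0)))\<^sup>2)))"
      by eventually_elim (simp add: identity[OF x' \<epsilon>])
  qed
  have cL: "continuous_on (ball x0 (\<rho> / 2)) Lf" unfolding Lf_def
    by (intro continuous_intros cW Ck_on_imp_continuous_on[OF Ek[of 0]])
  have ctf: "S (A z) = 1" if "norm (z - (x0, 0)) \<le> \<rho>" for z
    unfolding A_def z0_def using that by (intro Sin power_mono) auto
  have b\<Omega>: "ball x0 \<rho> \<subseteq> \<Omega>" using \<rho> by (intro order_trans[OF _ \<rho>(3)]) auto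
  obtain c where c: "c > 0" "\<And>x'. x' \<in> ball x0 (\<rho> / 2) \<Longrightarrow> Lf x' = c * v x'"
    using trace_average_limit[OF \<Omega>(1) cv' a(1) p(2) pa um[unfolded U_def] iu[unfolded U_def] Gm[unfolded U_def] Gf0[unfolded U_def] trb
        ctf \<rho>(1) b\<Omega> lim[unfolded U_def \<epsilon>_def] cL] by blast
  show ?thesis
  proof (rule that[OF Sk(1) S01 Sout c(1) Ek])
    fix x' assume "x' \<in> ball x0 (\<rho> / 2)"
    then show "c * u (x', 0) = lam * (2 / p) * (LINT x|lborel. (max (u (x, 0)) 0 * S ((norm (x - x0))\<^sup>2)) * norm (x - x') powr (- p)) + E x'"
      using c(2)[of x'] by (simp add: Lf_def v_def W_def f_def mult.assoc)
  qed
qed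

section \<open>Regularity of the nodal set\<close>

text \<open>Off the zero set \<open>max (v x) 0\<close> is locally \<open>v\<close> or 0, which
  gives differentiability there. The global Lipschitz bound is delicate only between
  \<open>K\<close> and its complement; the cutoff vanishes before the boundary of \<open>K\<close>
  is reached and thereby separates the points.\<close>

lemma truncated_positive_part:
  fixes v :: "'a::euclidean_space \<Rightarrow> real" and S :: "real \<Rightarrow> real"
  assumes O: "open V" "Ck_on 1 v V" "cball x0 (2 * \<rho>) \<subseteq> V" "0 < \<rho>" and neg: "negligible {x \<in> V. v x = 0}"
    and S: "\<And>k. Ck_on k S UNIV" "\<And>t. 0 \<le> S t" "\<And>t. S t \<le> 1" "\<And>t. t \<ge> 2 * \<rho>\<^sup>2 \<Longrightarrow> S t = 0"
  defines "f \<equiv> \<lambda>x. max (v x) 0 * S ((norm (x - x0))\<^sup>2)"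
  obtains L where "\<And>x y. \<bar>f x - f y\<bar> \<le> L * norm (x - y)" "\<And>x. x \<notin> cball x0 (2 * \<rho>) \<Longrightarrow> f x = 0"
    "\<And>x. x \<notin> {x \<in> V. v x = 0} \<Longrightarrow> f differentiable (at x)"
proof -
  define K where "K = cball x0 (2 * \<rho>)"
  define w where "w x = S ((norm (x - x0))\<^sup>2)" for x
  have f_eq: "f x = max (v x) 0 * w x" for x by (simp add: f_def w_def)
  have wk: "Ck_on k w UNIV" for k
    unfolding w_def[abs_def] by (rule Ck_on_compose_real[OF open_UNIV open_UNIV UNIV_I Ck_on_norm_sq S(1)])
  \<comment> \<open>The cutoff vanishes from radius \<open>sqrt 2 * \<rho>\<close> on;
    \<open>3 / 2\<close> is a rational above \<open>sqrt 2\<close> and leaves a margin of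
    \<open>\<rho> / 2\<close> to the boundary of \<open>K\<close>.\<close>
  have w0: "w x = 0" if "norm (x - x0) \<ge> 3 / 2 * \<rho>" for x
  proof -
    have "(3 / 2 * \<rho>)\<^sup>2 \<le> (norm (x - x0))\<^sup>2" using that O(4) by (intro power_mono) auto
    moreover have "(3 / 2 * \<rho>)\<^sup>2 = 9 / 4 * \<rho>\<^sup>2" by (simp add: power2_eq_square)
    ultimately have "2 * \<rho>\<^sup>2 \<le> (norm (x - x0))\<^sup>2" using zero_le_power2[of \<rho>] by linarith
    then show ?thesis by (simp add: w_def S)
  qed
  have f0: "f x = 0" if "x \<notin> K" for x
    using w0[of x] that O(4) by (simp add: f_eq K_def dist_norm norm_minus_commute)
  have hv: "Ck_holder_on 0 1 v K"
    by (rule Ck_on_imp_Ck_holder_on[of K V]) (use O in \<open>auto simp: K_def\<close>)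
  have hw: "Ck_holder_on 0 1 w K"
    by (rule Ck_on_imp_Ck_holder_on[of K UNIV]) (use wk in \<open>auto simp: K_def\<close>)
  obtain A B where A: "\<And>x y. x \<in> K \<Longrightarrow> y \<in> K \<Longrightarrow> \<bar>v x - v y\<bar> \<le> A * norm (x - y)"
    and B: "\<And>x y. x \<in> K \<Longrightarrow> y \<in> K \<Longrightarrow> \<bar>w x - w y\<bar> \<le> B * norm (x - y)"
    using hv hw by (simp add: powr_one_gt_zero_iff) blast
  obtain M where M: "\<And>x. x \<in> K \<Longrightarrow> \<bar>v x\<bar> \<le> M" using hv by (auto simp: bounded_iff)
  have "x0 \<in> K" using O(4) by (simp add: K_def)
  then have M0: "0 \<le> M" using M by fastforce
  have w1: "\<bar>w x\<bar> \<le> 1" for x using S(2,3) by (simp add: w_def)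
  have in_K: "\<bar>f x - f y\<bar> \<le> (\<bar>A\<bar> + M * \<bar>B\<bar>) * norm (x - y)" if "x \<in> K" "y \<in> K" for x y
  proof -
    have e: "f x - f y = (max (v x) 0 - max (v y) 0) * w x + max (v y) 0 * (w x - w y)" by (simp add: f_eq algebra_simps)
    have "\<bar>max (v x) 0 - max (v y) 0\<bar> \<le> \<bar>v x - v y\<bar>" by (simp add: max_def abs_if)
    also have "\<dots> \<le> \<bar>A\<bar> * norm (x - y)" by (rule order_trans[OF A[OF that]]) (intro mult_right_mono, auto)
    finally have "\<bar>(max (v x) 0 - max (v y) 0) * w x\<bar> \<le> \<bar>A\<bar> * norm (x - y)"
      using mult_mono[OF _ w1[of x], of "\<bar>max (v x) 0 - max (v y) 0\<bar>" "\<bar>A\<bar> * norm (x - y)"] by (simp add: abs_mult)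
    moreover have "\<bar>w x - w y\<bar> \<le> \<bar>B\<bar> * norm (x - y)" by (rule order_trans[OF B[OF that]]) (intro mult_right_mono, auto)
    then have "\<bar>max (v y) 0 * (w x - w y)\<bar> \<le> M * (\<bar>B\<bar> * norm (x - y))"
      using M[OF that(2)] M0 unfolding abs_mult by (intro mult_mono) auto
    ultimately show ?thesis unfolding e using abs_triangle_ineq[of "(max (v x) 0 - max (v y) 0) * w x" "max (v y) 0 * (w x - w y)"]
      by (simp add: distrib_right mult.assoc)
  qed
  \<comment> \<open>The summand \<open>2 * M / \<rho>\<close> is for pairs with one point outside
    \<open>K\<close>: there \<open>\<bar>f\<bar> \<le> M\<close> at the other point, and the two are
    at least \<open>\<rho> / 2\<close> apart unless \<open>f\<close> vanishes at both.\<close>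
  define L where "L = \<bar>A\<bar> + M * \<bar>B\<bar> + 2 * M / \<rho>"
  have L1: "\<bar>A\<bar> + M * \<bar>B\<bar> \<le> L" "2 * M / \<rho> \<le> L" using M0 O(4) by (auto simp: L_def)
  have out: "\<bar>f x\<bar> \<le> L * norm (x - y)" if y: "y \<notin> K" for x y
  proof (cases "norm (x - x0) < 3 / 2 * \<rho>")
    case True
    then have "x \<in> K" using O(4) by (simp add: K_def dist_norm norm_minus_commute)
    then have "\<bar>max (v x) 0\<bar> * \<bar>w x\<bar> \<le> M * 1" using M[of x] w1[of x] M0 by (intro mult_mono) auto
    then have fM: "\<bar>f x\<bar> \<le> M" by (simp add: f_eq abs_mult)
    have "norm (y - x0) > 2 * \<rho>" using y by (simp add: K_def dist_norm norm_minus_commute)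
    then have "norm (x - y) \<ge> \<rho> / 2" using True norm_triangle_ineq[of "y - x" "x - x0"] by (simp add: norm_minus_commute)
    then have "2 * M / \<rho> * (\<rho> / 2) \<le> L * norm (x - y)" using M0 O(4) L1(2) order_trans[OF _ L1(2), of 0] by (intro mult_mono) auto
    then show ?thesis using fM O(4) by simp
  next
    case False
    then have "f x = 0" using w0[of x] by (simp add: f_eq)
    moreover have "0 \<le> L" using M0 O(4) by (simp add: L_def)
    ultimately show ?thesis by simp
  qed
  have lip: "\<bar>f x - f y\<bar> \<le> L * norm (x - y)" for x y
  proof (cases "x \<in> K")
    case xK: True
    show ?thesis
    proof (cases "y \<in> K")
      case True
      show ?thesis by (rule order_trans[OF in_K[OF xK True]]) (intro mult_right_mono L1 norm_ge_zero)
    next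
      case False then show ?thesis using out[of y x] f0[of y] by simp
    qed
  next
    case False then show ?thesis using out[of x y] f0[of x] by (simp add: norm_minus_commute)
  qed
  have dif: "f differentiable (at x)" if x: "x \<notin> {x \<in> V. v x = 0}" for x
  proof (cases "x \<in> V")
    case True
    then have vx: "v x \<noteq> 0" using x by simp
    have cv: "continuous_on V v" using Ck_on_imp_continuous_on[OF O(2)] .
    have dv: "v differentiable (at x)" using O(2) True by (simp add: One_nat_def)
    have dw: "w differentiable (at x)" using wk[of 1] by (simp add: One_nat_def)
    show ?thesis
    proof (cases "v x > 0")
      case True
      let ?T = "V \<inter> v -` {0<..}"
      have "open ?T" by (rule continuous_open_preimage[OF cv O(1)]) simp
      moreover have "x \<in> ?T" using True \<open>x \<in> V\<close> by simp
      moreover have "v y * w y = f y" if "y \<in> ?T" for y using that by (simp add: f_eq)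
      moreover have "(\<lambda>y. v y * w y) differentiable (at x)" by (intro differentiable_mult dv dw)
      ultimately show ?thesis unfolding differentiable_def by (meson has_derivative_transform_within_open)
    next
      case False
      let ?T = "V \<inter> v -` {..<0}"
      have "open ?T" by (rule continuous_open_preimage[OF cv O(1)]) simp
      moreover have "x \<in> ?T" using False vx \<open>x \<in> V\<close> by simp
      moreover have "0 = f y" if "y \<in> ?T" for y using that by (simp add: f_eq)
      moreover have "(\<lambda>y. 0 :: real) differentiable (at x)" by simp
      ultimately show ?thesis unfolding differentiable_def by (meson has_derivative_transform_within_open)
    qed
  next
    case False
    have "open (- K)" by (simp add: K_def open_Compl)
    moreover have "x \<in> - K" using False O(3) by (auto simp: K_def)
    moreover have "0 = f y" if "y \<in> - K" for y using that f0 by simp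
    moreover have "(\<lambda>y. 0 :: real) differentiable (at x)" by simp
    ultimately show ?thesis unfolding differentiable_def by (meson has_derivative_transform_within_open)
  qed
  show ?thesis by (rule that[OF lip]) (use f0 dif in \<open>auto simp: K_def\<close>)
qed

theorem theorem6p4:
  fixes \<Omega> :: "(real ^ 'n::finite) set"
    and u :: "(real ^ 'n) \<times> real \<Rightarrow> real"
    and s a lam :: real
    and x\<^sub>0 :: "real ^ 'n"
  assumes domain: "smooth_bounded_domain \<Omega>"
    and params: "0 < s" "s < 1" "a = 1 - 2 * s" "lam > 0"
    and sol: "thin_eigen_solution a lam \<Omega> u"
    and C1_representative: "Ck_on 1 (\<lambda>x. u (x, 0)) \<Omega>"
    and x0: "x\<^sub>0 \<in> \<Omega>" "u (x\<^sub>0, 0) = 0" "x\<^sub>0 \<in> regular_set \<Omega> u"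
  shows "\<exists>V. open V \<and> x\<^sub>0 \<in> V \<and> V \<subseteq> \<Omega> \<and>
           (s \<le> 1 / 2 \<longrightarrow>
              (\<forall>\<alpha>. 0 < \<alpha> \<and> \<alpha> < 2 * s \<longrightarrow>
                 is_Ck_holder_graph 1 \<alpha> {x \<in> V. u (x, 0) = 0})) \<and>
           (s > 1 / 2 \<longrightarrow>
              (\<forall>\<alpha>. 0 < \<alpha> \<and> \<alpha> < 2 * s - 1 \<longrightarrow>
                 is_Ck_holder_graph 2 \<alpha> {x \<in> V. u (x, 0) = 0}))"
proof -
  define v where "v x = u (x, 0)" for x
  have \<Omega>: "open \<Omega>" "bounded \<Omega>" using domain by (auto simp: smooth_bounded_domain_def)
  have v1: "Ck_on 1 v \<Omega>" using C1_representative by (simp only: v_def[abs_def])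
  have vx0: "v x\<^sub>0 = 0" using x0(2) by (simp only: v_def)
  have cv: "continuous_on \<Omega> (\<lambda>x. u (x, 0))" by (rule Ck_on_imp_continuous_on[OF C1_representative])
  have dv: "(v has_derivative frechet_derivative v (at x\<^sub>0)) (at x\<^sub>0)"
    using v1 x0(1) by (intro Ck_on_has_derivative[of 0]) auto
  have "grad v x\<^sub>0 \<noteq> 0" using x0(3) by (simp add: regular_set_def v_def[abs_def])
  \<comment> \<open>The derivative in the direction of the gradient is its squared norm.\<close>
  then have nz: "frechet_derivative v (at x\<^sub>0) (grad v x\<^sub>0) \<noteq> 0"
    unfolding grad_inner(2)[OF dv, symmetric] by simp
  obtain r0 where r0: "r0 > 0" "ball x\<^sub>0 r0 \<subseteq> \<Omega>" using \<Omega>(1) x0(1) open_contains_ball by blast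
  \<comment> \<open>First use of the implicit function theorem, with \<open>v\<close> merely
    \<open>C^1\<close>. It shows that the zero set is null near \<open>x\<^sub>0\<close>, on which
    the differentiability of the positive part rests; for n = 1 it already gives the
    conclusion.\<close>
  obtain V0 where V0: "open V0" "x\<^sub>0 \<in> V0" "V0 \<subseteq> ball x\<^sub>0 r0" "negligible {x \<in> V0. v x = 0}"
    and g0: "\<And>k \<alpha>. 0 < \<alpha> \<Longrightarrow> \<alpha> \<le> 1 \<Longrightarrow> Ck_holder_on k \<alpha> v (ball x\<^sub>0 r0) \<or> CARD('n) = 1 \<Longrightarrow> is_Ck_holder_graph k \<alpha> {x \<in> V0. v x = 0}"
    using zero_set_graph[OF open_ball convex_ball _ Ck_on_subset[OF v1 r0(2)] vx0 nz] r0(1) by auto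
  \<comment> \<open>In both cases \<open>\<alpha> \<le> 1\<close>, as the Hoelder calculus requires:
    \<open>\<alpha> < 2 * s \<le> 1\<close> in the first and \<open>\<alpha> < 2 * s - 1 < 1\<close>
    in the second.\<close>
  have goal: ?thesis if V: "open V" "x\<^sub>0 \<in> V" "V \<subseteq> \<Omega>"
    and g1: "\<And>\<alpha>. 0 < \<alpha> \<Longrightarrow> \<alpha> \<le> 1 \<Longrightarrow> \<alpha> < 2 * s \<Longrightarrow> is_Ck_holder_graph 1 \<alpha> {x \<in> V. v x = 0}"
    and g2: "\<And>\<alpha>. 0 < \<alpha> \<Longrightarrow> \<alpha> \<le> 1 \<Longrightarrow> \<alpha> < 2 * s - 1 \<Longrightarrow> is_Ck_holder_graph 2 \<alpha> {x \<in> V. v x = 0}" for V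
  proof (intro exI[of _ V] conjI impI allI V)
    fix \<alpha> assume "s \<le> 1 / 2" "0 < \<alpha> \<and> \<alpha> < 2 * s"
    then show "is_Ck_holder_graph 1 \<alpha> {x \<in> V. u (x, 0) = 0}" using g1[of \<alpha>, unfolded v_def] by simp
  next
    fix \<alpha> assume "0 < \<alpha> \<and> \<alpha> < 2 * s - 1"
    then show "is_Ck_holder_graph 2 \<alpha> {x \<in> V. u (x, 0) = 0}" using g2[of \<alpha>, unfolded v_def] params(2) by simp
  qed
  show ?thesis
  proof (cases "CARD('n) = 1")
    case True
    show ?thesis by (rule goal[OF V0(1,2) order_trans[OF V0(3) r0(2)]]) (rule g0; use True in simp)+
  next
    case False
    have "CARD('n) > 0" by simp
    then have "CARD('n) \<ge> 2" using False by linarith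
    \<comment> \<open>Positive because n is at least 2 and \<open>s < 1\<close>.\<close>
    define p where "p = real DIM(real ^ 'n) - 2 * s"
    have p: "0 < p" "p < real DIM(real ^ 'n)" using \<open>CARD('n) \<ge> 2\<close> params by (auto simp: p_def)
    obtain e where e: "e > 0" "cball x\<^sub>0 e \<subseteq> V0" using V0(1,2) open_contains_cball by blast
    \<comment> \<open>\<open>e / 2\<close> keeps the ball of radius \<open>2 * \<rho>\<close> inside
      \<open>V0\<close>, and \<open>1 / 3\<close> ensures \<open>2 * \<rho> < 1\<close>.\<close>
    define \<rho> where "\<rho> = min (e / 2) (1 / 3)"
    have \<rho>: "0 < \<rho>" "2 * \<rho> < 1" using e(1) by (auto simp: \<rho>_def)
    have "2 * \<rho> \<le> e" by (simp add: \<rho>_def)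
    then have cb: "cball x\<^sub>0 (2 * \<rho>) \<subseteq> V0" using e(2) subset_cball[of "2 * \<rho>" e x\<^sub>0] by blast
    have V0\<Omega>: "V0 \<subseteq> \<Omega>" using V0(3) r0(2) by blast
    obtain S c E where S: "\<And>k. Ck_on k S UNIV" "\<And>t. 0 \<le> S t" "\<And>t. S t \<le> 1" "\<And>t. t \<ge> 2 * \<rho>\<^sup>2 \<Longrightarrow> S t = 0"
      and c: "c > 0" and E: "\<And>k. Ck_on k E (ball x\<^sub>0 (\<rho> / 2))"
      and rep: "\<And>x'. x' \<in> ball x\<^sub>0 (\<rho> / 2) \<Longrightarrow> c * u (x', 0) =
        lam * (2 / p) * (LINT x|lborel. (max (u (x, 0)) 0 * S ((norm (x - x\<^sub>0))\<^sup>2)) * norm (x - x') powr (- p)) + E x'"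
      by (rule thin_eigen_representation[OF \<Omega> params(1-3) sol cv p_def p(1) \<rho> order_trans[OF cb V0\<Omega>]]) (rule that; assumption)
    define f where "f x = max (v x) 0 * S ((norm (x - x\<^sub>0))\<^sup>2)" for x
    define W where "W x' = (LINT x|lborel. f x * norm (x - x') powr (- p))" for x'
    obtain L where L: "\<And>x y. \<bar>f x - f y\<bar> \<le> L * norm (x - y)" "\<And>x. x \<notin> cball x\<^sub>0 (2 * \<rho>) \<Longrightarrow> f x = 0"
      "\<And>x. x \<notin> {x \<in> V0. v x = 0} \<Longrightarrow> f differentiable (at x)"
      by (rule truncated_positive_part[OF V0(1) Ck_on_subset[OF v1 V0\<Omega>] cb \<rho>(1) V0(4) S, folded f_def])
        (assumption | (rule that; assumption))+
    have R: "0 < 2 * \<rho>" "2 * \<rho> < 3 * \<rho>" using \<rho> by auto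
    define O' where "O' = ball x\<^sub>0 (\<rho> / 4)"
    have "O' \<subseteq> cball x\<^sub>0 (2 * \<rho>)" using \<rho>(1) by (auto simp: O'_def)
    also have "\<dots> \<subseteq> \<Omega>" by (rule order_trans[OF cb V0\<Omega>])
    finally have O': "open O'" "convex O'" "x\<^sub>0 \<in> O'" "O' \<subseteq> \<Omega>" "O' \<subseteq> ball x\<^sub>0 (3 * \<rho>)" "O' \<subseteq> ball x\<^sub>0 (\<rho> / 2)"
      using \<rho>(1) by (simp_all add: O'_def subset_ball)
    have vW: "v x' = (lam * (2 / p) / c) * W x' + (1 / c) * E x'" if "x' \<in> O'" for x'
      using rep[of x'] that O'(6) c by (auto simp: v_def f_def W_def field_simps)
    \<comment> \<open>\<open>v\<close> is as regular as \<open>W\<close>, since \<open>E\<close> is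
      smooth. The radius \<open>\<rho> / 4\<close> of \<open>O'\<close> leaves a compact ball
      between \<open>O'\<close> and the domain of \<open>E\<close>, as needed for uniform
      bounds.\<close>
    have hold: "Ck_holder_on k \<alpha> v O'" if k: "Ck_holder_on k \<alpha> W (ball x\<^sub>0 (3 * \<rho>))" and \<alpha>: "0 < \<alpha>" "\<alpha> \<le> 1" for k \<alpha>
    proof -
      have "Ck_holder_on k \<alpha> E O'"
        by (rule Ck_on_imp_Ck_holder_on[of "cball x\<^sub>0 (\<rho> / 4)" "ball x\<^sub>0 (\<rho> / 2)", OF _ _ _ O'(2) \<alpha> E])
          (use \<rho> in \<open>auto simp: O'_def\<close>)
      then have "Ck_holder_on k \<alpha> (\<lambda>x'. (lam * (2 / p) / c) * W x' + (1 / c) * E x') O'"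
        by (intro Ck_holder_on_add Ck_holder_on_mult Ck_holder_on_const O' \<alpha> Ck_holder_on_subset[OF k])
      then show ?thesis by (rule iffD2[OF Ck_holder_on_cong[OF O'(1)], rotated]) (rule vW)
    qed
    \<comment> \<open>Second use of the implicit function theorem, now on \<open>O'\<close>, where
      the regularity of the potential is passed on to the graph.\<close>
    obtain V where V: "open V" "x\<^sub>0 \<in> V" "V \<subseteq> O'"
      and g: "\<And>k \<alpha>. 0 < \<alpha> \<Longrightarrow> \<alpha> \<le> 1 \<Longrightarrow> Ck_holder_on k \<alpha> v O' \<or> CARD('n) = 1 \<Longrightarrow> is_Ck_holder_graph k \<alpha> {x \<in> V. v x = 0}"
      using zero_set_graph[OF O'(1-3) Ck_on_subset[OF v1 O'(4)] vx0 nz] by auto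
    \<comment> \<open>With \<open>p = n - 2 s\<close> the two conditions read
      \<open>\<alpha> < 2 s\<close> and \<open>\<alpha> < 2 s - 1\<close>, the ranges claimed for
      the two kinds of graph.\<close>
    have pot: "p + \<alpha> < real DIM(real ^ 'n) \<Longrightarrow> Ck_holder_on 1 \<alpha> W (ball x\<^sub>0 (3 * \<rho>))"
      "p + 1 + \<alpha> < real DIM(real ^ 'n) \<Longrightarrow> Ck_holder_on 2 \<alpha> W (ball x\<^sub>0 (3 * \<rho>))" if "0 < \<alpha>" "\<alpha> \<le> 1" for \<alpha>
      unfolding W_def
      by (rule Ck_holder_on_riesz_potential(1)[OF p L(1) _ R V0(4) _ that]
            Ck_holder_on_riesz_potential(2)[OF p L(1) _ R V0(4) _ that], (erule L(2) | erule L(3) | assumption)+)+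
    show ?thesis
    proof (rule goal[OF V(1,2) order_trans[OF V(3) O'(4)]])
      fix \<alpha> :: real assume \<alpha>: "0 < \<alpha>" "\<alpha> \<le> 1"
      show "is_Ck_holder_graph 1 \<alpha> {x \<in> V. v x = 0}" if "\<alpha> < 2 * s"
        by (rule g[OF \<alpha> disjI1[OF hold[OF pot(1)[OF \<alpha>] \<alpha>]]]) (use that in \<open>simp add: p_def\<close>)
      show "is_Ck_holder_graph 2 \<alpha> {x \<in> V. v x = 0}" if "\<alpha> < 2 * s - 1"
        by (rule g[OF \<alpha> disjI1[OF hold[OF pot(2)[OF \<alpha>] \<alpha>]]]) (use that in \<open>simp add: p_def\<close>)
    qed
  qed
qed

end
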